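(* Let $d \geq 2$ be an integer. For all $s, r \in (1,\infty)$ with $\frac{2}{r} + \frac{d}{s} < \frac{d}{2}$ there exist an elliptic coefficient function $B \colon [0,1] \times \mathbb{R}^d \to \mathbb{C}^{d\times d}$ and $f\in L^\infty(0,1; L^2(\mathbb{R}^d))$ such that the unique solution $u \in L^2(0,1;H^1(\mathbb{R}^d)) \cap H^1(0,1;H^{-1}(\mathbb{R}^d))$ to $$u' - \operatorname{div}(B\nabla u) = f \ \text{ on } (0,1), \qquad u(0)=0,$$ satisfies $u \notin L^r(0,1; L^s(\mathbb{R}^d))$.
   Context: All function spaces consist of complex-valued functions. $H^1(\mathbb{R}^d)$ is the usual $L^2$-based Sobolev space and $H^{-1}(\mathbb{R}^d)$ is its (anti)dual, with $H^1(\mathbb{R}^d)\hookrightarrow L^2(\mathbb{R}^d)\hookrightarrow H^{-1}(\mathbb{R}^d)$. For a Banach space $X$, $L^p(0,1;X)$ is the Bochner space and $H^1(0,1;X)$ is the space of $u\in L^2(0,1;X)$ with weak derivative $u'\in L^2(0,1;X)$. Elliptic: a measurable function $B \colon [0,1] \times \mathbb{R}^d \to \mathbb{C}^{d\times d}$ is called elliptic if there exist constants $\Lambda, \lambda > 0$ such that for all $t \in [0,1]$, $x\in \mathbb{R}^d$ and $\xi \in \mathbb{C}^d$ one has $|B(t,x)\xi| \leq \Lambda |\xi|$ and $\operatorname{Re}\big(B(t,x)\xi\cdot\overline{\xi}\big) \geq \lambda|\xi|^2$. Here $\operatorname{div}(B(t)\nabla \cdot)\colon H^1(\mathbb{R}^d)\to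 H^{-1}(\mathbb{R}^d)$ is defined weakly by $\langle -\operatorname{div}(B(t)\nabla v), w\rangle = \int_{\mathbb{R}^d} B(t,x)\nabla v(x)\cdot\overline{\nabla w(x)}\,dx$. Solution: for $f\in L^2(0,1;H^{-1}(\mathbb{R}^d))$, a solution of the problem is a function $u\in L^2(0,1;H^1(\mathbb{R}^d))\cap H^1(0,1;H^{-1}(\mathbb{R}^d))$ such that for all $t\in[0,1]$ one has $u(t) - \int_0^t \operatorname{div}(B(\tau)\nabla u(\tau))\,d\tau = \int_0^t f(\tau)\,d\tau$, as Bochner integrals in $H^{-1}(\mathbb{R}^d)$ (using the continuous representative of $u$). By Lions' theorem, for every elliptic $B$ and every $f\in L^2(0,1;H^{-1}(\mathbb{R}^d))$ there is exactly one solution. *)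

theory Defs
  imports "HOL-Analysis.Analysis" "HOL-Library.Function_Algebras"
begin

section \<open>Bochner spaces over seminormed spaces of functions\<close>

text \<open>
  The values of our Bochner functions lie in spaces of functions that are determined only up to
  null sets, or that depend on a real exponent, so they are not types of class
  \<^class>\<open>banach\<close>. A space is therefore a set of points together with a seminorm, and two points
  at distance 0 represent the same element of the associated normed space.
\<close>

instantiation "fun" :: (type, real_vector) real_vector
begin

definition scaleR_fun :: "real \<Rightarrow> ('a \<Rightarrow> 'b) \<Rightarrow> 'a \<Rightarrow> 'b"
  where "scaleR_fun c f = (\<lambda>x. c *\<^sub>R f x)"

instance
  by standard (auto simp: scaleR_fun_def fun_eq_iff scaleR_add_right scaleR_add_left)

end

record 'v seminormed =
  points :: "'v set"
  snorm :: "'v \<Rightarrow> real"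

definition strongly_measurable ::
    "'t measure \<Rightarrow> ('v::real_vector) seminormed \<Rightarrow> ('t \<Rightarrow> 'v) \<Rightarrow> bool" where
  "strongly_measurable M X u \<longleftrightarrow>
     (\<exists>\<sigma>. (\<forall>k. simple_function M (\<sigma> k) \<and> \<sigma> k ` space M \<subseteq> points X) \<and>
          (AE t in M. u t \<in> points X \<and> (\<lambda>k. snorm X (\<sigma> k t - u t)) \<longlonglongrightarrow> 0))"

definition bochner_Lp ::
    "'t measure \<Rightarrow> real \<Rightarrow> ('v::real_vector) seminormed \<Rightarrow> ('t \<Rightarrow> 'v) set" where
  "bochner_Lp M p X =
     {u. strongly_measurable M X u \<and> (\<integral>\<^sup>+ t. ennreal (snorm X (u t) powr p) \<partial>M) < \<infinity>}"

definition bochner_Linf ::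
    "'t measure \<Rightarrow> ('v::real_vector) seminormed \<Rightarrow> ('t \<Rightarrow> 'v) set" where
  "bochner_Linf M X = {u. strongly_measurable M X u \<and> (\<exists>C. AE t in M. snorm X (u t) \<le> C)}"

text \<open>The clauses are those of \<^const>\<open>has_bochner_integral\<close>, relative to \<open>X\<close>.\<close>

definition has_bochner_integral_in ::
    "'t measure \<Rightarrow> ('v::real_vector) seminormed \<Rightarrow> ('t \<Rightarrow> 'v) \<Rightarrow> 'v \<Rightarrow> bool" where
  "has_bochner_integral_in M X u y \<longleftrightarrow>
     strongly_measurable M X u \<and> y \<in> points X \<and>
     (\<exists>\<sigma>. (\<forall>k. Bochner_Integration.simple_bochner_integrable M (\<sigma> k) \<and>
                \<sigma> k ` space M \<subseteq> points X) \<and>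
          (\<lambda>k. \<integral>\<^sup>+ t. ennreal (snorm X (u t - \<sigma> k t)) \<partial>M) \<longlonglongrightarrow> 0 \<and>
          (\<lambda>k. snorm X (Bochner_Integration.simple_bochner_integral M (\<sigma> k) - y)) \<longlonglongrightarrow> 0)"


section \<open>Test functions\<close>

definition partial_deriv ::
    "'a::euclidean_space \<Rightarrow> ('a \<Rightarrow> complex) \<Rightarrow> 'a \<Rightarrow> complex" where
  "partial_deriv b \<phi> x = frechet_derivative \<phi> (at x) b"

primrec continuously_differentiable ::
    "nat \<Rightarrow> ('a::euclidean_space \<Rightarrow> complex) \<Rightarrow> bool" where
  "continuously_differentiable 0 \<phi> \<longleftrightarrow> continuous_on UNIV \<phi>"
| "continuously_differentiable (Suc k) \<phi> \<longleftrightarrow>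
     (\<forall>x. \<phi> differentiable (at x)) \<and>
     (\<forall>b\<in>Basis. continuously_differentiable k (partial_deriv b \<phi>))"

definition test_function :: "'a::euclidean_space set \<Rightarrow> ('a \<Rightarrow> complex) \<Rightarrow> bool" where
  "test_function \<Omega> \<phi> \<longleftrightarrow>
     (\<forall>k. continuously_differentiable k \<phi>) \<and>
     (\<exists>K. compact K \<and> K \<subseteq> \<Omega> \<and> (\<forall>x. x \<notin> K \<longrightarrow> \<phi> x = 0))"


section \<open>Function spaces on R^d\<close>

definition Lspace :: "real \<Rightarrow> ('a::euclidean_space \<Rightarrow> complex) seminormed" where
  "Lspace p =
     \<lparr>points = {v. v \<in> borel_measurable lebesgue \<and>
                   integrable lebesgue (\<lambda>x. cmod (v x) powr p)},
      snorm = (\<lambda>v. (LINT x|lebesgue. cmod (v x) powr p) powr (1 / p))\<rparr>"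

definition is_weak_gradient ::
    "(real ^ 'n::finite \<Rightarrow> complex) \<Rightarrow> (real ^ 'n \<Rightarrow> complex ^ 'n) \<Rightarrow> bool" where
  "is_weak_gradient v g \<longleftrightarrow>
     (\<forall>i. (\<lambda>x. g x $ i) \<in> points (Lspace 2)) \<and>
     (\<forall>i \<phi>. test_function UNIV \<phi> \<longrightarrow>
        (LINT x|lebesgue. v x * partial_deriv (axis i 1) \<phi> x) =
        - (LINT x|lebesgue. g x $ i * \<phi> x))"

text \<open>The weak gradient is unique up to a null set; we fix some representative.\<close>

definition wgrad ::
    "(real ^ 'n::finite \<Rightarrow> complex) \<Rightarrow> real ^ 'n \<Rightarrow> complex ^ 'n" where
  "wgrad v = (SOME g. is_weak_gradient v g)"

definition H1 :: "(real ^ 'n::finite \<Rightarrow> complex) seminormed" where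
  "H1 =
     \<lparr>points = {v \<in> points (Lspace 2). \<exists>g. is_weak_gradient v g},
      snorm = (\<lambda>v. sqrt ((LINT x|lebesgue. (cmod (v x))\<^sup>2) +
                         (LINT x|lebesgue. (norm (wgrad v x))\<^sup>2)))\<rparr>"

text \<open>
  The antidual of \<open>H1\<close>. Functionals are total functions, so they are required to vanish off
  \<open>H1\<close>; this makes \<open>snorm Hneg1\<close> a norm. Boundedness forces a functional to respect
  equality almost everywhere.
\<close>

definition Hneg1 :: "((real ^ 'n::finite \<Rightarrow> complex) \<Rightarrow> complex) seminormed" where
  "Hneg1 =
     \<lparr>points = {L.
        (\<forall>w. w \<notin> points H1 \<longrightarrow> L w = 0) \<and>
        (\<forall>v\<in>points H1. \<forall>w\<in>points H1. L (\<lambda>x. v x + w x) = L v + L w) \<and>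
        (\<forall>c. \<forall>w\<in>points H1. L (\<lambda>x. c * w x) = cnj c * L w) \<and>
        (\<exists>C. \<forall>w\<in>points H1. cmod (L w) \<le> C * snorm H1 w)},
      snorm = (\<lambda>L. SUP w\<in>{w \<in> points H1. snorm H1 w \<le> 1}. cmod (L w))\<rparr>"

text \<open>The embedding of \<open>L\<^sup>2\<close>, and hence of \<open>H1\<close>, into \<open>Hneg1\<close>.\<close>

definition to_Hneg1 ::
    "(real ^ 'n::finite \<Rightarrow> complex) \<Rightarrow> (real ^ 'n \<Rightarrow> complex) \<Rightarrow> complex" where
  "to_Hneg1 v = (\<lambda>w. if w \<in> points H1 then LINT x|lebesgue. v x * cnj (w x) else 0)"


section \<open>The parabolic problem\<close>

definition herm :: "complex ^ 'n::finite \<Rightarrow> complex ^ 'n \<Rightarrow> complex" where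
  "herm a b = (\<Sum>i\<in>UNIV. a $ i * cnj (b $ i))"

definition elliptic ::
    "(real \<Rightarrow> real ^ 'n::finite \<Rightarrow> complex ^ 'n ^ 'n) \<Rightarrow> bool" where
  "elliptic B \<longleftrightarrow>
     (\<lambda>(t, x). B t x) \<in> borel_measurable (restrict_space borel ({0..1} \<times> UNIV)) \<and>
     (\<exists>\<Lambda>>0. \<exists>\<mu>>0. \<forall>t\<in>{0..1}. \<forall>x \<xi>.
        norm (B t x *v \<xi>) \<le> \<Lambda> * norm \<xi> \<and>
        Re (herm (B t x *v \<xi>) \<xi>) \<ge> \<mu> * (norm \<xi>)\<^sup>2)"

text \<open>\<open>div_op A v\<close> is the functional \<open>div (A \<nabla>v)\<close>.\<close>

definition div_op ::
    "(real ^ 'n::finite \<Rightarrow> complex ^ 'n ^ 'n) \<Rightarrow> (real ^ 'n \<Rightarrow> complex) \<Rightarrow>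
     (real ^ 'n \<Rightarrow> complex) \<Rightarrow> complex" where
  "div_op A v = (\<lambda>w. if w \<in> points H1
     then - (LINT x|lebesgue. herm (A x *v wgrad v x) (wgrad w x)) else 0)"

definition time_H1_Hneg1 ::
    "(real \<Rightarrow> (real ^ 'n::finite \<Rightarrow> complex) \<Rightarrow> complex) set" where
  "time_H1_Hneg1 =
     {U \<in> bochner_Lp (lebesgue_on {0<..<1}) 2 Hneg1.
        \<exists>G \<in> bochner_Lp (lebesgue_on {0<..<1}) 2 Hneg1.
          \<forall>\<phi>. test_function {0<..<1} \<phi> \<longrightarrow>
            (\<exists>I. has_bochner_integral_in (lebesgue_on {0<..<1}) Hneg1
                   (\<lambda>t w. partial_deriv 1 \<phi> t * U t w) I \<and>
                 has_bochner_integral_in (lebesgue_on {0<..<1}) Hneg1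
                   (\<lambda>t w. \<phi> t * G t w) (- I))}"

text \<open>
  In the next definition \<open>U\<close> is the representative of \<open>u\<close> that is continuous on \<open>[0,1]\<close> with
  values in \<open>Hneg1\<close>. The equation at \<open>t = 0\<close> contains the initial condition \<open>U 0 = 0\<close>.
\<close>

definition continuous_rep ::
    "(real \<Rightarrow> real ^ 'n::finite \<Rightarrow> complex) \<Rightarrow>
     (real \<Rightarrow> (real ^ 'n \<Rightarrow> complex) \<Rightarrow> complex) \<Rightarrow> bool" where
  "continuous_rep u U \<longleftrightarrow>
     (AE t in lebesgue_on {0<..<1}. U t = to_Hneg1 (u t)) \<and>
     (\<forall>t\<in>{0..1}. U t \<in> points Hneg1 \<and>
        ((\<lambda>\<tau>. snorm Hneg1 (U \<tau> - U t)) \<longlongrightarrow> 0) (at t within {0..1}))"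

definition is_solution ::
    "(real \<Rightarrow> real ^ 'n::finite \<Rightarrow> complex ^ 'n ^ 'n) \<Rightarrow>
     (real \<Rightarrow> (real ^ 'n \<Rightarrow> complex) \<Rightarrow> complex) \<Rightarrow>
     (real \<Rightarrow> real ^ 'n \<Rightarrow> complex) \<Rightarrow> bool" where
  "is_solution B F u \<longleftrightarrow>
     u \<in> bochner_Lp (lebesgue_on {0<..<1}) 2 H1 \<and>
     (\<lambda>t. to_Hneg1 (u t)) \<in> time_H1_Hneg1 \<and>
     (\<exists>U. continuous_rep u U \<and>
        (\<forall>t\<in>{0..1}. \<exists>D I.
           has_bochner_integral_in (lebesgue_on {0..t}) Hneg1 (\<lambda>\<tau>. div_op (B \<tau>) (u \<tau>)) D \<and>
           has_bochner_integral_in (lebesgue_on {0..t}) Hneg1 F I \<and>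
           U t - D = I))"

end

theory Submission
  imports Defs
begin

text \<open>
  Write \<open>n\<close> for the dimension, \<open>\<tau> = 1 - t\<close>, \<open>\<sigma> = |x|\<^sup>2\<close> and \<open>z = \<tau> / (\<tau> + \<sigma>)\<close>. The solution loses
  its integrability at the single point \<open>t = 1\<close>, \<open>x = 0\<close>. A scalar coefficient \<open>b(z)\<close> is invariant
  under parabolic scaling around that point, so that \<open>v\<^sub>t = div (b \<nabla>v)\<close> may have homogeneous
  solutions \<open>v = (\<tau> + \<sigma>)\<^bsup>-a\<^esup> H(z)\<close>. Such a \<open>v\<close> is of size \<open>(1 - t)\<^bsup>-a\<^esup>\<close> on the ball of radius
  \<open>\<surd>(1 - t)\<close>; hence its norm in \<open>L\<^sup>s\<close> is at least a multiple of \<open>(1 - t)\<^bsup>-a + n/(2s)\<^esup>\<close>, and the \<open>r\<close>-th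
  power of this is not integrable once \<open>a \<ge> 1/r + n/(2s)\<close>. On the other hand \<open>|v| \<le> C |x|\<^bsup>-2a\<^esup>\<close>, which
  is locally in \<open>L\<^sup>2\<close>, uniformly in time, as long as \<open>a < n/4\<close>; the energy of \<open>v\<close> is then finite too.
  The hypothesis on \<open>r\<close> and \<open>s\<close> says that both conditions hold for \<open>a = (n - \<epsilon>)/4\<close> with a small
  \<open>\<epsilon> > 0\<close>.

  The solution is \<open>u = t \<chi>(\<sigma>) v\<close>, where the factor \<open>t\<close> produces the initial value \<open>0\<close> and \<open>\<chi>\<close> is a
  cut-off. The term \<open>\<chi> v\<close> and the commutators with \<open>\<chi>\<close> are all that remains of
  \<open>f = u\<^sub>t - div (b \<nabla>u)\<close>, because \<open>v\<close> solves the equation. They are no larger than \<open>v\<close>, and this is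
  why \<open>f\<close> lies in \<open>L\<^sup>\<infinity>(L\<^sup>2)\<close> (\<open>forcing_eq\<close>, \<open>forcing_bounded\<close>).

  It remains to find \<open>b\<close> and \<open>H\<close>. Instead of solving for \<open>H\<close> one prescribes the flux
  \<open>b \<nabla>v = (\<tau> + \<sigma>)\<^bsup>-a-1\<^esup> K(z) x\<close>: the equation \<open>v\<^sub>t = div (b \<nabla>v)\<close> then becomes a first order
  relation between \<open>H\<close> and \<open>K\<close> with an explicit general solution, and \<open>b\<close> is the quotient of the
  flux by the gradient. Ellipticity is the only constraint. It says that this quotient has
  positive real part on \<open>[0,1]\<close>, and \<open>profile\<close> meets it with a complex \<open>K\<close> whose phase turns by
  half a circle.

  Two general facts connect the formulas with the notion of solution. A path that is
  continuous on \<open>[0,1)\<close> with values in \<open>H1\<close>, has finite energy and solves the equation when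
  tested pointwise in time is a solution in the sense of Bochner integrals
  (\<open>solution_criterion\<close>). Solutions are unique for every elliptic coefficient (\<open>solution_unique\<close>), by an energy
  argument that avoids a derivative of \<open>|u(t)|\<^sup>2\<close>.
\<close>


section \<open>Square integrable functions\<close>

definition square_integrable :: "'a measure \<Rightarrow> ('a \<Rightarrow> 'b::euclidean_space) \<Rightarrow> bool" where
  "square_integrable M F \<longleftrightarrow> F \<in> borel_measurable M \<and> integrable M (\<lambda>x. (norm (F x))\<^sup>2)"

definition L2_norm :: "'a measure \<Rightarrow> ('a \<Rightarrow> 'b::euclidean_space) \<Rightarrow> real" where
  "L2_norm M F = sqrt (LINT x|M. (norm (F x))\<^sup>2)"

lemma square_integrable_measurable [measurable_dest]:
  "square_integrable M F \<Longrightarrow> F \<in> borel_measurable M"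
  by (simp add: square_integrable_def)

lemma L2_norm_nonneg [simp]: "0 \<le> L2_norm M F"
  by (simp add: L2_norm_def)

lemma L2_norm_square: "(L2_norm M F)\<^sup>2 = (LINT x|M. (norm (F x))\<^sup>2)"
  by (simp add: L2_norm_def)

lemma square_integrable_dominated:
  fixes F :: "'a \<Rightarrow> 'b::euclidean_space" and G :: "'a \<Rightarrow> 'c::euclidean_space"
  assumes G: "square_integrable M G" and [measurable]: "F \<in> borel_measurable M"
    and le: "AE x in M. norm (F x) \<le> c * norm (G x)"
  shows "square_integrable M F"
proof -
  have "integrable M (\<lambda>x. c\<^sup>2 * (norm (G x))\<^sup>2)"
    using G by (simp add: square_integrable_def)
  then have "integrable M (\<lambda>x. (norm (F x))\<^sup>2)"
  proof (rule Bochner_Integration.integrable_bound)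
    show "AE x in M. norm ((norm (F x))\<^sup>2) \<le> norm (c\<^sup>2 * (norm (G x))\<^sup>2)"
      using le
    proof eventually_elim
      case (elim x)
      have "(norm (F x))\<^sup>2 \<le> (c * norm (G x))\<^sup>2"
        by (rule power_mono[OF elim]) simp
      then show ?case by (simp add: power_mult_distrib)
    qed
  qed measurable
  then show ?thesis by (simp add: square_integrable_def)
qed

lemma L2_norm_dominated:
  fixes F :: "'a \<Rightarrow> 'b::euclidean_space" and G :: "'a \<Rightarrow> 'c::euclidean_space"
  assumes G: "square_integrable M G" and [measurable]: "F \<in> borel_measurable M"
    and le: "AE x in M. norm (F x) \<le> c * norm (G x)" and c: "0 \<le> c"
  shows "L2_norm M F \<le> c * L2_norm M G"
proof -
  have F: "square_integrable M F" by (rule square_integrable_dominated[OF G _ le]) simp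
  have "(LINT x|M. (norm (F x))\<^sup>2) \<le> (LINT x|M. c\<^sup>2 * (norm (G x))\<^sup>2)"
  proof (rule integral_mono_AE)
    show "AE x in M. (norm (F x))\<^sup>2 \<le> c\<^sup>2 * (norm (G x))\<^sup>2"
      using le
    proof eventually_elim
      case (elim x)
      have "(norm (F x))\<^sup>2 \<le> (c * norm (G x))\<^sup>2"
        by (rule power_mono[OF elim]) simp
      then show ?case by (simp add: power_mult_distrib)
    qed
  qed (use F G in \<open>auto simp: square_integrable_def\<close>)
  then have "L2_norm M F \<le> sqrt (c\<^sup>2 * (LINT x|M. (norm (G x))\<^sup>2))"
    by (simp add: L2_norm_def)
  also have "\<dots> = c * L2_norm M G"
    using c by (simp add: L2_norm_def real_sqrt_mult)
  finally show ?thesis .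
qed

lemma square_integrable_add:
  fixes F G :: "'a \<Rightarrow> 'b::euclidean_space"
  assumes F: "square_integrable M F" and G: "square_integrable M G"
  shows "square_integrable M (\<lambda>x. F x + G x)"
proof -
  note [measurable] = F G
  have i: "integrable M (\<lambda>x. 2 * (norm (F x))\<^sup>2 + 2 * (norm (G x))\<^sup>2)"
    using F G by (simp add: square_integrable_def)
  have "integrable M (\<lambda>x. (norm (F x + G x))\<^sup>2)"
  proof (rule Bochner_Integration.integrable_bound[OF i])
    have "(norm (F x + G x))\<^sup>2 \<le> 2 * (norm (F x))\<^sup>2 + 2 * (norm (G x))\<^sup>2" for x
    proof -
      have "(norm (F x + G x))\<^sup>2 \<le> (norm (F x) + norm (G x))\<^sup>2"
        by (rule power_mono[OF norm_triangle_ineq]) simp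
      also have "\<dots> \<le> 2 * (norm (F x))\<^sup>2 + 2 * (norm (G x))\<^sup>2"
        using sum_squares_bound[of "norm (F x)" "norm (G x)"] by (simp add: power2_sum)
      finally show ?thesis .
    qed
    then show "AE x in M. norm ((norm (F x + G x))\<^sup>2) \<le> norm (2 * (norm (F x))\<^sup>2 + 2 * (norm (G x))\<^sup>2)"
      by simp
  qed measurable
  then show ?thesis by (simp add: square_integrable_def)
qed

lemma square_integrable_minus:
  fixes F :: "'a \<Rightarrow> 'b::euclidean_space"
  shows "square_integrable M F \<Longrightarrow> square_integrable M (\<lambda>x. - F x)"
  by (rule square_integrable_dominated[where c = 1 and G = F]) auto

lemma square_integrable_diff:
  fixes F G :: "'a \<Rightarrow> 'b::euclidean_space"
  assumes "square_integrable M F" and "square_integrable M G"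
  shows "square_integrable M (\<lambda>x. F x - G x)"
  using square_integrable_add[OF assms(1) square_integrable_minus[OF assms(2)]] by simp

lemma L2_norm_cong_AE:
  fixes F G :: "'a \<Rightarrow> 'b::euclidean_space"
  assumes "F \<in> borel_measurable M" "G \<in> borel_measurable M" "AE x in M. F x = G x"
  shows "L2_norm M F = L2_norm M G"
  unfolding L2_norm_def by (rule arg_cong[where f = sqrt], rule integral_cong_AE) (use assms in auto)

lemma integrable_norm_mult:
  fixes F :: "'a \<Rightarrow> 'b::euclidean_space" and G :: "'a \<Rightarrow> 'c::euclidean_space"
  assumes F: "square_integrable M F" and G: "square_integrable M G"
  shows "integrable M (\<lambda>x. norm (F x) * norm (G x))"
proof -
  note [measurable] = F G
  have i: "integrable M (\<lambda>x. (norm (F x))\<^sup>2 + (norm (G x))\<^sup>2)"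
    using F G by (simp add: square_integrable_def)
  show ?thesis
  proof (rule Bochner_Integration.integrable_bound[OF i])
    have "norm (F x) * norm (G x) \<le> (norm (F x))\<^sup>2 + (norm (G x))\<^sup>2" for x
      using sum_squares_bound[of "norm (F x)" "norm (G x)"]
        mult_nonneg_nonneg[of "norm (F x)" "norm (G x)"] by (simp del: mult_nonneg_nonneg)
    then show "AE x in M. norm (norm (F x) * norm (G x)) \<le> norm ((norm (F x))\<^sup>2 + (norm (G x))\<^sup>2)"
      by simp
  qed measurable
qed

lemma L2_norm_zero_AE:
  fixes F :: "'a \<Rightarrow> 'b::euclidean_space"
  assumes "square_integrable M F" "L2_norm M F = 0"
  shows "AE x in M. F x = 0"
proof -
  have "(LINT x|M. (norm (F x))\<^sup>2) = 0"
    using assms(2) by (simp add: L2_norm_def)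
  then have "AE x in M. (norm (F x))\<^sup>2 = 0"
    using assms(1) by (subst (asm) integral_nonneg_eq_0_iff_AE) (auto simp: square_integrable_def)
  then show ?thesis by simp
qed

text \<open>Optimising \<open>2ab \<le> \<theta>a\<^sup>2 + b\<^sup>2/\<theta>\<close> over \<open>\<theta>\<close> turns the pointwise bound into Cauchy-Schwarz.\<close>

lemma Cauchy_Schwarz_L2:
  fixes F :: "'a \<Rightarrow> 'b::euclidean_space" and G :: "'a \<Rightarrow> 'c::euclidean_space"
  assumes F: "square_integrable M F" and G: "square_integrable M G"
  shows "(LINT x|M. norm (F x) * norm (G x)) \<le> L2_norm M F * L2_norm M G"
proof (cases "L2_norm M F = 0 \<or> L2_norm M G = 0")
  case True
  note [measurable] = F G
  have "AE x in M. norm (F x) * norm (G x) = 0"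
    using True L2_norm_zero_AE[OF F] L2_norm_zero_AE[OF G] by fastforce
  then have "(LINT x|M. norm (F x) * norm (G x)) = (LINT x|M. 0)"
    by (intro integral_cong_AE) auto
  then show ?thesis by simp
next
  case False
  define A B where "A = L2_norm M F" and "B = L2_norm M G"
  have A: "A > 0" and B: "B > 0"
    using False L2_norm_nonneg[of M F] L2_norm_nonneg[of M G] by (auto simp: A_def B_def less_le)
  have "(LINT x|M. 2 * (norm (F x) * norm (G x)))
      \<le> (LINT x|M. B / A * (norm (F x))\<^sup>2 + A / B * (norm (G x))\<^sup>2)"
  proof (rule integral_mono)
    fix x
    have "0 \<le> (B * norm (F x) - A * norm (G x))\<^sup>2 / (A * B)"
      using A B by simp
    also have "\<dots> = B / A * (norm (F x))\<^sup>2 + A / B * (norm (G x))\<^sup>2 - 2 * (norm (F x) * norm (G x))"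
      using A B by (simp add: field_simps power2_eq_square)
    finally show "2 * (norm (F x) * norm (G x)) \<le> B / A * (norm (F x))\<^sup>2 + A / B * (norm (G x))\<^sup>2"
      by simp
  qed (use F G integrable_norm_mult[OF F G] in \<open>auto simp: square_integrable_def\<close>)
  also have "\<dots> = B / A * A\<^sup>2 + A / B * B\<^sup>2"
    using F G by (simp add: square_integrable_def A_def B_def L2_norm_square)
  also have "\<dots> = 2 * (A * B)"
    using A B by (simp add: power2_eq_square)
  finally show ?thesis by (simp add: A_def B_def)
qed

lemma L2_norm_triangle:
  fixes F G :: "'a \<Rightarrow> 'b::euclidean_space"
  assumes F: "square_integrable M F" and G: "square_integrable M G"
  shows "L2_norm M (\<lambda>x. F x + G x) \<le> L2_norm M F + L2_norm M G"
proof -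
  have "(L2_norm M (\<lambda>x. F x + G x))\<^sup>2 = (LINT x|M. (norm (F x + G x))\<^sup>2)"
    by (simp add: L2_norm_square)
  also have "\<dots> \<le> (LINT x|M. (norm (F x))\<^sup>2 + (norm (G x))\<^sup>2 + 2 * (norm (F x) * norm (G x)))"
  proof (rule integral_mono)
    fix x
    have "(norm (F x + G x))\<^sup>2 \<le> (norm (F x) + norm (G x))\<^sup>2"
      by (rule power_mono[OF norm_triangle_ineq]) simp
    then show "(norm (F x + G x))\<^sup>2 \<le> (norm (F x))\<^sup>2 + (norm (G x))\<^sup>2 + 2 * (norm (F x) * norm (G x))"
      by (simp add: power2_sum)
  qed (use F G integrable_norm_mult[OF F G] square_integrable_add[OF F G]
       in \<open>auto simp: square_integrable_def\<close>)
  also have "\<dots> = (L2_norm M F)\<^sup>2 + (L2_norm M G)\<^sup>2 + 2 * (LINT x|M. norm (F x) * norm (G x))"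
    using F G integrable_norm_mult[OF F G] by (simp add: square_integrable_def L2_norm_square)
  also have "\<dots> \<le> (L2_norm M F + L2_norm M G)\<^sup>2"
    using Cauchy_Schwarz_L2[OF F G] by (simp add: power2_sum)
  finally show ?thesis
    by (rule power2_le_imp_le) simp
qed


section \<open>Strong measurability in seminormed spaces of functions\<close>

text \<open>
  \<open>L\<^sup>2\<close>, \<open>H\<^sup>1\<close> and \<open>H\<^sup>-\<^sup>1\<close> are instances, so that facts on strong measurability need only one proof.
\<close>

locale seminormed_space =
  fixes X :: "('v::real_vector) seminormed"
  assumes zero_point [simp, intro]: "0 \<in> points X"
    and add_point [intro]: "u \<in> points X \<Longrightarrow> v \<in> points X \<Longrightarrow> u + v \<in> points X"
    and minus_point [intro]: "u \<in> points X \<Longrightarrow> - u \<in> points X"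
    and snorm_zero [simp]: "snorm X 0 = 0"
    and snorm_minus: "u \<in> points X \<Longrightarrow> snorm X (- u) = snorm X u"
    and snorm_triangle: "u \<in> points X \<Longrightarrow> v \<in> points X \<Longrightarrow> snorm X (u + v) \<le> snorm X u + snorm X v"
begin

lemma diff_point [intro]: "u \<in> points X \<Longrightarrow> v \<in> points X \<Longrightarrow> u - v \<in> points X"
  using add_point[OF _ minus_point, of u v] by simp

lemma snorm_diff_le: "u \<in> points X \<Longrightarrow> v \<in> points X \<Longrightarrow> snorm X (u - v) \<le> snorm X u + snorm X v"
  using snorm_triangle[OF _ minus_point, of u v] by (simp add: snorm_minus)

lemma snorm_nonneg: "u \<in> points X \<Longrightarrow> 0 \<le> snorm X u"
  using snorm_diff_le[of u u] by simp

lemma snorm_commute: "u \<in> points X \<Longrightarrow> v \<in> points X \<Longrightarrow> snorm X (u - v) = snorm X (v - u)"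
  using snorm_minus[of "v - u"] by auto

lemma snorm_diff_triangle:
  assumes "u \<in> points X" "v \<in> points X" "w \<in> points X"
  shows "snorm X (u - w) \<le> snorm X (u - v) + snorm X (v - w)"
  using snorm_triangle[of "u - v" "v - w"] assms by auto

lemma snorm_abs_diff:
  assumes "u \<in> points X" "v \<in> points X"
  shows "\<bar>snorm X u - snorm X v\<bar> \<le> snorm X (u - v)"
proof -
  have "u - v \<in> points X" "v - u \<in> points X" using assms by auto
  then show ?thesis
    using snorm_triangle[of "u - v" v] snorm_triangle[of "v - u" u] snorm_commute[OF assms] assms
    by auto
qed

lemma strongly_measurable_add:
  assumes u: "strongly_measurable M X u" and v: "strongly_measurable M X v"
  shows "strongly_measurable M X (\<lambda>t. u t + v t)"
proof -
  obtain \<sigma> where s: "\<And>k. simple_function M (\<sigma> k)" "\<And>k. \<sigma> k ` space M \<subseteq> points X"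
    "AE t in M. u t \<in> points X \<and> (\<lambda>k. snorm X (\<sigma> k t - u t)) \<longlonglongrightarrow> 0"
    using u by (auto simp: strongly_measurable_def)
  obtain \<rho> where r: "\<And>k. simple_function M (\<rho> k)" "\<And>k. \<rho> k ` space M \<subseteq> points X"
    "AE t in M. v t \<in> points X \<and> (\<lambda>k. snorm X (\<rho> k t - v t)) \<longlonglongrightarrow> 0"
    using v by (auto simp: strongly_measurable_def)
  have "AE t in M. u t + v t \<in> points X \<and>
      (\<lambda>k. snorm X ((\<sigma> k t + \<rho> k t) - (u t + v t))) \<longlonglongrightarrow> 0"
    using s(3) r(3) AE_space
  proof eventually_elim
    case (elim t)
    have p: "\<sigma> k t \<in> points X" "\<rho> k t \<in> points X" for k
      using s(2)[of k] r(2)[of k] elim by auto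
    have sum: "(\<lambda>k. snorm X (\<sigma> k t - u t) + snorm X (\<rho> k t - v t)) \<longlonglongrightarrow> 0"
      using tendsto_add[of "\<lambda>k. snorm X (\<sigma> k t - u t)" 0 _ "\<lambda>k. snorm X (\<rho> k t - v t)" 0] elim
      by auto
    have e: "(\<sigma> k t + \<rho> k t) - (u t + v t) = (\<sigma> k t - u t) + (\<rho> k t - v t)" for k
      by simp
    have "(\<lambda>k. snorm X ((\<sigma> k t + \<rho> k t) - (u t + v t))) \<longlonglongrightarrow> 0"
    proof (rule Lim_null_comparison[OF always_eventually sum], intro allI)
      fix k
      have q: "\<sigma> k t - u t \<in> points X" "\<rho> k t - v t \<in> points X"
        using p elim by auto
      show "norm (snorm X ((\<sigma> k t + \<rho> k t) - (u t + v t)))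
            \<le> snorm X (\<sigma> k t - u t) + snorm X (\<rho> k t - v t)"
        unfolding e using snorm_triangle[OF q] snorm_nonneg[OF add_point[OF q]] by simp
    qed
    then show ?case using elim by auto
  qed
  moreover have "simple_function M (\<lambda>t. \<sigma> k t + \<rho> k t)" for k
    using simple_function_compose2[OF s(1) r(1)] .
  moreover have "(\<lambda>t. \<sigma> k t + \<rho> k t) ` space M \<subseteq> points X" for k
    using s(2) r(2) by blast
  ultimately show ?thesis
    unfolding strongly_measurable_def by (intro exI[of _ "\<lambda>k t. \<sigma> k t + \<rho> k t"]) auto
qed

lemma strongly_measurable_minus:
  assumes u: "strongly_measurable M X u"
  shows "strongly_measurable M X (\<lambda>t. - u t)"
proof -
  obtain \<sigma> where s: "\<And>k. simple_function M (\<sigma> k)" "\<And>k. \<sigma> k ` space M \<subseteq> points X"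
    "AE t in M. u t \<in> points X \<and> (\<lambda>k. snorm X (\<sigma> k t - u t)) \<longlonglongrightarrow> 0"
    using u by (auto simp: strongly_measurable_def)
  have "AE t in M. - u t \<in> points X \<and> (\<lambda>k. snorm X (- \<sigma> k t - - u t)) \<longlonglongrightarrow> 0"
    using s(3) AE_space
  proof eventually_elim
    case (elim t)
    have "snorm X (- \<sigma> k t - - u t) = snorm X (\<sigma> k t - u t)" for k
    proof -
      have "\<sigma> k t \<in> points X" using s(2) elim by auto
      then show ?thesis
        using snorm_commute[of "u t" "\<sigma> k t"] elim by simp
    qed
    then show ?case using elim by auto
  qed
  moreover have "simple_function M (\<lambda>t. - \<sigma> k t)" for k
    using simple_function_compose1[OF s(1)] .
  moreover have "(\<lambda>t. - \<sigma> k t) ` space M \<subseteq> points X" for k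
    using s(2) by blast
  ultimately show ?thesis
    unfolding strongly_measurable_def by (intro exI[of _ "\<lambda>k t. - \<sigma> k t"]) auto
qed

lemma strongly_measurable_diff:
  assumes "strongly_measurable M X u" and "strongly_measurable M X v"
  shows "strongly_measurable M X (\<lambda>t. u t - v t)"
  using strongly_measurable_add[OF assms(1) strongly_measurable_minus[OF assms(2)]] by simp

text \<open>
  The points at which \<^const>\<open>strongly_measurable\<close> says nothing about \<open>u\<close> form a null set, so
  only a measurable function equal to the seminorm almost everywhere can be expected.
\<close>

lemma strongly_measurable_approx:
  assumes u: "strongly_measurable M X u"
  obtains g \<sigma> where "g \<in> borel_measurable M" "\<And>t. 0 \<le> g t" "AE t in M. snorm X (u t) = g t"
    "\<And>k. simple_function M (\<sigma> k)" "\<And>k. \<sigma> k ` space M \<subseteq> points X"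
    "\<And>k t. t \<in> space M \<Longrightarrow> snorm X (\<sigma> k t) \<le> 2 * g t"
    "AE t in M. u t \<in> points X \<and> (\<lambda>k. snorm X (\<sigma> k t - u t)) \<longlonglongrightarrow> 0"
proof -
  obtain \<sigma> where s: "\<And>k. simple_function M (\<sigma> k)" "\<And>k. \<sigma> k ` space M \<subseteq> points X"
    "AE t in M. u t \<in> points X \<and> (\<lambda>k. snorm X (\<sigma> k t - u t)) \<longlonglongrightarrow> 0"
    using u by (auto simp: strongly_measurable_def)
  define g where "g t = max 0 (lim (\<lambda>k. snorm X (\<sigma> k t)))" for t
  have [measurable]: "(\<lambda>t. snorm X (\<sigma> k t)) \<in> borel_measurable M" for k
    by (intro borel_measurable_simple_function simple_function_compose1[OF s(1)])
  have g [measurable]: "g \<in> borel_measurable M"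
    unfolding g_def by measurable
  have lim: "(\<lambda>k. snorm X (\<sigma> k t)) \<longlonglongrightarrow> snorm X (u t)"
    if "t \<in> space M" "u t \<in> points X" "(\<lambda>k. snorm X (\<sigma> k t - u t)) \<longlonglongrightarrow> 0" for t
  proof -
    have "\<sigma> k t \<in> points X" for k using s(2) that by auto
    then have "\<bar>snorm X (\<sigma> k t) - snorm X (u t)\<bar> \<le> snorm X (\<sigma> k t - u t)" for k
      using snorm_abs_diff that by blast
    then have "(\<lambda>k. snorm X (\<sigma> k t) - snorm X (u t)) \<longlonglongrightarrow> 0"
      by (intro Lim_null_comparison[OF _ that(3)]) auto
    then show ?thesis by (simp add: LIM_zero_iff)
  qed
  have gu: "AE t in M. snorm X (u t) = g t"
    using s(3) AE_space
  proof eventually_elim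
    case (elim t)
    then have "lim (\<lambda>k. snorm X (\<sigma> k t)) = snorm X (u t)"
      using lim by (intro limI) auto
    then show ?case using elim snorm_nonneg by (auto simp: g_def)
  qed
  define \<rho> where "\<rho> k t = (if snorm X (\<sigma> k t) \<le> 2 * g t then \<sigma> k t else 0)" for k t
  have r1: "simple_function M (\<rho> k)" for k
    unfolding \<rho>_def by (rule simple_function_If[OF s(1)]) auto
  have r2: "\<rho> k ` space M \<subseteq> points X" for k
    using s(2) by (auto simp: \<rho>_def)
  have "AE t in M. u t \<in> points X \<and> (\<lambda>k. snorm X (\<rho> k t - u t)) \<longlonglongrightarrow> 0"
    using s(3) AE_space gu
  proof eventually_elim
    case (elim t)
    have p: "\<sigma> k t \<in> points X" for k using s(2) elim by auto
    show ?case
    proof (cases "g t = 0")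
      case True
      then have "snorm X (\<rho> k t - u t) = 0" for k
      proof -
        have "\<rho> k t \<in> points X" "snorm X (\<rho> k t) \<le> 0"
          using p True by (auto simp: \<rho>_def)
        then have "snorm X (\<rho> k t - u t) \<le> 0"
          using snorm_diff_le[of "\<rho> k t" "u t"] elim True by auto
        then show ?thesis
          using snorm_nonneg[of "\<rho> k t - u t"] elim \<open>\<rho> k t \<in> points X\<close> by auto
      qed
      then show ?thesis using elim by auto
    next
      case False
      then have "snorm X (u t) < 2 * g t"
        using elim by (auto simp: g_def max_def split: if_splits)
      then have "\<forall>\<^sub>F k in sequentially. snorm X (\<sigma> k t) < 2 * g t"
        using lim elim by (intro order_tendstoD(2)) auto
      then have "\<forall>\<^sub>F k in sequentially. snorm X (\<sigma> k t - u t) = snorm X (\<rho> k t - u t)"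
        by eventually_elim (auto simp: \<rho>_def)
      then have "(\<lambda>k. snorm X (\<rho> k t - u t)) \<longlonglongrightarrow> 0"
        by (rule Lim_transform_eventually[rotated]) (use elim in auto)
      then show ?thesis using elim by auto
    qed
  qed
  moreover have "snorm X (\<rho> k t) \<le> 2 * g t" for k t
    by (auto simp: \<rho>_def g_def)
  moreover have "0 \<le> g t" for t by (simp add: g_def)
  ultimately show ?thesis
    by (intro that[OF g _ gu r1 r2]) auto
qed

end

lemma tendsto_floor_div: "(\<lambda>k. real_of_int \<lfloor>real (Suc k) * t\<rfloor> / real (Suc k)) \<longlonglongrightarrow> t"
proof (rule tendsto_sandwich)
  show "\<forall>\<^sub>F k in sequentially. t - 1 / real (Suc k) \<le> real_of_int \<lfloor>real (Suc k) * t\<rfloor> / real (Suc k)"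
  proof (intro always_eventually allI)
    fix k
    have "real (Suc k) * t - 1 \<le> real_of_int \<lfloor>real (Suc k) * t\<rfloor>" by linarith
    then have "(real (Suc k) * t - 1) / real (Suc k) \<le> real_of_int \<lfloor>real (Suc k) * t\<rfloor> / real (Suc k)"
      by (rule divide_right_mono) simp
    then show "t - 1 / real (Suc k) \<le> real_of_int \<lfloor>real (Suc k) * t\<rfloor> / real (Suc k)"
      by (simp add: diff_divide_distrib)
  qed
  show "\<forall>\<^sub>F k in sequentially. real_of_int \<lfloor>real (Suc k) * t\<rfloor> / real (Suc k) \<le> t"
    by (intro always_eventually allI) (simp add: divide_le_eq mult.commute[of _ t])
  show "(\<lambda>k. t - 1 / real (Suc k)) \<longlonglongrightarrow> t"
    using tendsto_diff[OF tendsto_const LIMSEQ_inverse_real_of_nat, of t]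
    by (simp add: inverse_eq_divide)
qed simp

text \<open>A continuous path is approximated by its values at the grid points \<open>j / k\<close>.\<close>

lemma (in seminormed_space) strongly_measurable_path:
  fixes u :: "real \<Rightarrow> 'v"
  assumes A: "A \<in> sets lebesgue" "A \<subseteq> {0..1}"
    and p: "\<And>t. t \<in> {0..<1} \<Longrightarrow> u t \<in> points X"
    and c: "\<And>t. t \<in> {0..<1} \<Longrightarrow> ((\<lambda>s. snorm X (u s - u t)) \<longlongrightarrow> 0) (at t within {0..<1})"
  shows "strongly_measurable (lebesgue_on A) X u"
proof -
  define r where "r k t = real_of_int \<lfloor>real (Suc k) * t\<rfloor> / real (Suc k)" for k and t :: real
  define \<sigma> where "\<sigma> k t = (if t < 1 then u (r k t) else 0)" for k t
  have r: "r k t \<in> {0..<1}" if "t \<in> {0..<1}" for k t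
  proof -
    have "real_of_int \<lfloor>real (Suc k) * t\<rfloor> \<le> real (Suc k) * t" by linarith
    also have "\<dots> < real (Suc k)" using that by (simp add: mult_less_cancel_left1)
    finally show ?thesis using that by (auto simp: r_def divide_simps)
  qed
  have [measurable]: "r k \<in> borel_measurable (lebesgue_on A)" for k
  proof -
    have "r k \<in> borel_measurable borel" unfolding r_def by measurable
    then show ?thesis
      by (intro measurable_restrict_space1 measurable_completion) simp
  qed
  have fin: "finite (r k ` A)" for k
  proof -
    have "r k ` A \<subseteq> (\<lambda>j. real_of_int j / real (Suc k)) ` {0..int (Suc k)}"
    proof
      fix y assume "y \<in> r k ` A"
      then obtain t where t: "t \<in> A" "y = r k t" by auto
      have t01: "0 \<le> t" "t \<le> 1" using t A by auto
      have "real (Suc k) * t \<le> real (Suc k)"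
        using t01 by (simp add: mult_le_cancel_left1)
      then have "real_of_int \<lfloor>real (Suc k) * t\<rfloor> \<le> real (Suc k)" by linarith
      then have "\<lfloor>real (Suc k) * t\<rfloor> \<in> {0..int (Suc k)}"
        using t01 by (auto simp flip: of_nat_Suc)
      then show "y \<in> (\<lambda>j. real_of_int j / real (Suc k)) ` {0..int (Suc k)}"
        unfolding t(2) r_def by (rule imageI)
    qed
    then show ?thesis by (rule finite_subset) simp
  qed
  have sp: "space (lebesgue_on A) = A" by simp
  have sr: "simple_function (lebesgue_on A) (r k)" for k
  proof (subst simple_function_borel_measurable)
    show "r k \<in> borel_measurable (lebesgue_on A)" by simp
    show "finite (r k ` space (lebesgue_on A))" using fin sp by simp
  qed auto
  have [measurable]: "(\<lambda>t. t) \<in> borel_measurable (lebesgue_on A)"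
    by (intro measurable_restrict_space1 measurable_completion) simp
  have "simple_function (lebesgue_on A) (\<sigma> k)" for k
    unfolding \<sigma>_def
    by (rule simple_function_If[OF simple_function_compose1[OF sr, where g = u] simple_function_const]) measurable
  moreover have "\<sigma> k ` space (lebesgue_on A) \<subseteq> points X" for k
    using r p A unfolding \<sigma>_def sp by force
  moreover have "AE t in lebesgue_on A. u t \<in> points X \<and> (\<lambda>k. snorm X (\<sigma> k t - u t)) \<longlonglongrightarrow> 0"
  proof -
    have "AE t in lebesgue. t \<noteq> (1::real)"
      by (rule AE_completion) (rule AE_lborel_singleton)
    then have "AE t in lebesgue. t \<in> A \<longrightarrow> u t \<in> points X \<and> (\<lambda>k. snorm X (\<sigma> k t - u t)) \<longlonglongrightarrow> 0"
    proof eventually_elim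
      case (elim t)
      show ?case
      proof
        assume "t \<in> A"
        then have t: "t \<in> {0..<1}" using A elim by force
        have "(\<lambda>k. snorm X (u (r k t) - u t)) \<longlonglongrightarrow> 0"
        proof -
          have "((\<lambda>s. snorm X (u s - u t)) \<longlongrightarrow> snorm X (u t - u t)) (at t within {0..<1})"
            using c[OF t] by simp
          then have "continuous (at t within {0..<1}) (\<lambda>s. snorm X (u s - u t))"
            by (simp add: continuous_within)
          then have "(\<lambda>k. snorm X (u (r k t) - u t)) \<longlonglongrightarrow> snorm X (u t - u t)"
            unfolding continuous_within_sequentially
            using r[OF t] tendsto_floor_div[of t] by (auto simp: r_def comp_def)
          then show ?thesis by simp
        qed
        then show "u t \<in> points X \<and> (\<lambda>k. snorm X (\<sigma> k t - u t)) \<longlonglongrightarrow> 0"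
          using p[OF t] t by (simp add: \<sigma>_def)
      qed
    qed
    then show ?thesis using A by (subst AE_restrict_space_iff) auto
  qed
  ultimately show ?thesis
    unfolding strongly_measurable_def by (intro exI[of _ \<sigma>]) auto
qed


section \<open>Differentiable functions of one real variable\<close>

text \<open>
  A recursion over witnesses of the derivative, rather than over \<^const>\<open>vector_derivative\<close>, makes the
  closure properties below direct inductions.
\<close>

primrec times_differentiable_on :: "nat \<Rightarrow> real set \<Rightarrow> (real \<Rightarrow> complex) \<Rightarrow> bool" where
  "times_differentiable_on 0 S F \<longleftrightarrow> True"
| "times_differentiable_on (Suc k) S F \<longleftrightarrow>
     (\<exists>F'. (\<forall>x\<in>S. (F has_vector_derivative F' x) (at x)) \<and> times_differentiable_on k S F')"

definition smooth_on :: "real set \<Rightarrow> (real \<Rightarrow> complex) \<Rightarrow> bool" where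
  "smooth_on S F \<longleftrightarrow> (\<forall>k. times_differentiable_on k S F)"

lemma times_differentiable_on_Suc_imp:
  "times_differentiable_on (Suc k) S F \<Longrightarrow> times_differentiable_on k S F"
  by (induction k arbitrary: F) auto

lemma times_differentiable_on_const: "times_differentiable_on k S (\<lambda>x. c)"
proof (induction k arbitrary: c)
  case (Suc k)
  show ?case
    using Suc[of 0] by (auto intro!: exI[of _ "\<lambda>x. 0"] derivative_eq_intros)
qed auto

lemma times_differentiable_on_add:
  "times_differentiable_on k S F \<Longrightarrow> times_differentiable_on k S G \<Longrightarrow>
   times_differentiable_on k S (\<lambda>x. F x + G x)"
proof (induction k arbitrary: F G)
  case (Suc k)
  then obtain F' G' where "\<forall>x\<in>S. (F has_vector_derivative F' x) (at x)" "times_differentiable_on k S F'"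
    "\<forall>x\<in>S. (G has_vector_derivative G' x) (at x)" "times_differentiable_on k S G'" by auto
  then show ?case
    using Suc.IH by (auto intro!: exI[of _ "\<lambda>x. F' x + G' x"] has_vector_derivative_add)
qed auto

lemma times_differentiable_on_mult:
  "times_differentiable_on k S F \<Longrightarrow> times_differentiable_on k S G \<Longrightarrow>
   times_differentiable_on k S (\<lambda>x. F x * G x)"
proof (induction k arbitrary: F G)
  case (Suc k)
  then obtain F' G' where FG: "\<forall>x\<in>S. (F has_vector_derivative F' x) (at x)" "times_differentiable_on k S F'"
    "\<forall>x\<in>S. (G has_vector_derivative G' x) (at x)" "times_differentiable_on k S G'" by auto
  have "times_differentiable_on k S F" "times_differentiable_on k S G"
    using Suc.prems times_differentiable_on_Suc_imp by blast+
  then have "times_differentiable_on k S (\<lambda>x. F x * G' x + F' x * G x)"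
    using FG Suc.IH by (intro times_differentiable_on_add) auto
  moreover have "\<forall>x\<in>S. ((\<lambda>x. F x * G x) has_vector_derivative F x * G' x + F' x * G x) (at x)"
    using FG by (auto intro!: has_vector_derivative_mult)
  ultimately show ?case by auto
qed auto

lemma times_differentiable_on_cong:
  assumes "open S" "\<And>x. x \<in> S \<Longrightarrow> F x = G x" "times_differentiable_on k S F"
  shows "times_differentiable_on k S G"
proof (cases k)
  case (Suc m)
  then obtain F' where F: "\<forall>x\<in>S. (F has_vector_derivative F' x) (at x)" "times_differentiable_on m S F'"
    using assms by auto
  have "\<forall>x\<in>S. (G has_vector_derivative F' x) (at x)"
    using F assms(1,2) has_vector_derivative_transform_within_open by blast
  then show ?thesis using F Suc by auto
qed auto

text \<open>A solution of a linear equation with smooth coefficient is smooth: each derivative of \<open>F\<close> is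
  a smooth multiple of \<open>F\<close>. Powers, exponentials and reciprocals are instances.\<close>

lemma times_differentiable_on_ode:
  assumes F: "\<And>x. x \<in> S \<Longrightarrow> (F has_vector_derivative \<omega> x * F x) (at x)"
  shows "times_differentiable_on k S \<omega> \<Longrightarrow> times_differentiable_on (Suc k) S F"
proof (induction k)
  case 0
  then show ?case using F unfolding times_differentiable_on.simps by (intro exI[of _ "\<lambda>x. \<omega> x * F x"]) auto
next
  case (Suc k)
  have "times_differentiable_on (Suc k) S F"
    using Suc times_differentiable_on_Suc_imp by blast
  then have "times_differentiable_on (Suc k) S (\<lambda>x. \<omega> x * F x)"
    using Suc.prems by (intro times_differentiable_on_mult)
  then show ?case
    using F unfolding times_differentiable_on.simps(2)[of "Suc k"] by (intro exI[of _ "\<lambda>x. \<omega> x * F x"]) auto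
qed

lemma times_differentiable_on_inverse:
  assumes nz: "\<And>x. x \<in> S \<Longrightarrow> F x \<noteq> 0"
  shows "times_differentiable_on k S F \<Longrightarrow> times_differentiable_on k S (\<lambda>x. inverse (F x))"
proof (induction k)
  case (Suc k)
  then obtain F' where F: "\<forall>x\<in>S. (F has_vector_derivative F' x) (at x)" "times_differentiable_on k S F'"
    by auto
  have "times_differentiable_on k S (\<lambda>x. inverse (F x))"
    using Suc times_differentiable_on_Suc_imp by blast
  then have "times_differentiable_on k S (\<lambda>x. (-1) * (F' x * inverse (F x)))"
    using F by (intro times_differentiable_on_mult times_differentiable_on_const) auto
  moreover have "((\<lambda>x. inverse (F x)) has_vector_derivative ((-1) * (F' x * inverse (F x))) * inverse (F x)) (at x)"
    if "x \<in> S" for x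
  proof -
    have "((inverse \<circ> F) has_vector_derivative F' x * - (inverse (F x) * inverse (F x))) (at x)"
      using F nz that
      by (intro field_vector_diff_chain_at) (auto intro!: DERIV_inverse[THEN DERIV_cong] simp: power2_eq_square)
    then show ?thesis by (simp add: comp_def mult_ac)
  qed
  ultimately show ?case by (intro times_differentiable_on_ode)
qed auto

lemma times_differentiable_on_compose:
  assumes g: "\<And>x. x \<in> S \<Longrightarrow> (g has_real_derivative g' x) (at x)" "\<And>x. x \<in> S \<Longrightarrow> g x \<in> T"
    and g': "times_differentiable_on k S (\<lambda>x. of_real (g' x))"
  shows "times_differentiable_on (Suc k) T F \<Longrightarrow> times_differentiable_on (Suc k) S (\<lambda>x. F (g x))"
  using g'
proof (induction k arbitrary: F)
  case 0
  then obtain F' where F: "\<forall>x\<in>T. (F has_vector_derivative F' x) (at x)" by auto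
  have "((F \<circ> g) has_vector_derivative g' x *\<^sub>R F' (g x)) (at x)" if "x \<in> S" for x
    using F g that by (intro vector_diff_chain_at) (auto simp: has_real_derivative_iff_has_vector_derivative)
  then show ?case
    unfolding comp_def times_differentiable_on.simps by (intro exI[of _ "\<lambda>x. g' x *\<^sub>R F' (g x)"]) auto
next
  case (Suc k)
  then obtain F' where F: "\<forall>x\<in>T. (F has_vector_derivative F' x) (at x)"
    "times_differentiable_on (Suc k) T F'" by auto
  have "((F \<circ> g) has_vector_derivative g' x *\<^sub>R F' (g x)) (at x)" if "x \<in> S" for x
    using F g that by (intro vector_diff_chain_at) (auto simp: has_real_derivative_iff_has_vector_derivative)
  then have "\<forall>x\<in>S. ((\<lambda>x. F (g x)) has_vector_derivative of_real (g' x) * F' (g x)) (at x)"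
    by (auto simp: comp_def scaleR_conv_of_real)
  moreover have "times_differentiable_on (Suc k) S (\<lambda>x. of_real (g' x) * F' (g x))"
  proof (rule times_differentiable_on_mult)
    have "times_differentiable_on k S (\<lambda>x. of_real (g' x))"
      by (rule times_differentiable_on_Suc_imp) (use Suc.prems(2) in simp)
    then show "times_differentiable_on (Suc k) S (\<lambda>x. F' (g x))"
      by (rule Suc.IH[OF F(2)])
  qed (rule Suc.prems(2))
  ultimately show ?case
    unfolding times_differentiable_on.simps(2)[of "Suc k"]
    by (intro exI[of _ "\<lambda>x. of_real (g' x) * F' (g x)"]) auto
qed

lemma smooth_on_const [intro]: "smooth_on S (\<lambda>x. c)"
  by (simp add: smooth_on_def times_differentiable_on_const)

lemma smooth_on_add [intro]: "smooth_on S F \<Longrightarrow> smooth_on S G \<Longrightarrow> smooth_on S (\<lambda>x. F x + G x)"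
  by (simp add: smooth_on_def times_differentiable_on_add)

lemma smooth_on_mult [intro]: "smooth_on S F \<Longrightarrow> smooth_on S G \<Longrightarrow> smooth_on S (\<lambda>x. F x * G x)"
  by (simp add: smooth_on_def times_differentiable_on_mult)

lemma smooth_on_minus [intro]: "smooth_on S F \<Longrightarrow> smooth_on S (\<lambda>x. - F x)"
  using smooth_on_mult[OF smooth_on_const[of S "-1"], of F] by simp

lemma smooth_on_diff [intro]: "smooth_on S F \<Longrightarrow> smooth_on S G \<Longrightarrow> smooth_on S (\<lambda>x. F x - G x)"
  using smooth_on_add[OF _ smooth_on_minus, of S F G] by simp

lemma smooth_on_inverse [intro]:
  "smooth_on S F \<Longrightarrow> (\<And>x. x \<in> S \<Longrightarrow> F x \<noteq> 0) \<Longrightarrow> smooth_on S (\<lambda>x. inverse (F x))"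
  by (simp add: smooth_on_def times_differentiable_on_inverse)

lemma smooth_on_divide [intro]:
  "smooth_on S F \<Longrightarrow> smooth_on S G \<Longrightarrow> (\<And>x. x \<in> S \<Longrightarrow> G x \<noteq> 0) \<Longrightarrow> smooth_on S (\<lambda>x. F x / G x)"
  by (simp add: divide_inverse smooth_on_mult smooth_on_inverse)

lemma smooth_on_subset: "smooth_on T F \<Longrightarrow> S \<subseteq> T \<Longrightarrow> smooth_on S F"
proof -
  have "times_differentiable_on k T F \<Longrightarrow> S \<subseteq> T \<Longrightarrow> times_differentiable_on k S F" for k
  proof (induction k arbitrary: F)
    case (Suc k)
    then obtain F' where "\<forall>x\<in>T. (F has_vector_derivative F' x) (at x)" "times_differentiable_on k T F'"
      by auto
    then have "(\<forall>x\<in>S. (F has_vector_derivative F' x) (at x)) \<and> times_differentiable_on k S F'"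
      using Suc by blast
    then show ?case by auto
  qed simp
  then show "smooth_on T F \<Longrightarrow> S \<subseteq> T \<Longrightarrow> smooth_on S F"
    by (auto simp: smooth_on_def)
qed

lemma smooth_on_of_real [intro]: "smooth_on S (\<lambda>x. of_real x)"
  unfolding smooth_on_def
proof
  fix k
  have "times_differentiable_on (Suc k) S (\<lambda>x. of_real x)"
    using times_differentiable_on_const[of k S 1]
    by (auto intro!: exI[of _ "\<lambda>x. 1"] has_vector_derivative_of_real derivative_eq_intros)
  then show "times_differentiable_on k S (\<lambda>x. of_real x)"
    by (rule times_differentiable_on_Suc_imp)
qed

lemma smooth_on_ode:
  "(\<And>x. x \<in> S \<Longrightarrow> (F has_vector_derivative \<omega> x * F x) (at x)) \<Longrightarrow> smooth_on S \<omega> \<Longrightarrow> smooth_on S F"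
  unfolding smooth_on_def using times_differentiable_on_ode times_differentiable_on_Suc_imp by blast

lemma smooth_on_compose:
  assumes "\<And>x. x \<in> S \<Longrightarrow> (g has_real_derivative g' x) (at x)" "\<And>x. x \<in> S \<Longrightarrow> g x \<in> T"
    and "smooth_on S (\<lambda>x. of_real (g' x))" "smooth_on T F"
  shows "smooth_on S (\<lambda>x. F (g x))"
  unfolding smooth_on_def
proof
  fix k
  have "times_differentiable_on (Suc k) S (\<lambda>x. F (g x))"
    by (rule times_differentiable_on_compose[where T = T, OF assms(1,2)])
      (use assms in \<open>auto simp: smooth_on_def simp del: times_differentiable_on.simps\<close>)
  then show "times_differentiable_on k S (\<lambda>x. F (g x))"
    by (rule times_differentiable_on_Suc_imp)
qed

lemma smooth_on_deriv:
  assumes "smooth_on S F" "open S"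
  shows "\<And>x. x \<in> S \<Longrightarrow> (F has_vector_derivative vector_derivative F (at x)) (at x)"
    and "smooth_on S (\<lambda>x. vector_derivative F (at x))"
proof -
  show "(F has_vector_derivative vector_derivative F (at x)) (at x)" if "x \<in> S" for x
  proof -
    have "times_differentiable_on (Suc 0) S F" using assms by (auto simp: smooth_on_def simp del: times_differentiable_on.simps)
    then show ?thesis using that by (auto simp: vector_derivative_works[symmetric] intro: differentiableI_vector)
  qed
  show "smooth_on S (\<lambda>x. vector_derivative F (at x))"
    unfolding smooth_on_def
  proof
    fix k
    have "times_differentiable_on (Suc k) S F"
      using assms unfolding smooth_on_def by blast
    then obtain F' where F: "\<forall>x\<in>S. (F has_vector_derivative F' x) (at x)" "times_differentiable_on k S F'"
      by auto
    show "times_differentiable_on k S (\<lambda>x. vector_derivative F (at x))"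
      by (rule times_differentiable_on_cong[OF assms(2) _ F(2)]) (use F in \<open>auto simp: vector_derivative_at\<close>)
  qed
qed

lemma smooth_on_continuous_on: "smooth_on S F \<Longrightarrow> open S \<Longrightarrow> continuous_on S F"
  using smooth_on_deriv(1) has_vector_derivative_continuous
  by (metis continuous_at_imp_continuous_on)

text \<open>
  The functions \<open>x\<^sup>-\<^sup>j exp(-1/x)\<close>, extended by \<open>0\<close> to the left half line, are closed under
  differentiation; this makes \<open>exp(-1/x)\<close> a smooth function that is flat at \<open>0\<close>.
\<close>

definition flat :: "nat \<Rightarrow> real \<Rightarrow> real" where
  "flat j x = (if x > 0 then exp (- 1 / x) / x ^ j else 0)"

text \<open>
  The exponential beats every power of \<open>1/x\<close>. The bound is quadratic in order that the difference
  quotients at \<open>0\<close> tend to \<open>0\<close>.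
\<close>

lemma flat_le_square:
  assumes "x > 0"
  shows "flat j x \<le> real (j + 2) ^ (j + 2) * x\<^sup>2"
proof -
  define m where "m = j + 2"
  have m: "m > 0" by (simp add: m_def)
  have "1 / (real m * x) \<le> exp (1 / (real m * x))"
    using exp_ge_add_one_self[of "1 / (real m * x)"] by linarith
  then have "(1 / (real m * x)) ^ m \<le> exp (1 / (real m * x)) ^ m"
    using assms by (intro power_mono) auto
  also have "\<dots> = exp (1 / x)"
    using m assms by (simp flip: exp_of_nat_mult)
  finally have *: "1 \<le> exp (1 / x) * (real m * x) ^ m"
    using assms m by (simp add: field_simps power_mult_distrib)
  have "exp (- 1 / x) * 1 \<le> exp (- 1 / x) * (exp (1 / x) * (real m * x) ^ m)"
    by (rule mult_left_mono[OF *]) simp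
  also have "\<dots> = (real m * x) ^ m"
    by (simp flip: exp_add mult.assoc)
  finally have "exp (- 1 / x) \<le> (real m * x) ^ m" by simp
  then have "flat j x \<le> (real m * x) ^ m / x ^ j"
    using assms by (simp add: flat_def divide_right_mono)
  also have "\<dots> = real m ^ m * (x ^ m / x ^ j)"
    by (simp add: power_mult_distrib)
  also have "x ^ m / x ^ j = x\<^sup>2"
    using assms by (simp add: m_def power_add power2_eq_square)
  finally show ?thesis by (simp add: m_def)
qed

lemma flat_nonneg: "0 \<le> flat j x"
  by (simp add: flat_def)

lemma DERIV_flat: "(flat j has_real_derivative flat (j + 2) x - real j * flat (j + 1) x) (at x)"
proof (cases x "0::real" rule: linorder_cases)
  case less
  have "(flat j has_real_derivative 0) (at x)"
    by (rule has_field_derivative_transform_within_open[where f = "\<lambda>x. 0" and S = "{..<0}"])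
      (use less in \<open>auto simp: flat_def\<close>)
  then show ?thesis using less by (simp add: flat_def)
next
  case greater
  have 1: "((\<lambda>x. exp (- 1 / x)) has_real_derivative exp (- 1 / x) / x\<^sup>2) (at x)"
    using greater by (auto intro!: derivative_eq_intros simp: power2_eq_square)
  have 2: "((\<lambda>x. inverse (x ^ j)) has_real_derivative - real j / x ^ (j + 1)) (at x)"
  proof -
    have "((\<lambda>x. inverse (x ^ j)) has_real_derivative
        - (inverse (x ^ j) * (real j * x ^ (j - 1)) * inverse (x ^ j))) (at x)"
      using greater by (auto intro!: derivative_eq_intros)
    also have "- (inverse (x ^ j) * (real j * x ^ (j - 1)) * inverse (x ^ j)) = - real j / x ^ (j + 1)"
      using greater by (cases j) (simp_all add: field_simps)
    finally show ?thesis .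
  qed
  have "((\<lambda>x. exp (- 1 / x) * inverse (x ^ j)) has_real_derivative
      flat (j + 2) x - real j * flat (j + 1) x) (at x)"
    using DERIV_mult[OF 1 2] greater
    by (simp add: flat_def field_simps power2_eq_square power_add)
  then show ?thesis
    by (rule has_field_derivative_transform_within_open[where S = "{0<..}"])
      (use greater in \<open>auto simp: flat_def field_simps\<close>)
next
  case equal
  define C where "C = real (j + 2) ^ (j + 2)"
  have "(flat j has_derivative (\<lambda>h. 0)) (at 0)"
  proof (rule has_derivativeI_sandwich[of 1])
    show "((\<lambda>y::real. C * \<bar>y\<bar>) \<longlongrightarrow> 0) (at 0)"
      by (rule tendsto_eq_intros refl | simp)+
    fix y :: real assume y: "y \<noteq> 0"
    have "\<bar>flat j y\<bar> \<le> C * y\<^sup>2"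
    proof (cases "y > 0")
      case True
      then show ?thesis using flat_le_square[of y j] flat_nonneg[of j y] by (simp add: C_def)
    qed (simp add: flat_def C_def)
    then have "\<bar>flat j y\<bar> / \<bar>y\<bar> \<le> C * y\<^sup>2 / \<bar>y\<bar>"
      by (rule divide_right_mono) simp
    also have "\<dots> = C * \<bar>y\<bar>" using y by (simp add: power2_eq_square abs_if)
    finally show "norm (flat j y - flat j 0 - 0) / norm (y - 0) \<le> C * \<bar>y\<bar>"
      by (simp add: flat_def)
  qed auto
  then have "(flat j has_real_derivative 0) (at 0)"
    unfolding has_field_derivative_def lambda_zero .
  then show ?thesis using equal by (simp add: flat_def)
qed

lemma smooth_on_flat: "smooth_on S (\<lambda>x. complex_of_real (flat j x))"
proof -
  have "times_differentiable_on k S (\<lambda>x. complex_of_real (flat j x))" for k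
  proof (induction k arbitrary: j)
    case (Suc k)
    have "times_differentiable_on k S (\<lambda>x. complex_of_real (flat (j + 2) x) +
        complex_of_real (- real j) * complex_of_real (flat (j + 1) x))"
      by (intro times_differentiable_on_add times_differentiable_on_mult times_differentiable_on_const Suc)
    moreover have "((\<lambda>x. complex_of_real (flat j x)) has_vector_derivative
        complex_of_real (flat (j + 2) x) + complex_of_real (- real j) * complex_of_real (flat (j + 1) x)) (at x)" for x
      using has_vector_derivative_of_real[of "flat j" "flat (j + 2) x - real j * flat (j + 1) x" "at x"]
        DERIV_flat[of j x]
      by (simp add: has_real_derivative_iff_has_vector_derivative)
    ultimately show ?case
      unfolding times_differentiable_on.simps(2)
      by (intro exI[of _ "\<lambda>x. complex_of_real (flat (j + 2) x) +
        complex_of_real (- real j) * complex_of_real (flat (j + 1) x)"]) auto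
  qed auto
  then show ?thesis by (simp add: smooth_on_def)
qed


section \<open>Test functions\<close>

lemma partial_deriv_eq:
  "(\<phi> has_derivative D) (at x) \<Longrightarrow> partial_deriv b \<phi> x = D b"
  by (simp add: partial_deriv_def frechet_derivative_at[symmetric])

lemma has_derivative_partial:
  "\<phi> differentiable (at x) \<Longrightarrow> (\<phi> has_derivative (\<lambda>b. partial_deriv b \<phi> x)) (at x)"
  unfolding partial_deriv_def using frechet_derivative_works by auto

lemma continuously_differentiable_Suc_imp:
  "continuously_differentiable (Suc k) \<phi> \<Longrightarrow> continuously_differentiable k \<phi>"
proof (induction k arbitrary: \<phi>)
  case 0
  then show ?case
    by (auto intro!: continuous_at_imp_continuous_on differentiable_imp_continuous_within)
next
  case (Suc k)
  then show ?case
    unfolding continuously_differentiable.simps(2)[of "Suc k"] continuously_differentiable.simps(2)[of k]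
    by blast
qed

lemma continuously_differentiable_SucI:
  assumes "\<And>x. (\<phi> has_derivative D x) (at x)"
    and "\<And>b. b \<in> Basis \<Longrightarrow> continuously_differentiable k (\<lambda>x. D x b)"
  shows "continuously_differentiable (Suc k) \<phi>"
proof -
  have "partial_deriv b \<phi> = (\<lambda>x. D x b)" for b
    using partial_deriv_eq[OF assms(1)] by auto
  then show ?thesis
    using assms by (auto simp: differentiable_def)
qed

lemma continuously_differentiable_const:
  "continuously_differentiable k (\<lambda>x. c)"
proof (induction k arbitrary: c)
  case (Suc k)
  show ?case
    by (rule continuously_differentiable_SucI[where D = "\<lambda>x b. 0"]) (use Suc in auto)
qed auto

lemma continuously_differentiable_add:
  "continuously_differentiable k \<phi> \<Longrightarrow> continuously_differentiable k \<psi> \<Longrightarrow>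
   continuously_differentiable k (\<lambda>x. \<phi> x + \<psi> x)"
proof (induction k arbitrary: \<phi> \<psi>)
  case 0
  then show ?case by (auto intro: continuous_intros)
next
  case (Suc k)
  show ?case
  proof (rule continuously_differentiable_SucI[where D = "\<lambda>x b. partial_deriv b \<phi> x + partial_deriv b \<psi> x"])
    show "((\<lambda>x. \<phi> x + \<psi> x) has_derivative (\<lambda>b. partial_deriv b \<phi> x + partial_deriv b \<psi> x)) (at x)" for x
      using Suc.prems by (intro has_derivative_add has_derivative_partial) auto
  qed (use Suc in auto)
qed

lemma continuously_differentiable_mult:
  "continuously_differentiable k \<phi> \<Longrightarrow> continuously_differentiable k \<psi> \<Longrightarrow>
   continuously_differentiable k (\<lambda>x. \<phi> x * \<psi> x)"
proof (induction k arbitrary: \<phi> \<psi>)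
  case 0
  then show ?case by (auto intro: continuous_intros)
next
  case (Suc k)
  show ?case
  proof (rule continuously_differentiable_SucI[where
        D = "\<lambda>x b. \<phi> x * partial_deriv b \<psi> x + partial_deriv b \<phi> x * \<psi> x"])
    show "((\<lambda>x. \<phi> x * \<psi> x) has_derivative (\<lambda>b. \<phi> x * partial_deriv b \<psi> x + partial_deriv b \<phi> x * \<psi> x)) (at x)" for x
      using Suc.prems by (intro has_derivative_mult has_derivative_partial) auto
    show "continuously_differentiable k (\<lambda>x. \<phi> x * partial_deriv b \<psi> x + partial_deriv b \<phi> x * \<psi> x)"
      if "b \<in> Basis" for b
      using Suc.prems that continuously_differentiable_Suc_imp
      by (intro continuously_differentiable_add Suc.IH) auto
  qed
qed

lemma continuously_differentiable_prod:
  "(\<And>i. i \<in> I \<Longrightarrow> continuously_differentiable k (\<phi> i)) \<Longrightarrow>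
   continuously_differentiable k (\<lambda>x. \<Prod>i\<in>I. \<phi> i x)"
  by (induction I rule: infinite_finite_induct)
    (auto intro: continuously_differentiable_const continuously_differentiable_mult)

lemma continuously_differentiable_inner:
  "continuously_differentiable k (\<lambda>x. complex_of_real (x \<bullet> c))"
proof (cases k)
  case (Suc m)
  show ?thesis
    unfolding Suc
  proof (rule continuously_differentiable_SucI[where D = "\<lambda>x b. complex_of_real (b \<bullet> c)"])
    show "((\<lambda>x. complex_of_real (x \<bullet> c)) has_derivative (\<lambda>b. complex_of_real (b \<bullet> c))) (at x)" for x
      by (intro bounded_linear_imp_has_derivative bounded_linear_compose[OF bounded_linear_of_real]
            bounded_linear_inner_left)
  qed (rule continuously_differentiable_const)
qed (auto intro: continuous_intros)

lemma continuously_differentiable_compose: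
  assumes g: "\<And>x. (g has_derivative g' x) (at x)" "\<And>x. g x \<in> S"
    and g': "\<And>b. b \<in> Basis \<Longrightarrow> continuously_differentiable k (\<lambda>x. complex_of_real (g' x b))"
  shows "times_differentiable_on (Suc k) S F \<Longrightarrow> continuously_differentiable k (\<lambda>x. F (g x))"
  using g'
proof (induction k arbitrary: F)
  case 0
  obtain F' where "\<forall>x\<in>S. (F has_vector_derivative F' x) (at x)"
    using 0 by auto
  then have "isCont F (g x)" for x
    using g(2) has_vector_derivative_continuous by blast
  then have "isCont (\<lambda>x. F (g x)) x" for x
    using has_derivative_continuous[OF g(1)] by (rule isCont_o2[rotated])
  then show ?case by (simp add: continuous_at_imp_continuous_on)
next
  case (Suc k)
  then obtain F' where F: "\<forall>x\<in>S. (F has_vector_derivative F' x) (at x)" "times_differentiable_on (Suc k) S F'"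
    by auto
  show ?case
  proof (rule continuously_differentiable_SucI)
    show "((\<lambda>x. F (g x)) has_derivative (\<lambda>b. complex_of_real (g' x b) * F' (g x))) (at x)" for x
    proof -
      have "((F \<circ> g) has_derivative ((\<lambda>h. h *\<^sub>R F' (g x)) \<circ> g' x)) (at x)"
        using F g unfolding has_vector_derivative_def by (intro diff_chain_at) auto
      then show ?thesis by (simp add: comp_def scaleR_conv_of_real)
    qed
    show "continuously_differentiable k (\<lambda>x. complex_of_real (g' x b) * F' (g x))" if "b \<in> Basis" for b
    proof (rule continuously_differentiable_mult)
      have d: "continuously_differentiable k (\<lambda>x. complex_of_real (g' x b))" if "b \<in> Basis" for b
        by (rule continuously_differentiable_Suc_imp) (rule Suc.prems(2)[OF that])
      show "continuously_differentiable k (\<lambda>x. complex_of_real (g' x b))"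
        by (rule d) (rule that)
      show "continuously_differentiable k (\<lambda>x. F' (g x))"
        by (rule Suc.IH[OF F(2) d])
    qed
  qed
qed

lemma continuously_differentiable_radial:
  fixes F :: "real \<Rightarrow> complex"
  assumes "smooth_on S F" "{0..} \<subseteq> S"
  shows "continuously_differentiable k (\<lambda>x::'a::euclidean_space. F ((norm x)\<^sup>2))"
proof -
  have "continuously_differentiable k (\<lambda>x::'a. F (x \<bullet> x))"
  proof (rule continuously_differentiable_compose)
    show "((\<lambda>x::'a. x \<bullet> x) has_derivative (\<lambda>b. 2 * (x \<bullet> b))) (at x)" for x
      by (auto intro!: derivative_eq_intros simp: inner_commute)
    show "continuously_differentiable k (\<lambda>x::'a. complex_of_real (2 * (x \<bullet> b)))" for b
      using continuously_differentiable_mult[OF continuously_differentiable_const[of k 2]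
          continuously_differentiable_inner[of k b]] by simp
    show "times_differentiable_on (Suc k) S F" using assms unfolding smooth_on_def by blast
  qed (use assms in auto)
  then show ?thesis by (simp add: power2_norm_eq_inner)
qed

lemma continuously_differentiable_cnj:
  "continuously_differentiable k \<phi> \<Longrightarrow> continuously_differentiable k (\<lambda>x. cnj (\<phi> x))"
proof (induction k arbitrary: \<phi>)
  case 0
  then show ?case by (auto intro: continuous_intros)
next
  case (Suc k)
  show ?case
  proof (rule continuously_differentiable_SucI[where D = "\<lambda>x b. cnj (partial_deriv b \<phi> x)"])
    show "((\<lambda>x. cnj (\<phi> x)) has_derivative (\<lambda>b. cnj (partial_deriv b \<phi> x))) (at x)" for x
      using Suc.prems by (intro has_derivative_cnj has_derivative_partial) auto
  qed (use Suc in auto)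
qed

lemma borel_measurable_lebesgue_id: "(\<lambda>x::'a::euclidean_space. x) \<in> borel_measurable lebesgue"
  by (rule measurable_completion) simp

lemma integrable_continuous_compact_support:
  fixes f :: "'a::euclidean_space \<Rightarrow> 'b::{banach, second_countable_topology}"
  assumes "continuous_on UNIV f" "compact K" "\<And>x. x \<notin> K \<Longrightarrow> f x = 0"
  shows "integrable lebesgue f"
proof -
  have "integrable lborel (\<lambda>x. indicator K x *\<^sub>R f x)"
    by (rule borel_integrable_compact[OF assms(2)]) (use assms(1) continuous_on_subset in blast)
  moreover have "(\<lambda>x. indicator K x *\<^sub>R f x) = f"
    using assms(3) by (auto simp: indicator_def)
  ultimately show ?thesis
    by (simp add: integrable_completion borel_measurable_integrable)
qed

text \<open>
  The difference quotients have integral \<open>0\<close> by translation invariance, and a function of class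
  \<open>C\<^sup>1\<close> with compact support is Lipschitz, which dominates them.
\<close>

lemma integral_partial_deriv_eq_0:
  fixes \<psi> :: "'a::euclidean_space \<Rightarrow> complex"
  assumes \<psi>: "continuously_differentiable 1 \<psi>" and K: "compact K" "\<And>x. x \<notin> K \<Longrightarrow> \<psi> x = 0"
    and b: "b \<in> Basis"
  shows "(LINT x|lebesgue. partial_deriv b \<psi> x) = 0"
proof -
  define h where "h k = 1 / real (Suc k)" for k
  have h: "h k > 0" "h k \<le> 1" for k by (auto simp: h_def)
  define Q where "Q k x = (\<psi> (x + h k *\<^sub>R b) - \<psi> x) /\<^sub>R h k" for k x
  have diff: "(\<psi> has_derivative (\<lambda>b. partial_deriv b \<psi> x)) (at x)" for x
    using \<psi> by (intro has_derivative_partial) auto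
  have cont: "continuous_on UNIV \<psi>" "continuous_on UNIV (partial_deriv b \<psi>)"
    using \<psi> b continuously_differentiable_Suc_imp[of 0 \<psi>] by auto
  have out: "partial_deriv b \<psi> x = 0" if "x \<notin> K" for x
  proof -
    have "((\<lambda>x. 0::complex) has_derivative (\<lambda>b. partial_deriv b \<psi> x)) (at x)"
      by (rule has_derivative_transform_within_open[OF diff, of "- K"])
        (use that K compact_imp_closed in auto)
    then have "(\<lambda>b. partial_deriv b \<psi> x) = (\<lambda>b. 0)"
      by (intro has_derivative_unique[of "\<lambda>x. 0::complex" _ x]) auto
    then show ?thesis by meson
  qed
  have "compact (partial_deriv b \<psi> ` K)"
    using K cont by (intro compact_continuous_image) (auto intro: continuous_on_subset)
  then obtain C where C: "C \<ge> 0" "\<And>x. x \<in> K \<Longrightarrow> norm (partial_deriv b \<psi> x) \<le> C"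
    using bounded_pos[of "partial_deriv b \<psi> ` K"] compact_imp_bounded by (metis imageI less_imp_le)
  have C': "norm (partial_deriv b \<psi> x) \<le> C" for x
    using C out by (cases "x \<in> K") auto
  have line: "((\<lambda>t. \<psi> (x + t *\<^sub>R b)) has_vector_derivative partial_deriv b \<psi> (x + t *\<^sub>R b)) (at t)" for x t
  proof -
    have "(\<psi> \<circ> (\<lambda>t. x + t *\<^sub>R b) has_derivative (\<lambda>y. partial_deriv y \<psi> (x + t *\<^sub>R b)) \<circ> (\<lambda>s. s *\<^sub>R b)) (at t)"
    proof (rule diff_chain_at)
      show "((\<lambda>t. x + t *\<^sub>R b) has_derivative (\<lambda>s. s *\<^sub>R b)) (at t)"
        by (auto intro!: derivative_eq_intros)
    qed (rule diff)
    moreover have "(\<lambda>y. partial_deriv y \<psi> (x + t *\<^sub>R b)) (s *\<^sub>R b) = s *\<^sub>R partial_deriv b \<psi> (x + t *\<^sub>R b)" for s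
      by (rule linear_cmul[OF bounded_linear.linear[OF has_derivative_bounded_linear[OF diff]]])
    ultimately show ?thesis
      by (simp add: has_vector_derivative_def comp_def)
  qed
  define K1 where "K1 = (\<lambda>(x, t). x - t *\<^sub>R b) ` (K \<times> {0..1})"
  have K1: "compact K1"
    unfolding K1_def
    by (intro compact_continuous_image compact_Times K)
      (auto simp: case_prod_beta intro!: continuous_intros)
  have mem: "x \<in> K1" if "x + t *\<^sub>R b \<in> K" "0 \<le> t" "t \<le> 1" for x t
    unfolding K1_def by (rule image_eqI[of _ _ "(x + t *\<^sub>R b, t)"]) (use that in auto)
  have Q: "norm (Q k x) \<le> C * indicator K1 x" for k x
  proof (cases "x \<in> K1")
    case True
    have "norm (\<psi> (x + h k *\<^sub>R b) - \<psi> (x + 0 *\<^sub>R b)) \<le> C * norm (h k - 0)"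
    proof (rule differentiable_bound[where S = UNIV])
      show "((\<lambda>t. \<psi> (x + t *\<^sub>R b)) has_derivative (\<lambda>s. s *\<^sub>R partial_deriv b \<psi> (x + t *\<^sub>R b))) (at t within UNIV)" for t
        using line[of x t] by (simp add: has_vector_derivative_def)
      show "onorm (\<lambda>s. s *\<^sub>R partial_deriv b \<psi> (x + t *\<^sub>R b)) \<le> C" for t
        by (rule onorm_le) (use C'[of "x + t *\<^sub>R b"] in \<open>auto simp: mult.commute[of C] intro: mult_left_mono\<close>)
    qed auto
    then have "norm (\<psi> (x + h k *\<^sub>R b) - \<psi> x) / h k \<le> C"
      using h[of k] by (simp add: pos_divide_le_eq)
    moreover have "norm (Q k x) = norm (\<psi> (x + h k *\<^sub>R b) - \<psi> x) / h k"
      unfolding Q_def norm_scaleR using h[of k] by (simp add: divide_inverse mult.commute)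
    ultimately show ?thesis using True by simp
  next
    case False
    then have "x + h k *\<^sub>R b \<notin> K" "x \<notin> K"
      using mem[of x "h k"] mem[of x 0] h[of k] by (auto simp: less_imp_le)
    then show ?thesis using K False by (simp add: Q_def)
  qed
  have lim: "(\<lambda>k. Q k x) \<longlonglongrightarrow> partial_deriv b \<psi> x" for x
  proof -
    have "((\<lambda>t. (\<psi> (x + t *\<^sub>R b) - \<psi> x) /\<^sub>R t) \<longlongrightarrow> partial_deriv b \<psi> x) (at 0)"
    proof -
      have "((\<lambda>t. norm (\<psi> (x + t *\<^sub>R b) - \<psi> x - t *\<^sub>R partial_deriv b \<psi> x) / norm t) \<longlongrightarrow> 0) (at 0)"
        using line[of x 0] by (simp add: has_vector_derivative_def has_derivative_iff_norm)
      then have "((\<lambda>t. norm ((\<psi> (x + t *\<^sub>R b) - \<psi> x) /\<^sub>R t - partial_deriv b \<psi> x)) \<longlongrightarrow> 0) (at 0)"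
      proof (rule Lim_transform_eventually)
        have "norm (\<psi> (x + t *\<^sub>R b) - \<psi> x - t *\<^sub>R partial_deriv b \<psi> x) / norm t =
            norm ((\<psi> (x + t *\<^sub>R b) - \<psi> x) /\<^sub>R t - partial_deriv b \<psi> x)" if "t \<noteq> 0" for t
        proof -
          have "(\<psi> (x + t *\<^sub>R b) - \<psi> x) /\<^sub>R t - partial_deriv b \<psi> x =
              (\<psi> (x + t *\<^sub>R b) - \<psi> x - t *\<^sub>R partial_deriv b \<psi> x) /\<^sub>R t"
            using that by (simp add: scaleR_diff_right)
          then show ?thesis by (simp add: divide_inverse mult.commute)
        qed
        then show "\<forall>\<^sub>F t in at 0. norm (\<psi> (x + t *\<^sub>R b) - \<psi> x - t *\<^sub>R partial_deriv b \<psi> x) / norm t =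
            norm ((\<psi> (x + t *\<^sub>R b) - \<psi> x) /\<^sub>R t - partial_deriv b \<psi> x)"
          by (auto simp: eventually_at intro!: exI[of _ 1])
      qed
      then show ?thesis
        by (simp only: tendsto_norm_zero_iff LIM_zero_iff)
    qed
    moreover have "filterlim h (at 0) sequentially"
      unfolding filterlim_at h_def using LIMSEQ_inverse_real_of_nat
      by (auto simp: inverse_eq_divide)
    ultimately show ?thesis
      unfolding Q_def by (rule filterlim_compose)
  qed
  have ints: "integrable lebesgue \<psi>"
    by (rule integrable_continuous_compact_support[OF cont(1) K])
  have "(LINT x|lebesgue. Q k x) = 0" for k
  proof -
    have c': "continuous_on UNIV (\<lambda>x. \<psi> (x + h k *\<^sub>R b))"
      using cont(1) by (rule continuous_on_compose2) (auto intro!: continuous_intros)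
    have i': "integrable lebesgue (\<lambda>x. \<psi> (x + h k *\<^sub>R b))"
      by (rule integrable_continuous_compact_support[OF c' K1])
        (use mem[of _ "h k"] h[of k] K in \<open>auto simp: less_imp_le\<close>)
    have "(LINT x|lebesgue. \<psi> (x + h k *\<^sub>R b)) = (LINT x|lborel. \<psi> (h k *\<^sub>R b + x))"
      using c' by (simp add: integral_completion borel_measurable_continuous_onI add.commute)
    also have "\<dots> = (LINT x|lborel. \<psi> x)"
      using cont(1) by (subst lborel_distr_plus[symmetric, of "h k *\<^sub>R b"], subst integral_distr)
        (auto intro: borel_measurable_continuous_onI)
    also have "\<dots> = (LINT x|lebesgue. \<psi> x)"
      using cont(1) by (simp add: integral_completion borel_measurable_continuous_onI)
    finally have "(LINT x|lebesgue. \<psi> (x + h k *\<^sub>R b)) = (LINT x|lebesgue. \<psi> x)" .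
    then show ?thesis
      using ints i' unfolding Q_def by simp
  qed
  moreover have "(\<lambda>k. LINT x|lebesgue. Q k x) \<longlonglongrightarrow> (LINT x|lebesgue. partial_deriv b \<psi> x)"
  proof (rule integral_dominated_convergence[where w = "\<lambda>x. C * indicator K1 x"])
    show "partial_deriv b \<psi> \<in> borel_measurable lebesgue"
      using cont by (intro measurable_completion) (simp add: borel_measurable_continuous_onI)
    show "Q k \<in> borel_measurable lebesgue" for k
    proof -
      have "continuous_on UNIV (\<lambda>x. \<psi> (x + h k *\<^sub>R b))"
        using cont(1) by (rule continuous_on_compose2) (auto intro!: continuous_intros)
      then have "continuous_on UNIV (Q k)"
        unfolding Q_def using cont(1) by (intro continuous_intros)
      then show ?thesis
        by (intro measurable_completion) (simp add: borel_measurable_continuous_onI)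
    qed
    show "integrable lebesgue (\<lambda>x. C * indicator K1 x)"
      using K1 by (intro integrable_mult_right integrable_real_indicator)
        (auto simp: emeasure_compact_finite lmeasurable_compact fmeasurableD2 less_top[symmetric] dest: lmeasurable_compact)
  qed (use lim Q in auto)
  ultimately have "(\<lambda>k. 0) \<longlonglongrightarrow> (LINT x|lebesgue. partial_deriv b \<psi> x)" by simp
  then show ?thesis using LIMSEQ_unique[OF tendsto_const] by metis
qed


lemma sigma_finite_lebesgue: "sigma_finite_measure (lebesgue :: 'a::euclidean_space measure)"
proof
  have "x \<in> (\<Union>n. cball 0 (real n))" for x :: 'a
    using real_arch_simple[of "norm x"] by auto
  then show "\<exists>A. countable A \<and> A \<subseteq> sets lebesgue \<and> \<Union>A = space lebesgue \<and>
      (\<forall>a\<in>A. emeasure (lebesgue :: 'a measure) a \<noteq> \<infinity>)"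
    by (intro exI[of _ "range (\<lambda>n::nat. cball (0::'a) (real n))"])
      (auto simp: emeasure_cball)
qed

text \<open>The products below increase to the indicator function of the box as \<open>k\<close> grows.\<close>

definition box_bump :: "nat \<Rightarrow> 'a::euclidean_space \<Rightarrow> 'a \<Rightarrow> 'a \<Rightarrow> complex" where
  "box_bump k a b x = (\<Prod>i\<in>Basis. complex_of_real (flat 0 (real (Suc k) * (x \<bullet> i - a \<bullet> i))) *
     complex_of_real (flat 0 (real (Suc k) * (b \<bullet> i - x \<bullet> i))))"

lemma continuously_differentiable_flat_affine:
  "continuously_differentiable k (\<lambda>x. complex_of_real (flat j (c + x \<bullet> v)))"
proof (rule continuously_differentiable_compose[where F = "\<lambda>y. complex_of_real (flat j y)" and S = UNIV])
  show "((\<lambda>x. c + x \<bullet> v) has_derivative (\<lambda>b. b \<bullet> v)) (at x)" for x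
    by (auto intro!: derivative_eq_intros)
  show "times_differentiable_on (Suc k) UNIV (\<lambda>y. complex_of_real (flat j y))"
    using smooth_on_flat unfolding smooth_on_def by blast
qed (auto intro: continuously_differentiable_const)

lemma flat_0: "flat 0 x \<le> 1" "x \<le> 0 \<Longrightarrow> flat 0 x = 0"
  by (auto simp: flat_def)

lemma test_function_box_bump: "test_function UNIV (box_bump k a b)"
  unfolding test_function_def
proof (intro conjI allI impI exI[of _ "cbox a b"])
  fix m
  have "continuously_differentiable m (\<lambda>x. \<Prod>i\<in>Basis.
     complex_of_real (flat 0 (- (real (Suc k) * (a \<bullet> i)) + x \<bullet> (real (Suc k) *\<^sub>R i))) *
     complex_of_real (flat 0 (real (Suc k) * (b \<bullet> i) + x \<bullet> (- real (Suc k) *\<^sub>R i))))"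
    by (intro continuously_differentiable_prod continuously_differentiable_mult
        continuously_differentiable_flat_affine)
  also have "(\<lambda>x. \<Prod>i\<in>Basis.
     complex_of_real (flat 0 (- (real (Suc k) * (a \<bullet> i)) + x \<bullet> (real (Suc k) *\<^sub>R i))) *
     complex_of_real (flat 0 (real (Suc k) * (b \<bullet> i) + x \<bullet> (- real (Suc k) *\<^sub>R i)))) = box_bump k a b"
    unfolding box_bump_def by (intro ext prod.cong refl) (simp add: algebra_simps)
  finally show "continuously_differentiable m (box_bump k a b)" .
  fix x assume "x \<notin> cbox a b"
  then obtain i where i: "i \<in> Basis" "x \<bullet> i < a \<bullet> i \<or> b \<bullet> i < x \<bullet> i"
    by (auto simp: mem_box not_le)
  then have "flat 0 (real (Suc k) * (x \<bullet> i - a \<bullet> i)) = 0 \<or> flat 0 (real (Suc k) * (b \<bullet> i - x \<bullet> i)) = 0"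
    using flat_0(2) by (auto simp: mult_le_0_iff)
  then show "box_bump k a b x = 0"
    unfolding box_bump_def using i(1) by (intro prod_zero) auto
qed auto

lemma norm_box_bump: "norm (box_bump k a b x) \<le> indicator (cbox a b) x"
proof (cases "x \<in> cbox a b")
  case True
  have "norm (box_bump k a b x) \<le> 1"
    unfolding box_bump_def prod_norm[symmetric]
    by (rule prod_le_1) (auto simp: norm_mult flat_nonneg flat_0 intro!: mult_le_one)
  then show ?thesis using True by simp
next
  case False
  then show ?thesis
    using test_function_box_bump[of k a b] box_bump_def
  proof -
    obtain i where i: "i \<in> Basis" "x \<bullet> i < a \<bullet> i \<or> b \<bullet> i < x \<bullet> i"
      using False by (auto simp: mem_box not_le)
    then have "flat 0 (real (Suc k) * (x \<bullet> i - a \<bullet> i)) = 0 \<or> flat 0 (real (Suc k) * (b \<bullet> i - x \<bullet> i)) = 0"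
      using flat_0(2) by (auto simp: mult_le_0_iff)
    then have "box_bump k a b x = 0"
      unfolding box_bump_def using i(1) by (intro prod_zero) auto
    then show ?thesis by simp
  qed
qed

lemma box_bump_tendsto: "(\<lambda>k. box_bump k a b x) \<longlonglongrightarrow> indicator (box a b) x"
proof (cases "x \<in> box a b")
  case True
  have lim: "(\<lambda>k. flat 0 (real (Suc k) * y)) \<longlonglongrightarrow> 1" if "y > 0" for y :: real
  proof -
    have "(\<lambda>k. exp (- (inverse (real (Suc k)) * inverse y))) \<longlonglongrightarrow> exp (- (0 * inverse y))"
      by (intro tendsto_intros LIMSEQ_inverse_real_of_nat)
    moreover have "flat 0 (real (Suc k) * y) = exp (- (inverse (real (Suc k)) * inverse y))" for k
    proof -
      have "real (Suc k) * y > 0" using that by (intro mult_pos_pos) auto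
      then show ?thesis using that unfolding flat_def by (simp add: divide_inverse mult.commute)
    qed
    ultimately show ?thesis by simp
  qed
  have "(\<lambda>k. box_bump k a b x) \<longlonglongrightarrow> (\<Prod>i\<in>(Basis::'a set). complex_of_real 1 * complex_of_real 1)"
    unfolding box_bump_def using True
    by (intro tendsto_prod tendsto_mult tendsto_of_real lim) (auto simp: mem_box)
  then show ?thesis using True by simp
next
  case False
  then obtain i where i: "i \<in> Basis" "x \<bullet> i \<le> a \<bullet> i \<or> b \<bullet> i \<le> x \<bullet> i"
    by (auto simp: mem_box not_less)
  have "box_bump k a b x = 0" for k
  proof -
    have "flat 0 (real (Suc k) * (x \<bullet> i - a \<bullet> i)) = 0 \<or> flat 0 (real (Suc k) * (b \<bullet> i - x \<bullet> i)) = 0"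
      using flat_0(2) i by (auto simp: mult_le_0_iff)
    then show ?thesis
      unfolding box_bump_def using i(1) by (intro prod_zero) auto
  qed
  then show ?thesis using False by simp
qed

text \<open>
  Testing with the bumps gives integral \<open>0\<close> over every open box. Inside a large box the sets over
  which \<open>g\<close> has integral \<open>0\<close> form a Dynkin system, and boxes generate the Borel sets.
\<close>

theorem fundamental_lemma:
  fixes g :: "'a::euclidean_space \<Rightarrow> complex"
  assumes g: "square_integrable lebesgue g"
    and 0: "\<And>\<phi>. test_function UNIV \<phi> \<Longrightarrow> (LINT x|lebesgue. g x * \<phi> x) = 0"
  shows "AE x in lebesgue. g x = 0"
proof -
  note [measurable] = borel_measurable_lebesgue_id
  have loc: "integrable lebesgue (\<lambda>x. norm (g x) * indicator (cbox a b) x)" for a b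
  proof -
    have "square_integrable lebesgue (indicator (cbox a b) :: 'a \<Rightarrow> real)"
      unfolding square_integrable_def
    proof
      have "integrable lebesgue (indicator (cbox a b) :: 'a \<Rightarrow> real)"
        by (rule integrable_real_indicator) (auto simp: emeasure_lborel_cbox_eq)
      moreover have "(norm (indicator (cbox a b) x :: real))\<^sup>2 = indicator (cbox a b) x" for x
        by (simp add: indicator_def)
      ultimately show "integrable lebesgue (\<lambda>x. (norm (indicator (cbox a b) x :: real))\<^sup>2)"
        by simp
    qed (rule borel_measurable_indicator, simp)
    from integrable_norm_mult[OF g this] show ?thesis by simp
  qed
  have box0: "(LINT x|lebesgue. indicator (box a b) x *\<^sub>R g x) = 0" for a b
  proof -
    have "(\<lambda>k. LINT x|lebesgue. g x * box_bump k a b x) \<longlonglongrightarrow> (LINT x|lebesgue. g x * indicator (box a b) x)"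
    proof (rule integral_dominated_convergence[OF _ _ loc[of a b]])
      have "continuous_on UNIV (box_bump k a b)" for k
        using test_function_box_bump[of k a b] by (auto simp: test_function_def dest: spec[of _ 0])
      then have [measurable]: "box_bump k a b \<in> borel_measurable lebesgue" for k
        by (intro measurable_completion) (simp add: borel_measurable_continuous_onI)
      show "(\<lambda>x. g x * box_bump k a b x) \<in> borel_measurable lebesgue" for k
        using g by measurable
      show "(\<lambda>x. g x * indicator (box a b) x) \<in> borel_measurable lebesgue"
        using g by measurable
      show "AE x in lebesgue. (\<lambda>k. g x * box_bump k a b x) \<longlonglongrightarrow> g x * indicator (box a b) x"
        by (auto intro!: tendsto_mult box_bump_tendsto)
      show "AE x in lebesgue. norm (g x * box_bump k a b x) \<le> norm (g x) * indicator (cbox a b) x" for k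
        by (auto simp: norm_mult intro!: mult_left_mono norm_box_bump)
    qed
    then have "(\<lambda>k. 0) \<longlonglongrightarrow> (LINT x|lebesgue. g x * indicator (box a b) x)"
      by (simp add: 0[OF test_function_box_bump])
    then have "(LINT x|lebesgue. g x * indicator (box a b) x) = 0"
      using LIMSEQ_unique[OF tendsto_const] by metis
    moreover have "indicator (box a b) x *\<^sub>R g x = g x * indicator (box a b) x" for x
      by (simp add: indicator_def)
    ultimately show ?thesis by simp
  qed
  have "AE x in lebesgue. x \<in> box (- (real n *\<^sub>R One)) (real n *\<^sub>R One) \<longrightarrow> g x = 0" for n :: nat
  proof -
    define B where "B = box (- (real n *\<^sub>R One)) (real n *\<^sub>R One :: 'a)"
    define G where "G x = indicator B x *\<^sub>R g x" for x
    have G: "integrable lebesgue G"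
    proof (rule Bochner_Integration.integrable_bound[OF loc])
      show "AE x in lebesgue. norm (G x) \<le> norm (norm (g x) *
          indicator (cbox (- (real n *\<^sub>R One)) (real n *\<^sub>R One)) x)"
        using box_subset_cbox by (auto simp: G_def B_def indicator_def)
      show "G \<in> borel_measurable lebesgue"
        unfolding G_def B_def using g by measurable
    qed
    note [measurable] = borel_measurable_integrable[OF G]
    have setI: "integrable lebesgue (\<lambda>x. indicator E x *\<^sub>R G x)" if "E \<in> sets lebesgue" for E
      using integrable_mult_indicator[OF that G] .
    have tot: "(LINT x|lebesgue. G x) = 0"
      unfolding G_def B_def by (rule box0)
    have borel0: "(LINT x|lebesgue. indicator E x *\<^sub>R G x) = 0" if "E \<in> sets borel" for E
    proof -
      have stable: "Int_stable (range (\<lambda>(a, b). box a b :: 'a set))"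
        by (auto simp: Int_stable_def box_Int_box)
      have closed: "range (\<lambda>(a, b). box a b :: 'a set) \<subseteq> Pow UNIV"
        by simp
      have "E \<in> sigma_sets UNIV (range (\<lambda>(a, b). box a b :: 'a set))"
        using that unfolding borel_eq_box by simp
      from stable closed this show ?thesis
      proof (induction rule: sigma_sets_induct_disjoint)
        case (basic E)
        then obtain a b where E: "E = box a b" by auto
        obtain c d where cd: "box a b \<inter> B = box c d"
          unfolding B_def box_Int_box by blast
        have "indicator E x *\<^sub>R G x = indicator (box c d) x *\<^sub>R g x" for x
          unfolding G_def E cd[symmetric] by (auto simp: indicator_def)
        then show ?case using box0 by simp
      next
        case (compl E)
        have "E \<in> sets borel"
          using compl(1) unfolding borel_eq_box by simp
        then have E: "E \<in> sets lebesgue" by simp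
        have "indicator (UNIV - E) x *\<^sub>R G x = G x - indicator E x *\<^sub>R G x" for x
          by (auto simp: indicator_def)
        then show ?case using compl setI[OF E] G tot by simp
      next
        case (union A)
        have "A i \<in> sets borel" for i
          using union(2) unfolding borel_eq_box by auto
        then have A: "A i \<in> sets lebesgue" for i by simp
        have "set_lebesgue_integral lebesgue (\<Union>i. A i) G = (\<Sum>i. set_lebesgue_integral lebesgue (A i) G)"
        proof (rule lebesgue_integral_countable_add)
          show "A i \<inter> A j = {}" if "i \<noteq> j" for i j
            using union(1) that by (auto simp: disjoint_family_on_def)
          show "set_integrable lebesgue (\<Union>i. A i) G"
            unfolding set_integrable_def by (rule setI) (use A in auto)
        qed (rule A)
        then show ?case using union.IH by (simp add: set_lebesgue_integral_def)
      qed simp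
    qed
    have "AE x in lebesgue. G x = 0"
    proof (rule sigma_finite_measure.density_zero[OF _ G])
      show "sigma_finite_measure (lebesgue :: 'a measure)"
        by (rule sigma_finite_lebesgue)
      fix E :: "'a set" assume "E \<in> sets lebesgue"
      then obtain S N N' where E: "E = S \<union> N" "N \<subseteq> N'" "N' \<in> null_sets lborel" "S \<in> sets lborel"
        by (rule sets_completionE)
      have "AE x in lebesgue. x \<notin> N'"
        using E(3) by (intro AE_completion AE_not_in)
      then have "AE x in lebesgue. indicator E x *\<^sub>R G x = indicator S x *\<^sub>R G x"
        by eventually_elim (use E in \<open>auto simp: indicator_def\<close>)
      then have "(LINT x|lebesgue. indicator E x *\<^sub>R G x) = (LINT x|lebesgue. indicator S x *\<^sub>R G x)"
        by (intro integral_cong_AE) (use \<open>E \<in> sets lebesgue\<close> E(4) in auto)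
      then show "set_lebesgue_integral lebesgue E G = 0"
        using borel0[of S] E(4) by (simp add: set_lebesgue_integral_def)
    qed
    then show ?thesis
      by eventually_elim (auto simp: G_def B_def)
  qed
  then have "AE x in lebesgue. \<forall>n::nat. x \<in> box (- (real n *\<^sub>R One)) (real n *\<^sub>R One) \<longrightarrow> g x = 0"
    by (subst AE_all_countable) auto
  moreover have "\<exists>n::nat. x \<in> box (- (real n *\<^sub>R One)) (real n *\<^sub>R One)" for x :: 'a
  proof -
    have "x \<in> (\<Union>i::nat. box (- (real i *\<^sub>R One)) (real i *\<^sub>R One))"
      unfolding UN_box_eq_UNIV by simp
    then show ?thesis by blast
  qed
  ultimately show ?thesis by auto
qed


section \<open>The spaces of the parabolic problem\<close>

lemma points_Lspace2: "v \<in> points (Lspace 2) \<longleftrightarrow> square_integrable lebesgue v"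
proof -
  have "(\<lambda>x. cmod (v x) powr 2) = (\<lambda>x. (cmod (v x))\<^sup>2)"
    by (intro ext) (metis norm_ge_zero powr_numeral)
  then show ?thesis by (simp add: Lspace_def square_integrable_def)
qed

lemma snorm_Lspace2: "snorm (Lspace 2) v = L2_norm lebesgue v"
proof -
  have "(\<lambda>x. cmod (v x) powr 2) = (\<lambda>x. (cmod (v x))\<^sup>2)"
    by (intro ext) (metis norm_ge_zero powr_numeral)
  then show ?thesis by (simp add: Lspace_def L2_norm_def powr_half_sqrt)
qed

lemma square_integrable_zero: "square_integrable M (\<lambda>x. 0)"
  by (simp add: square_integrable_def)

lemma square_integrable_cmult:
  fixes v :: "'a \<Rightarrow> complex"
  assumes "square_integrable M v"
  shows "square_integrable M (\<lambda>x. c * v x)"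
  by (rule square_integrable_dominated[OF assms, of _ "norm c"])
    (use assms in \<open>auto simp: norm_mult\<close>)

interpretation L2: seminormed_space "Lspace 2 :: ('a::euclidean_space \<Rightarrow> complex) seminormed"
proof
  fix u v :: "'a \<Rightarrow> complex"
  show "0 \<in> points (Lspace 2 :: ('a \<Rightarrow> complex) seminormed)"
    using square_integrable_zero by (simp add: points_Lspace2 zero_fun_def)
  show "snorm (Lspace 2) (0 :: 'a \<Rightarrow> complex) = 0"
    by (simp add: snorm_Lspace2 L2_norm_def)
  assume u: "u \<in> points (Lspace 2)"
  then show "- u \<in> points (Lspace 2)"
    using square_integrable_minus[of lebesgue u] by (simp add: points_Lspace2 fun_Compl_def)
  show "snorm (Lspace 2) (- u) = snorm (Lspace 2) u"
    by (simp add: snorm_Lspace2 L2_norm_def)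
  assume v: "v \<in> points (Lspace 2)"
  show "u + v \<in> points (Lspace 2)"
    using square_integrable_add[of lebesgue u v] u v by (simp add: points_Lspace2 plus_fun_def)
  show "snorm (Lspace 2) (u + v) \<le> snorm (Lspace 2) u + snorm (Lspace 2) v"
    using L2_norm_triangle[of lebesgue u v] u v by (simp add: points_Lspace2 snorm_Lspace2 plus_fun_def)
qed

lemma square_integrable_continuous_compact_support:
  fixes f :: "'a::euclidean_space \<Rightarrow> 'b::euclidean_space"
  assumes f: "continuous_on UNIV f" and K: "compact K" "\<And>x. x \<notin> K \<Longrightarrow> f x = 0"
  shows "square_integrable lebesgue f"
  unfolding square_integrable_def
proof
  show "f \<in> borel_measurable lebesgue"
    using f by (intro measurable_completion) (simp add: borel_measurable_continuous_onI)
  show "integrable lebesgue (\<lambda>x. (norm (f x))\<^sup>2)"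
    by (rule integrable_continuous_compact_support[OF _ K(1)])
      (use f K in \<open>auto intro!: continuous_intros\<close>)
qed

lemma partial_deriv_outside:
  assumes \<psi>: "\<And>x. \<psi> differentiable (at x)" and K: "compact K" "\<And>x. x \<notin> K \<Longrightarrow> \<psi> x = 0" and x: "x \<notin> K"
  shows "partial_deriv b \<psi> x = 0"
proof -
  have "((\<lambda>x. 0::complex) has_derivative (\<lambda>b. partial_deriv b \<psi> x)) (at x)"
    by (rule has_derivative_transform_within_open[OF has_derivative_partial[OF \<psi>], of "- K"])
      (use x K compact_imp_closed in auto)
  then have "(\<lambda>b. partial_deriv b \<psi> x) = (\<lambda>b. 0)"
    by (intro has_derivative_unique[of "\<lambda>x. 0::complex" _ x]) auto
  then show ?thesis by meson
qed

lemma test_function_square_integrable: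
  assumes "test_function UNIV \<phi>"
  shows "square_integrable lebesgue \<phi>"
    and "b \<in> Basis \<Longrightarrow> square_integrable lebesgue (partial_deriv b \<phi>)"
proof -
  obtain K where K: "compact K" "\<And>x. x \<notin> K \<Longrightarrow> \<phi> x = 0"
    using assms by (auto simp: test_function_def)
  have "continuously_differentiable 0 \<phi>" "continuously_differentiable (Suc 0) \<phi>"
    using assms unfolding test_function_def by blast+
  then have c: "continuous_on UNIV \<phi>" "\<And>x. \<phi> differentiable (at x)"
    "b \<in> Basis \<Longrightarrow> continuous_on UNIV (partial_deriv b \<phi>)"
    by auto
  show "square_integrable lebesgue \<phi>"
    by (rule square_integrable_continuous_compact_support[OF c(1) K])
  show "square_integrable lebesgue (partial_deriv b \<phi>)" if "b \<in> Basis"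
    by (rule square_integrable_continuous_compact_support[OF c(3)[OF that] K(1)])
      (rule partial_deriv_outside[OF c(2) K])
qed

lemma integrable_mult_square_integrable:
  fixes v w :: "'a \<Rightarrow> complex"
  assumes v: "square_integrable M v" and w: "square_integrable M w"
  shows "integrable M (\<lambda>x. v x * w x)"
  by (rule Bochner_Integration.integrable_bound[OF integrable_norm_mult[OF v w]])
    (use v w in \<open>auto simp: norm_mult\<close>)

lemma square_integrable_vec_nth:
  fixes g :: "'a \<Rightarrow> complex ^ 'n"
  assumes "square_integrable M g"
  shows "square_integrable M (\<lambda>x. g x $ i)"
proof (rule square_integrable_dominated[OF assms, of _ 1])
  have "(\<lambda>v::complex^'n. v $ i) \<in> borel_measurable borel"
    by (intro borel_measurable_continuous_onI continuous_intros)
  then show "(\<lambda>x. g x $ i) \<in> borel_measurable M"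
    using assms by (auto simp: square_integrable_def intro: measurable_compose)
qed (simp add: Finite_Cartesian_Product.norm_nth_le)

lemma borel_measurable_vec:
  fixes g :: "'a \<Rightarrow> complex ^ 'n"
  assumes "\<And>i. (\<lambda>x. g x $ i) \<in> borel_measurable M"
  shows "g \<in> borel_measurable M"
  unfolding borel_measurable_euclidean_space[of g]
proof
  fix b :: "complex ^ 'n" assume "b \<in> Basis"
  then obtain i c where b: "b = axis i c" by (auto simp: Basis_vec_def)
  show "(\<lambda>x. g x \<bullet> b) \<in> borel_measurable M"
    unfolding b inner_axis using assms[of i] by measurable
qed

lemma square_integrable_vec:
  fixes g :: "'a \<Rightarrow> complex ^ 'n"
  assumes g: "\<And>i. square_integrable M (\<lambda>x. g x $ i)"
  shows "square_integrable M g"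
proof -
  have "(\<lambda>x. (norm (g x))\<^sup>2) = (\<lambda>x. \<Sum>i\<in>UNIV. (norm (g x $ i))\<^sup>2)"
    by (auto simp: norm_vec_def L2_set_def sum_nonneg)
  moreover have "integrable M (\<lambda>x. \<Sum>i\<in>UNIV. (norm (g x $ i))\<^sup>2)"
    using g by (auto simp: square_integrable_def)
  moreover have "g \<in> borel_measurable M"
    by (rule borel_measurable_vec) (use g in \<open>simp add: square_integrable_def\<close>)
  ultimately show ?thesis
    by (simp add: square_integrable_def)
qed

lemma is_weak_gradient_square_integrable:
  "is_weak_gradient v g \<Longrightarrow> square_integrable lebesgue g"
  by (rule square_integrable_vec) (auto simp: is_weak_gradient_def points_Lspace2)

text \<open>
  The difference of the components is orthogonal to all test functions.
\<close>

lemma is_weak_gradient_unique: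
  fixes v :: "real ^ 'n::finite \<Rightarrow> complex"
  assumes g: "is_weak_gradient v g" and h: "is_weak_gradient v h"
  shows "AE x in lebesgue. g x = h x"
proof -
  have "AE x in lebesgue. g x $ i - h x $ i = 0" for i
  proof (rule fundamental_lemma)
    have gh: "square_integrable lebesgue (\<lambda>x. g x $ i)" "square_integrable lebesgue (\<lambda>x. h x $ i)"
      using g h by (auto simp: is_weak_gradient_def points_Lspace2)
    then show "square_integrable lebesgue (\<lambda>x. g x $ i - h x $ i)"
      by (rule square_integrable_diff)
    fix \<phi> :: "real ^ 'n \<Rightarrow> complex" assume \<phi>: "test_function UNIV \<phi>"
    have "(LINT x|lebesgue. v x * partial_deriv (axis i 1) \<phi> x) = - (LINT x|lebesgue. k x $ i * \<phi> x)"
      if "is_weak_gradient v k" for k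
      using that \<phi> by (simp add: is_weak_gradient_def)
    from this[OF g] this[OF h]
    have "(LINT x|lebesgue. g x $ i * \<phi> x) = (LINT x|lebesgue. h x $ i * \<phi> x)"
      by simp
    then show "(LINT x|lebesgue. (g x $ i - h x $ i) * \<phi> x) = 0"
      using integrable_mult_square_integrable[OF gh(1) test_function_square_integrable(1)[OF \<phi>]]
        integrable_mult_square_integrable[OF gh(2) test_function_square_integrable(1)[OF \<phi>]]
      by (simp add: left_diff_distrib)
  qed
  then have "AE x in lebesgue. \<forall>i\<in>UNIV. g x $ i - h x $ i = 0"
    by (intro AE_finite_allI) auto
  then show ?thesis
    by eventually_elim (auto simp: vec_eq_iff)
qed

lemma axis_in_Basis: "axis i (1::real) \<in> Basis"
  by (auto simp: Basis_vec_def)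

lemma is_weak_gradient_add:
  assumes v: "square_integrable lebesgue v" "is_weak_gradient v g"
    and w: "square_integrable lebesgue w" "is_weak_gradient w h"
  shows "is_weak_gradient (\<lambda>x. v x + w x) (\<lambda>x. g x + h x)"
  unfolding is_weak_gradient_def
proof (intro conjI allI impI)
  have gh: "square_integrable lebesgue (\<lambda>x. g x $ i)" "square_integrable lebesgue (\<lambda>x. h x $ i)" for i
    using v w by (auto simp: is_weak_gradient_def points_Lspace2)
  show "(\<lambda>x. (g x + h x) $ i) \<in> points (Lspace 2)" for i
    using square_integrable_add[OF gh] by (simp add: points_Lspace2)
  fix i and \<phi> :: "real ^ 'a \<Rightarrow> complex" assume \<phi>: "test_function UNIV \<phi>"
  show "(LINT x|lebesgue. (v x + w x) * partial_deriv (axis i 1) \<phi> x) =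
      - (LINT x|lebesgue. (g x + h x) $ i * \<phi> x)"
    using v(2) w(2) \<phi>
      integrable_mult_square_integrable[OF v(1) test_function_square_integrable(2)[OF \<phi> axis_in_Basis]]
      integrable_mult_square_integrable[OF w(1) test_function_square_integrable(2)[OF \<phi> axis_in_Basis]]
      integrable_mult_square_integrable[OF gh(1) test_function_square_integrable(1)[OF \<phi>]]
      integrable_mult_square_integrable[OF gh(2) test_function_square_integrable(1)[OF \<phi>]]
    by (simp add: distrib_right is_weak_gradient_def)
qed

lemma is_weak_gradient_cmult:
  assumes v: "square_integrable lebesgue v" "is_weak_gradient v g"
  shows "is_weak_gradient (\<lambda>x. c * v x) (\<lambda>x. c *s g x)"
  unfolding is_weak_gradient_def
proof (intro conjI allI impI)
  have g: "square_integrable lebesgue (\<lambda>x. g x $ i)" for i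
    using v by (auto simp: is_weak_gradient_def points_Lspace2)
  show "(\<lambda>x. (c *s g x) $ i) \<in> points (Lspace 2)" for i
    using square_integrable_cmult[OF g] by (simp add: points_Lspace2)
  fix i and \<phi> :: "real ^ 'a \<Rightarrow> complex" assume \<phi>: "test_function UNIV \<phi>"
  show "(LINT x|lebesgue. c * v x * partial_deriv (axis i 1) \<phi> x) =
      - (LINT x|lebesgue. (c *s g x) $ i * \<phi> x)"
    using v(2) \<phi> by (simp add: mult.assoc is_weak_gradient_def)
qed

lemma points_H1D:
  assumes "v \<in> points H1"
  shows "square_integrable lebesgue v" "is_weak_gradient v (wgrad v)"
    "square_integrable lebesgue (wgrad v)"
proof -
  show "square_integrable lebesgue v" using assms by (simp add: H1_def points_Lspace2)
  show g: "is_weak_gradient v (wgrad v)"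
    using assms someI_ex[of "is_weak_gradient v"] by (simp add: H1_def wgrad_def)
  show "square_integrable lebesgue (wgrad v)"
    by (rule is_weak_gradient_square_integrable[OF g])
qed

lemma points_H1I:
  "square_integrable lebesgue v \<Longrightarrow> is_weak_gradient v g \<Longrightarrow> v \<in> points H1"
  by (auto simp: H1_def points_Lspace2)

lemma wgrad_AE:
  "square_integrable lebesgue v \<Longrightarrow> is_weak_gradient v g \<Longrightarrow> AE x in lebesgue. wgrad v x = g x"
  using is_weak_gradient_unique points_H1D(2) points_H1I by blast

lemma H1_add: "v \<in> points H1 \<Longrightarrow> w \<in> points H1 \<Longrightarrow> (\<lambda>x. v x + w x) \<in> points H1"
  by (rule points_H1I[OF square_integrable_add is_weak_gradient_add]) (auto dest: points_H1D)

lemma H1_cmult: "v \<in> points H1 \<Longrightarrow> (\<lambda>x. c * v x) \<in> points H1"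
  by (rule points_H1I[OF square_integrable_cmult is_weak_gradient_cmult]) (auto dest: points_H1D)

lemma wgrad_add:
  assumes "v \<in> points H1" "w \<in> points H1"
  shows "AE x in lebesgue. wgrad (\<lambda>x. v x + w x) x = wgrad v x + wgrad w x"
  by (rule wgrad_AE) (use assms points_H1D in \<open>auto intro: square_integrable_add is_weak_gradient_add\<close>)

lemma wgrad_cmult:
  assumes "v \<in> points H1"
  shows "AE x in lebesgue. wgrad (\<lambda>x. c * v x) x = c *s wgrad v x"
  by (rule wgrad_AE) (use assms points_H1D in \<open>auto intro: square_integrable_cmult is_weak_gradient_cmult\<close>)

lemma square_integrable_Pair:
  assumes "square_integrable M v" "square_integrable M g"
  shows "square_integrable M (\<lambda>x. (v x, g x))"
  using assms by (auto simp: square_integrable_def norm_prod_def)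

text \<open>As the \<open>L\<^sup>2\<close> norm of the pair \<open>(v, \<nabla>v)\<close>, the norm of \<open>H\<^sup>1\<close> inherits the triangle inequality.\<close>

lemma snorm_H1:
  assumes "v \<in> points H1"
  shows "snorm H1 v = L2_norm lebesgue (\<lambda>x. (v x, wgrad v x))"
  using points_H1D[OF assms]
  by (simp add: H1_def L2_norm_def norm_prod_def square_integrable_def)

lemma jet_measurable:
  assumes "v \<in> points H1"
  shows "(\<lambda>x. (v x, wgrad v x)) \<in> borel_measurable lebesgue"
  using points_H1D[OF assms] by (intro borel_measurable_Pair) (auto simp: square_integrable_def)

lemma norm_vector_smult: "norm (c *s (v :: complex ^ 'n)) = norm c * norm v"
  by (simp add: norm_vec_def norm_mult L2_set_right_distrib)

lemma snorm_H1_cmult: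
  assumes v: "v \<in> points H1"
  shows "snorm H1 (\<lambda>x. c * v x) = norm c * snorm H1 v"
proof -
  have "snorm H1 (\<lambda>x. c * v x) = sqrt (LINT x|lebesgue. (norm (c * v x, wgrad (\<lambda>x. c * v x) x))\<^sup>2)"
    using snorm_H1[OF H1_cmult[OF v]] by (simp add: L2_norm_def)
  also have "(LINT x|lebesgue. (norm (c * v x, wgrad (\<lambda>x. c * v x) x))\<^sup>2) =
      (LINT x|lebesgue. (norm c)\<^sup>2 * (norm (v x, wgrad v x))\<^sup>2)"
  proof (rule integral_cong_AE)
    show "AE x in lebesgue. (norm (c * v x, wgrad (\<lambda>x. c * v x) x))\<^sup>2 = (norm c)\<^sup>2 * (norm (v x, wgrad v x))\<^sup>2"
      using wgrad_cmult[OF v, of c]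
      by eventually_elim (simp add: norm_prod_def norm_mult norm_vector_smult power_mult_distrib distrib_left)
  qed (use jet_measurable[OF v] jet_measurable[OF H1_cmult[OF v]] in measurable)
  also have "sqrt \<dots> = norm c * snorm H1 v"
    using snorm_H1[OF v] by (simp add: L2_norm_def real_sqrt_mult)
  finally show ?thesis .
qed

interpretation H1: seminormed_space "H1 :: (real ^ 'n::finite \<Rightarrow> complex) seminormed"
proof
  fix u v :: "real ^ 'n \<Rightarrow> complex"
  have zero: "is_weak_gradient (\<lambda>x. 0 :: complex) (\<lambda>x::real^'n. 0)"
    using square_integrable_zero by (simp add: is_weak_gradient_def points_Lspace2)
  have zH: "(\<lambda>x::real^'n. 0) \<in> points H1"
    using points_H1I[OF square_integrable_zero zero] .
  then show "0 \<in> points (H1 :: (real ^ 'n \<Rightarrow> complex) seminormed)"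
    by (simp add: zero_fun_def)
  show "snorm H1 (0 :: real ^ 'n \<Rightarrow> complex) = 0"
    using snorm_H1_cmult[OF zH, of 0] by (simp add: zero_fun_def)
  assume u: "u \<in> points H1"
  show "- u \<in> points H1"
    using H1_cmult[OF u, of "-1"] by (simp add: fun_Compl_def)
  show "snorm H1 (- u) = snorm H1 u"
    using snorm_H1_cmult[OF u, of "-1"] by (simp add: fun_Compl_def)
  assume v: "v \<in> points H1"
  show uv: "u + v \<in> points H1"
    using H1_add[OF u v] by (simp add: plus_fun_def)
  have "snorm H1 (\<lambda>x. u x + v x) = L2_norm lebesgue (\<lambda>x. (u x + v x, wgrad (\<lambda>x. u x + v x) x))"
    by (rule snorm_H1[OF H1_add[OF u v]])
  also have "\<dots> = L2_norm lebesgue (\<lambda>x. (u x, wgrad u x) + (v x, wgrad v x))"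
  proof (rule L2_norm_cong_AE)
    show "AE x in lebesgue. (u x + v x, wgrad (\<lambda>x. u x + v x) x) = (u x, wgrad u x) + (v x, wgrad v x)"
      using wgrad_add[OF u v] by eventually_elim simp
  qed (use jet_measurable[OF u] jet_measurable[OF v] jet_measurable[OF H1_add[OF u v]] in measurable)
  also have "\<dots> \<le> L2_norm lebesgue (\<lambda>x. (u x, wgrad u x)) + L2_norm lebesgue (\<lambda>x. (v x, wgrad v x))"
    by (intro L2_norm_triangle square_integrable_Pair points_H1D u v)
  also have "\<dots> = snorm H1 u + snorm H1 v"
    using u v by (simp add: snorm_H1)
  finally show "snorm H1 (u + v) \<le> snorm H1 u + snorm H1 v"
    by (simp add: plus_fun_def)
qed

lemma L2_norm_le_H1:
  assumes "v \<in> points H1"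
  shows "L2_norm lebesgue v \<le> snorm H1 v" "L2_norm lebesgue (wgrad v) \<le> snorm H1 v"
proof -
  have i: "0 \<le> (LINT x|lebesgue. (norm (wgrad v x))\<^sup>2)" "0 \<le> (LINT x|lebesgue. (norm (v x))\<^sup>2)"
    by simp_all
  show "L2_norm lebesgue v \<le> snorm H1 v" "L2_norm lebesgue (wgrad v) \<le> snorm H1 v"
    using i unfolding L2_norm_def H1_def by auto
qed

lemma Hneg1_pointI:
  assumes "\<And>w. w \<notin> points H1 \<Longrightarrow> L w = 0"
    and "\<And>v w. v \<in> points H1 \<Longrightarrow> w \<in> points H1 \<Longrightarrow> L (\<lambda>x. v x + w x) = L v + L w"
    and "\<And>c w. w \<in> points H1 \<Longrightarrow> L (\<lambda>x. c * w x) = cnj c * L w"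
    and "\<And>w. w \<in> points H1 \<Longrightarrow> cmod (L w) \<le> C * snorm H1 w"
  shows "L \<in> points Hneg1"
proof -
  have "\<exists>C. \<forall>w\<in>points H1. cmod (L w) \<le> C * snorm H1 w"
    using assms(4) by blast
  then show ?thesis using assms(1-3) by (simp add: Hneg1_def)
qed

lemma Hneg1_pointD:
  assumes "L \<in> points Hneg1"
  shows "w \<notin> points H1 \<Longrightarrow> L w = 0"
    and "v \<in> points H1 \<Longrightarrow> w \<in> points H1 \<Longrightarrow> L (\<lambda>x. v x + w x) = L v + L w"
    and "w \<in> points H1 \<Longrightarrow> L (\<lambda>x. c * w x) = cnj c * L w"
    and "\<exists>C. \<forall>w\<in>points H1. cmod (L w) \<le> C * snorm H1 w"
  using assms by (auto simp: Hneg1_def)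

lemma Hneg1_diff_arg:
  assumes "L \<in> points Hneg1" "v \<in> points H1" "w \<in> points H1"
  shows "L (v - w) = L v - L w"
  using Hneg1_pointD(2)[OF assms(1,2) H1_cmult[OF assms(3), of "-1"]]
    Hneg1_pointD(3)[OF assms(1,3), of "-1"] by (simp add: fun_diff_def)

lemma snorm_Hneg1_le:
  fixes L :: "(real ^ 'n::finite \<Rightarrow> complex) \<Rightarrow> complex"
  assumes "\<And>w. w \<in> points H1 \<Longrightarrow> cmod (L w) \<le> C * snorm H1 w" "0 \<le> C"
  shows "snorm Hneg1 L \<le> C"
proof -
  have "(SUP w\<in>{w \<in> points H1. snorm H1 w \<le> 1}. cmod (L w)) \<le> C"
  proof (rule cSUP_least)
    have "(0 :: real ^ 'n \<Rightarrow> complex) \<in> {w \<in> points H1. snorm H1 w \<le> 1}"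
      by simp
    then show "{w :: real ^ 'n \<Rightarrow> complex. w \<in> points H1 \<and> snorm H1 w \<le> 1} \<noteq> {}"
      by blast
    fix w :: "real ^ 'n \<Rightarrow> complex" assume w: "w \<in> {w \<in> points H1. snorm H1 w \<le> 1}"
    then have "cmod (L w) \<le> C * snorm H1 w" using assms by auto
    also have "\<dots> \<le> C * 1" by (rule mult_left_mono) (use w assms in auto)
    finally show "cmod (L w) \<le> C" by simp
  qed
  then show ?thesis by (simp add: Hneg1_def)
qed

lemma Hneg1_upper:
  fixes L :: "(real ^ 'n::finite \<Rightarrow> complex) \<Rightarrow> complex"
  assumes L: "L \<in> points Hneg1" and w: "w \<in> points H1" "snorm H1 w \<le> 1"
  shows "cmod (L w) \<le> snorm Hneg1 L"
proof -
  obtain C where C: "\<forall>w\<in>points H1. cmod (L w) \<le> C * snorm H1 w"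
    using Hneg1_pointD(4)[OF L] by blast
  have "cmod (L w) \<le> (SUP w\<in>{w \<in> points H1. snorm H1 w \<le> 1}. cmod (L w))"
  proof (rule cSUP_upper)
    show "bdd_above ((\<lambda>w. cmod (L w)) ` {w \<in> points H1. snorm H1 w \<le> 1})"
    proof (rule bdd_aboveI2)
      fix w :: "real ^ 'n \<Rightarrow> complex" assume w: "w \<in> {w \<in> points H1. snorm H1 w \<le> 1}"
      then have "cmod (L w) \<le> C * snorm H1 w" using C by auto
      also have "\<dots> \<le> \<bar>C\<bar> * 1"
        by (rule mult_mono) (use w H1.snorm_nonneg in auto)
      finally show "cmod (L w) \<le> \<bar>C\<bar>" by simp
    qed
  qed (use w in auto)
  then show ?thesis by (simp add: Hneg1_def)
qed

lemma Hneg1_bound: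
  assumes L: "L \<in> points Hneg1" and w: "w \<in> points H1"
  shows "cmod (L w) \<le> snorm Hneg1 L * snorm H1 w"
proof (cases "snorm H1 w = 0")
  case True
  obtain C where "\<forall>w\<in>points H1. cmod (L w) \<le> C * snorm H1 w"
    using Hneg1_pointD(4)[OF L] by blast
  then show ?thesis using True w by force
next
  case False
  then have p: "snorm H1 w > 0" using H1.snorm_nonneg[OF w] by simp
  define c where "c = complex_of_real (1 / snorm H1 w)"
  have c: "norm c * snorm H1 w = 1" using p by (simp add: c_def norm_divide)
  have "cmod (L (\<lambda>x. c * w x)) \<le> snorm Hneg1 L"
    using H1_cmult[OF w, of c] snorm_H1_cmult[OF w, of c] c by (intro Hneg1_upper[OF L]) auto
  moreover have "L (\<lambda>x. c * w x) = c * L w"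
    using Hneg1_pointD(3)[OF L w, of c] by (simp add: c_def)
  moreover have "cmod (L w) = cmod (c * L w) * snorm H1 w"
    using c by (simp add: norm_mult mult_ac)
  ultimately show ?thesis
    using p by (simp add: mult_right_mono)
qed

interpretation Hneg1: seminormed_space "Hneg1 :: ((real ^ 'n::finite \<Rightarrow> complex) \<Rightarrow> complex) seminormed"
proof
  fix L M :: "(real ^ 'n \<Rightarrow> complex) \<Rightarrow> complex"
  show "0 \<in> points (Hneg1 :: ((real ^ 'n \<Rightarrow> complex) \<Rightarrow> complex) seminormed)"
    by (rule Hneg1_pointI[where C = 0]) auto
  show "snorm Hneg1 (0 :: (real ^ 'n \<Rightarrow> complex) \<Rightarrow> complex) = 0"
  proof -
    have "(0 :: real ^ 'n \<Rightarrow> complex) \<in> {w \<in> points H1. snorm H1 w \<le> 1}"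
      by simp
    then have "{w::real ^ 'n \<Rightarrow> complex. w \<in> points H1 \<and> snorm H1 w \<le> 1} \<noteq> {}"
      by blast
    then show ?thesis by (simp add: Hneg1_def)
  qed
  assume L: "L \<in> points Hneg1"
  show "- L \<in> points Hneg1"
    by (rule Hneg1_pointI[where C = "snorm Hneg1 L"]) (use L Hneg1_bound in \<open>auto simp: Hneg1_pointD\<close>)
  show "snorm Hneg1 (- L) = snorm Hneg1 L" by (simp add: Hneg1_def)
  assume M: "M \<in> points Hneg1"
  have b: "cmod ((L + M) w) \<le> (snorm Hneg1 L + snorm Hneg1 M) * snorm H1 w" if "w \<in> points H1" for w
    using Hneg1_bound[OF L that] Hneg1_bound[OF M that] norm_triangle_ineq[of "L w" "M w"]
    by (simp add: distrib_right)
  show "L + M \<in> points Hneg1"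
    by (rule Hneg1_pointI[OF _ _ _ b]) (use L M in \<open>auto simp: Hneg1_pointD distrib_left\<close>)
  have "0 \<le> snorm Hneg1 L" if "L \<in> points Hneg1" for L :: "(real ^ 'n \<Rightarrow> complex) \<Rightarrow> complex"
    using Hneg1_upper[OF that, of 0] norm_ge_zero[of "L 0"] by (simp del: norm_ge_zero)
  then show "snorm Hneg1 (L + M) \<le> snorm Hneg1 L + snorm Hneg1 M"
    using L M by (intro snorm_Hneg1_le b) auto
qed

lemma norm_herm_le: "cmod (herm a b) \<le> norm a * norm b"
proof -
  have "cmod (herm a b) \<le> (\<Sum>i\<in>UNIV. \<bar>cmod (a $ i)\<bar> * \<bar>cmod (b $ i)\<bar>)"
    unfolding herm_def by (rule order_trans[OF norm_sum]) (simp add: norm_mult)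
  also have "\<dots> \<le> norm a * norm b"
    unfolding norm_vec_def by (rule L2_set_mult_ineq)
  finally show ?thesis .
qed

lemma herm_measurable [measurable]:
  fixes F G :: "'a \<Rightarrow> complex ^ 'n"
  assumes "F \<in> borel_measurable M" "G \<in> borel_measurable M"
  shows "(\<lambda>x. herm (F x) (G x)) \<in> borel_measurable M"
proof -
  have "(\<lambda>v::complex^'n. v $ i) \<in> borel_measurable borel" for i
    by (intro borel_measurable_continuous_onI continuous_intros)
  then have [measurable]: "(\<lambda>x. F x $ i) \<in> borel_measurable M" "(\<lambda>x. G x $ i) \<in> borel_measurable M" for i
    using assms by (auto intro: measurable_compose)
  have [measurable]: "(\<lambda>x. cnj (G x $ i)) \<in> borel_measurable M" for i
    by (rule borel_measurable_continuous_on[of cnj]) (auto intro: continuous_intros)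
  show ?thesis unfolding herm_def by measurable
qed

lemma integrable_herm:
  assumes F: "square_integrable M F" and G: "square_integrable M G"
  shows "integrable M (\<lambda>x. herm (F x) (G x))"
  by (rule Bochner_Integration.integrable_bound[OF integrable_norm_mult[OF F G]])
    (use F G norm_herm_le in \<open>auto simp: square_integrable_def\<close>)

lemma integral_herm_le:
  assumes F: "square_integrable M F" and G: "square_integrable M G"
  shows "cmod (LINT x|M. herm (F x) (G x)) \<le> L2_norm M F * L2_norm M G"
proof -
  have "cmod (LINT x|M. herm (F x) (G x)) \<le> (LINT x|M. norm (F x) * norm (G x))"
    by (rule order_trans[OF integral_norm_bound integral_mono])
      (use integrable_norm[OF integrable_herm[OF F G]] integrable_norm_mult[OF F G] norm_herm_le in auto)
  also have "\<dots> \<le> L2_norm M F * L2_norm M G"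
    by (rule Cauchy_Schwarz_L2[OF F G])
  finally show ?thesis .
qed

lemma herm_rules:
  "herm a (b + c) = herm a b + herm a c" "herm (a + c) b = herm a b + herm c b"
  "herm a (z *s b) = cnj z * herm a b" "herm (z *s a) b = z * herm a b"
  "herm (a - c) b = herm a b - herm c b" "herm a (b - c) = herm a b - herm a c"
  by (simp_all add: herm_def sum.distrib sum_distrib_left algebra_simps sum_subtractf)

text \<open>
  The functional \<open>div q\<close>. The operator \<open>div (A \<nabla>v)\<close> is the case \<open>q = A \<nabla>v\<close>; working with \<open>q\<close> makes
  linearity and boundedness visible.
\<close>

definition flux_functional :: "(real ^ 'n::finite \<Rightarrow> complex ^ 'n) \<Rightarrow> (real ^ 'n \<Rightarrow> complex) \<Rightarrow> complex" where
  "flux_functional q = (\<lambda>w. if w \<in> points H1 then - (LINT x|lebesgue. herm (q x) (wgrad w x)) else 0)"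

lemma flux_functional:
  assumes q: "square_integrable lebesgue q"
  shows "flux_functional q \<in> points Hneg1" "snorm Hneg1 (flux_functional q) \<le> L2_norm lebesgue q"
proof -
  have b: "cmod (flux_functional q w) \<le> L2_norm lebesgue q * snorm H1 w" if w: "w \<in> points H1" for w
  proof -
    have "cmod (flux_functional q w) \<le> L2_norm lebesgue q * L2_norm lebesgue (wgrad w)"
      using w integral_herm_le[OF q points_H1D(3)[OF w]] by (simp add: flux_functional_def)
    also have "\<dots> \<le> L2_norm lebesgue q * snorm H1 w"
      using L2_norm_le_H1(2)[OF w] by (rule mult_left_mono) simp
    finally show ?thesis .
  qed
  show "flux_functional q \<in> points Hneg1"
  proof (rule Hneg1_pointI[OF _ _ _ b])
    fix v w :: "real ^ 'a \<Rightarrow> complex" assume v: "v \<in> points H1" and w: "w \<in> points H1"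
    have "(LINT x|lebesgue. herm (q x) (wgrad (\<lambda>x. v x + w x) x)) =
        (LINT x|lebesgue. herm (q x) (wgrad v x) + herm (q x) (wgrad w x))"
    proof (rule integral_cong_AE)
      show "AE x in lebesgue. herm (q x) (wgrad (\<lambda>x. v x + w x) x) = herm (q x) (wgrad v x) + herm (q x) (wgrad w x)"
        using wgrad_add[OF v w] by eventually_elim (simp add: herm_rules)
    qed (use q points_H1D(3)[OF v] points_H1D(3)[OF w] points_H1D(3)[OF H1_add[OF v w]] in measurable)
    then show "flux_functional q (\<lambda>x. v x + w x) = flux_functional q v + flux_functional q w"
      using v w H1_add[OF v w] integrable_herm[OF q points_H1D(3)[OF v]] integrable_herm[OF q points_H1D(3)[OF w]]
      by (simp add: flux_functional_def)
  next
    fix c and w :: "real ^ 'a \<Rightarrow> complex" assume w: "w \<in> points H1"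
    have "(LINT x|lebesgue. herm (q x) (wgrad (\<lambda>x. c * w x) x)) = (LINT x|lebesgue. cnj c * herm (q x) (wgrad w x))"
    proof (rule integral_cong_AE)
      show "AE x in lebesgue. herm (q x) (wgrad (\<lambda>x. c * w x) x) = cnj c * herm (q x) (wgrad w x)"
        using wgrad_cmult[OF w, of c] by eventually_elim (simp add: herm_rules)
    qed (use q points_H1D(3)[OF w] points_H1D(3)[OF H1_cmult[OF w]] in measurable)
    then show "flux_functional q (\<lambda>x. c * w x) = cnj c * flux_functional q w"
      using w H1_cmult[OF w] by (simp add: flux_functional_def)
  qed (simp add: flux_functional_def)
  show "snorm Hneg1 (flux_functional q) \<le> L2_norm lebesgue q"
    by (rule snorm_Hneg1_le[OF b]) auto
qed

lemma integral_mult_cnj_le: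
  assumes v: "square_integrable lebesgue v" and w: "square_integrable lebesgue w"
  shows "cmod (LINT x|lebesgue. v x * cnj (w x)) \<le> L2_norm lebesgue v * L2_norm lebesgue w"
    and "integrable lebesgue (\<lambda>x. v x * cnj (w x))"
proof -
  have [measurable]: "(\<lambda>x. cnj (w x)) \<in> borel_measurable lebesgue"
    by (rule borel_measurable_continuous_on[of cnj]) (use w in \<open>auto intro: continuous_intros simp: square_integrable_def\<close>)
  show i: "integrable lebesgue (\<lambda>x. v x * cnj (w x))"
    by (rule Bochner_Integration.integrable_bound[OF integrable_norm_mult[OF v w]])
      (use v in \<open>auto simp: norm_mult\<close>)
  have "cmod (LINT x|lebesgue. v x * cnj (w x)) \<le> (LINT x|lebesgue. norm (v x) * norm (w x))"
    by (rule order_trans[OF integral_norm_bound integral_mono])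
      (use integrable_norm[OF i] integrable_norm_mult[OF v w] in \<open>auto simp: norm_mult\<close>)
  also have "\<dots> \<le> L2_norm lebesgue v * L2_norm lebesgue w"
    by (rule Cauchy_Schwarz_L2[OF v w])
  finally show "cmod (LINT x|lebesgue. v x * cnj (w x)) \<le> L2_norm lebesgue v * L2_norm lebesgue w" .
qed

lemma to_Hneg1:
  assumes v: "square_integrable lebesgue v"
  shows "to_Hneg1 v \<in> points Hneg1" "snorm Hneg1 (to_Hneg1 v) \<le> L2_norm lebesgue v"
proof -
  have b: "cmod (to_Hneg1 v w) \<le> L2_norm lebesgue v * snorm H1 w" if w: "w \<in> points H1" for w
  proof -
    have "cmod (to_Hneg1 v w) \<le> L2_norm lebesgue v * L2_norm lebesgue w"
      using w integral_mult_cnj_le(1)[OF v points_H1D(1)[OF w]] by (simp add: to_Hneg1_def)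
    also have "\<dots> \<le> L2_norm lebesgue v * snorm H1 w"
      using L2_norm_le_H1(1)[OF w] by (rule mult_left_mono) simp
    finally show ?thesis .
  qed
  note i = integral_mult_cnj_le(2)[OF v points_H1D(1)]
  show "to_Hneg1 v \<in> points Hneg1"
  proof (rule Hneg1_pointI[OF _ _ _ b])
    fix u w :: "real ^ 'a \<Rightarrow> complex" assume u: "u \<in> points H1" and w: "w \<in> points H1"
    show "to_Hneg1 v (\<lambda>x. u x + w x) = to_Hneg1 v u + to_Hneg1 v w"
      using u w H1_add[OF u w] i[OF u] i[OF w] by (simp add: to_Hneg1_def distrib_left)
  next
    fix c and w :: "real ^ 'a \<Rightarrow> complex" assume w: "w \<in> points H1"
    have "(LINT x|lebesgue. v x * (cnj c * cnj (w x))) = (LINT x|lebesgue. cnj c * (v x * cnj (w x)))"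
      by (simp add: mult_ac)
    then show "to_Hneg1 v (\<lambda>x. c * w x) = cnj c * to_Hneg1 v w"
      using w H1_cmult[OF w] by (simp add: to_Hneg1_def)
  qed (simp add: to_Hneg1_def)
  show "snorm Hneg1 (to_Hneg1 v) \<le> L2_norm lebesgue v"
    by (rule snorm_Hneg1_le[OF b]) auto
qed


section \<open>Bochner integrals of functionals are computed pointwise\<close>

lemma borel_measurable_lebesgue_on_AE:
  fixes f g :: "'a::euclidean_space \<Rightarrow> 'b::euclidean_space"
  assumes S: "S \<in> sets lebesgue" and f: "f \<in> borel_measurable (lebesgue_on S)"
    and ae: "AE x in lebesgue_on S. f x = g x"
  shows "g \<in> borel_measurable (lebesgue_on S)"
proof -
  have S': "S \<inter> space lebesgue \<in> sets lebesgue" using S by simp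
  have "(\<lambda>x. indicator S x *\<^sub>R f x) \<in> borel_measurable lebesgue"
    by (rule borel_measurable_restrict_space_iff[OF S', THEN iffD1, OF f])
  moreover have "AE x in lebesgue. indicator S x *\<^sub>R f x = indicator S x *\<^sub>R g x"
    using ae unfolding AE_restrict_space_iff[OF S']
    by eventually_elim (auto simp: indicator_def)
  ultimately have "(\<lambda>x. indicator S x *\<^sub>R g x) \<in> borel_measurable lebesgue"
    by (rule borel_measurable_AE)
  then show ?thesis
    by (rule borel_measurable_restrict_space_iff[OF S', THEN iffD2])
qed

lemma snorm_borel_measurable:
  assumes "seminormed_space X" "S \<in> sets lebesgue" "strongly_measurable (lebesgue_on S) X u"
  shows "(\<lambda>t::real. snorm X (u t)) \<in> borel_measurable (lebesgue_on S)"
proof (rule seminormed_space.strongly_measurable_approx[OF assms(1,3)])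
  fix g assume g: "g \<in> borel_measurable (lebesgue_on S)" "AE t in lebesgue_on S. snorm X (u t) = g t"
  have "AE t in lebesgue_on S. g t = snorm X (u t)"
    using g(2) by eventually_elim simp
  then show ?thesis
    by (rule borel_measurable_lebesgue_on_AE[OF assms(2) g(1)])
qed

lemma Hneg1_eval_measurable:
  assumes S: "S \<in> sets lebesgue" and u: "strongly_measurable (lebesgue_on S) Hneg1 u"
    and w: "w \<in> points H1"
  shows "(\<lambda>t::real. u t w) \<in> borel_measurable (lebesgue_on S)"
proof -
  let ?M = "lebesgue_on S"
  obtain \<sigma> where s: "\<And>k. simple_function ?M (\<sigma> k)" "\<And>k. \<sigma> k ` space ?M \<subseteq> points Hneg1"
    "AE t in ?M. u t \<in> points Hneg1 \<and> (\<lambda>k. snorm Hneg1 (\<sigma> k t - u t)) \<longlonglongrightarrow> 0"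
    using u by (auto simp: strongly_measurable_def)
  have [measurable]: "(\<lambda>t. \<sigma> k t w) \<in> borel_measurable ?M" for k
    by (intro borel_measurable_simple_function simple_function_compose1[OF s(1), where g = "\<lambda>L. L w"])
  have "(\<lambda>t. lim (\<lambda>k. \<sigma> k t w)) \<in> borel_measurable ?M"
    by measurable
  moreover have "AE t in ?M. lim (\<lambda>k. \<sigma> k t w) = u t w"
    using s(3) AE_space
  proof eventually_elim
    case (elim t)
    have "(\<lambda>k. \<sigma> k t w - u t w) \<longlonglongrightarrow> 0"
    proof (rule Lim_null_comparison)
      show "(\<lambda>k. snorm Hneg1 (\<sigma> k t - u t) * snorm H1 w) \<longlonglongrightarrow> 0"
        using elim by (intro tendsto_mult_left_zero) auto
      have "\<sigma> k t - u t \<in> points Hneg1" for k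
        using s(2)[of k] elim by auto
      then show "\<forall>\<^sub>F k in sequentially. norm (\<sigma> k t w - u t w) \<le> snorm Hneg1 (\<sigma> k t - u t) * snorm H1 w"
        using Hneg1_bound[OF _ w] by (intro always_eventually) fastforce
    qed
    then show ?case by (intro limI) (simp add: LIM_zero_iff)
  qed
  ultimately show ?thesis by (rule borel_measurable_lebesgue_on_AE[OF S])
qed

lemma simple_bochner_integrable_finite_measure:
  assumes "finite_measure M" "simple_function M \<sigma>"
  shows "Bochner_Integration.simple_bochner_integrable M \<sigma>"
proof -
  interpret finite_measure M by fact
  show ?thesis
    by (rule simple_bochner_integrable.intros[OF assms(2)]) simp
qed

lemma simple_bochner_integral_eval:
  fixes \<sigma> :: "'t \<Rightarrow> ('a \<Rightarrow> complex)"
  assumes M: "finite_measure M" and s: "simple_function M \<sigma>"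
  shows "Bochner_Integration.simple_bochner_integral M \<sigma> w = (LINT t|M. \<sigma> t w)"
proof -
  have "linear (\<lambda>L::'a \<Rightarrow> complex. L w)"
    by (rule linearI) (auto simp: scaleR_fun_def)
  then have "Bochner_Integration.simple_bochner_integral M (\<lambda>t. \<sigma> t w) = Bochner_Integration.simple_bochner_integral M \<sigma> w"
    by (rule simple_bochner_integral_linear) (rule simple_bochner_integrable_finite_measure[OF M s])
  moreover have "Bochner_Integration.simple_bochner_integrable M (\<lambda>t. \<sigma> t w)"
    by (rule simple_bochner_integrable_finite_measure[OF M simple_function_compose1[OF s, where g = "\<lambda>L. L w"]])
  ultimately show ?thesis
    by (simp add: simple_bochner_integrable_eq_integral)
qed

text \<open>
  The value \<open>0\<close> off \<^const>\<open>H1\<close> is the one that \<^const>\<open>Hneg1\<close> prescribes.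
\<close>

definition pointwise_integral ::
    "'t measure \<Rightarrow> ('t \<Rightarrow> (real ^ 'n::finite \<Rightarrow> complex) \<Rightarrow> complex) \<Rightarrow> (real ^ 'n \<Rightarrow> complex) \<Rightarrow> complex" where
  "pointwise_integral M u = (\<lambda>w. if w \<in> points H1 then LINT t|M. u t w else 0)"

locale integrable_functionals =
  fixes S :: "real set" and u :: "real \<Rightarrow> (real ^ 'n::finite \<Rightarrow> complex) \<Rightarrow> complex"
  assumes S: "S \<in> lmeasurable"
    and u: "strongly_measurable (lebesgue_on S) Hneg1 u"
    and fin: "(\<integral>\<^sup>+ t. ennreal (snorm Hneg1 (u t)) \<partial>lebesgue_on S) < \<infinity>"
begin

abbreviation "M \<equiv> lebesgue_on S"

lemma S': "S \<in> sets lebesgue" using S by (rule fmeasurableD)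

sublocale finite_measure M using S by (rule finite_measure_lebesgue_on)

lemma u_points: "AE t in M. u t \<in> points Hneg1"
  using u by (auto simp: strongly_measurable_def)

lemma integrable_snorm: "integrable M (\<lambda>t. snorm Hneg1 (u t))"
proof (rule integrableI_nonneg)
  show "(\<lambda>t. snorm Hneg1 (u t)) \<in> borel_measurable M"
    by (rule snorm_borel_measurable[OF Hneg1.seminormed_space_axioms S' u])
  show "AE t in M. 0 \<le> snorm Hneg1 (u t)"
    using u_points by eventually_elim (rule Hneg1.snorm_nonneg)
qed (use fin in auto)

lemma eval_bound: "w \<in> points H1 \<Longrightarrow> AE t in M. norm (u t w) \<le> snorm Hneg1 (u t) * snorm H1 w"
  using u_points by eventually_elim (rule Hneg1_bound)

lemma integrable_eval:
  assumes w: "w \<in> points H1"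
  shows "integrable M (\<lambda>t. u t w)"
proof (rule Bochner_Integration.integrable_bound)
  show "integrable M (\<lambda>t. snorm Hneg1 (u t) * snorm H1 w)"
    using integrable_snorm by simp
  show "(\<lambda>t. u t w) \<in> borel_measurable M"
    by (rule Hneg1_eval_measurable[OF S' u w])
  show "AE t in M. norm (u t w) \<le> norm (snorm Hneg1 (u t) * snorm H1 w)"
    using eval_bound[OF w] by eventually_elim auto
qed

lemma pointwise_integral_bound:
  assumes w: "w \<in> points H1"
  shows "cmod (pointwise_integral M u w) \<le> (LINT t|M. snorm Hneg1 (u t)) * snorm H1 w"
proof -
  have "cmod (LINT t|M. u t w) \<le> (LINT t|M. snorm Hneg1 (u t) * snorm H1 w)"
    by (rule order_trans[OF integral_norm_bound integral_mono_AE])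
      (use integrable_norm[OF integrable_eval[OF w]] integrable_snorm eval_bound[OF w] in auto)
  then show ?thesis using w by (simp add: pointwise_integral_def)
qed

lemma pointwise_integral_point: "pointwise_integral M u \<in> points Hneg1"
proof (rule Hneg1_pointI[OF _ _ _ pointwise_integral_bound])
  fix v w :: "real ^ 'n \<Rightarrow> complex" assume v: "v \<in> points H1" and w: "w \<in> points H1"
  have "(LINT t|M. u t (\<lambda>x. v x + w x)) = (LINT t|M. u t v + u t w)"
  proof (rule integral_cong_AE)
    show "AE t in M. u t (\<lambda>x. v x + w x) = u t v + u t w"
      using u_points by eventually_elim (rule Hneg1_pointD(2)[OF _ v w])
  qed (use integrable_eval[OF H1_add[OF v w]] integrable_eval[OF v] integrable_eval[OF w] in auto)
  then show "pointwise_integral M u (\<lambda>x. v x + w x) = pointwise_integral M u v + pointwise_integral M u w"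
    using v w H1_add[OF v w] integrable_eval[OF v] integrable_eval[OF w]
    by (simp add: pointwise_integral_def)
next
  fix c and w :: "real ^ 'n \<Rightarrow> complex" assume w: "w \<in> points H1"
  have "(LINT t|M. u t (\<lambda>x. c * w x)) = (LINT t|M. cnj c * u t w)"
  proof (rule integral_cong_AE)
    show "AE t in M. u t (\<lambda>x. c * w x) = cnj c * u t w"
      using u_points by eventually_elim (rule Hneg1_pointD(3)[OF _ w])
  qed (use integrable_eval[OF H1_cmult[OF w]] integrable_eval[OF w] in auto)
  then show "pointwise_integral M u (\<lambda>x. c * w x) = cnj c * pointwise_integral M u w"
    using w H1_cmult[OF w] by (simp add: pointwise_integral_def)
qed (auto simp: pointwise_integral_def)

end

lemma integrable_simple_function_compose:
  assumes "finite_measure M" "simple_function M \<sigma>"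
  shows "integrable M (\<lambda>t. (g (\<sigma> t) :: 'b::{banach, second_countable_topology}))"
  using simple_bochner_integrable_finite_measure[OF assms(1) simple_function_compose1[OF assms(2), where g = g]]
  by (rule has_bochner_integral_simple_bochner_integrable[THEN integrable.intros])

lemma simple_functionals:
  assumes S: "S \<in> lmeasurable" and s: "simple_function (lebesgue_on S) \<sigma>" "\<sigma> ` S \<subseteq> points Hneg1"
  shows "integrable_functionals S \<sigma>"
    and "Bochner_Integration.simple_bochner_integral (lebesgue_on S) \<sigma> = pointwise_integral (lebesgue_on S) \<sigma>"
proof -
  let ?M = "lebesgue_on S"
  note fm = finite_measure_lebesgue_on[OF S]
  show "integrable_functionals S \<sigma>"
  proof
    show "strongly_measurable ?M Hneg1 \<sigma>"
      unfolding strongly_measurable_def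
      by (rule exI[of _ "\<lambda>_. \<sigma>"]) (use s in \<open>auto intro!: AE_I2\<close>)
    have "(\<integral>\<^sup>+ t. ennreal (norm (snorm Hneg1 (\<sigma> t))) \<partial>?M) < \<infinity>"
      using integrable_simple_function_compose[OF fm s(1), of "snorm Hneg1"]
      by (simp add: integrable_iff_bounded)
    then show "(\<integral>\<^sup>+ t. ennreal (snorm Hneg1 (\<sigma> t)) \<partial>?M) < \<infinity>"
      by (rule le_less_trans[rotated]) (auto intro!: nn_integral_mono ennreal_leI)
  qed (rule S)
  show "Bochner_Integration.simple_bochner_integral ?M \<sigma> = pointwise_integral ?M \<sigma>"
  proof
    fix w
    have "(LINT t|?M. \<sigma> t w) = (LINT t|?M. 0)" if "w \<notin> points H1"
      by (rule Bochner_Integration.integral_cong) (use s(2) that Hneg1_pointD(1) in auto)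
    then show "Bochner_Integration.simple_bochner_integral ?M \<sigma> w = pointwise_integral ?M \<sigma> w"
      using simple_bochner_integral_eval[OF fm s(1)] by (simp add: pointwise_integral_def)
  qed
qed

text \<open>The simple functions are cut off where they exceed twice the norm of \<open>u\<close>, so that they
  converge in \<open>L\<^sup>1\<close> by dominated convergence.\<close>

lemma (in integrable_functionals) has_bochner_integral_pointwise:
  "has_bochner_integral_in M Hneg1 u (pointwise_integral M u)"
proof (rule Hneg1.strongly_measurable_approx[OF u])
  fix g \<sigma> assume g: "g \<in> borel_measurable M" "\<And>t. 0 \<le> g t" "AE t in M. snorm Hneg1 (u t) = g t"
    and s: "\<And>k. simple_function M (\<sigma> k)" "\<And>k. \<sigma> k ` space M \<subseteq> points Hneg1"
    and sg: "\<And>k t. t \<in> space M \<Longrightarrow> snorm Hneg1 (\<sigma> k t) \<le> 2 * g t"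
    and lim: "AE t in M. u t \<in> points Hneg1 \<and> (\<lambda>k. snorm Hneg1 (\<sigma> k t - u t)) \<longlonglongrightarrow> 0"
  note [measurable] = g(1)
  have ssm: "strongly_measurable M Hneg1 (\<sigma> k)" for k
    unfolding strongly_measurable_def
    by (rule exI[of _ "\<lambda>_. \<sigma> k"]) (use s(1)[of k] s(2)[of k] in \<open>auto intro!: AE_I2\<close>)
  have meas: "(\<lambda>t. snorm Hneg1 (\<sigma> k t - u t)) \<in> borel_measurable M" for k
    by (rule snorm_borel_measurable[OF Hneg1.seminormed_space_axioms S'
          Hneg1.strongly_measurable_diff[OF ssm u]])
  have gi: "integrable M g"
    by (rule Bochner_Integration.integrable_cong_AE[THEN iffD1, OF _ _ g(3) integrable_snorm])
      (use integrable_snorm in auto)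
  have bd: "AE t in M. norm (snorm Hneg1 (\<sigma> k t - u t)) \<le> 3 * g t" for k
    using lim g(3) AE_space
  proof eventually_elim
    case (elim t)
    have p: "\<sigma> k t \<in> points Hneg1" using s(2)[of k] elim by auto
    then have "\<sigma> k t - u t \<in> points Hneg1" using elim by auto
    then show ?case
      using Hneg1.snorm_diff_le[OF p, of "u t"] Hneg1.snorm_nonneg[of "\<sigma> k t - u t"] sg[of t k] elim
      by auto
  qed
  have L: "(\<lambda>k. LINT t|M. snorm Hneg1 (\<sigma> k t - u t)) \<longlonglongrightarrow> (LINT t|M. 0)"
    by (rule integral_dominated_convergence[where w = "\<lambda>t. 3 * g t"])
      (use meas gi bd lim in auto)
  have ints: "integrable M (\<lambda>t. snorm Hneg1 (\<sigma> k t - u t))" for k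
    by (rule Bochner_Integration.integrable_bound[where f = "\<lambda>t. 3 * g t"])
      (use meas gi bd[of k] g(2) in auto)
  have comm: "AE t in M. snorm Hneg1 (u t - \<sigma> k t) = snorm Hneg1 (\<sigma> k t - u t) \<and> 0 \<le> snorm Hneg1 (\<sigma> k t - u t)" for k
    using u_points AE_space
  proof eventually_elim
    case (elim t)
    have p: "\<sigma> k t \<in> points Hneg1" using s(2)[of k] elim by auto
    then have "\<sigma> k t - u t \<in> points Hneg1" using elim by auto
    then show ?case
      using Hneg1.snorm_commute[OF _ p, of "u t"] Hneg1.snorm_nonneg[of "\<sigma> k t - u t"] elim by auto
  qed
  have nn: "(\<integral>\<^sup>+ t. ennreal (snorm Hneg1 (u t - \<sigma> k t)) \<partial>M) = ennreal (LINT t|M. snorm Hneg1 (\<sigma> k t - u t))" for k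
  proof -
    have "(\<integral>\<^sup>+ t. ennreal (snorm Hneg1 (u t - \<sigma> k t)) \<partial>M) = (\<integral>\<^sup>+ t. ennreal (snorm Hneg1 (\<sigma> k t - u t)) \<partial>M)"
      by (rule nn_integral_cong_AE) (use comm[of k] in auto)
    also have "\<dots> = ennreal (LINT t|M. snorm Hneg1 (\<sigma> k t - u t))"
      by (rule nn_integral_eq_integral[OF ints]) (use comm[of k] in auto)
    finally show ?thesis .
  qed
  have conv1: "(\<lambda>k. \<integral>\<^sup>+ t. ennreal (snorm Hneg1 (u t - \<sigma> k t)) \<partial>M) \<longlonglongrightarrow> 0"
    unfolding nn using tendsto_ennrealI[OF L] by simp
  have bound: "cmod ((Bochner_Integration.simple_bochner_integral M (\<sigma> k) - pointwise_integral M u) w)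
      \<le> (LINT t|M. snorm Hneg1 (\<sigma> k t - u t)) * snorm H1 w" if w: "w \<in> points H1" for k w
  proof -
    have i: "integrable M (\<lambda>t. \<sigma> k t w)"
      by (rule integrable_simple_function_compose[OF finite_measure_axioms s(1), of "\<lambda>L. L w"])
    have "(Bochner_Integration.simple_bochner_integral M (\<sigma> k) - pointwise_integral M u) w = (LINT t|M. \<sigma> k t w - u t w)"
      using w simple_bochner_integral_eval[OF finite_measure_axioms s(1)] i integrable_eval[OF w]
      by (simp add: pointwise_integral_def)
    also have "cmod \<dots> \<le> (LINT t|M. snorm Hneg1 (\<sigma> k t - u t) * snorm H1 w)"
    proof (rule order_trans[OF integral_norm_bound integral_mono_AE])
      show "AE t in M. cmod (\<sigma> k t w - u t w) \<le> snorm Hneg1 (\<sigma> k t - u t) * snorm H1 w"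
        using u_points AE_space
      proof eventually_elim
        case (elim t)
        have "\<sigma> k t - u t \<in> points Hneg1" using s(2)[of k] elim by auto
        from Hneg1_bound[OF this w] show ?case by simp
      qed
    qed (use ints[of k] i integrable_eval[OF w] in auto)
    also have "\<dots> = (LINT t|M. snorm Hneg1 (\<sigma> k t - u t)) * snorm H1 w"
      by (rule integral_mult_left_zero)
    finally show ?thesis .
  qed
  have conv2: "(\<lambda>k. snorm Hneg1 (Bochner_Integration.simple_bochner_integral M (\<sigma> k) - pointwise_integral M u)) \<longlonglongrightarrow> 0"
  proof (rule Lim_null_comparison)
    show "(\<lambda>k. LINT t|M. snorm Hneg1 (\<sigma> k t - u t)) \<longlonglongrightarrow> 0" using L by simp
    have "0 \<le> (LINT t|M. snorm Hneg1 (\<sigma> k t - u t))" for k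
      by (rule integral_nonneg_AE) (use comm[of k] in auto)
    moreover have "Bochner_Integration.simple_bochner_integral M (\<sigma> k) \<in> points Hneg1" for k
      using simple_functionals[OF S s(1)[of k]] s(2)[of k] integrable_functionals.pointwise_integral_point
      by auto
    moreover have "snorm Hneg1 (Bochner_Integration.simple_bochner_integral M (\<sigma> k) - pointwise_integral M u)
        \<le> (LINT t|M. snorm Hneg1 (\<sigma> k t - u t))" for k
      by (rule snorm_Hneg1_le[OF bound], assumption) (rule calculation(1))
    ultimately show "\<forall>\<^sub>F k in sequentially.
        norm (snorm Hneg1 (Bochner_Integration.simple_bochner_integral M (\<sigma> k) - pointwise_integral M u))
        \<le> (LINT t|M. snorm Hneg1 (\<sigma> k t - u t))"
      using pointwise_integral_point
      by (intro always_eventually allI) (simp add: abs_of_nonneg[OF Hneg1.snorm_nonneg[OF Hneg1.diff_point]])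
  qed
  show ?thesis
    unfolding has_bochner_integral_in_def
    using u pointwise_integral_point conv1 conv2 s simple_bochner_integrable_finite_measure[OF finite_measure_axioms s(1)]
    by blast
qed

text \<open>
  Evaluation at \<open>w\<close> is bounded on \<^const>\<open>Hneg1\<close>, so it commutes with the limit over simple functions. This
  turns every statement about Bochner integrals into one about scalar integrals.
\<close>

lemma has_bochner_integral_inD:
  fixes u :: "real \<Rightarrow> (real ^ 'n::finite \<Rightarrow> complex) \<Rightarrow> complex"
  assumes S: "S \<in> lmeasurable" and i: "has_bochner_integral_in (lebesgue_on S) Hneg1 u y"
  shows "integrable_functionals S u" "y = pointwise_integral (lebesgue_on S) u"
proof -
  let ?M = "lebesgue_on S"
  interpret finite_measure ?M using S by (rule finite_measure_lebesgue_on)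
  obtain \<sigma> where u: "strongly_measurable ?M Hneg1 u" and y: "y \<in> points Hneg1"
    and s: "\<And>k. Bochner_Integration.simple_bochner_integrable ?M (\<sigma> k)" "\<And>k. \<sigma> k ` space ?M \<subseteq> points Hneg1"
    and conv: "(\<lambda>k. \<integral>\<^sup>+ t. ennreal (snorm Hneg1 (u t - \<sigma> k t)) \<partial>?M) \<longlonglongrightarrow> 0"
      "(\<lambda>k. snorm Hneg1 (Bochner_Integration.simple_bochner_integral ?M (\<sigma> k) - y)) \<longlonglongrightarrow> 0"
    using i unfolding has_bochner_integral_in_def by blast
  have sf: "simple_function ?M (\<sigma> k)" for k
    using s(1)[of k] by (auto elim: simple_bochner_integrable.cases)
  have ssm: "strongly_measurable ?M Hneg1 (\<sigma> k)" for k
    unfolding strongly_measurable_def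
    by (rule exI[of _ "\<lambda>_. \<sigma> k"]) (use sf[of k] s(2)[of k] in \<open>auto intro!: AE_I2\<close>)
  have up: "AE t in ?M. u t \<in> points Hneg1"
    using u by (auto simp: strongly_measurable_def)
  have S': "S \<in> sets lebesgue" using S by (rule fmeasurableD)
  note meas = snorm_borel_measurable[OF Hneg1.seminormed_space_axioms S']
  have m1: "(\<lambda>t. snorm Hneg1 (u t - \<sigma> k t)) \<in> borel_measurable ?M" for k
    by (rule meas[OF Hneg1.strongly_measurable_diff[OF u ssm]])
  have int1: "integrable ?M (\<lambda>t. \<sigma> k t w)" for k w
    by (rule integrable_simple_function_compose[OF finite_measure_axioms sf, of "\<lambda>L. L w"])
  obtain N where N: "\<And>k. k \<ge> N \<Longrightarrow> (\<integral>\<^sup>+ t. ennreal (snorm Hneg1 (u t - \<sigma> k t)) \<partial>?M) < 1"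
    using order_tendstoD(2)[OF conv(1), of 1] by (auto simp: eventually_sequentially)
  have "(\<integral>\<^sup>+ t. ennreal (snorm Hneg1 (u t)) \<partial>?M)
      \<le> (\<integral>\<^sup>+ t. ennreal (snorm Hneg1 (u t - \<sigma> N t)) + ennreal (norm (snorm Hneg1 (\<sigma> N t))) \<partial>?M)"
  proof (rule nn_integral_mono_AE)
    show "AE t in ?M. ennreal (snorm Hneg1 (u t))
        \<le> ennreal (snorm Hneg1 (u t - \<sigma> N t)) + ennreal (norm (snorm Hneg1 (\<sigma> N t)))"
      using up AE_space
    proof eventually_elim
      case (elim t)
      have p: "\<sigma> N t \<in> points Hneg1" "u t - \<sigma> N t \<in> points Hneg1" using s(2)[of N] elim by auto
      have "snorm Hneg1 (u t) \<le> snorm Hneg1 (u t - \<sigma> N t) + norm (snorm Hneg1 (\<sigma> N t))"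
        using Hneg1.snorm_triangle[OF p(2,1)] by simp
      then show ?case
        using Hneg1.snorm_nonneg[OF p(2)] by (simp add: ennreal_leI flip: ennreal_plus)
    qed
  qed
  also have "\<dots> = (\<integral>\<^sup>+ t. ennreal (snorm Hneg1 (u t - \<sigma> N t)) \<partial>?M) + (\<integral>\<^sup>+ t. ennreal (norm (snorm Hneg1 (\<sigma> N t))) \<partial>?M)"
    using m1[of N] meas[OF ssm[of N]] by (intro nn_integral_add) auto
  also have "\<dots> < \<infinity>"
  proof -
    have "(\<integral>\<^sup>+ t. ennreal (norm (snorm Hneg1 (\<sigma> N t))) \<partial>?M) < \<infinity>"
      using integrable_simple_function_compose[OF finite_measure_axioms sf, of "snorm Hneg1" N]
      by (simp add: integrable_iff_bounded)
    moreover have "(\<integral>\<^sup>+ t. ennreal (snorm Hneg1 (u t - \<sigma> N t)) \<partial>?M) < \<infinity>"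
      using N[of N] by (simp add: less_trans[OF _ ennreal_one_less_top])
    ultimately show ?thesis by simp
  qed
  finally show I: "integrable_functionals S u"
    using S u by unfold_locales auto
  interpret integrable_functionals S u by (rule I)
  have "y w = (LINT t|?M. u t w)" if w: "w \<in> points H1" for w
  proof -
    have "(\<lambda>k. LINT t|?M. \<sigma> k t w) \<longlonglongrightarrow> (LINT t|?M. u t w)"
    proof (rule tendsto_L1_int)
      have "(\<lambda>k. (\<integral>\<^sup>+ t. ennreal (snorm Hneg1 (u t - \<sigma> k t)) \<partial>?M) * ennreal (snorm H1 w)) \<longlonglongrightarrow> 0 * ennreal (snorm H1 w)"
        by (intro tendsto_mult_ennreal conv) auto
      then have lim: "(\<lambda>k. (\<integral>\<^sup>+ t. ennreal (snorm Hneg1 (u t - \<sigma> k t)) \<partial>?M) * ennreal (snorm H1 w)) \<longlonglongrightarrow> 0"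
        by simp
      show "(\<lambda>k. \<integral>\<^sup>+ t. ennreal (norm (\<sigma> k t w - u t w)) \<partial>?M) \<longlonglongrightarrow> 0"
      proof (rule tendsto_sandwich[OF _ _ tendsto_const lim])
        show "\<forall>\<^sub>F k in sequentially. (\<integral>\<^sup>+ t. ennreal (norm (\<sigma> k t w - u t w)) \<partial>?M)
            \<le> (\<integral>\<^sup>+ t. ennreal (snorm Hneg1 (u t - \<sigma> k t)) \<partial>?M) * ennreal (snorm H1 w)"
        proof (intro always_eventually allI)
          fix k
          have "(\<integral>\<^sup>+ t. ennreal (norm (\<sigma> k t w - u t w)) \<partial>?M)
              \<le> (\<integral>\<^sup>+ t. ennreal (snorm Hneg1 (u t - \<sigma> k t)) * ennreal (snorm H1 w) \<partial>?M)"
          proof (rule nn_integral_mono_AE)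
            show "AE t in ?M. ennreal (norm (\<sigma> k t w - u t w))
                \<le> ennreal (snorm Hneg1 (u t - \<sigma> k t)) * ennreal (snorm H1 w)"
              using up AE_space
            proof eventually_elim
              case (elim t)
              have p: "u t - \<sigma> k t \<in> points Hneg1" using s(2)[of k] elim by auto
              from Hneg1_bound[OF this w] show ?case
                using Hneg1.snorm_nonneg[OF p] H1.snorm_nonneg[OF w]
                by (simp add: ennreal_leI norm_minus_commute flip: ennreal_mult)
            qed
          qed
          then show "(\<integral>\<^sup>+ t. ennreal (norm (\<sigma> k t w - u t w)) \<partial>?M)
              \<le> (\<integral>\<^sup>+ t. ennreal (snorm Hneg1 (u t - \<sigma> k t)) \<partial>?M) * ennreal (snorm H1 w)"
            using m1[of k] by (simp add: nn_integral_multc)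
        qed
      qed auto
    qed (use int1 integrable_eval[OF w] in auto)
    moreover have "(\<lambda>k. (LINT t|?M. \<sigma> k t w) - y w) \<longlonglongrightarrow> 0"
    proof (rule Lim_null_comparison)
      show "(\<lambda>k. snorm Hneg1 (Bochner_Integration.simple_bochner_integral ?M (\<sigma> k) - y) * snorm H1 w) \<longlonglongrightarrow> 0"
        using conv(2) by (rule tendsto_mult_left_zero)
      have "Bochner_Integration.simple_bochner_integral ?M (\<sigma> k) - y \<in> points Hneg1" for k
        using simple_functionals[OF S sf[of k]] s(2)[of k] y
          integrable_functionals.pointwise_integral_point[of S "\<sigma> k"]
        by auto
      from Hneg1_bound[OF this w]
      show "\<forall>\<^sub>F k in sequentially. norm ((LINT t|?M. \<sigma> k t w) - y w)
          \<le> snorm Hneg1 (Bochner_Integration.simple_bochner_integral ?M (\<sigma> k) - y) * snorm H1 w"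
        by (auto simp: simple_bochner_integral_eval[OF finite_measure_axioms sf])
    qed
    then have "(\<lambda>k. LINT t|?M. \<sigma> k t w) \<longlonglongrightarrow> y w"
      by (simp only: LIM_zero_iff)
    ultimately show ?thesis
      by (rule LIMSEQ_unique[symmetric])
  qed
  then show "y = pointwise_integral ?M u"
    using Hneg1_pointD(1)[OF y] by (auto simp: pointwise_integral_def)
qed


section \<open>Uniqueness of solutions\<close>

abbreviation unit_interval :: "real measure" where
  "unit_interval \<equiv> lebesgue_on {0<..<1}"

lemma finite_measure_unit_interval: "finite_measure unit_interval"
  by (rule finite_measure_lebesgue_on) simp

lemma pair_sigma_finite_unit_interval: "pair_sigma_finite unit_interval unit_interval"
  using finite_measure_unit_interval
  by (simp add: pair_sigma_finite_def finite_measure_def)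

text \<open>
  A square integrable path has no values at individual times. The energy identity between the
  times \<open>t - h\<close> and \<open>t\<close> is therefore averaged over \<open>t\<close>, which leads to integrals over a strip of
  width \<open>h\<close> below the diagonal.
\<close>

definition strip :: "real \<Rightarrow> real \<Rightarrow> real \<Rightarrow> real" where
  "strip h t r = (if r < t \<and> t \<le> r + h then 1 else 0)"

lemma unit_interval_id_measurable: "(\<lambda>x. x) \<in> borel_measurable unit_interval"
  by (intro measurable_restrict_space1 borel_measurable_lebesgue_id)

lemma strip_measurable [measurable]:
  "(\<lambda>(t, r). strip h t r) \<in> borel_measurable (unit_interval \<Otimes>\<^sub>M unit_interval)"
  "strip h t \<in> borel_measurable unit_interval"
  "(\<lambda>t. strip h t r) \<in> borel_measurable unit_interval"
proof -
  note [measurable] = unit_interval_id_measurable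
  have [measurable]: "fst \<in> borel_measurable (unit_interval \<Otimes>\<^sub>M unit_interval)"
    "snd \<in> borel_measurable (unit_interval \<Otimes>\<^sub>M unit_interval)"
    by (rule measurable_compose[OF measurable_fst unit_interval_id_measurable],
        rule measurable_compose[OF measurable_snd unit_interval_id_measurable])
  show "(\<lambda>(t, r). strip h t r) \<in> borel_measurable (unit_interval \<Otimes>\<^sub>M unit_interval)"
    unfolding strip_def case_prod_beta by measurable
  show "strip h t \<in> borel_measurable unit_interval" "(\<lambda>t. strip h t r) \<in> borel_measurable unit_interval"
    unfolding strip_def[abs_def] by measurable
qed

lemma strip_bounds [simp]: "0 \<le> strip h t r" "strip h t r \<le> 1"
  by (auto simp: strip_def)

lemma nn_integral_strip:
  assumes "0 < h"
  shows "(\<integral>\<^sup>+ r. strip h t r \<partial>unit_interval) \<le> ennreal h"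
    and "(\<integral>\<^sup>+ t. strip h t r \<partial>unit_interval) \<le> ennreal h"
    and "0 < r \<Longrightarrow> r + h < 1 \<Longrightarrow> (\<integral>\<^sup>+ t. strip h t r \<partial>unit_interval) = ennreal h"
proof -
  have U: "{0<..<1::real} \<inter> space lebesgue \<in> sets lebesgue" by simp
  have "(\<integral>\<^sup>+ r. strip h t r \<partial>unit_interval) \<le> (\<integral>\<^sup>+ r. indicator {t - h..t} r \<partial>lebesgue)"
    unfolding nn_integral_restrict_space[OF U]
    by (rule nn_integral_mono) (auto simp: strip_def indicator_def)
  then show "(\<integral>\<^sup>+ r. strip h t r \<partial>unit_interval) \<le> ennreal h"
    using assms by simp
  have "(\<integral>\<^sup>+ t. strip h t r \<partial>unit_interval) \<le> (\<integral>\<^sup>+ t. indicator {r..r + h} t \<partial>lebesgue)"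
    unfolding nn_integral_restrict_space[OF U]
    by (rule nn_integral_mono) (auto simp: strip_def indicator_def)
  then show "(\<integral>\<^sup>+ t. strip h t r \<partial>unit_interval) \<le> ennreal h"
    using assms by simp
  assume "0 < r" "r + h < 1"
  then have "(\<integral>\<^sup>+ t. strip h t r \<partial>unit_interval) = (\<integral>\<^sup>+ t. indicator {r<..r + h} t \<partial>lebesgue)"
    unfolding nn_integral_restrict_space[OF U]
    by (intro nn_integral_cong) (auto simp: strip_def indicator_def)
  then show "(\<integral>\<^sup>+ t. strip h t r \<partial>unit_interval) = ennreal h"
    using assms by simp
qed

definition strip_integral :: "real \<Rightarrow> (real \<Rightarrow> real \<Rightarrow> ennreal) \<Rightarrow> ennreal" where
  "strip_integral h Q = (\<integral>\<^sup>+ t. \<integral>\<^sup>+ r. ennreal (strip h t r) * Q t r \<partial>unit_interval \<partial>unit_interval)"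

lemma strip_integral_one_variable:
  assumes h: "0 < h" and k [measurable]: "k \<in> borel_measurable unit_interval"
  shows "strip_integral h (\<lambda>t r. k t) \<le> ennreal h * (\<integral>\<^sup>+ t. k t \<partial>unit_interval)"
    and "strip_integral h (\<lambda>t r. k r) = (\<integral>\<^sup>+ r. (\<integral>\<^sup>+ t. strip h t r \<partial>unit_interval) * k r \<partial>unit_interval)"
    and "strip_integral h (\<lambda>t r. k r) \<le> ennreal h * (\<integral>\<^sup>+ t. k t \<partial>unit_interval)"
proof -
  interpret pair_sigma_finite unit_interval unit_interval by (rule pair_sigma_finite_unit_interval)
  have "strip_integral h (\<lambda>t r. k t) = (\<integral>\<^sup>+ t. (\<integral>\<^sup>+ r. strip h t r \<partial>unit_interval) * k t \<partial>unit_interval)"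
    unfolding strip_integral_def by (simp add: nn_integral_multc)
  also have "\<dots> \<le> (\<integral>\<^sup>+ t. ennreal h * k t \<partial>unit_interval)"
    by (intro nn_integral_mono mult_right_mono nn_integral_strip h) auto
  finally show "strip_integral h (\<lambda>t r. k t) \<le> ennreal h * (\<integral>\<^sup>+ t. k t \<partial>unit_interval)"
    by (simp add: nn_integral_cmult)
  have [measurable]: "(\<lambda>(t, r). k r) \<in> borel_measurable (unit_interval \<Otimes>\<^sub>M unit_interval)"
    by measurable
  have "strip_integral h (\<lambda>t r. k r) = (\<integral>\<^sup>+ r. \<integral>\<^sup>+ t. ennreal (strip h t r) * k r \<partial>unit_interval \<partial>unit_interval)"
    unfolding strip_integral_def
    by (rule Fubini'[symmetric]) measurable
  then show *: "strip_integral h (\<lambda>t r. k r) = (\<integral>\<^sup>+ r. (\<integral>\<^sup>+ t. strip h t r \<partial>unit_interval) * k r \<partial>unit_interval)"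
    by (simp add: nn_integral_multc)
  have "\<dots> \<le> (\<integral>\<^sup>+ r. ennreal h * k r \<partial>unit_interval)"
    by (intro nn_integral_mono mult_right_mono nn_integral_strip h) auto
  then show "strip_integral h (\<lambda>t r. k r) \<le> ennreal h * (\<integral>\<^sup>+ t. k t \<partial>unit_interval)"
    unfolding * by (simp add: nn_integral_cmult)
qed

lemma strip_integral_add:
  assumes [measurable]: "(\<lambda>(t, r). P t r) \<in> borel_measurable (unit_interval \<Otimes>\<^sub>M unit_interval)"
    "(\<lambda>(t, r). Q t r) \<in> borel_measurable (unit_interval \<Otimes>\<^sub>M unit_interval)"
  shows "strip_integral h (\<lambda>t r. P t r + Q t r) = strip_integral h P + strip_integral h Q"
proof -
  interpret pair_sigma_finite unit_interval unit_interval by (rule pair_sigma_finite_unit_interval)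
  have "strip_integral h (\<lambda>t r. P t r + Q t r) = (\<integral>\<^sup>+ t. (\<integral>\<^sup>+ r. ennreal (strip h t r) * P t r \<partial>unit_interval) +
      (\<integral>\<^sup>+ r. ennreal (strip h t r) * Q t r \<partial>unit_interval) \<partial>unit_interval)"
    unfolding strip_integral_def
    by (intro nn_integral_cong) (simp add: distrib_left, rule nn_integral_add; measurable)
  also have "\<dots> = strip_integral h P + strip_integral h Q"
    unfolding strip_integral_def by (rule nn_integral_add) measurable
  finally show ?thesis .
qed

lemma strip_integral_cmult:
  assumes [measurable]: "(\<lambda>(t, r). Q t r) \<in> borel_measurable (unit_interval \<Otimes>\<^sub>M unit_interval)"
  shows "strip_integral h (\<lambda>t r. c * Q t r) = c * strip_integral h Q"
proof -
  interpret pair_sigma_finite unit_interval unit_interval by (rule pair_sigma_finite_unit_interval)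
  have "strip_integral h (\<lambda>t r. c * Q t r) =
      (\<integral>\<^sup>+ t. c * (\<integral>\<^sup>+ r. ennreal (strip h t r) * Q t r \<partial>unit_interval) \<partial>unit_interval)"
    unfolding strip_integral_def
    by (intro nn_integral_cong) (simp add: mult.left_commute[of _ c], rule nn_integral_cmult, measurable)
  also have "\<dots> = c * strip_integral h Q"
    unfolding strip_integral_def by (rule nn_integral_cmult) measurable
  finally show ?thesis .
qed

lemma strip_integral_sum:
  assumes "finite R" "\<And>z. (\<lambda>(t, r). Q z t r) \<in> borel_measurable (unit_interval \<Otimes>\<^sub>M unit_interval)"
  shows "strip_integral h (\<lambda>t r. \<Sum>z\<in>R. Q z t r) = (\<Sum>z\<in>R. strip_integral h (Q z))"
  using assms(1)
proof induction
  case empty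
  then show ?case by (simp add: strip_integral_def)
next
  case (insert z R)
  have "(\<lambda>(t, r). \<Sum>z\<in>R. Q z t r) \<in> borel_measurable (unit_interval \<Otimes>\<^sub>M unit_interval)"
    using assms(2) unfolding case_prod_beta by (intro borel_measurable_sum)
  then show ?case
    using insert strip_integral_add[OF assms(2)[of z], of "\<lambda>t r. \<Sum>z\<in>R. Q z t r"] by simp
qed

lemma strip_integral_mono:
  assumes "AE t in unit_interval. AE r in unit_interval. ennreal (strip h t r) * P t r \<le> ennreal (strip h t r) * Q t r"
  shows "strip_integral h P \<le> strip_integral h Q"
  unfolding strip_integral_def
  by (rule nn_integral_mono_AE) (use assms in \<open>auto intro: nn_integral_mono_AE\<close>)

lemma continuous_approx_indicator:
  assumes E: "E \<in> sets lebesgue" and \<eta>: "0 < \<eta>"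
  obtains g :: "real \<Rightarrow> real" where "continuous_on UNIV g"
    "(\<integral>\<^sup>+ t. ennreal \<bar>indicator E t - g t\<bar> \<partial>unit_interval) < ennreal \<eta>"
proof -
  interpret finite_measure unit_interval by (rule finite_measure_unit_interval)
  have "(\<lambda>t. indicator E t :: real) \<in> borel_measurable (lebesgue_on UNIV)"
    using E by (simp add: borel_measurable_indicator)
  then have "(\<lambda>t. indicator E t :: real) measurable_on UNIV"
    by (simp add: measurable_on_iff_borel_measurable)
  then obtain N g where N: "negligible N" and g: "\<And>n. continuous_on UNIV (g n)"
    "\<And>t. t \<notin> N \<Longrightarrow> (\<lambda>n. g n t) \<longlonglongrightarrow> (indicator E t :: real)"
    by (auto simp: measurable_on_def)
  define f where "f n t = max 0 (min 1 (g n t))" for n t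
  have f: "continuous_on UNIV (f n)" for n
    unfolding f_def by (intro continuous_intros g)
  have fm: "f n \<in> borel_measurable unit_interval" for n
    by (intro measurable_restrict_space1 measurable_completion)
      (use f[of n] in \<open>simp add: borel_measurable_continuous_onI\<close>)
  have lim: "AE t in unit_interval. (\<lambda>n. \<bar>indicator E t - f n t\<bar>) \<longlonglongrightarrow> 0"
  proof -
    have "AE t in lebesgue. t \<notin> N"
      using N by (intro AE_not_in) (simp add: negligible_iff_null_sets)
    then have "AE t in lebesgue. t \<in> {0<..<1} \<longrightarrow> (\<lambda>n. \<bar>indicator E t - f n t\<bar>) \<longlonglongrightarrow> 0"
    proof eventually_elim
      case (elim t)
      have "(\<lambda>n. f n t) \<longlonglongrightarrow> max 0 (min 1 (indicator E t))"
        unfolding f_def by (intro tendsto_intros g elim)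
      then have "(\<lambda>n. \<bar>indicator E t - f n t\<bar>) \<longlonglongrightarrow> \<bar>indicator E t - max 0 (min 1 (indicator E t))\<bar>"
        by (intro tendsto_intros)
      then show ?case by (simp add: indicator_def split: if_splits)
    qed
    then show ?thesis by (subst AE_restrict_space_iff) auto
  qed
  have [measurable]: "(\<lambda>t. indicator E t :: real) \<in> borel_measurable unit_interval"
    by (intro measurable_restrict_space1 borel_measurable_indicator E)
  note [measurable] = fm
  have b: "\<bar>indicator E t - f n t\<bar> \<le> 1" for t n
    by (auto simp: f_def indicator_def)
  have "(\<lambda>n. LINT t|unit_interval. \<bar>indicator E t - f n t\<bar>) \<longlonglongrightarrow> (LINT t|unit_interval. 0)"
    by (rule integral_dominated_convergence[where w = "\<lambda>_. 1"])
      (use lim b in auto)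
  then have "\<forall>\<^sub>F n in sequentially. (LINT t|unit_interval. \<bar>indicator E t - f n t\<bar>) < \<eta>"
    using \<eta> by (intro order_tendstoD(2)) auto
  then obtain n where n: "(LINT t|unit_interval. \<bar>indicator E t - f n t\<bar>) < \<eta>"
    by (auto simp: eventually_sequentially)
  have "integrable unit_interval (\<lambda>t. \<bar>indicator E t - f n t\<bar>)"
    by (rule integrable_const_bound[of _ 1]) (use b in auto)
  then have "(\<integral>\<^sup>+ t. ennreal \<bar>indicator E t - f n t\<bar> \<partial>unit_interval) = ennreal (LINT t|unit_interval. \<bar>indicator E t - f n t\<bar>)"
    by (rule nn_integral_eq_integral) auto
  also have "\<dots> < ennreal \<eta>"
    using n by (intro ennreal_lessI \<eta>)
  finally show ?thesis using that f by blast
qed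

text \<open>
  The indicator function is \<open>L\<^sup>1\<close>-close to a continuous function, and the increments of the latter
  are uniformly small.
\<close>

lemma strip_integral_indicator:
  assumes E: "E \<in> sets lebesgue" and \<eta>: "0 < \<eta>"
  shows "\<exists>h0>0. \<forall>h. 0 < h \<and> h \<le> h0 \<longrightarrow>
    strip_integral h (\<lambda>t r. ennreal \<bar>indicator E t - indicator E r\<bar>) \<le> ennreal (\<eta> * h)"
proof -
  obtain g :: "real \<Rightarrow> real" where g: "continuous_on UNIV g"
    "(\<integral>\<^sup>+ t. ennreal \<bar>indicator E t - g t\<bar> \<partial>unit_interval) < ennreal (\<eta> / 4)"
    by (rule continuous_approx_indicator[OF E, of "\<eta> / 4"]) (use \<eta> in auto)
  have "uniformly_continuous_on {0..1} g"
    using g by (intro compact_uniformly_continuous) (auto intro: continuous_on_subset)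
  then obtain d where d: "d > 0" "\<And>t r. t \<in> {0..1} \<Longrightarrow> r \<in> {0..1} \<Longrightarrow> dist r t < d \<Longrightarrow> dist (g r) (g t) < \<eta> / 2"
    using \<eta> by (metis half_gt_zero uniformly_continuous_on_def)
  have gm: "g \<in> borel_measurable unit_interval"
    by (intro measurable_restrict_space1 measurable_completion)
      (use g in \<open>simp add: borel_measurable_continuous_onI\<close>)
  have em: "(\<lambda>t. indicator E t :: real) \<in> borel_measurable unit_interval"
    by (intro measurable_restrict_space1 borel_measurable_indicator E)
  define k where "k t = ennreal \<bar>indicator E t - g t\<bar>" for t
  have k [measurable]: "k \<in> borel_measurable unit_interval"
    unfolding k_def using gm em by measurable
  have "strip_integral h (\<lambda>t r. ennreal \<bar>indicator E t - indicator E r\<bar>) \<le> ennreal (\<eta> * h)"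
    if h: "0 < h" "h \<le> d / 2" for h
  proof -
    have "strip_integral h (\<lambda>t r. ennreal \<bar>indicator E t - indicator E r\<bar>)
        \<le> strip_integral h (\<lambda>t r. (k t + k r) + ennreal (\<eta> / 2))"
    proof (rule strip_integral_mono, intro AE_I2)
      fix t r :: real assume "t \<in> space unit_interval" "r \<in> space unit_interval"
      then have t: "t \<in> {0..1}" "r \<in> {0..1}" by auto
      show "ennreal (strip h t r) * ennreal \<bar>indicator E t - indicator E r\<bar> \<le> ennreal (strip h t r) * ((k t + k r) + ennreal (\<eta> / 2))"
      proof (cases "strip h t r = 0")
        case False
        then have "dist r t < d" using h d by (auto simp: strip_def dist_real_def split: if_splits)
        from d(2)[OF t this] have "\<bar>g t - g r\<bar> < \<eta> / 2" by (simp add: dist_real_def abs_minus_commute)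
        then have "\<bar>indicator E t - indicator E r\<bar> \<le> (\<bar>indicator E t - g t\<bar> + \<bar>indicator E r - g r\<bar>) + \<eta> / 2"
          by linarith
        then have "ennreal \<bar>indicator E t - indicator E r\<bar> \<le> (k t + k r) + ennreal (\<eta> / 2)"
          unfolding k_def using \<eta> by (simp add: ennreal_leI flip: ennreal_plus)
        then show ?thesis by (rule mult_left_mono) simp
      qed simp
    qed
    also have "\<dots> = (strip_integral h (\<lambda>t r. k t) + strip_integral h (\<lambda>t r. k r)) + strip_integral h (\<lambda>t r. ennreal (\<eta> / 2))"
      by (subst strip_integral_add, measurable, subst strip_integral_add, measurable)
    also have "\<dots> \<le> (ennreal h * ennreal (\<eta> / 4) + ennreal h * ennreal (\<eta> / 4)) + ennreal h * ennreal (\<eta> / 2)"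
    proof (intro add_mono)
      have kk: "ennreal h * (\<integral>\<^sup>+ t. k t \<partial>unit_interval) \<le> ennreal h * ennreal (\<eta> / 4)"
        using g(2) unfolding k_def by (intro mult_left_mono) auto
      show "strip_integral h (\<lambda>t r. k t) \<le> ennreal h * ennreal (\<eta> / 4)"
        "strip_integral h (\<lambda>t r. k r) \<le> ennreal h * ennreal (\<eta> / 4)"
        using strip_integral_one_variable[OF h(1) k] kk by (auto intro: order_trans)
      have "emeasure unit_interval (space unit_interval) = 1"
        by (subst emeasure_restrict_space) auto
      then show "strip_integral h (\<lambda>t r. ennreal (\<eta> / 2)) \<le> ennreal h * ennreal (\<eta> / 2)"
        using strip_integral_one_variable(1)[OF h(1), of "\<lambda>_. ennreal (\<eta> / 2)"] by simp
    qed
    also have "\<dots> = ennreal (\<eta> * h)"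
      using \<eta> h by (simp add: field_simps flip: ennreal_mult ennreal_plus)
    finally show ?thesis .
  qed
  then show ?thesis using d(1) by (intro exI[of _ "d / 2"]) auto
qed

text \<open>
  The increment from \<open>r\<close> to \<open>t\<close> vanishes unless \<open>r\<close> and \<open>t\<close> are separated by one of the finitely many level
  sets.
\<close>

lemma (in seminormed_space) strip_integral_simple:
  fixes \<sigma> :: "real \<Rightarrow> 'v"
  assumes s: "simple_function unit_interval \<sigma>" and p: "\<sigma> ` {0<..<1} \<subseteq> points X" and \<eta>: "0 < \<eta>"
  shows "\<exists>h0>0. \<forall>h. 0 < h \<and> h \<le> h0 \<longrightarrow>
    strip_integral h (\<lambda>t r. ennreal ((snorm X (\<sigma> t - \<sigma> r))\<^sup>2)) \<le> ennreal (\<eta> * h)"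
proof -
  define R where "R = \<sigma> ` {0<..<1}"
  have R: "finite R" "R \<noteq> {}"
    using simple_functionD(1)[OF s] by (auto simp: R_def)
  define C where "C = (\<Sum>y\<in>R. \<Sum>z\<in>R. (snorm X (y - z))\<^sup>2)"
  have C: "(snorm X (y - z))\<^sup>2 \<le> C" if "y \<in> R" "z \<in> R" for y z
  proof -
    have "(snorm X (y - z))\<^sup>2 \<le> (\<Sum>z\<in>R. (snorm X (y - z))\<^sup>2)"
      by (rule member_le_sum) (use that R in auto)
    also have "\<dots> \<le> C"
      unfolding C_def by (rule member_le_sum[of y R "\<lambda>y. \<Sum>z\<in>R. (snorm X (y - z))\<^sup>2"])
        (use that R in \<open>auto intro: sum_nonneg\<close>)
    finally show ?thesis .
  qed
  have C0: "0 \<le> C" by (auto simp: C_def intro!: sum_nonneg)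
  define E where "E z = {t\<in>{0<..<1}. \<sigma> t = z}" for z
  have E: "E z \<in> sets lebesgue" for z
  proof -
    have "\<sigma> -` {z} \<inter> space unit_interval \<in> sets unit_interval"
      using simple_functionD(2)[OF s] .
    moreover have "E z = \<sigma> -` {z} \<inter> space unit_interval"
      by (auto simp: E_def)
    ultimately show ?thesis
      by (simp add: sets_restrict_space_iff)
  qed
  define \<eta>' where "\<eta>' = \<eta> / ((C + 1) * card R)"
  have cR: "card R > 0" using R by (simp add: card_gt_0_iff)
  have \<eta>': "\<eta>' > 0" using \<eta> C0 cR by (simp add: \<eta>'_def)
  have "\<exists>h0. \<forall>z. 0 < h0 z \<and> (\<forall>h. 0 < h \<and> h \<le> h0 z \<longrightarrow>
      strip_integral h (\<lambda>t r. ennreal \<bar>indicator (E z) t - indicator (E z) r\<bar>) \<le> ennreal (\<eta>' * h))"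
    using strip_integral_indicator[OF E \<eta>'] by (intro choice) auto
  then obtain h0 where h0: "\<And>z. 0 < h0 z" "\<And>z h. 0 < h \<Longrightarrow> h \<le> h0 z \<Longrightarrow>
      strip_integral h (\<lambda>t r. ennreal \<bar>indicator (E z) t - indicator (E z) r\<bar>) \<le> ennreal (\<eta>' * h)"
    by blast
  have "strip_integral h (\<lambda>t r. ennreal ((snorm X (\<sigma> t - \<sigma> r))\<^sup>2)) \<le> ennreal (\<eta> * h)"
    if h: "0 < h" "h \<le> Min (h0 ` R)" for h
  proof -
    have em [measurable]: "(\<lambda>t. indicator (E z) t :: real) \<in> borel_measurable unit_interval" for z
      by (intro measurable_restrict_space1 borel_measurable_indicator E)
    have pm: "(\<lambda>(t, r). ennreal \<bar>indicator (E z) t - indicator (E z) r\<bar>) \<in> borel_measurable (unit_interval \<Otimes>\<^sub>M unit_interval)" for z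
      by measurable
    have "strip_integral h (\<lambda>t r. ennreal ((snorm X (\<sigma> t - \<sigma> r))\<^sup>2))
        \<le> strip_integral h (\<lambda>t r. ennreal C * (\<Sum>z\<in>R. ennreal \<bar>indicator (E z) t - indicator (E z) r\<bar>))"
    proof (rule strip_integral_mono, intro AE_I2 mult_left_mono)
      fix t r :: real assume t: "t \<in> space unit_interval" and r: "r \<in> space unit_interval"
      show "ennreal ((snorm X (\<sigma> t - \<sigma> r))\<^sup>2) \<le> ennreal C * (\<Sum>z\<in>R. ennreal \<bar>indicator (E z) t - indicator (E z) r\<bar>)"
      proof (cases "\<sigma> t = \<sigma> r")
        case False
        have tr: "\<sigma> t \<in> R" "\<sigma> r \<in> R" using t r by (auto simp: R_def)
        have "ennreal ((snorm X (\<sigma> t - \<sigma> r))\<^sup>2) \<le> ennreal C * 1"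
          using C[OF tr] by (simp add: ennreal_leI)
        also have "1 = ennreal \<bar>indicator (E (\<sigma> t)) t - indicator (E (\<sigma> t)) r\<bar>"
          using t r False by (auto simp: E_def indicator_def)
        also have "\<dots> \<le> (\<Sum>z\<in>R. ennreal \<bar>indicator (E z) t - indicator (E z) r\<bar>)"
          by (rule member_le_sum[of _ _ "\<lambda>z. ennreal \<bar>indicator (E z) t - indicator (E z) r\<bar>"]) (use tr R in auto)
        finally show ?thesis by (simp add: mult_left_mono)
      qed simp
    qed auto
    also have "\<dots> = ennreal C * (\<Sum>z\<in>R. strip_integral h (\<lambda>t r. ennreal \<bar>indicator (E z) t - indicator (E z) r\<bar>))"
    proof -
      have "(\<lambda>(t, r). \<Sum>z\<in>R. ennreal \<bar>indicator (E z) t - indicator (E z) r\<bar>)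
          \<in> borel_measurable (unit_interval \<Otimes>\<^sub>M unit_interval)"
        using pm unfolding case_prod_beta by (intro borel_measurable_sum)
      then show ?thesis
        by (subst strip_integral_cmult) (assumption, subst strip_integral_sum[OF R(1) pm], rule refl)
    qed
    also have "\<dots> \<le> ennreal C * (\<Sum>z\<in>R. ennreal (\<eta>' * h))"
      using h R by (intro mult_left_mono sum_mono h0) auto
    also have "\<dots> = ennreal (C * (card R * (\<eta>' * h)))"
      using C0 \<eta>' h by (simp add: ennreal_mult ennreal_of_nat_eq_real_of_nat)
    also have "\<dots> \<le> ennreal (\<eta> * h)"
    proof (rule ennreal_leI)
      have "card R * \<eta>' = \<eta> / (C + 1)"
        using cR by (simp add: \<eta>'_def)
      then have "C * (card R * (\<eta>' * h)) = (C / (C + 1)) * (\<eta> * h)"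
        by (simp flip: mult.assoc)
      also have "\<dots> \<le> 1 * (\<eta> * h)"
        using C0 \<eta> h by (intro mult_right_mono) (auto simp: divide_simps)
      finally show "C * (card R * (\<eta>' * h)) \<le> \<eta> * h" by simp
    qed
    finally show ?thesis .
  qed
  moreover have "Min (h0 ` R) > 0" using R h0 by simp
  ultimately show ?thesis by blast
qed

lemma sum_squares_three: "((a::real) + b + c)\<^sup>2 \<le> 3 * (a\<^sup>2 + b\<^sup>2 + c\<^sup>2)"
  using sum_squares_bound[of a b] sum_squares_bound[of a c] sum_squares_bound[of b c]
  by (simp add: power2_eq_square algebra_simps)

text \<open>Increments of a square integrable path are small on average. The majorant \<open>Q\<close> is there
  because it is measurable in both variables.\<close>

lemma (in seminormed_space) strip_integral_increments:
  fixes w :: "real \<Rightarrow> 'v"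
  assumes w: "strongly_measurable unit_interval X w"
    and fin: "(\<integral>\<^sup>+ t. ennreal ((snorm X (w t))\<^sup>2) \<partial>unit_interval) < \<infinity>" and \<eta>: "0 < \<eta>"
  obtains h0 Q where "h0 > 0" "(\<lambda>(t, r). Q t r) \<in> borel_measurable (unit_interval \<Otimes>\<^sub>M unit_interval)"
    "AE t in unit_interval. AE r in unit_interval. ennreal ((snorm X (w t - w r))\<^sup>2) \<le> Q t r"
    "\<And>h. 0 < h \<Longrightarrow> h \<le> h0 \<Longrightarrow> strip_integral h Q \<le> ennreal (\<eta> * h)"
proof (rule strongly_measurable_approx[OF w])
  have U: "{0<..<1::real} \<in> sets lebesgue" by simp
  fix g \<sigma>
  assume g [measurable]: "g \<in> borel_measurable unit_interval" and g0: "\<And>t. 0 \<le> g t"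
    and wg: "AE t in unit_interval. snorm X (w t) = g t"
    and s: "\<And>k. simple_function unit_interval (\<sigma> k)" "\<And>k. \<sigma> k ` space unit_interval \<subseteq> points X"
    and sg: "\<And>k t. t \<in> space unit_interval \<Longrightarrow> snorm X (\<sigma> k t) \<le> 2 * g t"
    and lim: "AE t in unit_interval. w t \<in> points X \<and> (\<lambda>k. snorm X (\<sigma> k t - w t)) \<longlonglongrightarrow> 0"
  have ssm: "strongly_measurable unit_interval X (\<sigma> k)" for k
    unfolding strongly_measurable_def
    by (rule exI[of _ "\<lambda>_. \<sigma> k"]) (use s(1)[of k] s(2)[of k] in \<open>auto intro!: AE_I2\<close>)
  define k where "k n t = (snorm X (\<sigma> n t - w t))\<^sup>2" for n t
  have k0: "0 \<le> k n t" for n t by (simp add: k_def)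
  have km [measurable]: "k n \<in> borel_measurable unit_interval" for n
    unfolding k_def
    by (intro borel_measurable_power snorm_borel_measurable[OF seminormed_space_axioms U] strongly_measurable_diff ssm w)
  have "(\<integral>\<^sup>+ t. ennreal ((g t)\<^sup>2) \<partial>unit_interval) = (\<integral>\<^sup>+ t. ennreal ((snorm X (w t))\<^sup>2) \<partial>unit_interval)"
    by (rule nn_integral_cong_AE) (use wg in auto)
  then have gi: "integrable unit_interval (\<lambda>t. 9 * (g t)\<^sup>2)"
    using fin by (intro integrable_mult_right integrableI_nonneg) auto
  have kb: "AE t in unit_interval. norm (k n t) \<le> 9 * (g t)\<^sup>2" for n
    using lim wg AE_space
  proof eventually_elim
    case (elim t)
    have p: "\<sigma> n t \<in> points X" using s(2)[of n] elim by auto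
    then have d: "\<sigma> n t - w t \<in> points X" using elim by auto
    have "snorm X (\<sigma> n t - w t) \<le> 3 * g t"
      using snorm_diff_le[OF p, of "w t"] sg[of t n] elim by auto
    then have "(snorm X (\<sigma> n t - w t))\<^sup>2 \<le> (3 * g t)\<^sup>2"
      by (rule power_mono) (rule snorm_nonneg[OF d])
    then show ?case by (simp add: k_def power_mult_distrib)
  qed
  have "(\<lambda>n. LINT t|unit_interval. k n t) \<longlonglongrightarrow> (LINT t|unit_interval. 0)"
  proof (rule integral_dominated_convergence[OF _ _ gi _ kb])
    show "AE t in unit_interval. (\<lambda>n. k n t) \<longlonglongrightarrow> 0"
      using lim unfolding k_def
      by eventually_elim (auto intro: tendsto_eq_intros)
  qed auto
  then have "\<forall>\<^sub>F n in sequentially. (LINT t|unit_interval. k n t) < \<eta> / 12"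
    using \<eta> by (intro order_tendstoD(2)) auto
  then obtain n where n: "(LINT t|unit_interval. k n t) < \<eta> / 12"
    by (auto simp: eventually_sequentially)
  have ki: "integrable unit_interval (k n)"
    by (rule Bochner_Integration.integrable_bound[OF gi]) (use kb[of n] in auto)
  have kn: "(\<integral>\<^sup>+ t. ennreal (k n t) \<partial>unit_interval) \<le> ennreal (\<eta> / 12)"
    using n k0 by (subst nn_integral_eq_integral[OF ki]) (auto intro!: ennreal_leI)
  obtain h0 where h0: "h0 > 0" "\<And>h. 0 < h \<Longrightarrow> h \<le> h0 \<Longrightarrow>
      strip_integral h (\<lambda>t r. ennreal ((snorm X (\<sigma> n t - \<sigma> n r))\<^sup>2)) \<le> ennreal (\<eta> / 6 * h)"
    using strip_integral_simple[OF s(1)[of n], of "\<eta> / 6"] s(2)[of n] \<eta> by auto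
  define Q0 where "Q0 t r = ennreal (k n t) + ennreal (k n r) + ennreal ((snorm X (\<sigma> n t - \<sigma> n r))\<^sup>2)" for t r
  have sm [measurable]: "(\<lambda>(t, r). ennreal ((snorm X (\<sigma> n t - \<sigma> n r))\<^sup>2)) \<in> borel_measurable (unit_interval \<Otimes>\<^sub>M unit_interval)"
  proof -
    have "simple_function (unit_interval \<Otimes>\<^sub>M unit_interval) (\<lambda>p. \<sigma> n (fst p))"
      "simple_function (unit_interval \<Otimes>\<^sub>M unit_interval) (\<lambda>p. \<sigma> n (snd p))"
    proof -
      have m: "\<sigma> n \<in> unit_interval \<rightarrow>\<^sub>M count_space UNIV"
        using s(1) by (rule measurable_simple_function)
      have f: "finite (\<sigma> n ` {0<..<1})" using simple_functionD(1)[OF s(1)[of n]] by simp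
      have "(\<lambda>p. \<sigma> n (fst p)) \<in> unit_interval \<Otimes>\<^sub>M unit_interval \<rightarrow>\<^sub>M count_space UNIV"
        "(\<lambda>p. \<sigma> n (snd p)) \<in> unit_interval \<Otimes>\<^sub>M unit_interval \<rightarrow>\<^sub>M count_space UNIV"
        by (rule measurable_compose[OF measurable_fst m], rule measurable_compose[OF measurable_snd m])
      moreover have "finite ((\<lambda>p. \<sigma> n (fst p)) ` space (unit_interval \<Otimes>\<^sub>M unit_interval))"
        "finite ((\<lambda>p. \<sigma> n (snd p)) ` space (unit_interval \<Otimes>\<^sub>M unit_interval))"
        by (rule finite_subset[OF _ f], auto simp: space_pair_measure)+
      ultimately show "simple_function (unit_interval \<Otimes>\<^sub>M unit_interval) (\<lambda>p. \<sigma> n (fst p))"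
        "simple_function (unit_interval \<Otimes>\<^sub>M unit_interval) (\<lambda>p. \<sigma> n (snd p))"
        by (auto simp: simple_function_def intro: measurable_sets)
    qed
    then have "simple_function (unit_interval \<Otimes>\<^sub>M unit_interval) (\<lambda>p. (snorm X (\<sigma> n (fst p) - \<sigma> n (snd p)))\<^sup>2)"
      by (rule simple_function_compose2[where h = "\<lambda>a b. (snorm X (a - b))\<^sup>2"])
    then have "(\<lambda>p. (snorm X (\<sigma> n (fst p) - \<sigma> n (snd p)))\<^sup>2) \<in> borel_measurable (unit_interval \<Otimes>\<^sub>M unit_interval)"
      by (rule borel_measurable_simple_function)
    then show ?thesis
      unfolding case_prod_beta by (rule measurable_compose[OF _ measurable_ennreal])
  qed
  have kpm [measurable]: "(\<lambda>(t, r). ennreal (k n t) + ennreal (k n r)) \<in> borel_measurable (unit_interval \<Otimes>\<^sub>M unit_interval)"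
    by measurable
  show ?thesis
  proof (rule that[OF h0(1), of "\<lambda>t r. 3 * Q0 t r"])
    show "(\<lambda>(t, r). 3 * Q0 t r) \<in> borel_measurable (unit_interval \<Otimes>\<^sub>M unit_interval)"
      unfolding Q0_def by measurable
    show "AE t in unit_interval. AE r in unit_interval. ennreal ((snorm X (w t - w r))\<^sup>2) \<le> 3 * Q0 t r"
      using lim AE_space
    proof eventually_elim
      case (elim t)
      note t = elim
      show ?case
        using lim AE_space
      proof eventually_elim
        case (elim r)
        have p: "\<sigma> n t \<in> points X" "\<sigma> n r \<in> points X" "w t \<in> points X" "w r \<in> points X"
          using s(2)[of n] elim t by auto
        have "snorm X (w t - w r) \<le> snorm X (w t - \<sigma> n t) + (snorm X (\<sigma> n t - \<sigma> n r) + snorm X (\<sigma> n r - w r))"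
          using snorm_diff_triangle[OF p(3,1,4)] snorm_diff_triangle[OF p(1,2,4)] by linarith
        then have "snorm X (w t - w r) \<le> snorm X (\<sigma> n t - w t) + snorm X (\<sigma> n r - w r) + snorm X (\<sigma> n t - \<sigma> n r)"
          using snorm_commute[OF p(3,1)] by simp
        then have "(snorm X (w t - w r))\<^sup>2 \<le> (snorm X (\<sigma> n t - w t) + snorm X (\<sigma> n r - w r) + snorm X (\<sigma> n t - \<sigma> n r))\<^sup>2"
          by (rule power_mono) (use snorm_nonneg p in auto)
        also have "\<dots> \<le> 3 * (k n t + k n r + (snorm X (\<sigma> n t - \<sigma> n r))\<^sup>2)"
          unfolding k_def by (rule sum_squares_three)
        finally have "ennreal ((snorm X (w t - w r))\<^sup>2) \<le> ennreal (3 * (k n t + k n r + (snorm X (\<sigma> n t - \<sigma> n r))\<^sup>2))"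
          by (rule ennreal_leI)
        also have "\<dots> = ennreal 3 * ennreal (k n t + k n r + (snorm X (\<sigma> n t - \<sigma> n r))\<^sup>2)"
          by (rule ennreal_mult) (auto simp: k_def)
        also have "\<dots> = 3 * Q0 t r"
          by (simp add: Q0_def k_def flip: ennreal_plus)
        finally show ?case .
      qed
    qed
    fix h assume h: "0 < h" "h \<le> h0"
    have "strip_integral h (\<lambda>t r. 3 * Q0 t r) = 3 * strip_integral h Q0"
    proof (rule strip_integral_cmult)
      show "(\<lambda>(t, r). Q0 t r) \<in> borel_measurable (unit_interval \<Otimes>\<^sub>M unit_interval)"
        unfolding Q0_def by measurable
    qed
    also have "strip_integral h Q0 = (strip_integral h (\<lambda>t r. ennreal (k n t)) + strip_integral h (\<lambda>t r. ennreal (k n r)))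
        + strip_integral h (\<lambda>t r. ennreal ((snorm X (\<sigma> n t - \<sigma> n r))\<^sup>2))"
      unfolding Q0_def by (subst strip_integral_add, measurable, subst strip_integral_add, measurable)
    also have "\<dots> \<le> (ennreal h * ennreal (\<eta> / 12) + ennreal h * ennreal (\<eta> / 12)) + ennreal (\<eta> / 6 * h)"
    proof (intro add_mono h0(2) h)
      have kk: "ennreal h * (\<integral>\<^sup>+ t. ennreal (k n t) \<partial>unit_interval) \<le> ennreal h * ennreal (\<eta> / 12)"
        using kn by (intro mult_left_mono) auto
      show "strip_integral h (\<lambda>t r. ennreal (k n t)) \<le> ennreal h * ennreal (\<eta> / 12)"
        "strip_integral h (\<lambda>t r. ennreal (k n r)) \<le> ennreal h * ennreal (\<eta> / 12)"
        using strip_integral_one_variable[OF h(1), of "\<lambda>t. ennreal (k n t)"] kk by (auto intro: order_trans)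
    qed
    also have "\<dots> = ennreal (\<eta> / 3 * h)"
      using \<eta> h by (simp add: field_simps flip: ennreal_mult ennreal_plus)
    also have "3 * ennreal (\<eta> / 3 * h) = ennreal (\<eta> * h)"
      using \<eta> h ennreal_mult[of 3 "\<eta> / 3 * h"] by simp
    finally show "strip_integral h (\<lambda>t r. 3 * Q0 t r) \<le> ennreal (\<eta> * h)"
      by (simp add: mult_left_mono)
  qed
qed


text \<open>
  A Lipschitz function of a strongly measurable path is a limit of simple functions.
\<close>

lemma (in seminormed_space) Lipschitz_borel_measurable:
  fixes w :: "real \<Rightarrow> 'v" and p :: "'v \<Rightarrow> real"
  assumes S: "S \<in> sets lebesgue" and w: "strongly_measurable (lebesgue_on S) X w"
    and p: "\<And>u v. u \<in> points X \<Longrightarrow> v \<in> points X \<Longrightarrow> \<bar>p u - p v\<bar> \<le> snorm X (u - v)"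
  shows "(\<lambda>t. p (w t)) \<in> borel_measurable (lebesgue_on S)"
proof -
  let ?M = "lebesgue_on S"
  obtain \<sigma> where s: "\<And>k. simple_function ?M (\<sigma> k)" "\<And>k. \<sigma> k ` space ?M \<subseteq> points X"
    "AE t in ?M. w t \<in> points X \<and> (\<lambda>k. snorm X (\<sigma> k t - w t)) \<longlonglongrightarrow> 0"
    using w by (auto simp: strongly_measurable_def)
  have [measurable]: "(\<lambda>t. p (\<sigma> k t)) \<in> borel_measurable ?M" for k
    by (intro borel_measurable_simple_function simple_function_compose1[OF s(1)])
  have "(\<lambda>t. lim (\<lambda>k. p (\<sigma> k t))) \<in> borel_measurable ?M"
    by measurable
  moreover have "AE t in ?M. lim (\<lambda>k. p (\<sigma> k t)) = p (w t)"
    using s(3) AE_space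
  proof eventually_elim
    case (elim t)
    have "(\<lambda>k. p (\<sigma> k t) - p (w t)) \<longlonglongrightarrow> 0"
    proof (rule Lim_null_comparison)
      show "(\<lambda>k. snorm X (\<sigma> k t - w t)) \<longlonglongrightarrow> 0" using elim by auto
      have "\<sigma> k t \<in> points X" for k using s(2)[of k] elim by auto
      then show "\<forall>\<^sub>F k in sequentially. norm (p (\<sigma> k t) - p (w t)) \<le> snorm X (\<sigma> k t - w t)"
        using p elim by (intro always_eventually allI) simp
    qed
    then show ?case by (intro limI) (simp add: LIM_zero_iff)
  qed
  ultimately show ?thesis by (rule borel_measurable_lebesgue_on_AE[OF S])
qed

lemma wgrad_diff:
  assumes "v \<in> points H1" "w \<in> points H1"
  shows "AE x in lebesgue. wgrad (v - w) x = wgrad v x - wgrad w x"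
proof -
  have "AE x in lebesgue. wgrad (\<lambda>x. v x + (-1) * w x) x = wgrad v x + wgrad (\<lambda>x. (-1) * w x) x"
    by (rule wgrad_add[OF assms(1) H1_cmult[OF assms(2)]])
  moreover have "AE x in lebesgue. wgrad (\<lambda>x. (-1) * w x) x = (-1) *s wgrad w x"
    by (rule wgrad_cmult[OF assms(2)])
  ultimately show ?thesis
  proof eventually_elim
    case (elim x)
    have "(\<lambda>x. v x + (-1) * w x) = v - w" by (simp add: fun_eq_iff)
    then show ?case using elim by (simp add: vec_eq_iff)
  qed
qed

lemma Lipschitz_H1:
  assumes "u \<in> points H1" "v \<in> points H1"
  shows "\<bar>L2_norm lebesgue (wgrad u) - L2_norm lebesgue (wgrad v)\<bar> \<le> snorm H1 (u - v)"
    and "\<bar>L2_norm lebesgue u - L2_norm lebesgue v\<bar> \<le> snorm H1 (u - v)"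
proof -
  have g: "L2_norm lebesgue (wgrad u) \<le> snorm H1 (u - v) + L2_norm lebesgue (wgrad v)"
    if "u \<in> points H1" "v \<in> points H1" for u v :: "real ^ 'a \<Rightarrow> complex"
  proof -
    note m = points_H1D(3)[OF that(1)] points_H1D(3)[OF that(2)] points_H1D(3)[OF H1.diff_point[OF that]]
    have "L2_norm lebesgue (wgrad u) = L2_norm lebesgue (\<lambda>x. wgrad (u - v) x + wgrad v x)"
      by (rule L2_norm_cong_AE) (use wgrad_diff[OF that] m in auto)
    also have "\<dots> \<le> L2_norm lebesgue (wgrad (u - v)) + L2_norm lebesgue (wgrad v)"
      by (rule L2_norm_triangle) (use m in auto)
    finally show ?thesis using L2_norm_le_H1(2)[OF H1.diff_point[OF that]] by simp
  qed
  show "\<bar>L2_norm lebesgue (wgrad u) - L2_norm lebesgue (wgrad v)\<bar> \<le> snorm H1 (u - v)"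
    using g[OF assms] g[OF assms(2,1)] H1.snorm_commute[OF assms] by simp
  have "\<bar>L2_norm lebesgue u - L2_norm lebesgue v\<bar> \<le> L2_norm lebesgue (u - v)"
    using L2.snorm_abs_diff[of u v] points_H1D(1)[OF assms(1)] points_H1D(1)[OF assms(2)]
    by (simp add: points_Lspace2 snorm_Lspace2)
  then show "\<bar>L2_norm lebesgue u - L2_norm lebesgue v\<bar> \<le> snorm H1 (u - v)"
    using L2_norm_le_H1(1)[OF H1.diff_point[OF assms]] by simp
qed

lemma Re_to_Hneg1_self:
  assumes "square_integrable lebesgue v" "v \<in> points H1"
  shows "Re (to_Hneg1 v v) = (L2_norm lebesgue v)\<^sup>2"
proof -
  have "to_Hneg1 v v = (LINT x|lebesgue. complex_of_real ((norm (v x))\<^sup>2))"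
    using assms(2) by (simp add: to_Hneg1_def complex_norm_square[symmetric] del: of_real_power)
  then show ?thesis by (simp add: L2_norm_square integral_complex_of_real del: of_real_power)
qed

lemma nn_integral_shift:
  assumes h: "0 < h" and f [measurable]: "f \<in> borel_measurable unit_interval"
  shows "(\<integral>\<^sup>+ t. (if h < t then f (t - h) else 0) \<partial>unit_interval) \<le> (\<integral>\<^sup>+ t. f t \<partial>unit_interval)"
proof -
  have U: "{0<..<1::real} \<inter> space lebesgue \<in> sets lebesgue" by simp
  define F where "F t = f t * indicator {0<..<1} t" for t
  have F: "F \<in> borel_measurable lebesgue"
    unfolding F_def using borel_measurable_restrict_space_iff_ennreal[OF U, THEN iffD1, OF f] .
  have "(\<integral>\<^sup>+ t. (if h < t then f (t - h) else 0) \<partial>unit_interval) \<le> (\<integral>\<^sup>+ t. F (- h + 1 * t) \<partial>lebesgue)"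
    unfolding nn_integral_restrict_space[OF U]
    by (rule nn_integral_mono) (use h in \<open>auto simp: F_def indicator_def\<close>)
  also have "\<dots> = (\<integral>\<^sup>+ t. F t \<partial>lebesgue)"
    using nn_integral_real_affine_lebesgue[OF F, of 1 "- h"] by simp
  also have "\<dots> = (\<integral>\<^sup>+ t. f t \<partial>unit_interval)"
    unfolding nn_integral_restrict_space[OF U] F_def ..
  finally show ?thesis .
qed

lemma AE_unit_interval_shift:
  assumes "AE t in unit_interval. P t"
  shows "AE t in unit_interval. h < t \<longrightarrow> 0 < h \<longrightarrow> P (t - h)"
proof -
  have U: "{0<..<1::real} \<inter> space lebesgue \<in> sets lebesgue" by simp
  have "AE t in lebesgue. t \<in> {0<..<1} \<longrightarrow> P t"
    using assms unfolding AE_restrict_space_iff[OF U] .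
  then have "AE t in lborel. t \<in> {0<..<1} \<longrightarrow> P t"
    by (simp add: AE_completion_iff)
  then obtain N where N: "N \<in> null_sets lborel" "{t. \<not> (t \<in> {0<..<1} \<longrightarrow> P t)} \<subseteq> N"
    by (auto elim!: AE_E simp: null_sets_def)
  have "AE t in lborel. t \<notin> {t. t - h \<in> N}"
    by (rule AE_not_in) (rule null_sets_translation[OF N(1)])
  then have "AE t in lborel. t \<in> {0<..<1} \<longrightarrow> h < t \<longrightarrow> 0 < h \<longrightarrow> P (t - h)"
  proof eventually_elim
    case (elim t)
    show ?case
    proof (intro impI)
      assume t: "t \<in> {0<..<1}" "h < t" "0 < h"
      then have "t - h \<in> {0<..<1}" by auto
      then show "P (t - h)" using elim N(2) by blast
    qed
  qed
  then show ?thesis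
    unfolding AE_restrict_space_iff[OF U] by (rule AE_completion)
qed

text \<open>
  The energy method. For \<open>t' = t - h\<close> the identity \<open>|w(t)|\<^sup>2 - Re (w(t'), w(t)) = Re \<integral> D(r)(w(t)) dr\<close>
  over \<open>t' < r < t\<close> involves \<open>w\<close> at two different times. Replacing \<open>w(t)\<close> by \<open>w(r)\<close> inside the integral
  makes it coercive, at the cost of an increment of \<open>w\<close> in \<open>H\<^sup>1\<close>, which is small on average over \<open>t\<close>.
\<close>

lemma energy_uniqueness:
  fixes w :: "real \<Rightarrow> real ^ 'n::finite \<Rightarrow> complex"
    and D :: "real \<Rightarrow> (real ^ 'n \<Rightarrow> complex) \<Rightarrow> complex"
  defines "G \<equiv> \<lambda>t. L2_norm lebesgue (wgrad (w t))"
  assumes w: "strongly_measurable unit_interval H1 w"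
    and fin: "(\<integral>\<^sup>+ t. ennreal ((snorm H1 (w t))\<^sup>2) \<partial>unit_interval) < \<infinity>"
    and Di: "\<And>z. z \<in> points H1 \<Longrightarrow> integrable unit_interval (\<lambda>r. D r z)"
    and \<Lambda>: "0 < \<Lambda>" and \<mu>: "0 < \<mu>"
    and D: "AE r in unit_interval. D r \<in> points Hneg1 \<and> Re (D r (w r)) \<le> - \<mu> * (G r)\<^sup>2 \<and>
      (\<forall>z\<in>points H1. cmod (D r z) \<le> \<Lambda> * G r * snorm H1 z)"
    and eq: "AE t in unit_interval. \<forall>z\<in>points H1.
      to_Hneg1 (w t) z = (LINT r|unit_interval. (if r < t then D r z else 0))"
  shows "AE t in unit_interval. AE x in lebesgue. w t x = 0"
proof -
  interpret finite_measure unit_interval by (rule finite_measure_unit_interval)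
  have U: "{0<..<1::real} \<in> sets lebesgue" by simp
  define \<phi> where "\<phi> t = (L2_norm lebesgue (w t))\<^sup>2" for t
  have wp: "AE t in unit_interval. w t \<in> points H1"
    using w by (auto simp: strongly_measurable_def)
  have Gm [measurable]: "G \<in> borel_measurable unit_interval"
    unfolding G_def by (rule H1.Lipschitz_borel_measurable[OF U w]) (rule Lipschitz_H1)
  have \<phi>m [measurable]: "\<phi> \<in> borel_measurable unit_interval"
    unfolding \<phi>_def
    by (intro borel_measurable_power H1.Lipschitz_borel_measurable[OF U w]) (rule Lipschitz_H1)
  have Nm [measurable]: "(\<lambda>t. snorm H1 (w t)) \<in> borel_measurable unit_interval"
    by (rule snorm_borel_measurable[OF H1.seminormed_space_axioms U w])
  have N2: "integrable unit_interval (\<lambda>t. (snorm H1 (w t))\<^sup>2)"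
    using fin by (intro integrableI_nonneg) auto
  have G0: "0 \<le> G t" for t by (simp add: G_def)
  have G2: "integrable unit_interval (\<lambda>t. (G t)\<^sup>2)"
  proof (rule Bochner_Integration.integrable_bound[OF N2])
    show "AE t in unit_interval. norm ((G t)\<^sup>2) \<le> norm ((snorm H1 (w t))\<^sup>2)"
      using wp by eventually_elim (auto simp: G_def intro!: power_mono L2_norm_le_H1)
  qed measurable
  have \<phi>fin: "(\<integral>\<^sup>+ t. ennreal (\<phi> t) \<partial>unit_interval) < \<infinity>"
  proof (rule le_less_trans[OF nn_integral_mono_AE fin])
    show "AE t in unit_interval. ennreal (\<phi> t) \<le> ennreal ((snorm H1 (w t))\<^sup>2)"
      using wp by eventually_elim (auto simp: \<phi>_def intro!: ennreal_leI power_mono L2_norm_le_H1)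
  qed
  define c where "c = \<Lambda>\<^sup>2 / (2 * \<mu>)"
  have c: "0 < c" using \<Lambda> \<mu> by (simp add: c_def)
  have young: "\<Lambda> * g * n \<le> \<mu> / 2 * g\<^sup>2 + c * n\<^sup>2" for g n :: real
  proof -
    have "0 \<le> (\<mu> * g - \<Lambda> * n)\<^sup>2 / (2 * \<mu>)" using \<mu> by simp
    also have "\<dots> = \<mu> / 2 * g\<^sup>2 + c * n\<^sup>2 - \<Lambda> * g * n"
      using \<mu> by (simp add: c_def power2_eq_square field_simps)
    finally show ?thesis by simp
  qed
  \<comment> \<open>Integrated over \<open>t\<close>, the terms \<open>\<phi> t\<close> and \<open>\<phi> (t - h)\<close> cancel since a translation does not
      increase the integral. What remains bounds the gradient by the increments.\<close>
  have main: "(\<integral>\<^sup>+ r. indicator {0<..<1 - h} r * ennreal ((G r)\<^sup>2) \<partial>unit_interval) \<le> ennreal (2 * c / \<mu> * \<eta>)"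
    if h: "0 < h" and Qm [measurable]: "(\<lambda>(t, r). Q t r) \<in> borel_measurable (unit_interval \<Otimes>\<^sub>M unit_interval)"
      and Q: "AE t in unit_interval. AE r in unit_interval. ennreal ((snorm H1 (w t - w r))\<^sup>2) \<le> Q t r"
      and J: "strip_integral h Q \<le> ennreal (\<eta> * h)" and \<eta>: "0 < \<eta>" for h Q \<eta>
  proof -
    have pt: "AE t in unit_interval. ennreal (\<phi> t / 2) +
        (\<integral>\<^sup>+ r. ennreal (strip h t r) * ennreal (\<mu> / 2 * (G r)\<^sup>2) \<partial>unit_interval)
        \<le> ennreal ((if h < t then \<phi> (t - h) else 0) / 2) +
        ennreal c * (\<integral>\<^sup>+ r. ennreal (strip h t r) * Q t r \<partial>unit_interval)"
      using wp eq AE_space Q AE_unit_interval_shift[OF wp, of h] AE_unit_interval_shift[OF eq, of h]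
    proof eventually_elim
      case (elim t)
      note wt = elim(1)
      have t: "0 < t" "t < 1" using elim(3) by auto
      have e1: "to_Hneg1 (w t) (w t) = (LINT r|unit_interval. (if r < t then D r (w t) else 0))"
        using elim(2) wt by blast
      have Dm [measurable]: "(\<lambda>r. D r (w t)) \<in> borel_measurable unit_interval"
        using Di[OF wt] by auto
      have ci: "integrable unit_interval (\<lambda>r. if P r then D r (w t) else 0)"
        if "Measurable.pred unit_interval P" for P
        by (rule Bochner_Integration.integrable_bound[OF Di[OF wt]]) (use that in auto)
      have [measurable]: "Measurable.pred unit_interval (\<lambda>r. r < s)" for s
        using unit_interval_id_measurable by measurable
      define W where "W = (if h < t then to_Hneg1 (w (t - h)) (w t) else 0)"
      have id: "to_Hneg1 (w t) (w t) - W = (LINT r|unit_interval. strip h t r *\<^sub>R D r (w t))"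
      proof -
        have "W = (LINT r|unit_interval. (if r < t - h then D r (w t) else 0))"
        proof (cases "h < t")
          case True
          then show ?thesis using elim(6) h wt by (simp add: W_def)
        next
          case False
          have "(LINT r|unit_interval. (if r < t - h then D r (w t) else 0)) = (LINT r|unit_interval. 0)"
            by (rule Bochner_Integration.integral_cong) (use False in auto)
          then show ?thesis using False by (simp add: W_def)
        qed
        then have "to_Hneg1 (w t) (w t) - W = (LINT r|unit_interval. (if r < t then D r (w t) else 0) - (if r < t - h then D r (w t) else 0))"
          unfolding e1 by (subst Bochner_Integration.integral_diff) (auto intro!: ci)
        also have "\<dots> = (LINT r|unit_interval. strip h t r *\<^sub>R D r (w t))"
          by (rule Bochner_Integration.integral_cong) (use h in \<open>auto simp: strip_def\<close>)
        finally show ?thesis .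
      qed
      have ReW: "Re W \<le> \<phi> t / 2 + (if h < t then \<phi> (t - h) else 0) / 2"
      proof (cases "h < t")
        case True
        then have wh: "w (t - h) \<in> points H1" using elim(5) h by simp
        have "Re W \<le> cmod (to_Hneg1 (w (t - h)) (w t))"
          using True complex_Re_le_cmod by (simp add: W_def)
        also have "\<dots> \<le> L2_norm lebesgue (w (t - h)) * L2_norm lebesgue (w t)"
          using integral_mult_cnj_le(1)[OF points_H1D(1)[OF wh] points_H1D(1)[OF wt]] wt
          by (simp add: to_Hneg1_def)
        also have "\<dots> \<le> \<phi> t / 2 + \<phi> (t - h) / 2"
          using sum_squares_bound[of "L2_norm lebesgue (w (t - h))" "L2_norm lebesgue (w t)"]
          by (simp add: \<phi>_def)
        finally show ?thesis using True by simp
      qed (simp add: W_def \<phi>_def)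
      have wtr: "strongly_measurable unit_interval H1 (\<lambda>r. w t - w r)"
      proof (rule H1.strongly_measurable_diff[OF _ w])
        show "strongly_measurable unit_interval H1 (\<lambda>r. w t)"
          unfolding strongly_measurable_def by (rule exI[of _ "\<lambda>k r. w t"]) (use wt in auto)
      qed
      have Im [measurable]: "(\<lambda>r. snorm H1 (w t - w r)) \<in> borel_measurable unit_interval"
        by (rule snorm_borel_measurable[OF H1.seminormed_space_axioms U wtr])
      have I2: "integrable unit_interval (\<lambda>r. (snorm H1 (w t - w r))\<^sup>2)"
      proof (rule Bochner_Integration.integrable_bound)
        show "integrable unit_interval (\<lambda>r. 2 * (snorm H1 (w t))\<^sup>2 + 2 * (snorm H1 (w r))\<^sup>2)"
          using N2 by simp
        show "AE r in unit_interval. norm ((snorm H1 (w t - w r))\<^sup>2) \<le> norm (2 * (snorm H1 (w t))\<^sup>2 + 2 * (snorm H1 (w r))\<^sup>2)"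
          using wp
        proof eventually_elim
          case (elim r)
          have "(snorm H1 (w t - w r))\<^sup>2 \<le> (snorm H1 (w t) + snorm H1 (w r))\<^sup>2"
            by (rule power_mono[OF H1.snorm_diff_le[OF wt elim] H1.snorm_nonneg[OF H1.diff_point[OF wt elim]]])
          then show ?case
            using sum_squares_bound[of "snorm H1 (w t)" "snorm H1 (w r)"] by (simp add: power2_sum)
        qed
      qed measurable
      have si: "integrable unit_interval (\<lambda>r. strip h t r * f r)" if "integrable unit_interval f" for f :: "real \<Rightarrow> real"
      proof (rule Bochner_Integration.integrable_bound[OF that])
        show "(\<lambda>r. strip h t r * f r) \<in> borel_measurable unit_interval"
          using that by measurable
        show "AE r in unit_interval. norm (strip h t r * f r) \<le> norm (f r)"
          by (simp add: strip_def)
      qed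
      have "Re (LINT r|unit_interval. strip h t r *\<^sub>R D r (w t)) = (LINT r|unit_interval. strip h t r * Re (D r (w t)))"
      proof -
        have "integrable unit_interval (\<lambda>r. strip h t r *\<^sub>R D r (w t))"
        proof (rule Bochner_Integration.integrable_bound[OF Di[OF wt]])
          show "(\<lambda>r. strip h t r *\<^sub>R D r (w t)) \<in> borel_measurable unit_interval"
            by measurable
          show "AE r in unit_interval. norm (strip h t r *\<^sub>R D r (w t)) \<le> norm (D r (w t))"
            by (simp add: strip_def)
        qed
        then show ?thesis by (subst integral_Re[symmetric]) auto
      qed
      also have "\<dots> \<le> (LINT r|unit_interval. strip h t r * (- (\<mu> / 2 * (G r)\<^sup>2) + c * (snorm H1 (w t - w r))\<^sup>2))"
      proof (rule integral_mono_AE)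
        show "AE r in unit_interval. strip h t r * Re (D r (w t))
            \<le> strip h t r * (- (\<mu> / 2 * (G r)\<^sup>2) + c * (snorm H1 (w t - w r))\<^sup>2)"
          using D wp
        proof eventually_elim
          case (elim r)
          have d: "w t - w r \<in> points H1" using wt elim by auto
          have "D r (w t) = D r (w r) + D r (w t - w r)"
            using Hneg1_diff_arg[of "D r" "w t" "w r"] elim wt by simp
          then have "Re (D r (w t)) \<le> - \<mu> * (G r)\<^sup>2 + cmod (D r (w t - w r))"
            using elim complex_Re_le_cmod[of "D r (w t - w r)"] by simp
          also have "\<dots> \<le> - \<mu> * (G r)\<^sup>2 + \<Lambda> * G r * snorm H1 (w t - w r)"
            using elim d by simp
          also have "\<dots> \<le> - (\<mu> / 2 * (G r)\<^sup>2) + c * (snorm H1 (w t - w r))\<^sup>2"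
            using young[of "G r" "snorm H1 (w t - w r)"] by simp
          finally show ?case by (rule mult_left_mono) simp
        qed
      qed (use Di[OF wt] G2 I2 in \<open>auto intro!: si\<close>)
      also have "\<dots> = - (LINT r|unit_interval. strip h t r * (\<mu> / 2 * (G r)\<^sup>2)) + c * (LINT r|unit_interval. strip h t r * (snorm H1 (w t - w r))\<^sup>2)"
      proof -
        have "(\<lambda>r. strip h t r * (- (\<mu> / 2 * (G r)\<^sup>2) + c * (snorm H1 (w t - w r))\<^sup>2)) =
            (\<lambda>r. c * (strip h t r * (snorm H1 (w t - w r))\<^sup>2) - strip h t r * (\<mu> / 2 * (G r)\<^sup>2))"
          by (simp add: fun_eq_iff algebra_simps)
        moreover have "integrable unit_interval (\<lambda>r. strip h t r * (\<mu> / 2 * (G r)\<^sup>2))"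
          using G2 by (intro si) auto
        ultimately show ?thesis using si[OF I2] by simp
      qed
      finally have real: "\<phi> t / 2 + (LINT r|unit_interval. strip h t r * (\<mu> / 2 * (G r)\<^sup>2))
          \<le> (if h < t then \<phi> (t - h) else 0) / 2 + c * (LINT r|unit_interval. strip h t r * (snorm H1 (w t - w r))\<^sup>2)"
        using ReW Re_to_Hneg1_self[OF points_H1D(1)[OF wt] wt] arg_cong[OF id, of Re] by (simp add: \<phi>_def)
      have nn: "(\<integral>\<^sup>+ r. ennreal (strip h t r) * ennreal (f r) \<partial>unit_interval) = ennreal (LINT r|unit_interval. strip h t r * f r)"
        if f: "integrable unit_interval f" "\<And>r. 0 \<le> f r" for f
      proof -
        have "(\<integral>\<^sup>+ r. ennreal (strip h t r * f r) \<partial>unit_interval) = ennreal (LINT r|unit_interval. strip h t r * f r)"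
          by (rule nn_integral_eq_integral[OF si[OF f(1)]]) (use f(2) in auto)
        moreover have "ennreal (strip h t r) * ennreal (f r) = ennreal (strip h t r * f r)" for r
          by (rule ennreal_mult[symmetric]) (use f(2) in auto)
        ultimately show ?thesis by simp
      qed
      have n1: "(\<integral>\<^sup>+ r. ennreal (strip h t r) * ennreal (\<mu> / 2 * (G r)\<^sup>2) \<partial>unit_interval) = ennreal (LINT r|unit_interval. strip h t r * (\<mu> / 2 * (G r)\<^sup>2))"
        by (rule nn) (use G2 \<mu> in auto)
      have n2: "ennreal (LINT r|unit_interval. strip h t r * (snorm H1 (w t - w r))\<^sup>2) \<le> (\<integral>\<^sup>+ r. ennreal (strip h t r) * Q t r \<partial>unit_interval)"
      proof -
        have "ennreal (LINT r|unit_interval. strip h t r * (snorm H1 (w t - w r))\<^sup>2) =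
            (\<integral>\<^sup>+ r. ennreal (strip h t r) * ennreal ((snorm H1 (w t - w r))\<^sup>2) \<partial>unit_interval)"
          by (rule nn[symmetric]) (use I2 in auto)
        also have "\<dots> \<le> (\<integral>\<^sup>+ r. ennreal (strip h t r) * Q t r \<partial>unit_interval)"
          using elim(4) by (intro nn_integral_mono_AE) (auto elim!: eventually_mono intro: mult_left_mono)
        finally show ?thesis .
      qed
      have nonneg: "0 \<le> \<phi> s" "0 \<le> (LINT r|unit_interval. strip h t r * (\<mu> / 2 * (G r)\<^sup>2))"
        "0 \<le> (LINT r|unit_interval. strip h t r * (snorm H1 (w t - w r))\<^sup>2)" for s
        using \<mu> by (auto simp: \<phi>_def intro!: integral_nonneg)
      have "ennreal (\<phi> t / 2) + ennreal (LINT r|unit_interval. strip h t r * (\<mu> / 2 * (G r)\<^sup>2))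
          \<le> ennreal ((if h < t then \<phi> (t - h) else 0) / 2) + ennreal c * ennreal (LINT r|unit_interval. strip h t r * (snorm H1 (w t - w r))\<^sup>2)"
        using ennreal_leI[OF real] nonneg c by (simp add: ennreal_plus ennreal_mult split: if_splits)
      also have "\<dots> \<le> ennreal ((if h < t then \<phi> (t - h) else 0) / 2) + ennreal c * (\<integral>\<^sup>+ r. ennreal (strip h t r) * Q t r \<partial>unit_interval)"
        using n2 by (intro add_left_mono mult_left_mono) auto
      finally show ?case unfolding n1 .
    qed
    define a where "a = (\<integral>\<^sup>+ t. ennreal (\<phi> t / 2) \<partial>unit_interval)"
    have afin: "a < \<infinity>"
    proof -
      have "a \<le> (\<integral>\<^sup>+ t. ennreal (\<phi> t) \<partial>unit_interval)"
        unfolding a_def by (intro nn_integral_mono ennreal_leI) (simp add: \<phi>_def)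
      then show ?thesis using \<phi>fin by (rule le_less_trans)
    qed
    have "a + strip_integral h (\<lambda>t r. ennreal (\<mu> / 2 * (G r)\<^sup>2)) =
        (\<integral>\<^sup>+ t. ennreal (\<phi> t / 2) + (\<integral>\<^sup>+ r. ennreal (strip h t r) * ennreal (\<mu> / 2 * (G r)\<^sup>2) \<partial>unit_interval) \<partial>unit_interval)"
      unfolding a_def strip_integral_def by (rule nn_integral_add[symmetric]) measurable
    also have "\<dots> \<le> (\<integral>\<^sup>+ t. ennreal ((if h < t then \<phi> (t - h) else 0) / 2) +
        ennreal c * (\<integral>\<^sup>+ r. ennreal (strip h t r) * Q t r \<partial>unit_interval) \<partial>unit_interval)"
      by (rule nn_integral_mono_AE[OF pt])
    also have "\<dots> \<le> (\<integral>\<^sup>+ t. ennreal ((if h < t then \<phi> (t - h) else 0) / 2) \<partial>unit_interval) +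
        (\<integral>\<^sup>+ t. ennreal c * (\<integral>\<^sup>+ r. ennreal (strip h t r) * Q t r \<partial>unit_interval) \<partial>unit_interval)"
    proof -
      interpret pair_sigma_finite unit_interval unit_interval by (rule pair_sigma_finite_unit_interval)
      have "(\<lambda>t. ennreal ((if h < t then \<phi> (t - h) else 0) / 2)) \<in> borel_measurable unit_interval"
      proof -
        define F where "F t = indicator {0<..<1} t *\<^sub>R \<phi> t" for t
        have F: "F \<in> borel_measurable lebesgue"
          unfolding F_def using borel_measurable_restrict_space_iff[THEN iffD1, OF _ \<phi>m] by simp
        have "(\<lambda>t. - h + 1 * t) \<in> lebesgue \<rightarrow>\<^sub>M lebesgue"
          using lebesgue_affine_measurable[where c = "\<lambda>x::real. 1" and t = "- h"] by simp
        then have "(\<lambda>t. F (t - h)) \<in> borel_measurable unit_interval"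
          using measurable_compose[OF _ F] by (intro measurable_restrict_space1) simp
        then have "(\<lambda>t. ennreal (F (t - h) / 2)) \<in> borel_measurable unit_interval" by measurable
        then show ?thesis
          by (rule measurable_cong[THEN iffD1, rotated]) (use h in \<open>auto simp: F_def indicator_def\<close>)
      qed
      moreover have "(\<lambda>t. ennreal c * (\<integral>\<^sup>+ r. ennreal (strip h t r) * Q t r \<partial>unit_interval)) \<in> borel_measurable unit_interval"
        by measurable
      ultimately show ?thesis by (intro eq_refl nn_integral_add)
    qed
    also have "(\<integral>\<^sup>+ t. ennreal ((if h < t then \<phi> (t - h) else 0) / 2) \<partial>unit_interval) \<le> a"
    proof -
      have "(\<integral>\<^sup>+ t. ennreal ((if h < t then \<phi> (t - h) else 0) / 2) \<partial>unit_interval) =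
          (\<integral>\<^sup>+ t. (if h < t then ennreal (\<phi> (t - h) / 2) else 0) \<partial>unit_interval)"
        by (rule nn_integral_cong) auto
      also have "\<dots> \<le> a"
        unfolding a_def by (rule nn_integral_shift[OF h]) measurable
      finally show ?thesis .
    qed
    also have "(\<integral>\<^sup>+ t. ennreal c * (\<integral>\<^sup>+ r. ennreal (strip h t r) * Q t r \<partial>unit_interval) \<partial>unit_interval) = ennreal c * strip_integral h Q"
    proof -
      interpret pair_sigma_finite unit_interval unit_interval by (rule pair_sigma_finite_unit_interval)
      show ?thesis unfolding strip_integral_def by (rule nn_integral_cmult) measurable
    qed
    finally have "a + strip_integral h (\<lambda>t r. ennreal (\<mu> / 2 * (G r)\<^sup>2)) \<le> a + ennreal c * strip_integral h Q"
      by (simp add: add_right_mono)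
    then have "strip_integral h (\<lambda>t r. ennreal (\<mu> / 2 * (G r)\<^sup>2)) \<le> ennreal c * strip_integral h Q"
      using afin by (auto simp: ennreal_add_left_cancel_le)
    also have "\<dots> \<le> ennreal c * ennreal (\<eta> * h)"
      using J by (rule mult_left_mono) simp
    finally have 1: "strip_integral h (\<lambda>t r. ennreal (\<mu> / 2 * (G r)\<^sup>2)) \<le> ennreal c * ennreal (\<eta> * h)" .
    have "ennreal (\<mu> / 2 * h) * (\<integral>\<^sup>+ r. indicator {0<..<1 - h} r * ennreal ((G r)\<^sup>2) \<partial>unit_interval) =
        (\<integral>\<^sup>+ r. ennreal (\<mu> / 2 * h) * (indicator {0<..<1 - h} r * ennreal ((G r)\<^sup>2)) \<partial>unit_interval)"
    proof (rule nn_integral_cmult[symmetric])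
      have "(indicator {0<..<1 - h} :: real \<Rightarrow> ennreal) \<in> borel_measurable unit_interval"
        by (intro measurable_restrict_space1 borel_measurable_indicator) simp
      then show "(\<lambda>r. indicator {0<..<1 - h} r * ennreal ((G r)\<^sup>2)) \<in> borel_measurable unit_interval"
        by measurable
    qed
    also have "\<dots> \<le> strip_integral h (\<lambda>t r. ennreal (\<mu> / 2 * (G r)\<^sup>2))"
    proof (subst strip_integral_one_variable(2)[OF h], measurable, rule nn_integral_mono)
      fix r :: real
      show "ennreal (\<mu> / 2 * h) * (indicator {0<..<1 - h} r * ennreal ((G r)\<^sup>2))
          \<le> (\<integral>\<^sup>+ t. ennreal (strip h t r) \<partial>unit_interval) * ennreal (\<mu> / 2 * (G r)\<^sup>2)"
      proof (cases "r \<in> {0<..<1 - h}")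
        case True
        then have "(\<integral>\<^sup>+ t. ennreal (strip h t r) \<partial>unit_interval) = ennreal h"
          by (intro nn_integral_strip(3)[OF h]) auto
        then show ?thesis
          using True h \<mu> by (simp add: mult_ac flip: ennreal_mult)
      qed simp
    qed
    also note 1
    finally have "ennreal (\<mu> / 2 * h) * (\<integral>\<^sup>+ r. indicator {0<..<1 - h} r * ennreal ((G r)\<^sup>2) \<partial>unit_interval)
        \<le> ennreal (\<mu> / 2 * h) * ennreal (2 * c / \<mu> * \<eta>)"
      using c \<eta> h \<mu> by (simp add: field_simps flip: ennreal_mult)
    then show ?thesis
      using h \<mu> by (subst (asm) ennreal_mult_le_mult_iff) auto
  qed
  have zero: "(\<integral>\<^sup>+ r. indicator {0<..<1 - d} r * ennreal ((G r)\<^sup>2) \<partial>unit_interval) = 0" if d: "0 < d" for d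
  proof -
    have "(\<integral>\<^sup>+ r. indicator {0<..<1 - d} r * ennreal ((G r)\<^sup>2) \<partial>unit_interval) \<le> 0 + ennreal e" if e: "0 < e" for e
    proof -
      define \<eta> where "\<eta> = e * \<mu> / (2 * c)"
      have \<eta>: "0 < \<eta>" using e c \<mu> by (simp add: \<eta>_def)
      obtain h0 Q where h0: "h0 > 0" "(\<lambda>(t, r). Q t r) \<in> borel_measurable (unit_interval \<Otimes>\<^sub>M unit_interval)"
        "AE t in unit_interval. AE r in unit_interval. ennreal ((snorm H1 (w t - w r))\<^sup>2) \<le> Q t r"
        "\<And>h. 0 < h \<Longrightarrow> h \<le> h0 \<Longrightarrow> strip_integral h Q \<le> ennreal (\<eta> * h)"
        using H1.strip_integral_increments[OF w fin \<eta>] by blast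
      define h where "h = min h0 d"
      have h: "0 < h" "h \<le> h0" "h \<le> d" using h0 d by (auto simp: h_def)
      have "(\<integral>\<^sup>+ r. indicator {0<..<1 - d} r * ennreal ((G r)\<^sup>2) \<partial>unit_interval)
          \<le> (\<integral>\<^sup>+ r. indicator {0<..<1 - h} r * ennreal ((G r)\<^sup>2) \<partial>unit_interval)"
        using h by (intro nn_integral_mono mult_right_mono) (auto simp: indicator_def)
      also have "\<dots> \<le> ennreal (2 * c / \<mu> * \<eta>)"
        by (rule main[OF h(1) h0(2,3) h0(4)[OF h(1,2)] \<eta>])
      also have "2 * c / \<mu> * \<eta> = e" using c \<mu> by (simp add: \<eta>_def)
      finally show ?thesis by simp
    qed
    then have "(\<integral>\<^sup>+ r. indicator {0<..<1 - d} r * ennreal ((G r)\<^sup>2) \<partial>unit_interval) \<le> 0"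
      by (rule ennreal_le_epsilon)
    then show ?thesis by simp
  qed
  have "AE r in unit_interval. \<forall>k::nat. indicator {0<..<1 - 1 / real (Suc k)} r * ennreal ((G r)\<^sup>2) = 0"
  proof (subst AE_all_countable, intro allI)
    fix k
    have "(indicator {0<..<1 - 1 / real (Suc k)} :: real \<Rightarrow> ennreal) \<in> borel_measurable unit_interval"
      by (intro measurable_restrict_space1 borel_measurable_indicator) simp
    then have "(\<lambda>r. indicator {0<..<1 - 1 / real (Suc k)} r * ennreal ((G r)\<^sup>2)) \<in> borel_measurable unit_interval"
      by measurable
    then show "AE r in unit_interval. indicator {0<..<1 - 1 / real (Suc k)} r * ennreal ((G r)\<^sup>2) = 0"
      using zero[of "1 / real (Suc k)"] by (subst nn_integral_0_iff_AE[symmetric]) auto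
  qed
  then have Gz: "AE r in unit_interval. G r = 0"
    using AE_space
  proof eventually_elim
    case (elim r)
    then have "r < 1" "0 < r" by auto
    obtain k where "inverse (real (Suc k)) < 1 - r"
      using reals_Archimedean[of "1 - r"] \<open>r < 1\<close> by auto
    then have "r \<in> {0<..<1 - 1 / real (Suc k)}" using \<open>0 < r\<close> by (simp add: inverse_eq_divide)
    then have "ennreal ((G r)\<^sup>2) = 0"
      using elim(1)[rule_format, of k] by simp
    then show ?case by (simp add: ennreal_eq_0_iff)
  qed
  \<comment> \<open>Once the gradient vanishes so does \<open>D\<close>, and the integral equation gives \<open>w = 0\<close>.\<close>
  have Dz: "AE r in unit_interval. \<forall>z\<in>points H1. D r z = 0"
    using D Gz by eventually_elim force
  show ?thesis
    using wp eq
  proof eventually_elim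
    case (elim t)
    have "to_Hneg1 (w t) (w t) = (LINT r|unit_interval. (if r < t then D r (w t) else 0))"
      using elim by blast
    also have "\<dots> = (LINT r|unit_interval. 0)"
    proof (rule integral_cong_AE)
      have "(\<lambda>r. D r (w t)) \<in> borel_measurable unit_interval" using Di[OF elim(1)] by auto
      moreover have "Measurable.pred unit_interval (\<lambda>r. r < t)"
        using unit_interval_id_measurable by measurable
      ultimately show "(\<lambda>r. if r < t then D r (w t) else 0) \<in> borel_measurable unit_interval" by measurable
      show "AE r in unit_interval. (if r < t then D r (w t) else 0) = 0"
        using Dz by eventually_elim (use elim(1) in auto)
    qed simp
    finally have "(L2_norm lebesgue (w t))\<^sup>2 = 0"
      using Re_to_Hneg1_self[OF points_H1D(1)[OF elim(1)] elim(1)] by simp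
    then show ?case
      using L2_norm_zero_AE[OF points_H1D(1)[OF elim(1)]] by simp
  qed
qed


lemma snorm_H1_nonneg [simp]: "0 \<le> snorm H1 v"
  by (simp add: H1_def)

lemma bochner_Lp_2_H1:
  fixes u :: "'t \<Rightarrow> real ^ 'n::finite \<Rightarrow> complex"
  shows "u \<in> bochner_Lp M 2 H1 \<longleftrightarrow>
    strongly_measurable M H1 u \<and> (\<integral>\<^sup>+ t. ennreal ((snorm H1 (u t))\<^sup>2) \<partial>M) < \<infinity>"
proof -
  have "snorm H1 v powr 2 = (snorm H1 v)\<^sup>2" for v :: "real ^ 'n \<Rightarrow> complex"
    by (metis powr_numeral snorm_H1_nonneg)
  then show ?thesis by (simp add: bochner_Lp_def)
qed

lemma integrable_unit_interval_subset:
  fixes f :: "real \<Rightarrow> 'b::{banach, second_countable_topology}"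
  assumes "integrable (lebesgue_on {0..1}) f"
  shows "integrable unit_interval f"
proof -
  have "integrable lebesgue (\<lambda>r. indicator {0..1} r *\<^sub>R f r)"
    using assms by (subst (asm) integrable_restrict_space) auto
  then have "integrable lebesgue (\<lambda>r. indicator {0<..<1} r *\<^sub>R (indicator {0..1} r *\<^sub>R f r))"
    by (rule integrable_mult_indicator[rotated]) simp
  also have "(\<lambda>r. indicator {0<..<1} r *\<^sub>R (indicator {0..1} r *\<^sub>R f r)) = (\<lambda>r. indicator {0<..<1} r *\<^sub>R f r)"
    by (auto simp: indicator_def)
  finally show ?thesis by (subst integrable_restrict_space) auto
qed

lemma AE_lebesgue_neq: "AE r in lebesgue. r \<noteq> (c::real)"
  by (rule AE_completion) (rule AE_lborel_singleton)

lemma integral_initial: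
  fixes f :: "real \<Rightarrow> 'b::{banach, second_countable_topology}"
  assumes f: "integrable (lebesgue_on {0..1}) f" and t: "t \<in> {0<..<1}"
  shows "(LINT r|lebesgue_on {0..t}. f r) = (LINT r|unit_interval. (if r < t then f r else 0))"
proof -
  have i: "integrable lebesgue (\<lambda>r. indicator {0..1} r *\<^sub>R f r)"
    using f by (subst (asm) integrable_restrict_space) auto
  have e1: "indicator {0..t} r *\<^sub>R f r = indicator {0..t} r *\<^sub>R (indicator {0..1} r *\<^sub>R f r)" for r
    using t by (auto simp: indicator_def)
  have e2: "indicator {0<..<1} r *\<^sub>R (if r < t then f r else 0) = indicator {0<..<t} r *\<^sub>R (indicator {0..1} r *\<^sub>R f r)" for r
    using t by (auto simp: indicator_def)
  have "(LINT r|lebesgue. indicator {0..t} r *\<^sub>R f r) = (LINT r|lebesgue. indicator {0<..<1} r *\<^sub>R (if r < t then f r else 0))"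
    unfolding e1 e2
  proof (rule integral_cong_AE)
    show "(\<lambda>r. indicator {0..t} r *\<^sub>R (indicator {0..1} r *\<^sub>R f r)) \<in> borel_measurable lebesgue"
      "(\<lambda>r. indicator {0<..<t} r *\<^sub>R (indicator {0..1} r *\<^sub>R f r)) \<in> borel_measurable lebesgue"
      by (rule borel_measurable_integrable[OF integrable_mult_indicator[OF _ i]]; simp)+
    show "AE r in lebesgue. indicator {0..t} r *\<^sub>R (indicator {0..1} r *\<^sub>R f r) =
        indicator {0<..<t} r *\<^sub>R (indicator {0..1} r *\<^sub>R f r)"
      using AE_lebesgue_neq[of 0] AE_lebesgue_neq[of t] by eventually_elim (auto simp: indicator_def)
  qed
  then show ?thesis
    by (subst (1 2) integral_restrict_space) auto
qed

lemma elliptic_measurable: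
  fixes B :: "real \<Rightarrow> real ^ 'n::finite \<Rightarrow> complex ^ 'n ^ 'n"
  assumes B: "elliptic B" and t: "t \<in> {0..1}" and v [measurable]: "v \<in> borel_measurable lebesgue"
  shows "(\<lambda>x. B t x *v v x) \<in> borel_measurable lebesgue"
proof -
  have [measurable]: "(\<lambda>x. (t, x)) \<in> borel \<rightarrow>\<^sub>M restrict_space borel ({0..1} \<times> UNIV)"
  proof (rule measurable_restrict_space2)
    show "(\<lambda>x. (t, x)) \<in> borel \<rightarrow>\<^sub>M borel"
      by (intro borel_measurable_continuous_onI continuous_intros)
  qed (use t in auto)
  have "(\<lambda>x. (\<lambda>(t, x). B t x) (t, x)) \<in> borel_measurable borel"
    by (rule measurable_compose[of "\<lambda>x. (t, x)"]) (use B in \<open>auto simp: elliptic_def\<close>)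
  then have "(\<lambda>x. B t x) \<in> borel_measurable borel" by simp
  then have Bm: "(\<lambda>x. B t x) \<in> borel_measurable lebesgue"
    by (intro measurable_completion) simp
  have "(\<lambda>A::complex^'n^'n. A $ i $ j) \<in> borel_measurable borel" for i j
    by (intro borel_measurable_continuous_onI continuous_intros)
  then have [measurable]: "(\<lambda>x. B t x $ i $ j) \<in> borel_measurable lebesgue" for i j
    using measurable_compose[OF Bm] by auto
  have "(\<lambda>A::complex^'n. A $ j) \<in> borel_measurable borel" for j
    by (intro borel_measurable_continuous_onI continuous_intros)
  then have [measurable]: "(\<lambda>x. v x $ j) \<in> borel_measurable lebesgue" for j
    using measurable_compose[OF v] by auto
  show ?thesis
    by (rule borel_measurable_vec) (simp add: matrix_vector_mult_def)
qed

lemma pointwise_integral_eval: "z \<in> points H1 \<Longrightarrow> pointwise_integral M u z = (LINT t|M. u t z)"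
  by (simp add: pointwise_integral_def)

lemma solution_integral_equations:
  assumes sol: "is_solution B F u"
  shows "\<exists>U. continuous_rep u U \<and> (\<forall>t\<in>{0..1}. \<exists>D I.
         has_bochner_integral_in (lebesgue_on {0..t}) Hneg1 (\<lambda>\<tau>. div_op (B \<tau>) (u \<tau>)) D \<and>
         has_bochner_integral_in (lebesgue_on {0..t}) Hneg1 F I \<and> U t - D = I)"
  using sol unfolding is_solution_def by (elim conjE)
lemma solution_pointwise_equations:
  assumes sol: "is_solution B F u"
  shows "\<exists>U. (AE t in unit_interval. U t = to_Hneg1 (u t)) \<and>
      (\<forall>t\<in>{0..1}. integrable_functionals {0..t} (\<lambda>\<tau>. div_op (B \<tau>) (u \<tau>)) \<and>
        U t = pointwise_integral (lebesgue_on {0..t}) (\<lambda>\<tau>. div_op (B \<tau>) (u \<tau>)) +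
          pointwise_integral (lebesgue_on {0..t}) F)"
proof -
  obtain U where U: "continuous_rep u U" and U2: "\<forall>t\<in>{0..1}. \<exists>D I.
         has_bochner_integral_in (lebesgue_on {0..t}) Hneg1 (\<lambda>\<tau>. div_op (B \<tau>) (u \<tau>)) D \<and>
         has_bochner_integral_in (lebesgue_on {0..t}) Hneg1 F I \<and> U t - D = I"
    using solution_integral_equations[OF sol] by (elim exE conjE)
  show ?thesis
  proof (intro exI[of _ U] conjI ballI)
    show "AE t in unit_interval. U t = to_Hneg1 (u t)"
      using U by (simp add: continuous_rep_def)
    fix t :: real assume "t \<in> {0..1}"
    then obtain D I where DI: "has_bochner_integral_in (lebesgue_on {0..t}) Hneg1 (\<lambda>\<tau>. div_op (B \<tau>) (u \<tau>)) D"
        "has_bochner_integral_in (lebesgue_on {0..t}) Hneg1 F I" "U t - D = I"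
      using U2 by blast
    have "U t = D + I" using DI(3) by (metis add.commute diff_add_cancel)
    then show "U t = pointwise_integral (lebesgue_on {0..t}) (\<lambda>\<tau>. div_op (B \<tau>) (u \<tau>)) +
          pointwise_integral (lebesgue_on {0..t}) F"
      using has_bochner_integral_inD(2)[OF _ DI(1)] has_bochner_integral_inD(2)[OF _ DI(2)] by simp
    show "integrable_functionals {0..t} (\<lambda>\<tau>. div_op (B \<tau>) (u \<tau>))"
      by (rule has_bochner_integral_inD(1)[OF _ DI(1)]) simp
  qed
qed

text \<open>
  The difference of two solutions solves the homogeneous integral equation, tested with any
  element of \<^const>\<open>H1\<close>; ellipticity makes the energy method applicable.
\<close>

theorem solution_unique:
  fixes B :: "real \<Rightarrow> real ^ 'n::finite \<Rightarrow> complex ^ 'n ^ 'n"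
  assumes B: "elliptic B" and u1: "is_solution B F u1" and u2: "is_solution B F u2"
  shows "AE t in unit_interval. AE x in lebesgue. u1 t x = u2 t x"
proof -
  obtain \<Lambda> \<mu> where L: "\<Lambda> > 0" "\<mu> > 0" and ell: "\<And>t x \<xi>. t \<in> {0..1} \<Longrightarrow> norm (B t x *v \<xi>) \<le> \<Lambda> * norm \<xi>"
    "\<And>t x \<xi>. t \<in> {0..1} \<Longrightarrow> \<mu> * (norm \<xi>)\<^sup>2 \<le> Re (herm (B t x *v \<xi>) \<xi>)"
    using B unfolding elliptic_def by blast
  obtain U1 where U1: "AE t in unit_interval. U1 t = to_Hneg1 (u1 t)"
    "\<And>t. t \<in> {0..1} \<Longrightarrow> integrable_functionals {0..t} (\<lambda>\<tau>. div_op (B \<tau>) (u1 \<tau>))"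
    "\<And>t. t \<in> {0..1} \<Longrightarrow> U1 t = pointwise_integral (lebesgue_on {0..t}) (\<lambda>\<tau>. div_op (B \<tau>) (u1 \<tau>)) +
          pointwise_integral (lebesgue_on {0..t}) F"
    using solution_pointwise_equations[OF u1] by (elim exE conjE) (rule that, auto)
  obtain U2 where U2: "AE t in unit_interval. U2 t = to_Hneg1 (u2 t)"
    "\<And>t. t \<in> {0..1} \<Longrightarrow> integrable_functionals {0..t} (\<lambda>\<tau>. div_op (B \<tau>) (u2 \<tau>))"
    "\<And>t. t \<in> {0..1} \<Longrightarrow> U2 t = pointwise_integral (lebesgue_on {0..t}) (\<lambda>\<tau>. div_op (B \<tau>) (u2 \<tau>)) +
          pointwise_integral (lebesgue_on {0..t}) F"
    using solution_pointwise_equations[OF u2] by (elim exE conjE) (rule that, auto)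
  have H: "strongly_measurable unit_interval H1 u1" "(\<integral>\<^sup>+ t. ennreal ((snorm H1 (u1 t))\<^sup>2) \<partial>unit_interval) < \<infinity>"
    "strongly_measurable unit_interval H1 u2" "(\<integral>\<^sup>+ t. ennreal ((snorm H1 (u2 t))\<^sup>2) \<partial>unit_interval) < \<infinity>"
    using u1 u2 by (auto simp: is_solution_def bochner_Lp_2_H1)
  have p: "AE t in unit_interval. u1 t \<in> points H1" "AE t in unit_interval. u2 t \<in> points H1"
    using H by (auto simp: strongly_measurable_def)
  define w where "w t = u1 t - u2 t" for t
  define D where "D t = div_op (B t) (u1 t) - div_op (B t) (u2 t)" for t
  have Deq: "D t = flux_functional (\<lambda>x. B t x *v wgrad (w t) x)"
    if t: "t \<in> {0..1}" and u: "u1 t \<in> points H1" "u2 t \<in> points H1" for t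
  proof
    fix z
    have wt: "w t \<in> points H1" using u by (auto simp: w_def)
    have q: "square_integrable lebesgue (\<lambda>x. B t x *v wgrad v x)" if "v \<in> points H1" for v
      by (rule square_integrable_dominated[OF points_H1D(3)[OF that] elliptic_measurable[OF B t], of _ \<Lambda>])
        (use points_H1D(3)[OF that] ell(1)[OF t] in auto)
    show "D t z = flux_functional (\<lambda>x. B t x *v wgrad (w t) x) z"
    proof (cases "z \<in> points H1")
      case True
      note m = integrable_herm[OF q[OF u(1)] points_H1D(3)[OF True]] integrable_herm[OF q[OF u(2)] points_H1D(3)[OF True]]
        integrable_herm[OF q[OF wt] points_H1D(3)[OF True]]
      have "(LINT x|lebesgue. herm (B t x *v wgrad (w t) x) (wgrad z x)) =
          (LINT x|lebesgue. herm (B t x *v wgrad (u1 t) x) (wgrad z x) - herm (B t x *v wgrad (u2 t) x) (wgrad z x))"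
      proof (rule integral_cong_AE)
        show "AE x in lebesgue. herm (B t x *v wgrad (w t) x) (wgrad z x) =
            herm (B t x *v wgrad (u1 t) x) (wgrad z x) - herm (B t x *v wgrad (u2 t) x) (wgrad z x)"
          using wgrad_diff[OF u] unfolding w_def
          by eventually_elim (simp add: matrix_vector_mult_diff_distrib herm_rules)
      qed (use m in auto)
      then show ?thesis using True m by (simp add: D_def div_op_def flux_functional_def)
    qed (simp add: D_def div_op_def flux_functional_def)
  qed
  have Di: "integrable (lebesgue_on {0..1}) (\<lambda>r. D r z)" if "z \<in> points H1" for z
    using integrable_functionals.integrable_eval[OF U1(2)[of 1] that]
      integrable_functionals.integrable_eval[OF U2(2)[of 1] that]
    by (simp add: D_def)
  have "AE t in unit_interval. AE x in lebesgue. w t x = 0"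
  proof (rule energy_uniqueness[where D = D and \<Lambda> = \<Lambda> and \<mu> = \<mu>])
    show "strongly_measurable unit_interval H1 w"
      unfolding w_def by (rule H1.strongly_measurable_diff[OF H(1,3)])
    have U: "{0<..<1::real} \<in> sets lebesgue" by simp
    note m = snorm_borel_measurable[OF H1.seminormed_space_axioms U H(1)]
      snorm_borel_measurable[OF H1.seminormed_space_axioms U H(3)]
    have "(\<integral>\<^sup>+ t. ennreal ((snorm H1 (w t))\<^sup>2) \<partial>unit_interval)
        \<le> (\<integral>\<^sup>+ t. 2 * ennreal ((snorm H1 (u1 t))\<^sup>2) + 2 * ennreal ((snorm H1 (u2 t))\<^sup>2) \<partial>unit_interval)"
    proof (rule nn_integral_mono_AE)
      show "AE t in unit_interval. ennreal ((snorm H1 (w t))\<^sup>2) \<le>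
          2 * ennreal ((snorm H1 (u1 t))\<^sup>2) + 2 * ennreal ((snorm H1 (u2 t))\<^sup>2)"
        using p
      proof eventually_elim
        case (elim t)
        have "(snorm H1 (w t))\<^sup>2 \<le> (snorm H1 (u1 t) + snorm H1 (u2 t))\<^sup>2"
          unfolding w_def by (rule power_mono[OF H1.snorm_diff_le[OF elim]]) simp
        also have "\<dots> \<le> 2 * (snorm H1 (u1 t))\<^sup>2 + 2 * (snorm H1 (u2 t))\<^sup>2"
          using sum_squares_bound[of "snorm H1 (u1 t)" "snorm H1 (u2 t)"] by (simp add: power2_sum)
        finally have "ennreal ((snorm H1 (w t))\<^sup>2) \<le> ennreal (2 * (snorm H1 (u1 t))\<^sup>2 + 2 * (snorm H1 (u2 t))\<^sup>2)"
          by (rule ennreal_leI)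
        also have "\<dots> = 2 * ennreal ((snorm H1 (u1 t))\<^sup>2) + 2 * ennreal ((snorm H1 (u2 t))\<^sup>2)"
          by (simp add: ennreal_mult)
        finally show ?case .
      qed
    qed
    also have "\<dots> = 2 * (\<integral>\<^sup>+ t. ennreal ((snorm H1 (u1 t))\<^sup>2) \<partial>unit_interval) + 2 * (\<integral>\<^sup>+ t. ennreal ((snorm H1 (u2 t))\<^sup>2) \<partial>unit_interval)"
      using m by (simp add: nn_integral_add nn_integral_cmult)
    also have "\<dots> < \<infinity>"
      using H by (simp add: ennreal_mult_less_top)
    finally show "(\<integral>\<^sup>+ t. ennreal ((snorm H1 (w t))\<^sup>2) \<partial>unit_interval) < \<infinity>" .
    show "integrable unit_interval (\<lambda>r. D r z)" if "z \<in> points H1" for z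
      by (rule integrable_unit_interval_subset[OF Di[OF that]])
    show "AE r in unit_interval. D r \<in> points Hneg1 \<and>
        Re (D r (w r)) \<le> - \<mu> * (L2_norm lebesgue (wgrad (w r)))\<^sup>2 \<and>
        (\<forall>z\<in>points H1. cmod (D r z) \<le> \<Lambda> * L2_norm lebesgue (wgrad (w r)) * snorm H1 z)"
      using p AE_space
    proof eventually_elim
      case (elim r)
      then have r: "r \<in> {0..1}" by auto
      have wr: "w r \<in> points H1" using elim by (auto simp: w_def)
      note g = points_H1D(3)[OF wr]
      have gm: "wgrad (w r) \<in> borel_measurable lebesgue" using g by auto
      have qb: "AE x in lebesgue. norm (B r x *v wgrad (w r) x) \<le> \<Lambda> * norm (wgrad (w r) x)"
        using ell(1)[OF r] by auto
      have q: "square_integrable lebesgue (\<lambda>x. B r x *v wgrad (w r) x)"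
        by (rule square_integrable_dominated[OF g elliptic_measurable[OF B r gm] qb])
      have qn: "L2_norm lebesgue (\<lambda>x. B r x *v wgrad (w r) x) \<le> \<Lambda> * L2_norm lebesgue (wgrad (w r))"
        by (rule L2_norm_dominated[OF g elliptic_measurable[OF B r gm] qb]) (use L in simp)
      note D' = Deq[OF r elim(1,2)]
      have "Re (D r (w r)) \<le> - \<mu> * (L2_norm lebesgue (wgrad (w r)))\<^sup>2"
      proof -
        have "\<mu> * (L2_norm lebesgue (wgrad (w r)))\<^sup>2 = (LINT x|lebesgue. \<mu> * (norm (wgrad (w r) x))\<^sup>2)"
          by (simp add: L2_norm_square)
        also have "\<dots> \<le> (LINT x|lebesgue. Re (herm (B r x *v wgrad (w r) x) (wgrad (w r) x)))"
          by (rule integral_mono) (use g integrable_herm[OF q g] ell(2)[OF r] in \<open>auto simp: square_integrable_def\<close>)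
        also have "\<dots> = - Re (D r (w r))"
          unfolding D' using wr integral_Re[OF integrable_herm[OF q g]] by (simp add: flux_functional_def)
        finally show ?thesis by simp
      qed
      moreover have "cmod (D r z) \<le> \<Lambda> * L2_norm lebesgue (wgrad (w r)) * snorm H1 z" if z: "z \<in> points H1" for z
      proof -
        have "cmod (D r z) \<le> snorm Hneg1 (D r) * snorm H1 z"
          unfolding D' by (rule Hneg1_bound[OF flux_functional(1)[OF q] z])
        also have "\<dots> \<le> (\<Lambda> * L2_norm lebesgue (wgrad (w r))) * snorm H1 z"
          unfolding D' using flux_functional(2)[OF q] qn by (intro mult_right_mono) auto
        finally show ?thesis .
      qed
      ultimately show ?case
        unfolding D' using flux_functional(1)[OF q] by auto
    qed
    show "AE t in unit_interval. \<forall>z\<in>points H1.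
        to_Hneg1 (w t) z = (LINT r|unit_interval. (if r < t then D r z else 0))"
      using U1(1) U2(1) p AE_space
    proof eventually_elim
      case (elim t)
      then have t: "t \<in> {0<..<1}" "t \<in> {0..1}" by auto
      show ?case
      proof
        fix z :: "real ^ 'n \<Rightarrow> complex" assume z: "z \<in> points H1"
        have "to_Hneg1 (w t) z = to_Hneg1 (u1 t) z - to_Hneg1 (u2 t) z"
          using z integral_mult_cnj_le(2)[OF points_H1D(1)[OF elim(3)] points_H1D(1)[OF z]]
            integral_mult_cnj_le(2)[OF points_H1D(1)[OF elim(4)] points_H1D(1)[OF z]]
          by (simp add: to_Hneg1_def w_def left_diff_distrib)
        also have "\<dots> = (LINT r|lebesgue_on {0..t}. div_op (B r) (u1 r) z) - (LINT r|lebesgue_on {0..t}. div_op (B r) (u2 r) z)"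
          using elim(1,2) U1(3)[OF t(2)] U2(3)[OF t(2)] z
          by (simp flip: elim(1) elim(2) add: pointwise_integral_eval)
        also have "\<dots> = (LINT r|lebesgue_on {0..t}. D r z)"
          using integrable_functionals.integrable_eval[OF U1(2)[OF t(2)] z]
            integrable_functionals.integrable_eval[OF U2(2)[OF t(2)] z] by (simp add: D_def)
        also have "\<dots> = (LINT r|unit_interval. (if r < t then D r z else 0))"
          by (rule integral_initial[OF Di[OF z] t(1)])
        finally show "to_Hneg1 (w t) z = (LINT r|unit_interval. (if r < t then D r z else 0))" .
      qed
    qed
  qed (use L in auto)
  then show ?thesis
    by eventually_elim (simp add: w_def)
qed


section \<open>Solutions from continuous data on the half-open interval\<close>

text \<open>
  The interval is half open because the solution has its singularity at \<open>t = 1\<close>.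
\<close>

definition path_in :: "('v::real_vector) seminormed \<Rightarrow> (real \<Rightarrow> 'v) \<Rightarrow> bool" where
  "path_in X G \<longleftrightarrow> (\<forall>t\<in>{0..<1}. G t \<in> points X \<and>
     ((\<lambda>s. snorm X (G s - G t)) \<longlongrightarrow> 0) (at t within {0..<1}))"

lemma path_inI:
  assumes "\<And>t. t \<in> {0..<1} \<Longrightarrow> G t \<in> points X"
    and "\<And>t. t \<in> {0..<1} \<Longrightarrow> ((\<lambda>s. snorm X (G s - G t)) \<longlongrightarrow> 0) (at t within {0..<1})"
  shows "path_in X G"
  using assms by (simp add: path_in_def)

lemma path_inD:
  assumes "path_in X G" "t \<in> {0..<1}"
  shows "G t \<in> points X" "((\<lambda>s. snorm X (G s - G t)) \<longlongrightarrow> 0) (at t within {0..<1})"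
  using assms by (auto simp: path_in_def)

lemma eventually_at_within_mem: "\<forall>\<^sub>F s in at t within S. s \<in> S"
  by (simp add: eventually_at_filter)

lemma path_in_comparison:
  assumes F: "path_in Y F" and p: "\<And>t. t \<in> {0..<1} \<Longrightarrow> G t \<in> points X"
    and X: "seminormed_space X"
    and le: "\<And>s t. s \<in> {0..<1} \<Longrightarrow> t \<in> {0..<1} \<Longrightarrow> snorm X (G s - G t) \<le> snorm Y (F s - F t)"
  shows "path_in X G"
proof (rule path_inI[OF p], assumption)
  interpret seminormed_space X by (rule X)
  fix t :: real assume t: "t \<in> {0..<1}"
  show "((\<lambda>s. snorm X (G s - G t)) \<longlongrightarrow> 0) (at t within {0..<1})"
  proof (rule Lim_null_comparison[OF _ path_inD(2)[OF F t]])
    show "\<forall>\<^sub>F s in at t within {0..<1}. norm (snorm X (G s - G t)) \<le> snorm Y (F s - F t)"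
      using eventually_at_within_mem
    proof eventually_elim
      case (elim s)
      then show ?case
        using le[OF elim t] snorm_nonneg[OF diff_point[OF p[OF elim] p[OF t]]] by simp
    qed
  qed
qed

lemma path_in_cong:
  assumes "path_in X F" "\<And>t. t \<in> {0..<1} \<Longrightarrow> G t = F t" "seminormed_space X"
  shows "path_in X G"
  by (rule path_in_comparison[OF assms(1) _ assms(3)]) (use assms(2) path_inD(1)[OF assms(1)] in auto)

lemma (in seminormed_space) path_in_add:
  assumes F: "path_in X F" and G: "path_in X G"
  shows "path_in X (\<lambda>t. F t + G t)"
proof (rule path_inI)
  fix t :: real assume t: "t \<in> {0..<1}"
  note p = path_inD(1)[OF F] path_inD(1)[OF G]
  show "F t + G t \<in> points X" using p[OF t] by auto
  show "((\<lambda>s. snorm X (F s + G s - (F t + G t))) \<longlongrightarrow> 0) (at t within {0..<1})"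
  proof (rule Lim_null_comparison)
    show "((\<lambda>s. snorm X (F s - F t) + snorm X (G s - G t)) \<longlongrightarrow> 0) (at t within {0..<1})"
      using tendsto_add[OF path_inD(2)[OF F t] path_inD(2)[OF G t]] by simp
    show "\<forall>\<^sub>F s in at t within {0..<1}. norm (snorm X (F s + G s - (F t + G t))) \<le> snorm X (F s - F t) + snorm X (G s - G t)"
      using eventually_at_within_mem
    proof eventually_elim
      case (elim s)
      have q: "F s - F t \<in> points X" "G s - G t \<in> points X"
        using p(1)[OF elim] p(2)[OF elim] p(1)[OF t] p(2)[OF t] by auto
      have "F s + G s - (F t + G t) = (F s - F t) + (G s - G t)" by simp
      then show ?case
        using snorm_triangle[OF q] snorm_nonneg[OF add_point[OF q]] by (simp only:) simp
    qed
  qed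
qed

lemma to_Hneg1_diff:
  assumes "square_integrable lebesgue v" "square_integrable lebesgue w"
  shows "to_Hneg1 v - to_Hneg1 w = to_Hneg1 (v - w)"
proof
  fix z :: "real ^ 'a \<Rightarrow> complex"
  show "(to_Hneg1 v - to_Hneg1 w) z = to_Hneg1 (v - w) z"
    using integral_mult_cnj_le(2)[OF assms(1) points_H1D(1), of z] integral_mult_cnj_le(2)[OF assms(2) points_H1D(1), of z]
    by (simp add: to_Hneg1_def left_diff_distrib)
qed

lemma to_Hneg1_add:
  assumes "square_integrable lebesgue v" "square_integrable lebesgue w"
  shows "to_Hneg1 v + to_Hneg1 w = to_Hneg1 (\<lambda>x. v x + w x)"
proof
  fix z :: "real ^ 'a \<Rightarrow> complex"
  show "(to_Hneg1 v + to_Hneg1 w) z = to_Hneg1 (\<lambda>x. v x + w x) z"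
    using integral_mult_cnj_le(2)[OF assms(1) points_H1D(1), of z] integral_mult_cnj_le(2)[OF assms(2) points_H1D(1), of z]
    by (simp add: to_Hneg1_def distrib_right)
qed

lemma path_in_to_Hneg1:
  assumes "path_in (Lspace 2) v"
  shows "path_in Hneg1 (\<lambda>t. to_Hneg1 (v t))"
proof (rule path_in_comparison[OF assms _ Hneg1.seminormed_space_axioms])
  note p = path_inD(1)[OF assms, unfolded points_Lspace2]
  show "to_Hneg1 (v t) \<in> points Hneg1" if "t \<in> {0..<1}" for t
    by (rule to_Hneg1(1)[OF p[OF that]])
  show "snorm Hneg1 (to_Hneg1 (v s) - to_Hneg1 (v t)) \<le> snorm (Lspace 2) (v s - v t)"
    if "s \<in> {0..<1}" "t \<in> {0..<1}" for s t
  proof -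
    have "square_integrable lebesgue (v s - v t)"
      using square_integrable_diff[OF p[OF that(1)] p[OF that(2)]] by (simp add: fun_diff_def)
    from to_Hneg1(2)[OF this] show ?thesis
      unfolding to_Hneg1_diff[OF p[OF that(1)] p[OF that(2)]] snorm_Lspace2 .
  qed
qed

lemma path_in_H1_L2:
  assumes "path_in H1 u"
  shows "path_in (Lspace 2) u"
proof (rule path_in_comparison[OF assms _ L2.seminormed_space_axioms])
  note p = path_inD(1)[OF assms]
  show "u t \<in> points (Lspace 2)" if "t \<in> {0..<1}" for t
    unfolding points_Lspace2 by (rule points_H1D(1)[OF p[OF that]])
  show "snorm (Lspace 2) (u s - u t) \<le> snorm H1 (u s - u t)"
    if "s \<in> {0..<1}" "t \<in> {0..<1}" for s t
    unfolding snorm_Lspace2 by (rule L2_norm_le_H1(1)[OF H1.diff_point[OF p[OF that(1)] p[OF that(2)]]])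
qed

lemma Hneg1_cmult:
  assumes L: "L \<in> points Hneg1"
  shows "(\<lambda>w. c * L w) \<in> points Hneg1" "snorm Hneg1 (\<lambda>w. c * L w) \<le> cmod c * snorm Hneg1 L"
proof -
  have b: "cmod (c * L w) \<le> (cmod c * snorm Hneg1 L) * snorm H1 w" if "w \<in> points H1" for w
    using mult_left_mono[OF Hneg1_bound[OF L that], of "cmod c"] by (simp add: norm_mult mult.assoc)
  show "(\<lambda>w. c * L w) \<in> points Hneg1"
    by (rule Hneg1_pointI[OF _ _ _ b]) (use L in \<open>auto simp: Hneg1_pointD algebra_simps\<close>)
  show "snorm Hneg1 (\<lambda>w. c * L w) \<le> cmod c * snorm Hneg1 L"
    by (rule snorm_Hneg1_le[OF b]) (use Hneg1.snorm_nonneg[OF L] in auto)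
qed

lemma path_in_Hneg1_cmult:
  assumes G: "path_in Hneg1 G" and c: "continuous_on {0..<1} c"
  shows "path_in Hneg1 (\<lambda>t w. c t * G t w)"
proof (rule path_inI)
  fix t :: real assume t: "t \<in> {0..<1}"
  note p = path_inD(1)[OF G]
  show "(\<lambda>w. c t * G t w) \<in> points Hneg1" by (rule Hneg1_cmult(1)[OF p[OF t]])
  have lim: "((\<lambda>s. cmod (c s) * snorm Hneg1 (G s - G t) + cmod (c s - c t) * snorm Hneg1 (G t)) \<longlongrightarrow> cmod (c t) * 0 + cmod (c t - c t) * snorm Hneg1 (G t)) (at t within {0..<1})"
    using c t by (intro tendsto_intros path_inD(2)[OF G t]) (auto simp: continuous_on_def)
  show "((\<lambda>s. snorm Hneg1 ((\<lambda>w. c s * G s w) - (\<lambda>w. c t * G t w))) \<longlongrightarrow> 0) (at t within {0..<1})"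
  proof (rule Lim_null_comparison[OF _ lim[simplified]])
    show "\<forall>\<^sub>F s in at t within {0..<1}. norm (snorm Hneg1 ((\<lambda>w. c s * G s w) - (\<lambda>w. c t * G t w)))
        \<le> cmod (c s) * snorm Hneg1 (G s - G t) + cmod (c s - c t) * snorm Hneg1 (G t)"
      using eventually_at_within_mem
    proof eventually_elim
      case (elim s)
      have d: "G s - G t \<in> points Hneg1" using p[OF elim] p[OF t] by auto
      have e: "(\<lambda>w. c s * G s w) - (\<lambda>w. c t * G t w) = (\<lambda>w. c s * (G s - G t) w) + (\<lambda>w. (c s - c t) * G t w)"
        by (simp add: fun_eq_iff algebra_simps)
      show ?case
        unfolding e real_norm_def
        using Hneg1.snorm_triangle[OF Hneg1_cmult(1)[OF d, of "c s"] Hneg1_cmult(1)[OF p[OF t], of "c s - c t"]]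
          Hneg1_cmult(2)[OF d, of "c s"] Hneg1_cmult(2)[OF p[OF t], of "c s - c t"]
          Hneg1.snorm_nonneg[OF Hneg1.add_point[OF Hneg1_cmult(1)[OF d, of "c s"] Hneg1_cmult(1)[OF p[OF t], of "c s - c t"]]]
        by linarith
    qed
  qed
qed

lemma nn_integral_closed_interval:
  "(\<integral>\<^sup>+ t. f t \<partial>lebesgue_on {0..1}) = (\<integral>\<^sup>+ t. f t \<partial>unit_interval)"
proof -
  have "(\<integral>\<^sup>+ t. f t * indicator {0..1} t \<partial>lebesgue) = (\<integral>\<^sup>+ t. f t * indicator {0<..<1} t \<partial>lebesgue)"
  proof (rule nn_integral_cong_AE)
    show "AE t in lebesgue. f t * indicator {0..1} t = f t * indicator {0<..<1} t"
      using AE_lebesgue_neq[of 0] AE_lebesgue_neq[of 1] by eventually_elim (auto simp: indicator_def)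
  qed
  then show ?thesis by (subst (1 2) nn_integral_restrict_space) auto
qed

lemma path_functionals:
  assumes G: "path_in Hneg1 G" and fin: "(\<integral>\<^sup>+ t. ennreal (snorm Hneg1 (G t)) \<partial>unit_interval) < \<infinity>"
    and A: "A \<in> sets lebesgue" "A \<subseteq> {0..1}"
  shows "integrable_functionals A G"
proof
  show "A \<in> lmeasurable"
    by (rule fmeasurableI2[of "{0..1}"]) (use A in auto)
  show "strongly_measurable (lebesgue_on A) Hneg1 G"
    by (rule Hneg1.strongly_measurable_path[OF A]) (use path_inD[OF G] in auto)
  have "(\<integral>\<^sup>+ t. ennreal (snorm Hneg1 (G t)) \<partial>lebesgue_on A) \<le> (\<integral>\<^sup>+ t. ennreal (snorm Hneg1 (G t)) \<partial>lebesgue_on {0..1})"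
    using A by (subst (1 2) nn_integral_restrict_space) (auto intro!: nn_integral_mono simp: indicator_def)
  then show "(\<integral>\<^sup>+ t. ennreal (snorm Hneg1 (G t)) \<partial>lebesgue_on A) < \<infinity>"
    using fin unfolding nn_integral_closed_interval by (rule le_less_trans)
qed

text \<open>
  The norm of an increment is at most the increment of the scalar primitive of
  \<open>\<lambda>r. snorm Hneg1 (G r)\<close>, which is continuous up to \<open>t = 1\<close> by integrability.
\<close>

lemma primitive_continuous:
  fixes G :: "real \<Rightarrow> (real ^ 'n::finite \<Rightarrow> complex) \<Rightarrow> complex"
  assumes G: "path_in Hneg1 G" and fin: "(\<integral>\<^sup>+ t. ennreal (snorm Hneg1 (G t)) \<partial>unit_interval) < \<infinity>"
    and t: "t \<in> {0..1}"
  shows "((\<lambda>\<tau>. snorm Hneg1 (pointwise_integral (lebesgue_on {0..\<tau>}) G - pointwise_integral (lebesgue_on {0..t}) G))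
    \<longlongrightarrow> 0) (at t within {0..1})"
proof -
  define U where "U \<tau> = pointwise_integral (lebesgue_on {0..\<tau>}) G" for \<tau>
  define P where "P \<tau> = integral {0..\<tau>} (\<lambda>r. snorm Hneg1 (G r))" for \<tau>
  note pf = path_functionals[OF G fin]
  have Up: "U \<tau> \<in> points Hneg1" if "\<tau> \<in> {0..1}" for \<tau>
    unfolding U_def by (rule integrable_functionals.pointwise_integral_point[OF pf]) (use that in auto)
  have gi: "(\<lambda>r. snorm Hneg1 (G r)) integrable_on {0..1}"
    by (rule integrable_on_lebesgue_on[OF integrable_functionals.integrable_snorm[OF pf]]) auto
  have le: "snorm Hneg1 (U b - U a) \<le> P b - P a" if ab: "0 \<le> a" "a \<le> b" "b \<le> 1" for a b
  proof (rule snorm_Hneg1_le)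
    have "P a + integral {a..b} (\<lambda>r. snorm Hneg1 (G r)) = P b"
      unfolding P_def using ab gi
      by (intro Henstock_Kurzweil_Integration.integral_combine) (auto intro: integrable_on_subinterval)
    moreover have L: "(LINT r|lebesgue_on {a..b}. snorm Hneg1 (G r)) = integral {a..b} (\<lambda>r. snorm Hneg1 (G r))"
      by (rule lebesgue_integral_eq_integral[OF integrable_functionals.integrable_snorm[OF pf]]) (use ab in auto)
    ultimately have PP: "P b - P a = (LINT r|lebesgue_on {a..b}. snorm Hneg1 (G r))" by simp
    have "0 \<le> (LINT r|lebesgue_on {a..b}. snorm Hneg1 (G r))"
      by (rule integral_nonneg_AE, rule eventually_mono[OF integrable_functionals.u_points[OF pf]])
        (use ab Hneg1.snorm_nonneg in auto)
    then show "0 \<le> P b - P a" by (simp add: PP)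
    fix z :: "real ^ 'n \<Rightarrow> complex" assume z: "z \<in> points H1"
    have hi: "(\<lambda>r. G r z) integrable_on {0..1}"
      by (rule integrable_on_lebesgue_on[OF integrable_functionals.integrable_eval[OF pf z]]) auto
    have e: "pointwise_integral (lebesgue_on {c..d}) G z = integral {c..d} (\<lambda>r. G r z)"
      if "0 \<le> c" "d \<le> 1" for c d
      unfolding pointwise_integral_eval[OF z]
      by (rule lebesgue_integral_eq_integral[OF integrable_functionals.integrable_eval[OF pf z]]) (use that in auto)
    have "integral {0..a} (\<lambda>r. G r z) + integral {a..b} (\<lambda>r. G r z) = integral {0..b} (\<lambda>r. G r z)"
      using ab hi by (intro Henstock_Kurzweil_Integration.integral_combine) (auto intro: integrable_on_subinterval)
    then have "(U b - U a) z = pointwise_integral (lebesgue_on {a..b}) G z"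
      using e ab unfolding U_def by (simp add: algebra_simps flip: add_diff_eq)
    then show "cmod ((U b - U a) z) \<le> (P b - P a) * snorm H1 z"
      unfolding PP
      by (simp only:) (rule integrable_functionals.pointwise_integral_bound[OF pf z], use ab in auto)
  qed
  have le2: "snorm Hneg1 (U b - U a) \<le> \<bar>P b - P a\<bar>" if ab: "a \<in> {0..1}" "b \<in> {0..1}" for a b
  proof (cases "a \<le> b")
    case True
    then show ?thesis using le[of a b] ab by auto
  next
    case False
    then show ?thesis using le[of b a] Hneg1.snorm_commute[OF Up[OF ab(2)] Up[OF ab(1)]] ab by auto
  qed
  have "continuous_on {0..1} P"
    unfolding P_def by (rule indefinite_integral_continuous_1[OF gi])
  then have "(P \<longlongrightarrow> P t) (at t within {0..1})"
    using t by (simp add: continuous_on_def)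
  then have "((\<lambda>\<tau>. \<bar>P \<tau> - P t\<bar>) \<longlongrightarrow> \<bar>P t - P t\<bar>) (at t within {0..1})"
    by (intro tendsto_intros)
  then have lim: "((\<lambda>\<tau>. \<bar>P \<tau> - P t\<bar>) \<longlongrightarrow> 0) (at t within {0..1})" by simp
  have "((\<lambda>\<tau>. snorm Hneg1 (U \<tau> - U t)) \<longlongrightarrow> 0) (at t within {0..1})"
  proof (rule Lim_null_comparison[OF _ lim])
    show "\<forall>\<^sub>F \<tau> in at t within {0..1}. norm (snorm Hneg1 (U \<tau> - U t)) \<le> \<bar>P \<tau> - P t\<bar>"
      using eventually_at_within_mem
      by eventually_elim (use le2[OF t] Hneg1.snorm_nonneg[OF Hneg1.diff_point[OF Up Up[OF t]]] in auto)
  qed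
  then show ?thesis by (simp add: U_def)
qed

text \<open>
  The derivative of \<open>u\<close>, tested with \<open>z\<close>, is \<open>dq + f\<close> at every time before \<open>1\<close>, so the fundamental theorem
  of calculus identifies the primitive of the functional \<open>div (B \<nabla>u) + f\<close> with \<open>u\<close>. Continuity makes all
  functions strongly measurable; the energy makes them integrable up to \<open>t = 1\<close>, and there the
  primitive supplies the value of the continuous representative.
\<close>

theorem solution_criterion:
  fixes u dq f :: "real \<Rightarrow> real ^ 'n::finite \<Rightarrow> complex" and B :: "real \<Rightarrow> real ^ 'n \<Rightarrow> complex ^ 'n ^ 'n"
  assumes u: "path_in H1 u" and u2: "(\<integral>\<^sup>+ t. ennreal ((snorm H1 (u t))\<^sup>2) \<partial>unit_interval) < \<infinity>"
    and dq: "path_in (Lspace 2) dq" and f: "path_in (Lspace 2) f"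
    and D: "\<And>t. t \<in> {0..<1} \<Longrightarrow> div_op (B t) (u t) = to_Hneg1 (dq t)"
    and Dle: "\<And>t. t \<in> {0..<1} \<Longrightarrow> snorm Hneg1 (to_Hneg1 (dq t)) \<le> \<Lambda> * snorm H1 (u t)"
    and C: "\<And>t. t \<in> {0..<1} \<Longrightarrow> L2_norm lebesgue (f t) \<le> C"
    and der: "\<And>t z. t \<in> {0..<1} \<Longrightarrow> z \<in> points H1 \<Longrightarrow>
      ((\<lambda>s. LINT x|lebesgue. u s x * cnj (z x)) has_vector_derivative
       (LINT x|lebesgue. (dq t x + f t x) * cnj (z x))) (at t within {0..<1})"
    and u0: "u 0 = (\<lambda>x. 0)"
  shows "is_solution B (\<lambda>t. to_Hneg1 (f t)) u"
proof -
  interpret finite_measure unit_interval by (rule finite_measure_unit_interval)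
  have U01: "{0<..<1::real} \<in> sets lebesgue" "{0<..<1::real} \<subseteq> {0..1}" by auto
  define N where "N t = snorm H1 (u t)" for t
  define DD where "DD t = div_op (B t) (u t)" for t
  define FF where "FF t = to_Hneg1 (f t)" for t
  define G where "G t = DD t + FF t" for t
  have um: "strongly_measurable unit_interval H1 u"
    by (rule H1.strongly_measurable_path[OF U01]) (use path_inD[OF u] in auto)
  have Nm [measurable]: "N \<in> borel_measurable unit_interval"
    unfolding N_def by (rule snorm_borel_measurable[OF H1.seminormed_space_axioms U01(1) um])
  have N2: "integrable unit_interval (\<lambda>t. (N t)\<^sup>2)"
  proof (rule integrableI_nonneg)
    show "(\<integral>\<^sup>+ t. ennreal ((N t)\<^sup>2) \<partial>unit_interval) < \<infinity>"
      using u2 by (simp add: N_def)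
  qed auto
  have N1: "integrable unit_interval N"
  proof (rule Bochner_Integration.integrable_bound[where f = "\<lambda>t. 1 + (N t)\<^sup>2"])
    have "N t \<le> 1 + (N t)\<^sup>2" for t
      using sum_squares_bound[of 1 "N t"] by (simp add: N_def power2_eq_square) (smt (verit) snorm_H1_nonneg)
    then show "AE t in unit_interval. norm (N t) \<le> norm (1 + (N t)\<^sup>2)"
      by (auto simp: N_def)
  qed (use N2 in auto)
  have pD: "path_in Hneg1 DD"
    by (rule path_in_cong[OF path_in_to_Hneg1[OF dq] _ Hneg1.seminormed_space_axioms]) (simp add: DD_def D)
  have pF: "path_in Hneg1 FF"
    unfolding FF_def by (rule path_in_to_Hneg1[OF f])
  have pG: "path_in Hneg1 G"
    unfolding G_def by (rule Hneg1.path_in_add[OF pD pF])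
  have f2: "square_integrable lebesgue (f t)" if "t \<in> {0..<1}" for t
    using path_inD(1)[OF f that] by (simp add: points_Lspace2)
  have dq2: "square_integrable lebesgue (dq t)" if "t \<in> {0..<1}" for t
    using path_inD(1)[OF dq that] by (simp add: points_Lspace2)
  have u2': "square_integrable lebesgue (u t)" if "t \<in> {0..<1}" for t
    by (rule points_H1D(1)[OF path_inD(1)[OF u that]])
  have nD: "snorm Hneg1 (DD t) \<le> \<Lambda> * N t" if "t \<in> {0..<1}" for t
    using Dle[OF that] D[OF that] by (simp add: DD_def N_def)
  have nF: "snorm Hneg1 (FF t) \<le> C" if "t \<in> {0..<1}" for t
    using to_Hneg1(2)[OF f2[OF that]] C[OF that] by (simp add: FF_def)
  have nG: "snorm Hneg1 (G t) \<le> \<bar>\<Lambda>\<bar> * N t + \<bar>C\<bar>" if t: "t \<in> {0..<1}" for t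
  proof -
    have "\<Lambda> * N t \<le> \<bar>\<Lambda>\<bar> * N t" by (rule mult_right_mono) (auto simp: N_def)
    then show ?thesis
      using Hneg1.snorm_triangle[OF path_inD(1)[OF pD t] path_inD(1)[OF pF t]] nD[OF t] nF[OF t]
      by (simp add: G_def)
  qed
  have fin_bound: "(\<integral>\<^sup>+ t. ennreal (g t) \<partial>unit_interval) < \<infinity>"
    if "\<And>t. t \<in> {0..<1} \<Longrightarrow> g t \<le> k t" "integrable unit_interval k" for g k
  proof -
    have "(\<integral>\<^sup>+ t. ennreal (g t) \<partial>unit_interval) \<le> (\<integral>\<^sup>+ t. ennreal (norm (k t)) \<partial>unit_interval)"
    proof (rule nn_integral_mono)
      fix t assume "t \<in> space unit_interval"
      then have "g t \<le> k t" using that(1) by auto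
      then show "ennreal (g t) \<le> ennreal (norm (k t))" by (intro ennreal_leI) simp
    qed
    also have "\<dots> < \<infinity>" using that(2) by (simp add: integrable_iff_bounded)
    finally show ?thesis .
  qed
  have finD: "(\<integral>\<^sup>+ t. ennreal (snorm Hneg1 (DD t)) \<partial>unit_interval) < \<infinity>"
    by (rule fin_bound[OF nD]) (use N1 in auto)
  have finF: "(\<integral>\<^sup>+ t. ennreal (snorm Hneg1 (FF t)) \<partial>unit_interval) < \<infinity>"
    by (rule fin_bound[OF nF]) auto
  have finG: "(\<integral>\<^sup>+ t. ennreal (snorm Hneg1 (G t)) \<partial>unit_interval) < \<infinity>"
    by (rule fin_bound[OF nG]) (use N1 in auto)
  define U where "U t = pointwise_integral (lebesgue_on {0..t}) G" for t
  have Gz: "G t z = (LINT x|lebesgue. (dq t x + f t x) * cnj (z x))" if t: "t \<in> {0..<1}" and z: "z \<in> points H1" for t z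
    using z to_Hneg1_add[OF dq2[OF t] f2[OF t]] D[OF t] by (simp add: G_def DD_def FF_def to_Hneg1_def)
  have Ueq: "U t = to_Hneg1 (u t)" if t: "t \<in> {0..<1}" for t
  proof
    fix z
    show "U t z = to_Hneg1 (u t) z"
    proof (cases "z \<in> points H1")
      case True
      define y where "y s = (LINT x|lebesgue. u s x * cnj (z x))" for s
      have "(y has_vector_derivative G s z) (at s within {0..t})" if "s \<in> {0..t}" for s
        using der[of s z] Gz[of s z] True that t unfolding y_def
        by (auto intro: has_vector_derivative_within_subset)
      then have "((\<lambda>s. G s z) has_integral y t - y 0) {0..t}"
        using t by (intro fundamental_theorem_of_calculus) auto
      moreover have "((\<lambda>s. G s z) has_integral (LINT s|lebesgue_on {0..t}. G s z)) {0..t}"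
        by (rule has_integral_integral_lebesgue_on[OF integrable_functionals.integrable_eval[OF path_functionals[OF pG finG] True]])
          (use t in auto)
      ultimately have "(LINT s|lebesgue_on {0..t}. G s z) = y t - y 0"
        using has_integral_unique by blast
      then show ?thesis
        using True u0 by (simp add: U_def pointwise_integral_eval to_Hneg1_def y_def)
    qed (simp add: U_def pointwise_integral_def to_Hneg1_def)
  qed
  have rep: "continuous_rep u U"
    unfolding continuous_rep_def
  proof (intro conjI ballI)
    show "AE t in unit_interval. U t = to_Hneg1 (u t)"
      by (rule AE_I2) (use Ueq in auto)
    fix t :: real assume t: "t \<in> {0..1}"
    show "U t \<in> points Hneg1"
      unfolding U_def by (rule integrable_functionals.pointwise_integral_point[OF path_functionals[OF pG finG]]) (use t in auto)
    show "((\<lambda>\<tau>. snorm Hneg1 (U \<tau> - U t)) \<longlongrightarrow> 0) (at t within {0..1})"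
      unfolding U_def by (rule primitive_continuous[OF pG finG t])
  qed
  have eqn: "\<exists>D I. has_bochner_integral_in (lebesgue_on {0..t}) Hneg1 (\<lambda>\<tau>. div_op (B \<tau>) (u \<tau>)) D \<and>
      has_bochner_integral_in (lebesgue_on {0..t}) Hneg1 (\<lambda>t. to_Hneg1 (f t)) I \<and> U t - D = I"
    if t: "t \<in> {0..1}" for t
  proof -
    have A: "{0..t} \<in> sets lebesgue" "{0..t} \<subseteq> {0..1}" using t by auto
    interpret DI: integrable_functionals "{0..t}" DD by (rule path_functionals[OF pD finD A])
    interpret FI: integrable_functionals "{0..t}" FF by (rule path_functionals[OF pF finF A])
    have "U t - pointwise_integral (lebesgue_on {0..t}) DD = pointwise_integral (lebesgue_on {0..t}) FF"
    proof
      fix z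
      show "(U t - pointwise_integral (lebesgue_on {0..t}) DD) z = pointwise_integral (lebesgue_on {0..t}) FF z"
        using DI.integrable_eval[of z] FI.integrable_eval[of z]
        by (simp add: U_def pointwise_integral_def G_def)
    qed
    then show ?thesis
      using DI.has_bochner_integral_pointwise FI.has_bochner_integral_pointwise
      unfolding DD_def FF_def by blast
  qed
  have pU: "path_in Hneg1 (\<lambda>t. to_Hneg1 (u t))"
    by (rule path_in_to_Hneg1[OF path_in_H1_L2[OF u]])
  have nU: "snorm Hneg1 (to_Hneg1 (u t)) \<le> N t" if "t \<in> {0..<1}" for t
    using to_Hneg1(2)[OF u2'[OF that]] L2_norm_le_H1(1)[OF path_inD(1)[OF u that]] by (simp add: N_def)
  have Lp: "H \<in> bochner_Lp unit_interval 2 Hneg1"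
    if H: "path_in Hneg1 H" and k: "\<And>t. t \<in> {0..<1} \<Longrightarrow> (snorm Hneg1 (H t))\<^sup>2 \<le> k t" "integrable unit_interval k" for H k
    unfolding bochner_Lp_def
  proof (intro CollectI conjI)
    show "strongly_measurable unit_interval Hneg1 H"
      by (rule Hneg1.strongly_measurable_path[OF U01]) (use path_inD[OF H] in auto)
    show "(\<integral>\<^sup>+ t. ennreal (snorm Hneg1 (H t) powr 2) \<partial>unit_interval) < \<infinity>"
    proof (rule fin_bound[OF _ k(2)])
      fix t :: real assume t: "t \<in> {0..<1}"
      have "snorm Hneg1 (H t) powr 2 = (snorm Hneg1 (H t))\<^sup>2"
        by (rule powr_numeral) (rule Hneg1.snorm_nonneg[OF path_inD(1)[OF H t]])
      then show "snorm Hneg1 (H t) powr 2 \<le> k t" using k(1)[OF t] by simp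
    qed
  qed
  have LpU: "(\<lambda>t. to_Hneg1 (u t)) \<in> bochner_Lp unit_interval 2 Hneg1"
  proof (rule Lp[OF pU _ N2])
    fix t :: real assume t: "t \<in> {0..<1}"
    show "(snorm Hneg1 (to_Hneg1 (u t)))\<^sup>2 \<le> (N t)\<^sup>2"
      by (rule power_mono[OF nU[OF t] Hneg1.snorm_nonneg[OF path_inD(1)[OF pU t]]])
  qed
  have LpG: "G \<in> bochner_Lp unit_interval 2 Hneg1"
  proof (rule Lp[OF pG, of "\<lambda>t. 2 * \<Lambda>\<^sup>2 * (N t)\<^sup>2 + 2 * C\<^sup>2"])
    fix t :: real assume t: "t \<in> {0..<1}"
    have "(snorm Hneg1 (G t))\<^sup>2 \<le> (\<bar>\<Lambda>\<bar> * N t + \<bar>C\<bar>)\<^sup>2"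
      by (rule power_mono[OF nG[OF t] Hneg1.snorm_nonneg[OF path_inD(1)[OF pG t]]])
    also have "\<dots> \<le> 2 * (\<bar>\<Lambda>\<bar> * N t)\<^sup>2 + 2 * \<bar>C\<bar>\<^sup>2"
      using sum_squares_bound[of "\<bar>\<Lambda>\<bar> * N t" "\<bar>C\<bar>"] by (simp add: power2_sum)
    finally show "(snorm Hneg1 (G t))\<^sup>2 \<le> 2 * \<Lambda>\<^sup>2 * (N t)\<^sup>2 + 2 * C\<^sup>2"
      by (simp add: power_mult_distrib)
  qed (use N2 in auto)
  have weak: "\<exists>I. has_bochner_integral_in unit_interval Hneg1 (\<lambda>t w. partial_deriv 1 \<phi> t * to_Hneg1 (u t) w) I \<and>
      has_bochner_integral_in unit_interval Hneg1 (\<lambda>t w. \<phi> t * G t w) (- I)"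
    if \<phi>: "test_function {0<..<1} \<phi>" for \<phi> :: "real \<Rightarrow> complex"
  proof -
    obtain K where K: "compact K" "K \<subseteq> {0<..<1}" "\<And>x. x \<notin> K \<Longrightarrow> \<phi> x = 0"
      using \<phi> by (auto simp: test_function_def)
    have "continuously_differentiable (Suc 0) \<phi>" "continuously_differentiable 0 \<phi>"
      using \<phi> unfolding test_function_def by blast+
    then have d: "\<And>x. \<phi> differentiable (at x)" and c: "continuous_on UNIV \<phi>" "continuous_on UNIV (partial_deriv 1 \<phi>)"
      by auto
    have out: "partial_deriv 1 \<phi> x = 0" if "x \<notin> K" for x
      by (rule partial_deriv_outside[OF d K(1,3) that])
    have dv: "(\<phi> has_vector_derivative partial_deriv 1 \<phi> x) (at x)" for x
    proof -
      have D: "(\<phi> has_derivative (\<lambda>b. partial_deriv b \<phi> x)) (at x)" by (rule has_derivative_partial[OF d])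
      have "(\<lambda>b. partial_deriv b \<phi> x) = (\<lambda>b. b *\<^sub>R partial_deriv 1 \<phi> x)"
      proof
        fix b
        show "partial_deriv b \<phi> x = b *\<^sub>R partial_deriv 1 \<phi> x"
          using linear_cmul[OF bounded_linear.linear[OF has_derivative_bounded_linear[OF D]], of b 1] by simp
      qed
      then show ?thesis
        unfolding has_vector_derivative_def by (rule has_derivative_eq_rhs[OF D])
    qed
    define g where "g = partial_deriv 1 \<phi>"
    define V1 where "V1 t = (\<lambda>w. g t * to_Hneg1 (u t) w)" for t
    define V2 where "V2 t = (\<lambda>w. \<phi> t * G t w)" for t
    have bd: "\<exists>M. \<forall>x. cmod (k x) \<le> M" if "continuous_on UNIV k" "\<And>x. x \<notin> K \<Longrightarrow> k x = 0" for k :: "real \<Rightarrow> complex"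
    proof -
      have "compact (k ` K)" using that(1) K(1) by (intro compact_continuous_image) (auto intro: continuous_on_subset)
      then obtain M where M: "\<forall>x\<in>K. cmod (k x) \<le> M"
        by (auto dest!: compact_imp_bounded simp: bounded_iff)
      have "cmod (k x) \<le> max M 0" for x
        using M that(2)[of x] by (cases "x \<in> K") auto
      then show ?thesis by blast
    qed
    obtain M1 where M1: "\<And>x. cmod (g x) \<le> M1" using bd[OF c(2) out] unfolding g_def by blast
    obtain M2 where M2: "\<And>x. cmod (\<phi> x) \<le> M2" using bd[OF c(1) K(3)] by blast
    have p1: "path_in Hneg1 V1"
      unfolding V1_def by (rule path_in_Hneg1_cmult[OF pU]) (use c in \<open>auto simp: g_def intro: continuous_on_subset\<close>)
    have p2: "path_in Hneg1 V2"
      unfolding V2_def by (rule path_in_Hneg1_cmult[OF pG]) (use c in \<open>auto intro: continuous_on_subset\<close>)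
    have f1: "(\<integral>\<^sup>+ t. ennreal (snorm Hneg1 (V1 t)) \<partial>unit_interval) < \<infinity>"
    proof (rule fin_bound[where k = "\<lambda>t. M1 * N t"])
      fix t :: real assume t: "t \<in> {0..<1}"
      have "snorm Hneg1 (V1 t) \<le> cmod (g t) * snorm Hneg1 (to_Hneg1 (u t))"
        unfolding V1_def by (rule Hneg1_cmult(2)[OF path_inD(1)[OF pU t]])
      also have "\<dots> \<le> M1 * N t"
        by (rule mult_mono[OF M1 nU[OF t]]) (use M1[of 0] Hneg1.snorm_nonneg[OF path_inD(1)[OF pU t]] in \<open>auto intro: order_trans[OF norm_ge_zero]\<close>)
      finally show "snorm Hneg1 (V1 t) \<le> M1 * N t" .
    qed (use N1 in auto)
    have f2: "(\<integral>\<^sup>+ t. ennreal (snorm Hneg1 (V2 t)) \<partial>unit_interval) < \<infinity>"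
    proof (rule fin_bound[where k = "\<lambda>t. M2 * (\<bar>\<Lambda>\<bar> * N t + \<bar>C\<bar>)"])
      fix t :: real assume t: "t \<in> {0..<1}"
      have "snorm Hneg1 (V2 t) \<le> cmod (\<phi> t) * snorm Hneg1 (G t)"
        unfolding V2_def by (rule Hneg1_cmult(2)[OF path_inD(1)[OF pG t]])
      also have "\<dots> \<le> M2 * (\<bar>\<Lambda>\<bar> * N t + \<bar>C\<bar>)"
        by (rule mult_mono[OF M2 nG[OF t]]) (use M2[of 0] Hneg1.snorm_nonneg[OF path_inD(1)[OF pG t]] in \<open>auto intro: order_trans[OF norm_ge_zero]\<close>)
      finally show "snorm Hneg1 (V2 t) \<le> M2 * (\<bar>\<Lambda>\<bar> * N t + \<bar>C\<bar>)" .
    qed (use N1 in auto)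
    interpret I1: integrable_functionals "{0<..<1}" V1 by (rule path_functionals[OF p1 f1 U01])
    interpret I2: integrable_functionals "{0<..<1}" V2 by (rule path_functionals[OF p2 f2 U01])
    \<comment> \<open>The support of \<open>\<phi>\<close> stays away from \<open>1\<close>, where \<open>u\<close> may blow up; the product rule is
      integrated over \<open>[0,b]\<close> only.\<close>
    obtain b where b: "0 < b" "b < 1" "K \<subseteq> {0<..<b}"
    proof (cases "K = {}")
      case True
      then show ?thesis using that[of "1/2"] by auto
    next
      case False
      then obtain m where m: "m \<in> K" "\<And>x. x \<in> K \<Longrightarrow> x \<le> m"
        using compact_attains_sup[OF K(1)] by blast
      have "0 < m" "m < 1" using m(1) K(2) by auto
      then show ?thesis using that[of "(m + 1) / 2"] m(2) K(2) by force
    qed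
    have e: "pointwise_integral unit_interval V2 = - pointwise_integral unit_interval V1"
    proof
      fix z
      show "pointwise_integral unit_interval V2 z = (- pointwise_integral unit_interval V1) z"
      proof (cases "z \<in> points H1")
        case True
        define y where "y s = (LINT x|lebesgue. u s x * cnj (z x))" for s
        define k where "k s = g s * y s + \<phi> s * G s z" for s
        have k12: "k s = V1 s z + V2 s z" for s
          using True by (simp add: k_def V1_def V2_def y_def to_Hneg1_def)
        have "((\<lambda>s. \<phi> s * y s) has_vector_derivative k s) (at s within {0..b})" if s: "s \<in> {0..b}" for s
        proof -
          have "(y has_vector_derivative G s z) (at s within {0..b})"
            using der[of s z] Gz[of s z] True s b unfolding y_def
            by (auto intro: has_vector_derivative_within_subset)
          then have "((\<lambda>s. \<phi> s * y s) has_vector_derivative \<phi> s * G s z + g s * y s) (at s within {0..b})"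
            unfolding g_def by (intro has_vector_derivative_mult has_vector_derivative_at_within[OF dv])
          then show ?thesis by (simp add: k_def add.commute)
        qed
        then have "(k has_integral \<phi> b * y b - \<phi> 0 * y 0) {0..b}"
          using b by (intro fundamental_theorem_of_calculus) auto
        moreover have "\<phi> b = 0" "\<phi> 0 = 0"
          using b by (intro K(3); auto)+
        ultimately have k0: "(k has_integral 0) {0..b}" by simp
        have ki: "integrable unit_interval k"
          unfolding k12 using I1.integrable_eval[OF True] I2.integrable_eval[OF True] by simp
        have kK: "k s = 0" if "s \<notin> K" for s
          using out[OF that] K(3)[OF that] by (simp add: k_def g_def)
        have ind: "indicator {0<..<1} s *\<^sub>R k s = indicator {0..b} s *\<^sub>R k s" for s
          using kK[of s] b by (cases "s \<in> K") (auto simp: indicator_def)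
        have "integrable lebesgue (\<lambda>s. indicator {0<..<1} s *\<^sub>R k s)"
          using ki by (subst (asm) integrable_restrict_space) auto
        then have "integrable (lebesgue_on {0..b}) k"
          unfolding ind by (subst integrable_restrict_space) auto
        then have "(k has_integral (LINT s|lebesgue_on {0..b}. k s)) {0..b}"
          by (rule has_integral_integral_lebesgue_on) auto
        then have "(LINT s|lebesgue_on {0..b}. k s) = 0"
          using k0 has_integral_unique by blast
        then have "(LINT s|unit_interval. k s) = 0"
          by (simp add: integral_restrict_space ind)
        then have "(LINT s|unit_interval. V1 s z) + (LINT s|unit_interval. V2 s z) = 0"
          unfolding k12 using I1.integrable_eval[OF True] I2.integrable_eval[OF True] by simp
        then show ?thesis
          using True by (simp add: pointwise_integral_eval eq_neg_iff_add_eq_0 add.commute)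
      qed (simp add: pointwise_integral_def)
    qed
    have V: "V1 = (\<lambda>t w. partial_deriv 1 \<phi> t * to_Hneg1 (u t) w)" "V2 = (\<lambda>t w. \<phi> t * G t w)"
      by (auto simp: V1_def V2_def g_def fun_eq_iff)
    show ?thesis
      using I1.has_bochner_integral_pointwise I2.has_bochner_integral_pointwise[unfolded e]
      unfolding V by (intro exI conjI)
  qed
  have "(\<lambda>t. to_Hneg1 (u t)) \<in> time_H1_Hneg1"
    unfolding time_H1_Hneg1_def using LpU LpG weak by blast
  moreover have "u \<in> bochner_Lp unit_interval 2 H1"
    using um u2 by (simp add: bochner_Lp_2_H1)
  ultimately show ?thesis
    unfolding is_solution_def by (intro conjI exI[of _ U] ballI rep eqn)
qed


section \<open>The profile of the self-similar solution\<close>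

text \<open>
  Up to a positive factor this is the real part of the flux divided by the gradient for the
  profile chosen below, where \<open>A = \<delta>z\<close> and \<open>w = 1 - z\<close>. For \<open>A \<le> w\<close> the first three terms add up to
  at least \<open>w(w - A)/(A + w)\<close>, and the last term is positive where this vanishes. For \<open>w < A\<close> the last term
  is at least \<open>1\<close>, more than the first three can lose.
\<close>

lemma profile_energy_pos:
  fixes \<epsilon> a z :: real
  defines "\<delta> \<equiv> \<epsilon> / 2"
  defines "A \<equiv> \<delta> * z" and "w \<equiv> 1 - z"
  defines "g \<equiv> (A - w) / (A + w)" and "q \<equiv> A\<^sup>2 + w\<^sup>2"
  defines "M \<equiv> 1 + w * g"
  assumes \<epsilon>: "0 < \<epsilon>" "\<epsilon> \<le> 1 / 4" and a: "2 * a \<ge> 1 - \<epsilon> / 2" and z: "0 \<le> z" "z \<le> 1"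
  shows "0 < \<epsilon> * (g + 2 * w / q) + 2 * a * (M + 1) * ((A - w)\<^sup>2 / q) - 2 * M + 4 * A\<^sup>2 / (A + w)\<^sup>2"
proof -
  have \<delta>: "0 < \<delta>" "\<delta> \<le> 1 / 8" using \<epsilon> by (auto simp: \<delta>_def)
  have A: "0 \<le> A" "A \<le> \<delta>" using \<delta> z by (auto simp: A_def mult_left_le)
  have w: "0 \<le> w" "w \<le> 1" using z by (auto simp: w_def)
  have Aw: "0 < A + w"
  proof (cases "z = 1")
    case True
    then show ?thesis using \<delta> by (simp add: A_def w_def)
  next
    case False
    then have "w > 0" using z by (simp add: w_def)
    then show ?thesis using A by simp
  qed
  have q: "0 < q"
  proof -
    have "A \<noteq> 0 \<or> w \<noteq> 0" using Aw by auto
    then show ?thesis by (auto simp: q_def sum_power2_gt_zero_iff)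
  qed
  define p where "p = A * w / q"
  have p0: "0 \<le> p" using A w q by (simp add: p_def)
  have p1: "(A - w)\<^sup>2 / q = 1 - 2 * p"
  proof -
    have "(A - w)\<^sup>2 = q - 2 * (A * w)" by (simp add: q_def power2_diff)
    then show ?thesis using q by (simp add: p_def diff_divide_distrib)
  qed
  have p2: "0 \<le> 1 - 2 * p"
    unfolding p1[symmetric] using q by simp
  define T where "T = 4 * A\<^sup>2 / (A + w)\<^sup>2"
  have T0: "0 \<le> T" by (simp add: T_def)
  define E1 where "E1 = \<epsilon> * (g + 2 * w / q)"
  define E2 where "E2 = 2 * a * (M + 1) * ((A - w)\<^sup>2 / q)"
  have A2: "2 * A = \<epsilon> * z" by (simp add: A_def \<delta>_def)
  show ?thesis
  proof (cases "A \<le> w")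
    case True
    define y where "y = - (w * g)"
    have y0: "0 \<le> y" unfolding y_def g_def using True w Aw by (simp add: mult_nonneg_nonpos divide_nonpos_pos)
    have "- g \<le> 1" unfolding g_def using A Aw by (simp add: minus_divide_left pos_divide_le_eq)
    then have "w * (- g) \<le> 1 * 1" using w by (intro mult_mono') (use True Aw in \<open>auto simp: g_def divide_nonpos_pos\<close>)
    then have y1: "y \<le> 1" by (simp add: y_def)
    have My: "M = 1 - y" by (simp add: M_def y_def)
    have "(1 - \<epsilon> / 2) * ((2 - y) * (1 - 2 * p)) \<le> (2 * a) * ((2 - y) * (1 - 2 * p))"
      using a p2 y1 by (intro mult_right_mono mult_nonneg_nonneg) auto
    moreover have "(1 - \<epsilon> / 2) * ((2 - y) * (1 - 2 * p)) = (2 - y - \<epsilon> - 4 * p) + (\<epsilon> / 2 * y + 2 * (y * p) + \<epsilon> * ((2 - y) * p))"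
      by (simp add: algebra_simps)
    moreover have "0 \<le> \<epsilon> / 2 * y + 2 * (y * p) + \<epsilon> * ((2 - y) * p)"
      using \<epsilon> y0 y1 p0 by simp
    ultimately have s1: "2 - y - \<epsilon> - 4 * p \<le> 2 * a * (M + 1) * ((A - w)\<^sup>2 / q)"
      unfolding p1 My by (simp add: mult.assoc)
    have s2: "0 \<le> \<epsilon> * (g + 2 * w / q) - \<epsilon> - 4 * p"
    proof -
      have "z * (A + w) \<le> A * (1 - A) + w * z"
        using True A z mult_left_mono[of z "1 - A" A] by (simp add: algebra_simps w_def)
      also have "\<dots> = A + w - q" by (simp add: q_def w_def power2_eq_square algebra_simps)
      finally have "\<epsilon> * (z * (A + w)) \<le> \<epsilon> * (A + w - q)"
        using \<epsilon> by (intro mult_left_mono) auto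
      then have "0 \<le> \<epsilon> * (A + w - q) - 2 * A * (A + w)"
        by (simp add: A2 mult.assoc)
      then have "0 \<le> 2 * w / (q * (A + w)) * (\<epsilon> * (A + w - q) - 2 * A * (A + w))"
        using w q Aw by (intro mult_nonneg_nonneg) auto
      also have "\<dots> = \<epsilon> * (2 * w / q - 2 * w / (A + w)) - 4 * p"
      proof -
        have "2 * w / (q * r) * (\<epsilon> * (r - q) - 2 * A * r) = \<epsilon> * (2 * w / q - 2 * w / r) - 4 * (A * w / q)"
          if "r \<noteq> 0" for r
          using q that by (simp add: field_simps)
        from this[of "A + w"] show ?thesis using Aw by (simp add: p_def)
      qed
      also have "2 * w / (A + w) = 1 - g"
        using Aw by (simp add: g_def field_simps)
      finally show ?thesis by (simp add: algebra_simps)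
    qed
    have "0 < y + T"
    proof (cases "A = 0")
      case True
      then have "z = 0" using \<delta> by (simp add: A_def)
      then have "y = 1" using True by (simp add: y_def g_def w_def)
      then show ?thesis using T0 by simp
    next
      case False
      then have "0 < T" using Aw by (simp add: T_def)
      then show ?thesis using y0 by simp
    qed
    then show ?thesis
      using s1 s2 My unfolding E1_def[symmetric] E2_def[symmetric] T_def[symmetric] by linarith
  next
    case False
    then have A0: "0 < A" using w by simp
    define x where "x = w * g"
    have g: "0 \<le> g" "g \<le> 1" unfolding g_def using False Aw w by (auto simp: pos_divide_le_eq)
    have x: "0 \<le> x" "x \<le> w" unfolding x_def using g w by (auto simp: mult_left_le)
    have "(1 - \<epsilon> / 2) * ((2 + x) * (1 - 2 * p)) \<le> (2 * a) * ((2 + x) * (1 - 2 * p))"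
      using a p2 x by (intro mult_right_mono mult_nonneg_nonneg) auto
    moreover have "(1 - \<epsilon> / 2) * ((2 + x) * (1 - 2 * p)) = (2 - \<epsilon> - 4 * p) + (2 * \<epsilon> * p + (1 - \<epsilon> / 2) * (x * (1 - 2 * p)))"
      by (simp add: algebra_simps)
    moreover have "0 \<le> 2 * \<epsilon> * p + (1 - \<epsilon> / 2) * (x * (1 - 2 * p))"
      using \<epsilon> x p0 p2 by simp
    ultimately have "2 - \<epsilon> - 4 * p \<le> (2 * a) * ((2 + x) * (1 - 2 * p))"
      by linarith
    moreover have "M + 1 = 2 + x" by (simp add: M_def x_def)
    ultimately have s1: "2 - \<epsilon> - 4 * p \<le> 2 * a * (M + 1) * ((A - w)\<^sup>2 / q)"
      unfolding p1 by (simp add: mult.assoc)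
    have s2: "0 \<le> \<epsilon> * (g + 2 * w / q) - 4 * p"
    proof -
      define Y where "Y = 2 * w / q"
      have "4 * p = Y * (\<epsilon> * z)" by (simp add: p_def Y_def flip: A2)
      then have "\<epsilon> * (g + Y) - 4 * p = \<epsilon> * g + Y * (\<epsilon> * (1 - z))"
        by (simp add: algebra_simps)
      then have "\<epsilon> * (g + 2 * w / q) - 4 * p = \<epsilon> * g + Y * (\<epsilon> * w)"
        by (simp add: Y_def w_def)
      moreover have "0 \<le> Y" using w q by (simp add: Y_def)
      ultimately show ?thesis using \<epsilon> g w by simp
    qed
    have "(A + w)\<^sup>2 \<le> (2 * A)\<^sup>2" using False w Aw by (intro power_mono) auto
    then have "1 \<le> T" unfolding T_def using Aw by (simp add: power2_eq_square)
    moreover have "w \<le> 1 / 8" using False A \<delta> by simp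
    moreover have "M = 1 + x" by (simp add: M_def x_def)
    ultimately show ?thesis
      using s1 s2 x \<epsilon> unfolding E1_def[symmetric] E2_def[symmetric] T_def[symmetric] by linarith
  qed
qed

lemma compact_interval_bounds:
  fixes f :: "real \<Rightarrow> real"
  assumes "continuous_on {0..1} f" "\<And>z. z \<in> {0..1} \<Longrightarrow> 0 < f z"
  shows "\<exists>c>0. \<forall>z\<in>{0..1}. c \<le> f z"
proof -
  obtain x where "x \<in> {0..1}" "\<forall>y\<in>{0..1}. f x \<le> f y"
    using continuous_attains_inf[OF _ _ assms(1)] by auto
  then show ?thesis using assms(2) by blast
qed

text \<open>
  The two equations are \<open>v\<^sub>t = div (b \<nabla>v)\<close> and the definition of the flux, for
  \<open>v = (\<tau> + \<sigma>)\<^bsup>-a\<^esup> H(z)\<close> and the flux \<open>(\<tau> + \<sigma>)\<^bsup>-a-1\<^esup> K(z) x\<close>. The first one holds for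
  \<open>K = a\<Psi> - (1 - z)\<Psi>'\<close> and \<open>H = 2zK + (n - 2a)\<Psi>\<close> with an arbitrary function \<open>\<Psi>\<close>, and the second one
  determines \<open>b\<close>.

  In terms of \<open>\<pi> = -\<Psi>'/\<Psi>\<close> and \<open>\<kappa> = K/\<Psi> = a + (1 - z)\<pi>\<close>, the factor \<open>\<Psi>\<close> cancels from \<open>b\<close>, so ellipticity is a
  condition on \<open>\<kappa>\<close> alone. The function \<open>\<kappa>\<close> has to take the value \<open>a\<close> at \<open>z = 1\<close>. It is chosen with the phase
  of \<open>(A + iw)/(A - iw)\<close>, where \<open>A = \<delta>z\<close> and \<open>w = 1 - z\<close>, which makes half a turn between \<open>z = 0\<close> and \<open>z = 1\<close>,
  most of it where \<open>1 - z\<close> is comparable to \<open>\<delta>\<close>. The modulus \<open>a m\<close> is nearly constant; its factor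
  \<open>m\<close> is adjusted such that \<open>z m = 1 + w(A - w)/(A + w)\<close>.
\<close>

lemma profile:
  fixes n \<epsilon> a :: real
  assumes n: "2 \<le> n" and \<epsilon>: "0 < \<epsilon>" "\<epsilon> \<le> 1 / 4" and a_def: "a = (n - \<epsilon>) / 4"
  obtains S and H K b :: "real \<Rightarrow> complex" and \<mu> where "open S" "{0..1} \<subseteq> S"
    "smooth_on S H" "smooth_on S K" "smooth_on S b" "0 < \<mu>" "H 1 \<noteq> 0"
    "\<And>z. z \<in> {0..1} \<Longrightarrow> \<mu> \<le> Re (b z)"
    "\<And>z. z \<in> {0..1} \<Longrightarrow> a * H z - (1 - z) * vector_derivative H (at z) =
      n * K z - 2 * (1 - z) * ((a + 1) * K z + z * vector_derivative K (at z))"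
    "\<And>z. z \<in> S \<Longrightarrow> K z = 2 * b z * (- a * H z - z * vector_derivative H (at z))"
proof -
  have a: "2 * a \<ge> 1 - \<epsilon> / 2" using n by (simp add: a_def)
  have a0: "0 < a" using n \<epsilon> by (simp add: a_def)
  define \<delta> where "\<delta> = \<epsilon> / 2"
  have \<delta>: "0 < \<delta>" "\<delta> \<le> 1 / 8" using \<epsilon> by (auto simp: \<delta>_def)
  define J where "J = {-1<..<1 + \<delta>}"
  define \<alpha> where "\<alpha> z = \<delta> * z + (1 - z)" for z
  have \<alpha>: "0 < \<alpha> z" if "z \<le> 1 + \<delta>" for z
  proof -
    have "(1 - \<delta>) * z \<le> (1 - \<delta>) * (1 + \<delta>)" using that \<delta> by (intro mult_left_mono) auto
    also have "\<dots> < 1" using \<delta> by (simp add: algebra_simps)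
    finally show ?thesis by (simp add: \<alpha>_def algebra_simps)
  qed
  define \<beta> where "\<beta> z = complex_of_real (\<delta> * z) - \<i> * complex_of_real (1 - z)" for z
  have \<beta>: "\<beta> z \<noteq> 0" for z
    using \<delta> by (auto simp: \<beta>_def complex_eq_iff)
  define m where "m z = 1 + 2 * \<delta> * (1 - z) / \<alpha> z" for z
  \<comment> \<open>\<open>\<pi>\<close> is written without the quotient \<open>(\<kappa> - a)/(1 - z)\<close>, so that it is visibly smooth at \<open>z = 1\<close>.\<close>
  define \<kappa> where "\<kappa> z = complex_of_real (a * m z) * (cnj (\<beta> z) / \<beta> z)" for z
  define \<pi> where "\<pi> z = complex_of_real a * (complex_of_real (2 * \<delta> / \<alpha> z) + 2 * \<i> * complex_of_real (m z) / \<beta> z)" for z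
  have \<kappa>\<pi>: "\<kappa> z = a + (1 - z) * \<pi> z" if "z \<le> 1 + \<delta>" for z
  proof -
    have cb: "cnj (\<beta> z) = \<beta> z + 2 * \<i> * complex_of_real (1 - z)"
      by (simp add: \<beta>_def)
    define W where "W = complex_of_real (1 - z)"
    define D where "D = complex_of_real (2 * \<delta> / \<alpha> z)"
    define I where "I = 2 * \<i> / \<beta> z"
    have e: "cnj (\<beta> z) / \<beta> z = 1 + W * I"
      unfolding cb using \<beta>[of z] by (simp add: add_divide_distrib W_def I_def)
    have m: "complex_of_real (m z) = 1 + W * D"
    proof -
      have "m z = 1 + (1 - z) * (2 * \<delta> / \<alpha> z)" by (simp add: m_def mult_ac)
      then show ?thesis by (simp add: W_def D_def)
    qed
    have "\<pi> z = a * (D + complex_of_real (m z) * I)" by (simp add: \<pi>_def D_def I_def)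
    moreover have "\<kappa> z = a * complex_of_real (m z) * (1 + W * I)" by (simp add: \<kappa>_def e)
    ultimately have "\<kappa> z = a + W * \<pi> z"
      unfolding m by (simp add: algebra_simps)
    then show ?thesis by (simp add: W_def)
  qed
  have sR: "smooth_on J (\<lambda>z. complex_of_real (c * z + d))" for c d
  proof -
    have "smooth_on J (\<lambda>z. complex_of_real c * complex_of_real z + complex_of_real d)"
      by (intro smooth_on_add smooth_on_mult smooth_on_const smooth_on_of_real)
    then show ?thesis by simp
  qed
  have s\<alpha>: "smooth_on J (\<lambda>z. complex_of_real (\<alpha> z))"
    using sR[of "\<delta> - 1" 1] by (simp add: \<alpha>_def algebra_simps)
  have s1: "smooth_on J (\<lambda>z. complex_of_real (1 - z))"
    using sR[of "- 1" 1] by (simp add: algebra_simps)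
  have s\<delta>: "smooth_on J (\<lambda>z. complex_of_real (\<delta> * z))"
    using sR[of \<delta> 0] by simp
  have s\<beta>: "smooth_on J \<beta>"
    unfolding \<beta>_def by (intro smooth_on_diff smooth_on_mult smooth_on_const s\<delta> s1)
  have s\<beta>': "smooth_on J (\<lambda>z. cnj (\<beta> z))"
  proof -
    have "smooth_on J (\<lambda>z. complex_of_real (\<delta> * z) + \<i> * complex_of_real (1 - z))"
      by (intro smooth_on_add smooth_on_mult smooth_on_const s\<delta> s1)
    then show ?thesis by (simp add: \<beta>_def)
  qed
  have J\<alpha>: "complex_of_real (\<alpha> z) \<noteq> 0" if "z \<in> J" for z
    using \<alpha>[of z] that by (auto simp: J_def)
  have sm: "smooth_on J (\<lambda>z. complex_of_real (m z))"
  proof -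
    have "smooth_on J (\<lambda>z. 1 + complex_of_real (2 * \<delta>) * complex_of_real (1 - z) / complex_of_real (\<alpha> z))"
      by (intro smooth_on_add smooth_on_mult smooth_on_divide smooth_on_const s\<alpha> s1 J\<alpha>)
    then show ?thesis by (simp add: m_def)
  qed
  have s\<kappa>: "smooth_on J \<kappa>"
  proof -
    have "smooth_on J (\<lambda>z. complex_of_real a * complex_of_real (m z) * (cnj (\<beta> z) / \<beta> z))"
      by (intro smooth_on_mult smooth_on_divide smooth_on_const sm s\<beta> s\<beta>' \<beta>)
    then show ?thesis by (simp add: \<kappa>_def[abs_def])
  qed
  have s\<pi>: "smooth_on J \<pi>"
  proof -
    have "smooth_on J (\<lambda>z. complex_of_real a * (complex_of_real (2 * \<delta>) / complex_of_real (\<alpha> z) + 2 * \<i> * complex_of_real (m z) / \<beta> z))"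
      by (intro smooth_on_mult smooth_on_add smooth_on_divide smooth_on_const sm s\<beta> s\<alpha> \<beta> J\<alpha>)
    then show ?thesis by (simp add: \<pi>_def[abs_def])
  qed
  have c\<pi>: "continuous_on {-1..1 + \<delta>} \<pi>"
    unfolding \<pi>_def \<beta>_def m_def \<alpha>_def
    using \<alpha> \<beta> by (intro continuous_intros) (force simp: \<alpha>_def \<beta>_def)+
  obtain P where P: "\<And>z. z \<in> {-1..1 + \<delta>} \<Longrightarrow> (P has_vector_derivative \<pi> z) (at z within {-1..1 + \<delta>})"
    using antiderivative_continuous[OF c\<pi>] by blast
  have openJ: "open J" by (simp add: J_def)
  have J01: "{0..1} \<subseteq> J" using \<delta> by (auto simp: J_def)
  define \<Psi> where "\<Psi> z = exp (- P z)" for z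
  have P': "(P has_vector_derivative \<pi> z) (at z)" if "z \<in> J" for z
  proof -
    have "z \<in> interior {-1..1 + \<delta>}" using that by (simp add: J_def)
    then have "at z within {-1..1 + \<delta>} = at z" by (rule at_within_interior)
    moreover have "z \<in> {-1..1 + \<delta>}" using that by (simp add: J_def)
    ultimately show ?thesis using P[of z] by simp
  qed
  have \<Psi>': "(\<Psi> has_vector_derivative (- \<pi> z) * \<Psi> z) (at z)" if "z \<in> J" for z
  proof -
    have "((\<lambda>z. - P z) has_vector_derivative - \<pi> z) (at z)"
      by (rule has_vector_derivative_minus[OF P'[OF that]])
    then have "((exp \<circ> (\<lambda>z. - P z)) has_vector_derivative - \<pi> z * exp (- P z)) (at z)"
      by (rule field_vector_diff_chain_at) (auto intro: DERIV_exp)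
    then show ?thesis by (simp add: \<Psi>_def[abs_def] comp_def)
  qed
  have \<Psi>0: "\<Psi> z \<noteq> 0" for z by (simp add: \<Psi>_def)
  have s\<Psi>: "smooth_on J \<Psi>"
    by (rule smooth_on_ode[OF \<Psi>' smooth_on_minus[OF s\<pi>]])
  define \<kappa>' where "\<kappa>' z = vector_derivative \<kappa> (at z)" for z
  have d\<kappa>: "(\<kappa> has_vector_derivative \<kappa>' z) (at z)" if "z \<in> J" for z
    unfolding \<kappa>'_def by (rule smooth_on_deriv(1)[OF s\<kappa> openJ that])
  define K where "K z = \<Psi> z * \<kappa> z" for z
  define H where "H z = \<Psi> z * (2 * complex_of_real z * \<kappa> z + complex_of_real (n - 2 * a))" for z
  have sK: "smooth_on J K"
    unfolding K_def by (intro smooth_on_mult s\<Psi> s\<kappa>)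
  have sH: "smooth_on J H"
    unfolding H_def by (intro smooth_on_mult smooth_on_add smooth_on_const smooth_on_of_real s\<Psi> s\<kappa>)
  have dK: "vector_derivative K (at z) = \<Psi> z * (\<kappa>' z - \<pi> z * \<kappa> z)" if "z \<in> J" for z
  proof (rule vector_derivative_at)
    have "(K has_vector_derivative \<Psi> z * \<kappa>' z + (- \<pi> z) * \<Psi> z * \<kappa> z) (at z)"
      unfolding K_def[abs_def] by (rule has_vector_derivative_mult[OF \<Psi>'[OF that] d\<kappa>[OF that]])
    then show "(K has_vector_derivative \<Psi> z * (\<kappa>' z - \<pi> z * \<kappa> z)) (at z)"
      by (simp add: algebra_simps)
  qed
  have dH: "vector_derivative H (at z) = \<Psi> z * (2 * \<kappa> z + 2 * z * \<kappa>' z - \<pi> z * (2 * z * \<kappa> z + (n - 2 * a)))"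
    if "z \<in> J" for z
  proof -
    have "((\<lambda>z. 2 * complex_of_real z) has_vector_derivative 2) (at z)"
      by (auto intro!: derivative_eq_intros has_vector_derivative_of_real)
    from has_vector_derivative_add[OF has_vector_derivative_mult[OF this d\<kappa>[OF that]] has_vector_derivative_const]
    have "((\<lambda>z. 2 * complex_of_real z * \<kappa> z + complex_of_real (n - 2 * a)) has_vector_derivative
        2 * complex_of_real z * \<kappa>' z + 2 * \<kappa> z) (at z)" by simp
    from has_vector_derivative_mult[OF \<Psi>'[OF that] this]
    have "(H has_vector_derivative \<Psi> z * (2 * complex_of_real z * \<kappa>' z + 2 * \<kappa> z) +
        (- \<pi> z) * \<Psi> z * (2 * complex_of_real z * \<kappa> z + complex_of_real (n - 2 * a))) (at z)"
      unfolding H_def[abs_def] .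
    from vector_derivative_at[OF this] show ?thesis by (simp add: algebra_simps)
  qed
  \<comment> \<open>The gradient of \<open>v\<close> is a multiple of \<open>- a H - z H' = \<Psi> N\<close>.\<close>
  define N where "N z = (z * \<pi> z - a) * (2 * z * \<kappa> z + (n - 2 * a)) - 2 * z * \<kappa> z - 2 * z\<^sup>2 * \<kappa>' z" for z
  have L: "- a * H z - z * vector_derivative H (at z) = \<Psi> z * N z" if "z \<in> J" for z
    unfolding dH[OF that] H_def N_def by (simp add: algebra_simps power2_eq_square)
  have modulus: "\<kappa> z * cnj (\<kappa> z) = complex_of_real ((a * m z)\<^sup>2)" for z
  proof -
    have "cmod (\<kappa> z) = \<bar>a * m z\<bar>"
      using \<beta>[of z] by (simp add: \<kappa>_def norm_mult norm_divide abs_mult)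
    then have "(cmod (\<kappa> z))\<^sup>2 = (a * m z)\<^sup>2" by simp
    then show ?thesis by (metis complex_norm_square)
  qed
  have key: "0 < Re (N z * cnj (\<kappa> z))" if z: "z \<in> {0..1}" for z
  proof -
    have zJ: "z \<in> J" using z J01 by auto
    have \<alpha>z: "\<alpha> z > 0" using \<alpha>[of z] z \<delta> by simp
    define A w where "A = \<delta> * z" and "w = 1 - z"
    have \<alpha>Aw: "\<alpha> z = A + w" by (simp add: \<alpha>_def A_def w_def)
    define m' where "m' = - (2 * \<delta>\<^sup>2) / (A + w)\<^sup>2"
    have dm: "(m has_real_derivative m') (at z)"
    proof -
      have "(\<alpha> has_real_derivative \<delta> - 1) (at z)"
        unfolding \<alpha>_def by (auto intro!: derivative_eq_intros)
      then have "(m has_real_derivative ((- 2 * \<delta>) * \<alpha> z - (2 * \<delta> * (1 - z)) * (\<delta> - 1)) / (\<alpha> z * \<alpha> z)) (at z)"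
        unfolding m_def[abs_def] using \<alpha>z by (auto intro!: derivative_eq_intros)
      moreover have "((- 2 * \<delta>) * \<alpha> z - (2 * \<delta> * (1 - z)) * (\<delta> - 1)) = - (2 * \<delta>\<^sup>2)"
        by (simp add: \<alpha>_def algebra_simps power2_eq_square)
      ultimately show ?thesis by (simp add: m'_def \<alpha>Aw power2_eq_square)
    qed
    have Re\<kappa>': "Re (\<kappa>' z * cnj (\<kappa> z)) = a\<^sup>2 * m z * m'"
    proof -
      have "((\<lambda>z. \<kappa> z * cnj (\<kappa> z)) has_vector_derivative \<kappa> z * cnj (\<kappa>' z) + \<kappa>' z * cnj (\<kappa> z)) (at z)"
        by (intro has_vector_derivative_mult d\<kappa> zJ has_vector_derivative_cnj)
      moreover have "((\<lambda>z. complex_of_real ((a * m z)\<^sup>2)) has_vector_derivative complex_of_real (2 * a\<^sup>2 * m z * m')) (at z)"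
        using dm by (intro has_vector_derivative_of_real)
          (auto simp: has_real_derivative_iff_has_vector_derivative[symmetric] power2_eq_square intro!: derivative_eq_intros)
      ultimately have "\<kappa> z * cnj (\<kappa>' z) + \<kappa>' z * cnj (\<kappa> z) = complex_of_real (2 * a\<^sup>2 * m z * m')"
        unfolding modulus by (rule vector_derivative_unique_at)
      from arg_cong[OF this, of Re] show ?thesis by (simp add: algebra_simps)
    qed
    define q where "q = A\<^sup>2 + w\<^sup>2"
    have q0: "q > 0"
    proof -
      have "A \<noteq> 0 \<or> w \<noteq> 0" using \<alpha>z \<alpha>Aw by auto
      then show ?thesis by (auto simp: q_def sum_power2_gt_zero_iff)
    qed
    define g where "g = (A - w) / (A + w)"
    define M where "M = 1 + w * g"
    have zm: "z * m z = M"
    proof -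
      have "z * (A + w + 2 * \<delta> * w) = A + w + w * (A - w)"
        by (simp add: A_def w_def algebra_simps)
      then have "z * (A + w + 2 * \<delta> * w) / (A + w) = (A + w + w * (A - w)) / (A + w)" by simp
      moreover have "z * m z = z * (A + w + 2 * \<delta> * w) / (A + w)"
        using \<alpha>z unfolding m_def \<alpha>Aw w_def[symmetric] by (simp add: field_simps)
      moreover have "(A + w + w * (A - w)) / (A + w) = M"
        using \<alpha>z unfolding M_def g_def \<alpha>Aw by (simp add: field_simps)
      ultimately show ?thesis by simp
    qed
    have c\<beta>: "\<beta> z = Complex A (- w)" by (simp add: \<beta>_def A_def w_def complex_eq_iff)
    have inv\<beta>: "1 / \<beta> z = Complex (A / q) (w / q)"
      unfolding c\<beta> by (simp add: complex_eq_iff Re_divide Im_divide q_def)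
    define c s where "c = (A\<^sup>2 - w\<^sup>2) / q" and "s = 2 * A * w / q"
    have e: "cnj (\<beta> z) / \<beta> z = Complex c s"
      unfolding c\<beta> by (simp add: complex_eq_iff Re_divide Im_divide q_def c_def s_def power2_eq_square)
    have cs: "Complex c s * Complex c (- s) = 1"
    proof -
      have "c\<^sup>2 + s\<^sup>2 = ((A\<^sup>2 - w\<^sup>2)\<^sup>2 + (2 * A * w)\<^sup>2) / q\<^sup>2"
        by (simp add: c_def s_def power_divide add_divide_distrib)
      also have "(A\<^sup>2 - w\<^sup>2)\<^sup>2 + (2 * A * w)\<^sup>2 = q\<^sup>2"
        by (simp add: q_def power2_eq_square algebra_simps)
      finally have "c\<^sup>2 + s\<^sup>2 = 1" using q0 by simp
      then show ?thesis by (simp add: complex_eq_iff power2_eq_square)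
    qed
    have \<kappa>z: "\<kappa> z = complex_of_real (a * m z) * Complex c s" by (simp add: \<kappa>_def e)
    define X Y where "X = g - 2 * M * w / q" and "Y = 2 * M * A / q"
    have z\<pi>: "z * \<pi> z - a = complex_of_real a * Complex X Y"
    proof -
      have "z * \<pi> z - a = complex_of_real a * (complex_of_real (2 * A / (A + w) - 1) + 2 * \<i> * complex_of_real M * (1 / \<beta> z))"
        unfolding \<pi>_def zm[symmetric] by (simp add: A_def \<alpha>Aw w_def algebra_simps)
      also have "2 * A / (A + w) - 1 = g" using \<alpha>z \<alpha>Aw by (simp add: g_def field_simps)
      also have "complex_of_real g + 2 * \<i> * complex_of_real M * (1 / \<beta> z) = Complex X Y"
        unfolding inv\<beta> by (simp add: complex_eq_iff X_def Y_def)
      finally show ?thesis .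
    qed
    have cX: "X * c + Y * s = g + 2 * w / q"
    proof -
      have "X * c + Y * s = g * c + 2 * M * w * ((- (A\<^sup>2 - w\<^sup>2) + 2 * A * A) / q) / q"
        by (simp add: X_def Y_def c_def s_def algebra_simps diff_divide_distrib add_divide_distrib power2_eq_square)
      also have "(- (A\<^sup>2 - w\<^sup>2) + 2 * A * A) / q = 1"
      proof -
        have "- (A\<^sup>2 - w\<^sup>2) + 2 * A * A = q" by (simp add: q_def power2_eq_square)
        then show ?thesis using q0 by simp
      qed
      also have "g * c + 2 * M * w * 1 / q = g * (c + 2 * w\<^sup>2 / q) + 2 * w / q"
        by (simp add: M_def algebra_simps add_divide_distrib power2_eq_square)
      also have "c + 2 * w\<^sup>2 / q = 1"
        using q0 by (simp add: c_def divide_simps) (simp add: q_def)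
      finally show ?thesis by simp
    qed
    have gc: "g * c = (A - w)\<^sup>2 / q"
      using \<alpha>z \<alpha>Aw by (simp add: g_def c_def power2_eq_square square_diff_square_factored)
    have XM: "X * M + (X * c + Y * s) = (M + 1) * ((A - w)\<^sup>2 / q)"
    proof -
      have "X * M + (X * c + Y * s) = g * (M + 1) - 2 * w * (M\<^sup>2 - 1) / q"
        unfolding cX by (simp add: X_def algebra_simps diff_divide_distrib power2_eq_square)
      also have "M\<^sup>2 - 1 = (M + 1) * (w * g)"
        by (simp add: M_def power2_eq_square algebra_simps)
      also have "g * (M + 1) - 2 * w * ((M + 1) * (w * g)) / q = (M + 1) * (g * (1 - 2 * w\<^sup>2 / q))"
        by (simp add: algebra_simps power2_eq_square)
      also have "1 - 2 * w\<^sup>2 / q = c"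
        using q0 by (simp add: c_def divide_simps) (simp add: q_def)
      finally show ?thesis by (simp add: gc)
    qed
    have "Re (N z * cnj (\<kappa> z)) = a\<^sup>2 * m z *
        (\<epsilon> * (g + 2 * w / q) + 2 * a * (M + 1) * ((A - w)\<^sup>2 / q) - 2 * M + 4 * A\<^sup>2 / (A + w)\<^sup>2)"
    proof -
      have t1: "(z * \<pi> z - a) * (2 * z * \<kappa> z + (n - 2 * a)) * cnj (\<kappa> z) =
          complex_of_real (a\<^sup>2 * m z) * (Complex X Y * (complex_of_real (2 * a * M) + complex_of_real (n - 2 * a) * Complex c (- s)))"
      proof -
        have "(2 * z * \<kappa> z + (n - 2 * a)) * cnj (\<kappa> z) = complex_of_real (a * m z) *
            (2 * z * complex_of_real (a * m z) * (Complex c s * Complex c (- s)) + complex_of_real (n - 2 * a) * Complex c (- s))"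
          unfolding \<kappa>z by (simp add: algebra_simps complex_cnj)
        also have "\<dots> = complex_of_real (a * m z) * (complex_of_real (2 * a * M) + complex_of_real (n - 2 * a) * Complex c (- s))"
          unfolding cs zm[symmetric] by (simp add: mult_ac)
        finally show ?thesis
          unfolding z\<pi> by (simp add: mult_ac power2_eq_square)
      qed
      have "N z * cnj (\<kappa> z) = (z * \<pi> z - a) * (2 * z * \<kappa> z + (n - 2 * a)) * cnj (\<kappa> z)
          - 2 * complex_of_real z * (\<kappa> z * cnj (\<kappa> z)) - 2 * complex_of_real (z\<^sup>2) * (\<kappa>' z * cnj (\<kappa> z))"
        by (simp add: N_def algebra_simps)
      then have "Re (N z * cnj (\<kappa> z)) = a\<^sup>2 * m z * (X * (2 * a * M + (n - 2 * a) * c) + Y * ((n - 2 * a) * s))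
          - 2 * z * (a * m z)\<^sup>2 - 2 * z\<^sup>2 * (a\<^sup>2 * m z * m')"
        unfolding t1 modulus using Re\<kappa>' by simp
      also have "n - 2 * a = \<epsilon> + 2 * a" by (simp add: a_def field_simps)
      also have "a\<^sup>2 * m z * (X * (2 * a * M + (\<epsilon> + 2 * a) * c) + Y * ((\<epsilon> + 2 * a) * s))
          - 2 * z * (a * m z)\<^sup>2 - 2 * z\<^sup>2 * (a\<^sup>2 * m z * m')
        = a\<^sup>2 * m z * (\<epsilon> * (X * c + Y * s) + 2 * a * (X * M + (X * c + Y * s)) - 2 * (z * m z) - 2 * z\<^sup>2 * m')"
        by (simp add: algebra_simps power2_eq_square)
      also have "2 * z\<^sup>2 * m' = - (4 * A\<^sup>2 / (A + w)\<^sup>2)"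
        by (simp add: m'_def A_def power_mult_distrib)
      finally show ?thesis unfolding XM unfolding cX zm by (simp add: mult.assoc)
    qed
    moreover have "0 < a\<^sup>2 * m z"
    proof -
      have "m z > 0"
        unfolding m_def using \<alpha>z z \<delta> by (intro add_pos_nonneg) auto
      then show ?thesis using a0 by simp
    qed
    moreover have "0 < \<epsilon> * (g + 2 * w / q) + 2 * a * (M + 1) * ((A - w)\<^sup>2 / q) - 2 * M + 4 * A\<^sup>2 / (A + w)\<^sup>2"
      using profile_energy_pos[OF \<epsilon> a, of z] z
      unfolding M_def g_def q_def A_def w_def \<delta>_def by simp
    ultimately show ?thesis by simp
  qed
  have s\<kappa>': "smooth_on J \<kappa>'"
    unfolding \<kappa>'_def[abs_def] by (rule smooth_on_deriv(2)[OF s\<kappa> openJ])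
  have sN: "smooth_on J N"
  proof -
    have "smooth_on J (\<lambda>z. (complex_of_real z * \<pi> z - complex_of_real a) * (2 * complex_of_real z * \<kappa> z + complex_of_real (n - 2 * a))
        - 2 * complex_of_real z * \<kappa> z - 2 * (complex_of_real z * complex_of_real z) * \<kappa>' z)"
      by (intro smooth_on_mult smooth_on_add smooth_on_diff smooth_on_const smooth_on_of_real s\<pi> s\<kappa> s\<kappa>')
    then show ?thesis by (simp add: N_def[abs_def] power2_eq_square)
  qed
  define S where "S = {z \<in> J. N z \<noteq> 0}"
  have openS: "open S"
  proof -
    have "continuous_on J N" by (rule smooth_on_continuous_on[OF sN openJ])
    then have "open (N -` (- {0}) \<inter> J)"
      using openJ by (subst (asm) continuous_on_open_vimage) auto
    also have "N -` (- {0}) \<inter> J = S" by (auto simp: S_def)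
    finally show ?thesis .
  qed
  have S01: "{0..1} \<subseteq> S"
    using J01 key by (force simp: S_def)
  have SJ: "S \<subseteq> J" by (auto simp: S_def)
  define b where "b z = \<kappa> z / (2 * N z)" for z
  have sb: "smooth_on S b"
    unfolding b_def
    by (intro smooth_on_divide smooth_on_mult smooth_on_const smooth_on_subset[OF s\<kappa> SJ] smooth_on_subset[OF sN SJ])
      (auto simp: S_def)
  have "0 < Re (b z)" if "z \<in> {0..1}" for z
  proof -
    have "Re (b z) = Re (cnj (b z))" by simp
    also have "cnj (b z) = (N z * cnj (\<kappa> z)) / (2 * (N z * cnj (N z)))"
      using key[OF that] by (auto simp: b_def)
    also have "\<dots> = (N z * cnj (\<kappa> z)) / complex_of_real (2 * (cmod (N z))\<^sup>2)"
      by (simp only: of_real_mult complex_norm_square of_real_numeral)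
    also have "Re \<dots> = Re (N z * cnj (\<kappa> z)) / (2 * (cmod (N z))\<^sup>2)"
      by (simp only: Re_divide_of_real)
    also have "\<dots> > 0"
      using key[OF that] by (intro divide_pos_pos) auto
    finally show ?thesis .
  qed
  moreover have "continuous_on {0..1} (\<lambda>z. Re (b z))"
    by (intro continuous_intros continuous_on_subset[OF smooth_on_continuous_on[OF sb openS] S01])
  ultimately obtain \<mu> where \<mu>: "0 < \<mu>" "\<And>z. z \<in> {0..1} \<Longrightarrow> \<mu> \<le> Re (b z)"
    using compact_interval_bounds by meson
  show ?thesis
  proof (rule that[OF openS S01 smooth_on_subset[OF sH SJ] smooth_on_subset[OF sK SJ] sb \<mu>(1)])
    show "H 1 \<noteq> 0"
    proof -
      have "\<kappa> 1 = a" using \<kappa>\<pi>[of 1] \<delta> by simp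
      then have "H 1 = \<Psi> 1 * complex_of_real n" by (simp add: H_def)
      then show ?thesis using \<Psi>0 n by simp
    qed
    show "\<mu> \<le> Re (b z)" if "z \<in> {0..1}" for z by (rule \<mu>(2)[OF that])
    show "a * H z - (1 - z) * vector_derivative H (at z) =
      n * K z - 2 * (1 - z) * ((a + 1) * K z + z * vector_derivative K (at z))" if "z \<in> {0..1}" for z
    proof -
      have zJ: "z \<in> J" using that J01 by auto
      have k: "\<kappa> z = a + (1 - z) * \<pi> z" using \<kappa>\<pi>[of z] that \<delta> by simp
      have "a * H z - (1 - z) * vector_derivative H (at z) = \<Psi> z * ((2 * z * \<kappa> z + (n - 2 * a)) * (a + (1 - z) * \<pi> z) - (1 - z) * (2 * \<kappa> z + 2 * z * \<kappa>' z))"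
        unfolding dH[OF zJ] by (simp add: H_def algebra_simps)
      also have "\<dots> = \<Psi> z * ((2 * z * \<kappa> z + (n - 2 * a)) * \<kappa> z - (1 - z) * (2 * \<kappa> z + 2 * z * \<kappa>' z))"
        unfolding k[symmetric] ..
      also have "\<dots> = n * K z - 2 * (1 - z) * ((a + 1) * K z + z * (\<Psi> z * (\<kappa>' z - \<pi> z * \<kappa> z)))
          + 2 * z * \<Psi> z * \<kappa> z * (\<kappa> z - (a + (1 - z) * \<pi> z))"
        unfolding K_def by (simp add: algebra_simps)
      also have "\<kappa> z - (a + (1 - z) * \<pi> z) = 0" using k by simp
      finally show ?thesis unfolding dK[OF zJ] by simp
    qed
    show "K z = 2 * b z * (- a * H z - z * vector_derivative H (at z))" if "z \<in> S" for z
    proof -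
      have z: "z \<in> J" "N z \<noteq> 0" using that by (auto simp: S_def)
      then show ?thesis unfolding L[OF z(1)] by (simp add: K_def b_def)
    qed
  qed
qed


section \<open>Classical radial solutions\<close>

text \<open>
  \<open>G\<close> is uniformly continuous on the product of \<open>[0, (1 + t)/2]\<close> with the unit ball.
\<close>

lemma uniformly_close_slices:
  fixes G :: "real \<Rightarrow> 'a::euclidean_space \<Rightarrow> 'b::real_normed_vector"
  assumes G: "continuous_on ({0..<1} \<times> UNIV) (\<lambda>(t, x). G t x)"
    and G0: "\<And>t x. t \<in> {0..<1} \<Longrightarrow> 1 < norm x \<Longrightarrow> G t x = 0"
    and t: "t \<in> {0..<1}" and e: "0 < e"
  obtains d where "0 < d" "\<And>s x. s \<in> {0..<1} \<Longrightarrow> \<bar>s - t\<bar> < d \<Longrightarrow> norm (G s x - G t x) \<le> e"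
proof -
  define T where "T = (1 + t) / 2"
  have T: "t < T" "T < 1" using t by (auto simp: T_def)
  define Q where "Q = {0..T} \<times> cball (0::'a) 1"
  have "compact Q" unfolding Q_def by (intro compact_Times) auto
  moreover have "continuous_on Q (\<lambda>(t, x). G t x)"
    by (rule continuous_on_subset[OF G]) (use T in \<open>auto simp: Q_def\<close>)
  ultimately have "uniformly_continuous_on Q (\<lambda>(t, x). G t x)"
    by (rule compact_uniformly_continuous[rotated])
  then have "\<exists>d>0. \<forall>p\<in>Q. \<forall>q\<in>Q. dist q p < d \<longrightarrow> dist (case q of (t, x) \<Rightarrow> G t x) (case p of (t, x) \<Rightarrow> G t x) < e"
    using e by (simp only: uniformly_continuous_on_def)
  then obtain d where d: "d > 0"
    "\<forall>p\<in>Q. \<forall>q\<in>Q. dist q p < d \<longrightarrow> dist (case q of (t, x) \<Rightarrow> G t x) (case p of (t, x) \<Rightarrow> G t x) < e"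
    by (elim exE conjE)
  show ?thesis
  proof (rule that[of "min d (T - t)"])
    show "0 < min d (T - t)" using d T by simp
    fix s and x :: 'a assume s: "s \<in> {0..<1}" "\<bar>s - t\<bar> < min d (T - t)"
    show "norm (G s x - G t x) \<le> e"
    proof (cases "norm x \<le> 1")
      case True
      have "(t, x) \<in> Q" "(s, x) \<in> Q" using True s t T by (auto simp: Q_def)
      moreover have "dist (s, x) (t, x) < d" using s by (simp add: dist_Pair_Pair dist_real_def)
      ultimately have "dist (case (s, x) of (t, x) \<Rightarrow> G t x) (case (t, x) of (t, x) \<Rightarrow> G t x) < e"
        using d(2) by blast
      then show ?thesis by (simp add: dist_norm)
    qed (use s t e G0 in simp)
  qed
qed

lemma square_integrable_indicator_cball:
  "square_integrable lebesgue (indicator (cball 0 1) :: 'a::euclidean_space \<Rightarrow> real)"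
proof -
  have "integrable lebesgue (indicator (cball 0 1) :: 'a \<Rightarrow> real)"
    by (intro integrable_real_indicator) (auto simp: emeasure_cball)
  moreover have "(\<lambda>x::'a. (norm (indicator (cball 0 1) x :: real))\<^sup>2) = indicator (cball 0 1)"
    by (auto simp: indicator_def)
  ultimately show ?thesis by (simp add: square_integrable_def borel_measurable_integrable)
qed

lemma L2_norm_unit_ball_le:
  fixes F :: "'a::euclidean_space \<Rightarrow> 'b::euclidean_space"
  assumes "F \<in> borel_measurable lebesgue" "\<And>x. norm (F x) \<le> e" "\<And>x. 1 < norm x \<Longrightarrow> F x = 0" "0 \<le> e"
  shows "L2_norm lebesgue F \<le> e * L2_norm lebesgue (indicator (cball 0 1) :: 'a \<Rightarrow> real)"
proof (rule L2_norm_dominated[OF square_integrable_indicator_cball assms(1) AE_I2 assms(4)])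
  show "norm (F x) \<le> e * norm (indicator (cball 0 1) x :: real)" for x
    using assms(2)[of x] assms(3)[of x] by (cases "norm x \<le> 1") (auto simp: indicator_def)
qed

lemma continuous_slice:
  assumes "continuous_on ({0..<1} \<times> UNIV) (\<lambda>(t, x). G t x)" "t \<in> {0..<1::real}"
  shows "continuous_on UNIV (G t)"
proof -
  have "continuous_on UNIV ((\<lambda>(t, x). G t x) \<circ> (\<lambda>x. (t, x)))"
    by (rule continuous_on_compose)
      (auto intro!: continuous_intros continuous_on_subset[OF assms(1)] simp: assms(2)[simplified])
  then show ?thesis by (simp add: comp_def)
qed

lemma slices_L2:
  fixes G :: "real \<Rightarrow> 'a::euclidean_space \<Rightarrow> 'b::euclidean_space"
  assumes G: "continuous_on ({0..<1} \<times> UNIV) (\<lambda>(t, x). G t x)"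
    and G0: "\<And>t x. t \<in> {0..<1} \<Longrightarrow> 1 < norm x \<Longrightarrow> G t x = 0"
    and t: "t \<in> {0..<1}"
  shows "square_integrable lebesgue (G t)"
    and "((\<lambda>s. L2_norm lebesgue (\<lambda>x. G s x - G t x)) \<longlongrightarrow> 0) (at t within {0..<1})"
proof -
  have sq: "square_integrable lebesgue (G t)" if "t \<in> {0..<1}" for t
    by (rule square_integrable_continuous_compact_support[OF continuous_slice[OF G that], of "cball 0 1"])
      (use G0[OF that] in auto)
  show "square_integrable lebesgue (G t)" by (rule sq[OF t])
  define N where "N = L2_norm lebesgue (indicator (cball 0 1) :: 'a \<Rightarrow> real)"
  have N: "0 \<le> N" by (simp add: N_def)
  show "((\<lambda>s. L2_norm lebesgue (\<lambda>x. G s x - G t x)) \<longlongrightarrow> 0) (at t within {0..<1})"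
  proof (rule tendstoI)
    fix e :: real assume e: "0 < e"
    define e' where "e' = e / (N + 1)"
    have e': "0 < e'" using e N by (simp add: e'_def)
    obtain d where d: "0 < d" "\<And>s x. s \<in> {0..<1} \<Longrightarrow> \<bar>s - t\<bar> < d \<Longrightarrow> norm (G s x - G t x) \<le> e'"
      using uniformly_close_slices[OF G G0 t e'] by blast
    have "L2_norm lebesgue (\<lambda>x. G s x - G t x) < e" if s: "s \<in> {0..<1}" "\<bar>s - t\<bar> < d" for s
    proof -
      have "L2_norm lebesgue (\<lambda>x. G s x - G t x) \<le> e' * N"
        unfolding N_def
        by (rule L2_norm_unit_ball_le)
          (use sq[OF s(1)] sq[OF t] d(2)[OF s] G0 s t e' in \<open>auto simp: square_integrable_def\<close>)
      also have "\<dots> < e' * (N + 1)" using e' by simp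
      also have "\<dots> = e" using N by (simp add: e'_def)
      finally show ?thesis .
    qed
    then show "\<forall>\<^sub>F s in at t within {0..<1}. dist (L2_norm lebesgue (\<lambda>x. G s x - G t x)) 0 < e"
      unfolding eventually_at using d(1) by (intro exI[of _ d]) (auto simp: dist_real_def)
  qed
qed

lemma path_in_L2I:
  fixes G :: "real \<Rightarrow> 'a::euclidean_space \<Rightarrow> complex"
  assumes "continuous_on ({0..<1} \<times> UNIV) (\<lambda>(t, x). G t x)"
    and "\<And>t x. t \<in> {0..<1} \<Longrightarrow> 1 < norm x \<Longrightarrow> G t x = 0"
  shows "path_in (Lspace 2) G"
  by (rule path_inI) (use slices_L2[OF assms] in \<open>simp_all add: points_Lspace2 snorm_Lspace2 fun_diff_def\<close>)

text \<open>
  By the mean value inequality and the uniform continuity of \<open>U'\<close>, the difference quotients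
  converge uniformly on the unit ball, hence in \<open>L\<^sup>2\<close>.
\<close>

lemma pairing_has_vector_derivative:
  fixes U U' :: "real \<Rightarrow> real ^ 'n::finite \<Rightarrow> complex"
  assumes U: "continuous_on ({0..<1} \<times> UNIV) (\<lambda>(t, x). U t x)"
      "\<And>t x. t \<in> {0..<1} \<Longrightarrow> 1 < norm x \<Longrightarrow> U t x = 0"
    and U': "continuous_on ({0..<1} \<times> UNIV) (\<lambda>(t, x). U' t x)"
      "\<And>t x. t \<in> {0..<1} \<Longrightarrow> 1 < norm x \<Longrightarrow> U' t x = 0"
    and der: "\<And>t x. t \<in> {0..<1} \<Longrightarrow> ((\<lambda>s. U s x) has_vector_derivative U' t x) (at t within {0..<1})"
    and z: "square_integrable lebesgue z" and t: "t \<in> {0..<1}"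
  shows "((\<lambda>s. LINT x|lebesgue. U s x * cnj (z x)) has_vector_derivative
      (LINT x|lebesgue. U' t x * cnj (z x))) (at t within {0..<1})"
  unfolding has_vector_derivative_def has_derivative_within_alt
proof (intro conjI bounded_linear_scaleR_left allI impI)
  fix e :: real assume e: "0 < e"
  define N where "N = L2_norm lebesgue (indicator (cball 0 1) :: real ^ 'n \<Rightarrow> real)"
  define Z where "Z = L2_norm lebesgue z"
  have NZ: "0 \<le> N" "0 \<le> Z" by (simp_all add: N_def Z_def)
  define e' where "e' = e / (N * Z + 1)"
  have e': "0 < e'" using e NZ by (simp add: e'_def add_nonneg_pos)
  obtain d where d: "0 < d" "\<And>s x. s \<in> {0..<1} \<Longrightarrow> \<bar>s - t\<bar> < d \<Longrightarrow> norm (U' s x - U' t x) \<le> e'"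
    using uniformly_close_slices[OF U' t e'] by blast
  have sU: "square_integrable lebesgue (U s)" if "s \<in> {0..<1}" for s
    by (rule slices_L2(1)[OF U(1) _ that]) (rule U(2))
  have sU': "square_integrable lebesgue (U' t)"
    by (rule slices_L2(1)[OF U'(1) _ t]) (rule U'(2))
  have "norm ((LINT x|lebesgue. U s x * cnj (z x)) - (LINT x|lebesgue. U t x * cnj (z x)) -
      (s - t) *\<^sub>R (LINT x|lebesgue. U' t x * cnj (z x))) \<le> e * norm (s - t)"
    if s: "s \<in> {0..<1}" "norm (s - t) < d" for s
  proof -
    define W where "W x = U s x - U t x - complex_of_real (s - t) * U' t x" for x
    have sW: "square_integrable lebesgue W"
      unfolding W_def by (intro square_integrable_diff square_integrable_cmult sU sU' s t)
    have seg: "closed_segment t s \<subseteq> {0..<1}"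
      using s t by (auto simp: closed_segment_eq_real_ivl)
    have W: "norm (W x) \<le> norm (s - t) * e'" for x
    proof -
      have "norm (U s x - U t x - (s - t) *\<^sub>R U' t x) \<le> norm (s - t) * e'"
      proof (rule vector_differentiable_bound_linearization[where S = "closed_segment t s" and f' = "\<lambda>r. U' r x"])
        show "((\<lambda>s. U s x) has_vector_derivative U' r x) (at r within closed_segment t s)"
          if "r \<in> closed_segment t s" for r
          by (rule has_vector_derivative_within_subset[OF der seg]) (use that seg in blast)
        show "norm (U' r x - U' t x) \<le> e'" if r: "r \<in> closed_segment t s" for r
        proof -
          from r have "\<bar>r - t\<bar> \<le> \<bar>s - t\<bar>" by (auto simp: closed_segment_eq_real_ivl split: if_splits)
          then show "norm (U' r x - U' t x) \<le> e'"
            using d(2)[of r x] r seg s by auto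
        qed
      qed auto
      then show ?thesis by (simp add: W_def scaleR_conv_of_real)
    qed
    have "L2_norm lebesgue W \<le> (norm (s - t) * e') * N"
      unfolding N_def
      by (rule L2_norm_unit_ball_le) (use sW W U(2) U'(2) s t e' in \<open>auto simp: square_integrable_def W_def\<close>)
    have "(LINT x|lebesgue. U s x * cnj (z x)) - (LINT x|lebesgue. U t x * cnj (z x)) -
        (s - t) *\<^sub>R (LINT x|lebesgue. U' t x * cnj (z x)) = (LINT x|lebesgue. W x * cnj (z x))"
    proof -
      have "(\<lambda>x. W x * cnj (z x)) = (\<lambda>x. U s x * cnj (z x) - U t x * cnj (z x) - (s - t) *\<^sub>R (U' t x * cnj (z x)))"
        by (simp add: W_def fun_eq_iff algebra_simps scaleR_conv_of_real)
      then show ?thesis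
        using integral_mult_cnj_le(2)[OF sU[OF s(1)] z] integral_mult_cnj_le(2)[OF sU[OF t] z] integral_mult_cnj_le(2)[OF sU' z]
        by simp
    qed
    also have "norm \<dots> \<le> L2_norm lebesgue W * Z"
      unfolding Z_def by (rule integral_mult_cnj_le(1)[OF sW z])
    also have "\<dots> \<le> ((norm (s - t) * e') * N) * Z"
      by (rule mult_right_mono) fact+
    also have "\<dots> = norm (s - t) * (e' * (N * Z))" by simp
    also have "\<dots> \<le> norm (s - t) * e"
    proof (rule mult_left_mono)
      have "e' * (N * Z) \<le> e' * (N * Z + 1)" using e' by simp
      also have "\<dots> = e" using NZ by (simp add: e'_def add_nonneg_eq_0_iff)
      finally show "e' * (N * Z) \<le> e" .
    qed simp
    finally show ?thesis by (simp add: mult.commute)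
  qed
  then show "\<exists>d>0. \<forall>y\<in>{0..<1}. norm (y - t) < d \<longrightarrow>
      norm ((LINT x|lebesgue. U y x * cnj (z x)) - (LINT x|lebesgue. U t x * cnj (z x)) -
        (y - t) *\<^sub>R (LINT x|lebesgue. U' t x * cnj (z x))) \<le> e * norm (y - t)"
    using d(1) by (intro exI[of _ d]) auto
qed

lemma partial_deriv_mult:
  assumes "v differentiable (at x)" "\<phi> differentiable (at x)"
  shows "partial_deriv b (\<lambda>x. v x * \<phi> x) x = v x * partial_deriv b \<phi> x + partial_deriv b v x * \<phi> x"
  by (rule partial_deriv_eq[OF has_derivative_mult[OF has_derivative_partial[OF assms(1)] has_derivative_partial[OF assms(2)]]])

text \<open>
  For a test function \<open>\<phi>\<close> the product \<open>v \<phi>\<close> is of class \<open>C\<^sup>1\<close> with compact support, so the integrals of its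
  partial derivatives vanish.
\<close>

lemma classical_weak_gradient:
  fixes v :: "real ^ 'n::finite \<Rightarrow> complex"
  assumes v: "continuously_differentiable 1 v" and K: "compact K" "\<And>x. x \<notin> K \<Longrightarrow> v x = 0"
  shows "square_integrable lebesgue v" "is_weak_gradient v (\<lambda>x. \<chi> i. partial_deriv (axis i 1) v x)"
proof -
  have vd: "v differentiable (at x)" for x using v by simp
  have v0: "continuous_on UNIV v"
    using continuously_differentiable_Suc_imp[of 0 v] v by simp
  show vs: "square_integrable lebesgue v"
    by (rule square_integrable_continuous_compact_support[OF v0 K])
  have ps: "square_integrable lebesgue (partial_deriv (axis i 1) v)" for i
    by (rule square_integrable_continuous_compact_support[OF _ K(1) partial_deriv_outside[OF vd K]])
      (use v axis_in_Basis in auto)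
  show "is_weak_gradient v (\<lambda>x. \<chi> i. partial_deriv (axis i 1) v x)"
    unfolding is_weak_gradient_def
  proof (intro conjI allI impI)
    show "(\<lambda>x. (\<chi> i. partial_deriv (axis i 1) v x) $ i) \<in> points (Lspace 2)" for i
      unfolding points_Lspace2 using ps[of i] by simp
    fix i and \<phi> :: "real ^ 'n \<Rightarrow> complex" assume \<phi>: "test_function UNIV \<phi>"
    then have c: "continuously_differentiable 1 \<phi>" by (simp add: test_function_def)
    then have \<phi>d: "\<phi> differentiable (at x)" for x by simp
    note s\<phi> = test_function_square_integrable[OF \<phi>]
    have "0 = (LINT x|lebesgue. partial_deriv (axis i 1) (\<lambda>x. v x * \<phi> x) x)"
      by (rule integral_partial_deriv_eq_0[symmetric, OF continuously_differentiable_mult[OF v c] K(1) _ axis_in_Basis])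
        (use K(2) in simp)
    also have "\<dots> = (LINT x|lebesgue. v x * partial_deriv (axis i 1) \<phi> x) + (LINT x|lebesgue. partial_deriv (axis i 1) v x * \<phi> x)"
      unfolding partial_deriv_mult[OF vd \<phi>d]
      by (rule Bochner_Integration.integral_add[OF integrable_mult_square_integrable[OF vs s\<phi>(2)[OF axis_in_Basis]]
          integrable_mult_square_integrable[OF ps s\<phi>(1)]])
    finally show "(LINT x|lebesgue. v x * partial_deriv (axis i 1) \<phi> x) =
        - (LINT x|lebesgue. (\<chi> i. partial_deriv (axis i 1) v x) $ i * \<phi> x)"
      by (simp add: eq_neg_iff_add_eq_0)
  qed
qed

lemma has_derivative_radial:
  fixes x :: "'a::real_inner"
  assumes "(F has_vector_derivative F') (at ((norm x)\<^sup>2))"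
  shows "((\<lambda>x. F ((norm x)\<^sup>2)) has_derivative (\<lambda>b. complex_of_real (2 * (x \<bullet> b)) * F')) (at x)"
proof -
  have "((\<lambda>x::'a. x \<bullet> x) has_derivative (\<lambda>b. 2 * (x \<bullet> b))) (at x)"
    by (auto intro!: derivative_eq_intros simp: inner_commute)
  moreover have "(F has_derivative (\<lambda>h. h *\<^sub>R F')) (at (x \<bullet> x))"
    using assms by (simp add: has_vector_derivative_def power2_norm_eq_inner)
  ultimately have "((F \<circ> (\<lambda>x. x \<bullet> x)) has_derivative ((\<lambda>h. h *\<^sub>R F') \<circ> (\<lambda>b. 2 * (x \<bullet> b)))) (at x)"
    by (rule diff_chain_at)
  then show ?thesis
    by (simp add: comp_def power2_norm_eq_inner[abs_def] scaleR_conv_of_real)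
qed

lemma partial_deriv_cnj:
  assumes "\<phi> differentiable (at x)"
  shows "partial_deriv b (\<lambda>x. cnj (\<phi> x)) x = cnj (partial_deriv b \<phi> x)"
  by (rule partial_deriv_eq[OF bounded_linear.has_derivative[OF bounded_linear_cnj has_derivative_partial[OF assms]]])

text \<open>
  The conjugated components of \<open>q\<close> serve as test functions for the weak gradient of \<open>w\<close>.
\<close>

lemma flux_functional_classical:
  fixes q :: "real ^ 'n::finite \<Rightarrow> complex ^ 'n"
  assumes q: "\<And>i. test_function UNIV (\<lambda>x. q x $ i)"
  shows "flux_functional q = to_Hneg1 (\<lambda>x. \<Sum>i\<in>UNIV. partial_deriv (axis i 1) (\<lambda>x. q x $ i) x)"
proof
  fix w :: "real ^ 'n \<Rightarrow> complex"
  have qd: "(\<lambda>x. q x $ i) differentiable (at x)" for i x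
  proof -
    have "continuously_differentiable 1 (\<lambda>x. q x $ i)" using q[of i] by (simp add: test_function_def)
    then show ?thesis by simp
  qed
  note sq = test_function_square_integrable[OF q]
  show "flux_functional q w = to_Hneg1 (\<lambda>x. \<Sum>i\<in>UNIV. partial_deriv (axis i 1) (\<lambda>x. q x $ i) x) w"
  proof (cases "w \<in> points H1")
    case True
    note w = points_H1D[OF True]
    have i1: "integrable lebesgue (\<lambda>x. q x $ i * cnj (wgrad w x $ i))" for i
      by (rule integral_mult_cnj_le(2)[OF sq(1) square_integrable_vec_nth[OF w(3)]])
    have i2: "integrable lebesgue (\<lambda>x. partial_deriv (axis i 1) (\<lambda>x. q x $ i) x * cnj (w x))" for i
      by (rule integral_mult_cnj_le(2)[OF sq(2)[OF axis_in_Basis] w(1)])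
    have "- (LINT x|lebesgue. q x $ i * cnj (wgrad w x $ i)) =
        (LINT x|lebesgue. partial_deriv (axis i 1) (\<lambda>x. q x $ i) x * cnj (w x))" for i
    proof -
      have "test_function UNIV (\<lambda>x. cnj (q x $ i))"
        using q[of i] unfolding test_function_def by (auto intro: continuously_differentiable_cnj)
      then have "(LINT x|lebesgue. w x * partial_deriv (axis i 1) (\<lambda>x. cnj (q x $ i)) x) =
          - (LINT x|lebesgue. wgrad w x $ i * cnj (q x $ i))"
        using w(2) unfolding is_weak_gradient_def by blast
      then have "cnj (LINT x|lebesgue. w x * partial_deriv (axis i 1) (\<lambda>x. cnj (q x $ i)) x) =
          - cnj (LINT x|lebesgue. wgrad w x $ i * cnj (q x $ i))" by simp
      then show ?thesis
        unfolding partial_deriv_cnj[OF qd] by (simp del: Bochner_Integration.integral_cnj add: Bochner_Integration.integral_cnj[symmetric] mult.commute)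
    qed
    then have "(\<Sum>i\<in>UNIV. - (LINT x|lebesgue. q x $ i * cnj (wgrad w x $ i))) =
        (\<Sum>i\<in>UNIV. LINT x|lebesgue. partial_deriv (axis i 1) (\<lambda>x. q x $ i) x * cnj (w x))" by simp
    moreover have "(\<Sum>i\<in>UNIV. - (LINT x|lebesgue. q x $ i * cnj (wgrad w x $ i))) = flux_functional q w"
      using True i1 by (simp add: flux_functional_def herm_def sum_negf)
    moreover have "(\<Sum>i\<in>UNIV. LINT x|lebesgue. partial_deriv (axis i 1) (\<lambda>x. q x $ i) x * cnj (w x)) =
        to_Hneg1 (\<lambda>x. \<Sum>i\<in>UNIV. partial_deriv (axis i 1) (\<lambda>x. q x $ i) x) w"
      using True i2 by (simp add: to_Hneg1_def sum_distrib_right)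
    ultimately show ?thesis by simp
  qed (simp add: flux_functional_def to_Hneg1_def)
qed

text \<open>The functions of time and of the squared radius from which the solution is composed.\<close>

definition radial_family :: "(real \<Rightarrow> real \<Rightarrow> complex) \<Rightarrow> bool" where
  "radial_family F \<longleftrightarrow> continuous_on ({0..<1} \<times> {0..}) (\<lambda>(t, \<sigma>). F t \<sigma>) \<and>
     (\<forall>t\<in>{0..<1}. \<forall>\<sigma>>1. F t \<sigma> = 0)"

lemma radial_familyD:
  assumes "radial_family F"
  shows "continuous_on ({0..<1} \<times> UNIV) (\<lambda>(t, x::'a::euclidean_space). F t ((norm x)\<^sup>2))"
    and "t \<in> {0..<1} \<Longrightarrow> 1 < norm (x::'a) \<Longrightarrow> F t ((norm x)\<^sup>2) = 0"
proof -
  have "continuous_on ({0..<1} \<times> UNIV) ((\<lambda>(t, \<sigma>). F t \<sigma>) \<circ> (\<lambda>(t, x::'a). (t, (norm x)\<^sup>2)))"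
    unfolding case_prod_beta
    by (intro continuous_on_compose continuous_intros
        continuous_on_subset[OF assms[unfolded radial_family_def case_prod_beta, THEN conjunct1]]) auto
  then show "continuous_on ({0..<1} \<times> UNIV) (\<lambda>(t, x::'a). F t ((norm x)\<^sup>2))"
    by (simp add: comp_def case_prod_beta)
  show "t \<in> {0..<1} \<Longrightarrow> 1 < norm (x::'a) \<Longrightarrow> F t ((norm x)\<^sup>2) = 0"
    using assms unfolding radial_family_def by (simp add: power2_eq_square less_1_mult)
qed

definition complex_vec :: "real ^ 'n::finite \<Rightarrow> complex ^ 'n" where
  "complex_vec x = (\<chi> i. complex_of_real (x $ i))"

lemma norm_complex_vec: "norm (complex_vec x) = norm x"
  by (simp add: complex_vec_def norm_vec_def L2_set_def)

lemma mat_vector_mult: "mat c *v \<xi> = c *s (\<xi> :: complex ^ 'n::finite)"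
  by (simp add: vec_eq_iff matrix_vector_mult_def mat_def if_distrib[of "\<lambda>x. x * _"] cong: if_cong)

lemma continuously_differentiable_coordinate:
  "continuously_differentiable k (\<lambda>x::real ^ 'n::finite. complex_of_real (x $ i))"
  using continuously_differentiable_inner[of k "axis i (1::real)"] by (simp add: inner_axis)

text \<open>
  Here \<open>U1\<close> and \<open>g1\<close> are derivatives with respect to \<open>\<sigma> = |x|\<^sup>2\<close>, and \<open>U2\<close> is the time derivative. Hence
  \<open>\<nabla>u = 2 U1 x\<close>, the flux \<open>\<beta> \<nabla>u\<close> equals \<open>g x\<close>, and its divergence is \<open>n g + 2\<sigma> g1\<close>. For times before
  \<open>1\<close> everything is smooth in \<open>x\<close>, so the weak operators agree with the classical ones, and
  \<open>solution_criterion\<close> applies.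
\<close>

theorem radial_solution:
  fixes U U1 U2 g g1 :: "real \<Rightarrow> real \<Rightarrow> complex" and \<beta> :: "real \<Rightarrow> real ^ 'n::finite \<Rightarrow> complex"
  defines "u \<equiv> \<lambda>t (x :: real ^ 'n). U t ((norm x)\<^sup>2)"
    and "f \<equiv> \<lambda>t (x :: real ^ 'n). U2 t ((norm x)\<^sup>2) -
      (of_nat CARD('n) * g t ((norm x)\<^sup>2) + 2 * complex_of_real ((norm x)\<^sup>2) * g1 t ((norm x)\<^sup>2))"
  assumes smooth: "\<And>t. t \<in> {0..<1} \<Longrightarrow> \<exists>S. {0..} \<subseteq> S \<and> smooth_on S (U t) \<and> smooth_on S (g t)"
    and U1: "\<And>t \<sigma>. t \<in> {0..<1} \<Longrightarrow> 0 \<le> \<sigma> \<Longrightarrow> (U t has_vector_derivative U1 t \<sigma>) (at \<sigma>)"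
    and g1: "\<And>t \<sigma>. t \<in> {0..<1} \<Longrightarrow> 0 \<le> \<sigma> \<Longrightarrow> (g t has_vector_derivative g1 t \<sigma>) (at \<sigma>)"
    and U2: "\<And>t \<sigma>. t \<in> {0..<1} \<Longrightarrow> 0 \<le> \<sigma> \<Longrightarrow> ((\<lambda>s. U s \<sigma>) has_vector_derivative U2 t \<sigma>) (at t within {0..<1})"
    and fam: "radial_family U" "radial_family U1" "radial_family U2" "radial_family g" "radial_family g1"
    and U0: "\<And>\<sigma>. U 0 \<sigma> = 0"
    and flux: "\<And>t x. t \<in> {0..<1} \<Longrightarrow> \<beta> t x * (2 * U1 t ((norm x)\<^sup>2)) = g t ((norm x)\<^sup>2)"
    and \<beta>: "\<And>t x. t \<in> {0..<1} \<Longrightarrow> cmod (\<beta> t x) \<le> \<Lambda>"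
    and energy: "(\<integral>\<^sup>+ t. ennreal (LINT x|lebesgue. (cmod (U t ((norm (x :: real ^ 'n))\<^sup>2)))\<^sup>2 +
        4 * (norm x)\<^sup>2 * (cmod (U1 t ((norm x)\<^sup>2)))\<^sup>2) \<partial>unit_interval) < \<infinity>"
    and C: "\<And>t. t \<in> {0..<1} \<Longrightarrow> L2_norm lebesgue (f t) \<le> C"
  shows "is_solution (\<lambda>t x. mat (\<beta> t x)) (\<lambda>t. to_Hneg1 (f t)) u" "path_in (Lspace 2) f"
proof -
  define dq where "dq t x = of_nat CARD('n) * g t ((norm x)\<^sup>2) + 2 * complex_of_real ((norm x)\<^sup>2) * g1 t ((norm x)\<^sup>2)"
    for t and x :: "real ^ 'n"
  define G where "G t x = (2 * U1 t ((norm x)\<^sup>2)) *s complex_vec x" for t and x :: "real ^ 'n"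
  define q where "q t x = g t ((norm x)\<^sup>2) *s complex_vec x" for t and x :: "real ^ 'n"
  note c = radial_familyD[where 'a = "real ^ 'n", OF fam(1)] radial_familyD[where 'a = "real ^ 'n", OF fam(2)]
    radial_familyD[where 'a = "real ^ 'n", OF fam(3)] radial_familyD[where 'a = "real ^ 'n", OF fam(4)]
    radial_familyD[where 'a = "real ^ 'n", OF fam(5)]
  have dq: "path_in (Lspace 2) dq"
  proof (rule path_in_L2I)
    show "continuous_on ({0..<1} \<times> UNIV) (\<lambda>(t, x). dq t x)"
      unfolding dq_def case_prod_beta
      by (intro continuous_intros c(7,9)[unfolded case_prod_beta])
  qed (simp add: dq_def c(8,10))
  show f: "path_in (Lspace 2) f"
  proof (rule path_in_L2I)
    show "continuous_on ({0..<1} \<times> UNIV) (\<lambda>(t, x). f t x)"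
      unfolding f_def case_prod_beta
      by (intro continuous_intros c(5,7,9)[unfolded case_prod_beta])
  qed (simp add: f_def c(6,8,10))
  have cd: "continuously_differentiable k (u t)" "continuously_differentiable k (\<lambda>x. q t x $ i)"
    if t: "t \<in> {0..<1}" for k t i
  proof -
    obtain S where S: "{0..} \<subseteq> S" "smooth_on S (U t)" "smooth_on S (g t)" using smooth[OF t] by auto
    show "continuously_differentiable k (u t)"
      unfolding u_def by (rule continuously_differentiable_radial[OF S(2,1)])
    have "continuously_differentiable k (\<lambda>x. g t ((norm x)\<^sup>2) * complex_of_real (x $ i))"
      by (intro continuously_differentiable_mult continuously_differentiable_coordinate
          continuously_differentiable_radial[OF S(3,1)])
    then show "continuously_differentiable k (\<lambda>x. q t x $ i)"
      by (simp add: q_def complex_vec_def)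
  qed
  have u0: "u t x = 0" if "t \<in> {0..<1}" "x \<notin> cball 0 1" for t x
    unfolding u_def by (rule c(2)[OF that(1)]) (use that(2) in auto)
  have du: "(u t has_derivative (\<lambda>b. complex_of_real (2 * (x \<bullet> b)) * U1 t ((norm x)\<^sup>2))) (at x)"
    if t: "t \<in> {0..<1}" for t x
    unfolding u_def by (rule has_derivative_radial[OF U1[OF t]]) simp
  have pu: "(\<chi> i. partial_deriv (axis i 1) (u t) x) = G t x" if t: "t \<in> {0..<1}" for t x
    unfolding partial_deriv_eq[OF du[OF t]] by (simp add: vec_eq_iff G_def complex_vec_def inner_axis)
  have wu: "square_integrable lebesgue (u t)" "is_weak_gradient (u t) (G t)" if t: "t \<in> {0..<1}" for t
    using classical_weak_gradient[OF cd(1)[OF t] compact_cball u0[OF t]] unfolding pu[OF t] by blast+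
  have uH: "u t \<in> points H1" if "t \<in> {0..<1}" for t by (rule points_H1I[OF wu[OF that]])
  have gu: "AE x in lebesgue. wgrad (u t) x = G t x" if "t \<in> {0..<1}" for t by (rule wgrad_AE[OF wu[OF that]])
  define J where "J t x = (u t x, G t x)" for t x
  have Jc: "continuous_on ({0..<1} \<times> UNIV) (\<lambda>(t, x). J t x)"
    unfolding J_def G_def u_def complex_vec_def vector_scalar_mult_def case_prod_beta
    by (simp, intro continuous_intros continuous_on_vec_lambda c(1,3)[unfolded case_prod_beta])
  have J0: "J t x = 0" if "t \<in> {0..<1}" "1 < norm x" for t x
    using c(2,4)[OF that] by (simp add: J_def G_def u_def zero_prod_def)
  have JL: "square_integrable lebesgue (J t)"
      "((\<lambda>s. L2_norm lebesgue (\<lambda>x. J s x - J t x)) \<longlongrightarrow> 0) (at t within {0..<1})" if "t \<in> {0..<1}" for t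
    by (rule slices_L2[OF Jc _ that], rule J0, assumption+)+
  have snJ: "snorm H1 (u s - u t) = L2_norm lebesgue (\<lambda>x. J s x - J t x)" if st: "s \<in> {0..<1}" "t \<in> {0..<1}" for s t
  proof -
    have H: "u s - u t \<in> points H1" by (rule H1.diff_point[OF uH[OF st(1)] uH[OF st(2)]])
    show ?thesis
      unfolding snorm_H1[OF H]
    proof (rule L2_norm_cong_AE[OF jet_measurable[OF H]])
      show "(\<lambda>x. J s x - J t x) \<in> borel_measurable lebesgue"
        using JL(1)[OF st(1)] JL(1)[OF st(2)] by (auto simp: square_integrable_def)
      show "AE x in lebesgue. ((u s - u t) x, wgrad (u s - u t) x) = J s x - J t x"
        using wgrad_diff[OF uH[OF st(1)] uH[OF st(2)]] gu[OF st(1)] gu[OF st(2)]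
        by eventually_elim (simp add: J_def)
    qed
  qed
  have u: "path_in H1 u"
  proof (rule path_inI[OF uH], assumption)
    fix t :: real assume t: "t \<in> {0..<1}"
    show "((\<lambda>s. snorm H1 (u s - u t)) \<longlongrightarrow> 0) (at t within {0..<1})"
    proof (rule Lim_transform_eventually[OF JL(2)[OF t]])
      show "\<forall>\<^sub>F s in at t within {0..<1}. L2_norm lebesgue (\<lambda>x. J s x - J t x) = snorm H1 (u s - u t)"
        using eventually_at_within_mem by eventually_elim (use snJ t in simp)
    qed
  qed
  have snu: "(snorm H1 (u t))\<^sup>2 = (LINT x|lebesgue. (cmod (U t ((norm (x :: real ^ 'n))\<^sup>2)))\<^sup>2 +
        4 * (norm x)\<^sup>2 * (cmod (U1 t ((norm x)\<^sup>2)))\<^sup>2)" if t: "t \<in> {0..<1}" for t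
  proof -
    have "snorm H1 (u t) = L2_norm lebesgue (J t)"
      unfolding snorm_H1[OF uH[OF t]]
    proof (rule L2_norm_cong_AE[OF jet_measurable[OF uH[OF t]]])
      show "J t \<in> borel_measurable lebesgue" using JL(1)[OF t] by (simp add: square_integrable_def)
      show "AE x in lebesgue. (u t x, wgrad (u t) x) = J t x"
        using gu[OF t] by eventually_elim (simp add: J_def)
    qed
    moreover have "(norm (J t x))\<^sup>2 = (cmod (U t ((norm x)\<^sup>2)))\<^sup>2 + 4 * (norm x)\<^sup>2 * (cmod (U1 t ((norm x)\<^sup>2)))\<^sup>2" for x
      by (simp add: J_def norm_Pair u_def G_def norm_vector_smult norm_complex_vec norm_mult power_mult_distrib)
    ultimately show ?thesis by (simp add: L2_norm_square)
  qed
  have energy': "(\<integral>\<^sup>+ t. ennreal ((snorm H1 (u t))\<^sup>2) \<partial>unit_interval) < \<infinity>"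
  proof -
    have "(\<integral>\<^sup>+ t. ennreal ((snorm H1 (u t))\<^sup>2) \<partial>unit_interval) =
        (\<integral>\<^sup>+ t. ennreal (LINT x|lebesgue. (cmod (U t ((norm (x :: real ^ 'n))\<^sup>2)))\<^sup>2 +
        4 * (norm x)\<^sup>2 * (cmod (U1 t ((norm x)\<^sup>2)))\<^sup>2) \<partial>unit_interval)"
      by (rule nn_integral_cong) (subst snu, auto simp: space_restrict_space)
    with energy show ?thesis by simp
  qed
  have pq: "partial_deriv (axis i 1) (\<lambda>x. q t x $ i) x =
      g t ((norm x)\<^sup>2) + 2 * complex_of_real ((x $ i)\<^sup>2) * g1 t ((norm x)\<^sup>2)" if t: "t \<in> {0..<1}" for t x i
  proof -
    have "((\<lambda>x::real ^ 'n. complex_of_real (x $ i)) has_derivative (\<lambda>b. complex_of_real (b $ i))) (at x)"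
      by (intro bounded_linear_imp_has_derivative bounded_linear_compose[OF bounded_linear_of_real bounded_linear_vec_nth])
    from has_derivative_mult[OF has_derivative_radial[OF g1[OF t zero_le_power2]] this]
    have "((\<lambda>x. q t x $ i) has_derivative (\<lambda>b. g t ((norm x)\<^sup>2) * complex_of_real (b $ i) +
        complex_of_real (2 * (x \<bullet> b)) * g1 t ((norm x)\<^sup>2) * complex_of_real (x $ i))) (at x)"
      by (simp add: q_def complex_vec_def)
    from partial_deriv_eq[OF this, of "axis i 1"] show ?thesis
      by (simp add: inner_axis power2_eq_square)
  qed
  have dqs: "(\<lambda>x. \<Sum>i\<in>UNIV. partial_deriv (axis i 1) (\<lambda>x. q t x $ i) x) = dq t" if t: "t \<in> {0..<1}" for t
  proof
    fix x :: "real ^ 'n"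
    have "(norm x)\<^sup>2 = (\<Sum>i\<in>UNIV. (x $ i)\<^sup>2)"
      unfolding power2_norm_eq_inner by (simp add: inner_vec_def power2_eq_square)
    then have "complex_of_real ((norm x)\<^sup>2) = (\<Sum>i\<in>UNIV. complex_of_real ((x $ i)\<^sup>2))" by simp
    then show "(\<Sum>i\<in>UNIV. partial_deriv (axis i 1) (\<lambda>x. q t x $ i) x) = dq t x"
      unfolding pq[OF t] dq_def by (simp add: sum.distrib sum_distrib_left sum_distrib_right)
  qed
  have qt: "test_function UNIV (\<lambda>x. q t x $ i)" if t: "t \<in> {0..<1}" for t i
    unfolding test_function_def
  proof (intro conjI allI exI[of _ "cball 0 1"] impI)
    show "q t x $ i = 0" if "x \<notin> cball 0 1" for x
      using c(8)[OF t, of x] that by (simp add: q_def)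
  qed (use cd(2)[OF t] in auto)
  have Bq: "mat (\<beta> t x) *v G t x = q t x" if t: "t \<in> {0..<1}" for t x
    unfolding mat_vector_mult G_def q_def flux[OF t, symmetric] by (simp add: vec_eq_iff)
  have D: "div_op (\<lambda>x. mat (\<beta> t x)) (u t) = to_Hneg1 (dq t)" if t: "t \<in> {0..<1}" for t
  proof -
    have "div_op (\<lambda>x. mat (\<beta> t x)) (u t) = flux_functional (q t)"
    proof
      fix w
      have "(LINT x|lebesgue. herm (mat (\<beta> t x) *v wgrad (u t) x) (wgrad w x)) = (LINT x|lebesgue. herm (q t x) (wgrad w x))"
        if w: "w \<in> points H1"
      proof (rule integral_cong_AE)
        have m: "q t \<in> borel_measurable lebesgue"
          by (rule borel_measurable_vec) (use test_function_square_integrable(1)[OF qt[OF t]] in \<open>simp add: square_integrable_def\<close>)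
        have gw: "wgrad w \<in> borel_measurable lebesgue" using points_H1D(3)[OF w] by (simp add: square_integrable_def)
        show "(\<lambda>x. herm (q t x) (wgrad w x)) \<in> borel_measurable lebesgue"
          by (rule herm_measurable[OF m gw])
        have AE: "AE x in lebesgue. q t x = mat (\<beta> t x) *v wgrad (u t) x"
          using gu[OF t] by eventually_elim (simp add: Bq[OF t])
        show AE': "AE x in lebesgue. herm (mat (\<beta> t x) *v wgrad (u t) x) (wgrad w x) = herm (q t x) (wgrad w x)"
          using AE by eventually_elim simp
        show "(\<lambda>x. herm (mat (\<beta> t x) *v wgrad (u t) x) (wgrad w x)) \<in> borel_measurable lebesgue"
          by (rule borel_measurable_AE[OF herm_measurable[OF m gw]]) (use AE in eventually_elim, simp)
      qed
      then show "div_op (\<lambda>x. mat (\<beta> t x)) (u t) w = flux_functional (q t) w"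
        by (simp add: div_op_def flux_functional_def)
    qed
    then show ?thesis using flux_functional_classical[OF qt[OF t]] dqs[OF t] by simp
  qed
  have Dle: "snorm Hneg1 (to_Hneg1 (dq t)) \<le> \<Lambda> * snorm H1 (u t)" if t: "t \<in> {0..<1}" for t
  proof -
    have sq: "square_integrable lebesgue (q t)"
      by (rule square_integrable_vec[OF test_function_square_integrable(1)[OF qt[OF t]]])
    have \<Lambda>: "0 \<le> \<Lambda>" using order_trans[OF norm_ge_zero \<beta>[OF t]] .
    have "snorm Hneg1 (to_Hneg1 (dq t)) = snorm Hneg1 (flux_functional (q t))"
      using flux_functional_classical[OF qt[OF t]] dqs[OF t] by simp
    also have "\<dots> \<le> L2_norm lebesgue (q t)" by (rule flux_functional(2)[OF sq])
    also have "\<dots> \<le> \<Lambda> * L2_norm lebesgue (wgrad (u t))"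
    proof (rule L2_norm_dominated[OF points_H1D(3)[OF uH[OF t]] _ _ \<Lambda>])
      show "q t \<in> borel_measurable lebesgue" using sq by (simp add: square_integrable_def)
      show "AE x in lebesgue. norm (q t x) \<le> \<Lambda> * norm (wgrad (u t) x)"
        using gu[OF t]
      proof eventually_elim
        case (elim x)
        have "norm (q t x) = cmod (\<beta> t x) * norm (G t x)"
          unfolding Bq[OF t, symmetric] mat_vector_mult norm_vector_smult ..
        then show ?case using elim mult_right_mono[OF \<beta>[OF t, of x], of "norm (G t x)"] by simp
      qed
    qed
    also have "\<dots> \<le> \<Lambda> * snorm H1 (u t)"
      by (rule mult_left_mono[OF L2_norm_le_H1(2)[OF uH[OF t]] \<Lambda>])
    finally show ?thesis .
  qed
  show "is_solution (\<lambda>t x. mat (\<beta> t x)) (\<lambda>t. to_Hneg1 (f t)) u"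
  proof (rule solution_criterion[OF u energy' dq f D Dle C])
    fix t and z :: "real ^ 'n \<Rightarrow> complex" assume t: "t \<in> {0..<1::real}" and z: "z \<in> points H1"
    have "dq t x + f t x = U2 t ((norm x)\<^sup>2)" for x by (simp add: dq_def f_def)
    then show "((\<lambda>s. LINT x|lebesgue. u s x * cnj (z x)) has_vector_derivative
       (LINT x|lebesgue. (dq t x + f t x) * cnj (z x))) (at t within {0..<1})"
      unfolding u_def
      using pairing_has_vector_derivative[OF c(1) _ c(5) _ _ points_H1D(1)[OF z] t] c(2,6) U2 by simp
  next
    show "u 0 = (\<lambda>x. 0)" by (simp add: u_def U0)
  qed
qed


section \<open>Integrable singularities\<close>

text \<open>
  On the dyadic shell of radius about \<open>2\<^bsup>-k\<^esup>\<close> the integrand is at most \<open>2\<^bsup>e(k+1)\<^esup>\<close>. Majorising by the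
  sum of these constants over the balls, rather than the shells, gives a geometric series.
\<close>

lemma integrable_norm_powr:
  fixes y :: "'a::euclidean_space"
  assumes e: "0 \<le> e" "e < real DIM('a)"
  shows "integrable lebesgue (\<lambda>x. indicator (cball y 1) x * norm (x - y) powr (- e))"
proof (rule integrableI_bounded)
  have "(\<lambda>x. indicator (cball y 1) x * norm (x - y) powr (- e)) \<in> borel_measurable borel"
    by (intro borel_measurable_times borel_measurable_indicator powr_real_measurable borel_measurable_const
        borel_measurable_continuous_onI continuous_intros) auto
  then show "(\<lambda>x. indicator (cball y 1) x * norm (x - y) powr (- e)) \<in> borel_measurable lebesgue"
    by (intro measurable_completion) simp
  define h where "h k = (2 powr e * 2 powr (e * real k))" for k :: nat
  have pw: "ennreal (norm (indicator (cball y 1) x * norm (x - y) powr (- e))) \<le>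
      (\<Sum>k. ennreal (h k) * indicator (cball y (1 / 2 ^ k)) x)" for x
  proof (cases "x \<in> cball y 1 \<and> x \<noteq> y")
    case True
    define r where "r = norm (x - y)"
    have r: "0 < r" "r \<le> 1" using True by (auto simp: r_def dist_norm norm_minus_commute)
    define k where "k = (LEAST k::nat. 1 / 2 ^ (k + 1) < r)"
    have ex: "\<exists>k::nat. 1 / 2 ^ (k + 1) < r"
    proof -
      obtain k where "(1 / 2) ^ k < r" using real_arch_pow_inv[OF r(1), of "1 / 2"] by auto
      moreover have "(1 / 2 :: real) ^ (k + 1) \<le> (1 / 2) ^ k" by simp
      ultimately have "1 / 2 ^ (k + 1) < r" by (simp add: power_one_over)
      then show ?thesis by blast
    qed
    have k1: "1 / 2 ^ (k + 1) < r" unfolding k_def using ex by (rule LeastI_ex)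
    have k2: "r \<le> 1 / 2 ^ k"
    proof (cases k)
      case (Suc j)
      then have "\<not> 1 / 2 ^ (j + 1) < r"
        by (intro not_less_Least[where P = "\<lambda>k. 1 / 2 ^ (k + 1) < r"]) (simp only: k_def[symmetric] lessI)
      then show ?thesis using Suc by simp
    qed (use r in simp)
    have "r powr (- e) \<le> (1 / 2 ^ (k + 1)) powr (- e)"
      by (rule powr_mono2') (use e k1 in auto)
    also have "1 / 2 ^ (k + 1) = 2 powr (- (1 + real k))"
    proof -
      have "(2::real) ^ (k + 1) = 2 powr real (k + 1)" by (rule powr_realpow[symmetric]) simp
      then show ?thesis by (simp only: powr_minus of_nat_add of_nat_1 add.commute inverse_eq_divide)
    qed
    also have "(2 powr (- (1 + real k))) powr (- e) = h k"
      by (simp add: h_def powr_powr powr_add[symmetric] algebra_simps)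
    finally have "r powr (- e) \<le> h k" .
    then have "ennreal (norm (indicator (cball y 1) x * norm (x - y) powr (- e))) \<le> ennreal (h k) * indicator (cball y (1 / 2 ^ k)) x"
      using True k2 by (simp add: r_def dist_norm norm_minus_commute ennreal_leI)
    also have "\<dots> = sum (\<lambda>k. ennreal (h k) * indicator (cball y (1 / 2 ^ k)) x) {k}"
      by (simp only: sum.insert sum.empty finite.emptyI empty_iff not_False_eq_True add_0_right)
    also have "\<dots> \<le> (\<Sum>k. ennreal (h k) * indicator (cball y (1 / 2 ^ k)) x)"
      by (rule sum_le_suminf) auto
    finally show ?thesis .
  qed auto
  define V where "V = unit_ball_vol (real DIM('a))"
  define \<rho> where "\<rho> = 2 powr (e - real DIM('a))"
  have V: "0 \<le> V" by (simp add: V_def)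
  have "(\<integral>\<^sup>+ x. ennreal (norm (indicator (cball y 1) x * norm (x - y) powr (- e))) \<partial>lebesgue)
      \<le> (\<integral>\<^sup>+ x. (\<Sum>k. ennreal (h k) * indicator (cball y (1 / 2 ^ k)) x) \<partial>lebesgue)"
    by (rule nn_integral_mono) (rule pw)
  also have "\<dots> = (\<Sum>k. \<integral>\<^sup>+ x. ennreal (h k) * indicator (cball y (1 / 2 ^ k)) x \<partial>lebesgue)"
    by (intro nn_integral_suminf borel_measurable_times_ennreal borel_measurable_const borel_measurable_indicator) auto
  also have "\<dots> = (\<Sum>k. ennreal (2 powr e * V * \<rho> ^ k))"
  proof (rule suminf_cong)
    fix k
    have "(\<integral>\<^sup>+ x. ennreal (h k) * indicator (cball y (1 / 2 ^ k)) x \<partial>lebesgue) =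
        ennreal (h k) * ennreal (V * (1 / 2 ^ k) ^ DIM('a))"
      by (simp add: nn_integral_cmult_indicator emeasure_cball V_def)
    also have "\<dots> = ennreal (h k * (V * (1 / 2 ^ k) ^ DIM('a)))"
      by (rule ennreal_mult[symmetric]) (use V in \<open>auto simp: h_def\<close>)
    also have "h k * (V * (1 / 2 ^ k) ^ DIM('a)) = 2 powr e * V * \<rho> ^ k"
    proof -
      have "(1 / 2 ^ k) ^ DIM('a) = (2 powr (- real DIM('a) * real k) :: real)"
      proof -
        have "(1 / 2 ^ k) ^ DIM('a) = 1 / (2::real) ^ (DIM('a) * k)"
          by (simp add: power_one_over power_mult[symmetric] mult.commute power_divide)
        also have "(2::real) ^ (DIM('a) * k) = 2 powr real (DIM('a) * k)" by (rule powr_realpow[symmetric]) simp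
        finally show ?thesis by (simp add: powr_minus inverse_eq_divide)
      qed
      moreover have "\<rho> ^ k = 2 powr ((e - real DIM('a)) * real k)"
        unfolding \<rho>_def by (simp add: powr_realpow[symmetric] powr_powr)
      ultimately show ?thesis
        by (simp add: h_def powr_add[symmetric] algebra_simps)
    qed
    finally show "(\<integral>\<^sup>+ x. ennreal (h k) * indicator (cball y (1 / 2 ^ k)) x \<partial>lebesgue) = ennreal (2 powr e * V * \<rho> ^ k)" .
  qed
  also have "\<dots> < \<infinity>"
  proof -
    have "\<rho> < 2 powr 0" unfolding \<rho>_def by (rule powr_less_mono) (use e in auto)
    then have "summable (\<lambda>k. 2 powr e * V * \<rho> ^ k)"
      by (intro summable_mult summable_geometric) (auto simp: \<rho>_def)
    then have "(\<Sum>k. ennreal (2 powr e * V * \<rho> ^ k)) \<noteq> top"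
      by (rule ennreal_suminf_neq_top) (use V in \<open>auto simp: \<rho>_def\<close>)
    then show ?thesis by (simp add: less_top)
  qed
  finally show "(\<integral>\<^sup>+ x. ennreal (norm (indicator (cball y 1) x * norm (x - y) powr (- e))) \<partial>lebesgue) < \<infinity>" .
qed

text \<open>
  The primitive \<open>- c ln (1 - t)\<close> is unbounded; \<open>T\<close> is the time at which it exceeds a supposed value
  of the integral.
\<close>

lemma nn_integral_inverse_infinite:
  assumes c: "0 < c"
  shows "(\<integral>\<^sup>+ t. ennreal (c / (1 - t)) * indicator {1 / 2..<1} t \<partial>lebesgue) = \<infinity>"
proof (rule ccontr)
  define I where "I = (\<integral>\<^sup>+ t. ennreal (c / (1 - t)) * indicator {1 / 2..<1} t \<partial>lebesgue)"
  assume "\<not> ?thesis"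
  then have "I \<noteq> \<infinity>" by (simp add: I_def)
  then obtain m where m: "I = ennreal m" "0 \<le> m" by (cases I) auto
  define N where "N = (m + 1) / c + ln 2"
  define T where "T = 1 - exp (- N)"
  have "ln 2 \<le> N" using c m by (simp add: N_def)
  then have "exp (- N) \<le> exp (- ln (2::real))" by simp
  then have T: "1 / 2 \<le> T" "T < 1" by (auto simp: T_def exp_minus)
  have "ennreal (- c * ln (1 - T) - - c * ln (1 - 1 / 2)) = (\<integral>\<^sup>+ t. ennreal (c / (1 - t)) * indicator {1 / 2..T} t \<partial>lborel)"
  proof (rule nn_integral_FTC_Icc[symmetric])
    show "(\<lambda>t. c / (1 - t)) \<in> borel_measurable borel" by measurable
    show "((\<lambda>t. - c * ln (1 - t)) has_real_derivative c / (1 - t)) (at t)" if "t \<in> {1 / 2..T}" for t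
      using that T by (auto intro!: derivative_eq_intros)
  qed (use T c in auto)
  also have "\<dots> = (\<integral>\<^sup>+ t. ennreal (c / (1 - t)) * indicator {1 / 2..T} t \<partial>lebesgue)"
    by (rule nn_integral_completion[symmetric])
  also have "\<dots> \<le> I"
    unfolding I_def by (rule nn_integral_mono) (use T in \<open>auto simp: indicator_def\<close>)
  also have "- c * ln (1 - T) - - c * ln (1 - 1 / 2) = m + 1"
    using c by (simp add: T_def N_def ln_div field_simps)
  finally show False using m by simp
qed

section \<open>Self-similar functions\<close>

text \<open>
  The functions that are homogeneous of degree \<open>-c\<close> in \<open>(\<tau>, \<sigma>)\<close>. Their derivatives with respect to \<open>\<sigma>\<close> and \<open>\<tau>\<close>
  are homogeneous of degree \<open>-c - 1\<close>, with the profiles \<open>dsig c M\<close> and \<open>dtau c M\<close>.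
\<close>

definition selfsim :: "real \<Rightarrow> (real \<Rightarrow> complex) \<Rightarrow> real \<Rightarrow> real \<Rightarrow> complex" where
  "selfsim c M \<tau> \<sigma> = complex_of_real ((\<tau> + \<sigma>) powr (- c)) * M (\<tau> / (\<tau> + \<sigma>))"

definition dsig :: "real \<Rightarrow> (real \<Rightarrow> complex) \<Rightarrow> real \<Rightarrow> complex" where
  "dsig c M z = - complex_of_real c * M z - complex_of_real z * vector_derivative M (at z)"

definition dtau :: "real \<Rightarrow> (real \<Rightarrow> complex) \<Rightarrow> real \<Rightarrow> complex" where
  "dtau c M z = - complex_of_real c * M z + complex_of_real (1 - z) * vector_derivative M (at z)"

lemma selfsim_chain:
  assumes r: "(\<rho> has_real_derivative 1) (at y)" "0 < \<rho> y"
    and z: "(\<zeta> has_real_derivative d / \<rho> y) (at y)" and M: "(M has_vector_derivative M') (at (\<zeta> y))"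
  shows "((\<lambda>y. complex_of_real (\<rho> y powr (- c)) * M (\<zeta> y)) has_vector_derivative
    complex_of_real (\<rho> y powr (- (c + 1))) * (- complex_of_real c * M (\<zeta> y) + complex_of_real d * M')) (at y)"
proof -
  have p: "\<rho> y powr (- c) = \<rho> y * \<rho> y powr (- (c + 1))"
    using r(2) by (simp add: powr_mult_base)
  have "((\<lambda>y. \<rho> y powr (- c)) has_real_derivative - c * \<rho> y powr (- (c + 1))) (at y)"
    using DERIV_fun_powr[OF r, of "- c"] by simp
  then have "((\<lambda>y. complex_of_real (\<rho> y powr (- c))) has_vector_derivative
      complex_of_real (- c * \<rho> y powr (- (c + 1)))) (at y)"
    by (intro has_vector_derivative_of_real) (simp add: has_real_derivative_iff_has_vector_derivative)
  moreover have "((M \<circ> \<zeta>) has_vector_derivative (d / \<rho> y) *\<^sub>R M') (at y)"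
    by (rule vector_diff_chain_at[where f = \<zeta> and g = M, OF _ M]) (use z in \<open>simp add: has_real_derivative_iff_has_vector_derivative\<close>)
  ultimately have "((\<lambda>y. complex_of_real (\<rho> y powr (- c)) * (M \<circ> \<zeta>) y) has_vector_derivative
      complex_of_real (\<rho> y powr (- c)) * ((d / \<rho> y) *\<^sub>R M') + complex_of_real (- c * \<rho> y powr (- (c + 1))) * (M \<circ> \<zeta>) y) (at y)"
    by (rule has_vector_derivative_mult)
  then show ?thesis
    unfolding p using r(2) by (simp add: scaleR_conv_of_real algebra_simps comp_def)
qed

lemma selfsim_derivatives:
  assumes M: "smooth_on S M" "open S" and r: "0 < \<tau> + \<sigma>" and z: "\<tau> / (\<tau> + \<sigma>) \<in> S"
  shows "(selfsim c M \<tau> has_vector_derivative selfsim (c + 1) (dsig c M) \<tau> \<sigma>) (at \<sigma>)"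
    and "((\<lambda>\<tau>. selfsim c M \<tau> \<sigma>) has_vector_derivative selfsim (c + 1) (dtau c M) \<tau> \<sigma>) (at \<tau>)"
proof -
  note d = smooth_on_deriv(1)[OF M z]
  have add1: "((\<lambda>\<sigma>. \<tau> + \<sigma>) has_real_derivative 1) (at \<sigma>)" "((\<lambda>\<tau>. \<tau> + \<sigma>) has_real_derivative 1) (at \<tau>)"
    by (auto intro!: derivative_eq_intros)
  have "((\<lambda>\<sigma>. \<tau> / (\<tau> + \<sigma>)) has_real_derivative (- (\<tau> / (\<tau> + \<sigma>))) / (\<tau> + \<sigma>)) (at \<sigma>)"
    using r by (auto intro!: derivative_eq_intros simp: field_simps)
  from selfsim_chain[OF add1(1) r this d, of c]
  show "(selfsim c M \<tau> has_vector_derivative selfsim (c + 1) (dsig c M) \<tau> \<sigma>) (at \<sigma>)"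
    by (simp add: selfsim_def[abs_def] dsig_def)
  have "((\<lambda>\<tau>. \<tau> / (\<tau> + \<sigma>)) has_real_derivative (1 - \<tau> / (\<tau> + \<sigma>)) / (\<tau> + \<sigma>)) (at \<tau>)"
    using r by (auto intro!: derivative_eq_intros simp: divide_simps)
  from selfsim_chain[OF add1(2) r this d, of c]
  show "((\<lambda>\<tau>. selfsim c M \<tau> \<sigma>) has_vector_derivative selfsim (c + 1) (dtau c M) \<tau> \<sigma>) (at \<tau>)"
    by (simp add: selfsim_def dtau_def)
qed

lemma smooth_on_dsig: "smooth_on S M \<Longrightarrow> open S \<Longrightarrow> smooth_on S (dsig c M)"
  unfolding dsig_def by (intro smooth_on_diff smooth_on_mult smooth_on_const smooth_on_of_real smooth_on_deriv(2))

lemma smooth_on_dtau: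
  assumes "smooth_on S M" "open S"
  shows "smooth_on S (dtau c M)"
proof -
  have "smooth_on S (\<lambda>z. - complex_of_real c * M z + (1 - complex_of_real z) * vector_derivative M (at z))"
    by (intro smooth_on_add smooth_on_diff smooth_on_mult smooth_on_const smooth_on_of_real smooth_on_deriv(2) assms)
  then show ?thesis by (simp add: dtau_def[abs_def])
qed

text \<open>
  For \<open>\<tau> > 0\<close> the set contains \<open>[0,\<infinity>)\<close> if \<open>S\<close> contains \<open>[0,1]\<close>, which is what smoothness in \<open>x\<close> requires.
\<close>

lemma smooth_on_selfsim:
  assumes "smooth_on S M"
  shows "smooth_on {\<sigma>. 0 < \<tau> + \<sigma> \<and> \<tau> / (\<tau> + \<sigma>) \<in> S} (selfsim c M \<tau>)"
  unfolding selfsim_def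
proof (rule smooth_on_mult)
  let ?T = "{\<sigma>. 0 < \<tau> + \<sigma> \<and> \<tau> / (\<tau> + \<sigma>) \<in> S}"
  have lin: "smooth_on ?T (\<lambda>\<sigma>. complex_of_real \<tau> + complex_of_real \<sigma>)"
    by (intro smooth_on_add smooth_on_const smooth_on_of_real)
  have nz: "complex_of_real \<tau> + complex_of_real \<sigma> \<noteq> 0" if "\<sigma> \<in> ?T" for \<sigma>
    using that by (simp flip: of_real_add)
  show "smooth_on ?T (\<lambda>\<sigma>. complex_of_real ((\<tau> + \<sigma>) powr (- c)))"
  proof (rule smooth_on_ode[where \<omega> = "\<lambda>\<sigma>. complex_of_real (- c) / (complex_of_real \<tau> + complex_of_real \<sigma>)"])
    fix \<sigma> assume "\<sigma> \<in> ?T"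
    then have r: "0 < \<tau> + \<sigma>" by simp
    have "((\<lambda>\<sigma>. \<tau> + \<sigma>) has_real_derivative 1) (at \<sigma>)" by (auto intro!: derivative_eq_intros)
    from DERIV_fun_powr[OF this r, of "- c"]
    have "((\<lambda>\<sigma>. (\<tau> + \<sigma>) powr (- c)) has_real_derivative (- c / (\<tau> + \<sigma>)) * (\<tau> + \<sigma>) powr (- c)) (at \<sigma>)"
      using r by (simp add: powr_diff)
    then have "((\<lambda>\<sigma>. complex_of_real ((\<tau> + \<sigma>) powr (- c))) has_vector_derivative
        complex_of_real ((- c / (\<tau> + \<sigma>)) * (\<tau> + \<sigma>) powr (- c))) (at \<sigma>)"
      by (intro has_vector_derivative_of_real) (simp add: has_real_derivative_iff_has_vector_derivative)
    then show "((\<lambda>\<sigma>. complex_of_real ((\<tau> + \<sigma>) powr (- c))) has_vector_derivative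
        complex_of_real (- c) / (complex_of_real \<tau> + complex_of_real \<sigma>) * complex_of_real ((\<tau> + \<sigma>) powr (- c))) (at \<sigma>)"
      by simp
  qed (intro smooth_on_divide smooth_on_const lin nz)
  show "smooth_on ?T (\<lambda>\<sigma>. M (\<tau> / (\<tau> + \<sigma>)))"
  proof (rule smooth_on_compose[OF _ _ _ assms])
    show "((\<lambda>\<sigma>. \<tau> / (\<tau> + \<sigma>)) has_real_derivative - \<tau> / ((\<tau> + \<sigma>) * (\<tau> + \<sigma>))) (at \<sigma>)" if "\<sigma> \<in> ?T" for \<sigma>
      using that by (auto intro!: derivative_eq_intros)
    have "smooth_on ?T (\<lambda>\<sigma>. complex_of_real (- \<tau>) / ((complex_of_real \<tau> + complex_of_real \<sigma>) * (complex_of_real \<tau> + complex_of_real \<sigma>)))"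
      by (intro smooth_on_divide smooth_on_mult smooth_on_const lin) (use nz in simp)
    then show "smooth_on ?T (\<lambda>\<sigma>. complex_of_real (- \<tau> / ((\<tau> + \<sigma>) * (\<tau> + \<sigma>))))" by simp
  qed simp
qed

lemma selfsim_ratio: "0 \<le> \<tau> \<Longrightarrow> 0 \<le> \<sigma> \<Longrightarrow> \<tau> / (\<tau> + \<sigma>) \<in> {0..1::real}"
  by (auto simp: divide_simps)

text \<open>
  Every function occurring below is a sum of products of a self-similar function with a cut-off in
  space; the exponent records its growth at the singularity.
\<close>

definition family_of_order :: "real \<Rightarrow> (real \<Rightarrow> real \<Rightarrow> complex) \<Rightarrow> bool" where
  "family_of_order c F \<longleftrightarrow> radial_family F \<and>
     (\<exists>C\<ge>0. \<forall>t\<in>{0..<1}. \<forall>\<sigma>\<ge>0. cmod (F t \<sigma>) \<le> C * (1 - t + \<sigma>) powr (- c))"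

lemma family_of_order_add:
  assumes "family_of_order c F" "family_of_order c G"
  shows "family_of_order c (\<lambda>t \<sigma>. F t \<sigma> + G t \<sigma>)"
proof -
  obtain C D where C: "0 \<le> C" "\<And>t \<sigma>. t \<in> {0..<1} \<Longrightarrow> 0 \<le> \<sigma> \<Longrightarrow> cmod (F t \<sigma>) \<le> C * (1 - t + \<sigma>) powr (- c)"
    and D: "0 \<le> D" "\<And>t \<sigma>. t \<in> {0..<1} \<Longrightarrow> 0 \<le> \<sigma> \<Longrightarrow> cmod (G t \<sigma>) \<le> D * (1 - t + \<sigma>) powr (- c)"
    using assms unfolding family_of_order_def by blast
  have "cmod (F t \<sigma> + G t \<sigma>) \<le> (C + D) * (1 - t + \<sigma>) powr (- c)" if "t \<in> {0..<1}" "0 \<le> \<sigma>" for t \<sigma>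
    using norm_triangle_ineq[of "F t \<sigma>" "G t \<sigma>"] C(2)[OF that] D(2)[OF that] by (simp add: distrib_right)
  moreover have "radial_family (\<lambda>t \<sigma>. F t \<sigma> + G t \<sigma>)"
    using assms unfolding family_of_order_def radial_family_def case_prod_beta by (auto intro!: continuous_intros)
  ultimately show ?thesis
    unfolding family_of_order_def using C(1) D(1) by (intro conjI exI[of _ "C + D"]) auto
qed

text \<open>
  The order may be increased because \<open>1 - t + \<sigma> \<le> 2\<close> on the support of the cut-off.
\<close>

lemma family_of_order_term:
  assumes p: "continuous_on UNIV p" "\<And>t. t \<in> {0..<1} \<Longrightarrow> \<bar>p t\<bar> \<le> 1"
    and \<kappa>: "continuous_on UNIV \<kappa>" "\<And>\<sigma>. 1 < \<sigma> \<Longrightarrow> \<kappa> \<sigma> = 0"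
    and M: "continuous_on {0..1} M" and c: "c \<le> c'"
  shows "family_of_order c' (\<lambda>t \<sigma>. complex_of_real (p t) * \<kappa> \<sigma> * selfsim c M (1 - t) \<sigma>)"
  unfolding family_of_order_def radial_family_def
proof (intro conjI)
  have "compact (M ` {0..1})" by (rule compact_continuous_image[OF M]) simp
  then obtain A where A: "\<And>z. z \<in> {0..1} \<Longrightarrow> cmod (M z) \<le> A"
    using compact_imp_bounded bounded_iff by (metis imageI)
  have A0: "0 \<le> A" using A[of 0] norm_ge_zero[of "M 0"] by (meson atLeastAtMost_iff order_trans zero_le_one order_refl)
  have "compact (\<kappa> ` {0..1})"
    by (rule compact_continuous_image) (use \<kappa>(1) in \<open>auto intro: continuous_on_subset\<close>)
  then obtain D where D: "\<And>z. z \<in> {0..1} \<Longrightarrow> cmod (\<kappa> z) \<le> D"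
    using compact_imp_bounded bounded_iff by (metis imageI)
  have D0: "0 \<le> D" using D[of 0] norm_ge_zero[of "\<kappa> 0"] by (meson atLeastAtMost_iff order_trans zero_le_one order_refl)
  have z: "(1 - t) / (1 - t + \<sigma>) \<in> {0..1}" if "t \<in> {0..<1}" "0 \<le> \<sigma>" for t \<sigma> :: real
    using selfsim_ratio[of "1 - t" \<sigma>] that by simp
  have cp: "continuous_on ({0..<1} \<times> {0..}) (\<lambda>x. p (fst x))"
    by (rule continuous_on_compose2[OF p(1)]) (auto intro: continuous_intros)
  have c\<kappa>: "continuous_on ({0..<1} \<times> {0..}) (\<lambda>x. \<kappa> (snd x))"
    by (rule continuous_on_compose2[OF \<kappa>(1)]) (auto intro: continuous_intros)
  have cM: "continuous_on ({0..<1} \<times> {0..}) (\<lambda>x::real \<times> real. M ((1 - fst x) / (1 - fst x + snd x)))"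
    by (rule continuous_on_compose2[OF M]) (use z in \<open>auto intro!: continuous_intros\<close>)
  show "continuous_on ({0..<1} \<times> {0..}) (\<lambda>(t, \<sigma>). complex_of_real (p t) * \<kappa> \<sigma> * selfsim c M (1 - t) \<sigma>)"
    unfolding selfsim_def case_prod_beta by (intro continuous_intros cp c\<kappa> cM) auto
  show "\<forall>t\<in>{0..<1}. \<forall>\<sigma>>1. complex_of_real (p t) * \<kappa> \<sigma> * selfsim c M (1 - t) \<sigma> = 0"
    using \<kappa>(2) by simp
  define E where "E = D * A * 2 powr (c' - c)"
  have E0: "0 \<le> E" using A0 D0 by (simp add: E_def)
  show "\<exists>C\<ge>0. \<forall>t\<in>{0..<1}. \<forall>\<sigma>\<ge>0. cmod (complex_of_real (p t) * \<kappa> \<sigma> * selfsim c M (1 - t) \<sigma>) \<le> C * (1 - t + \<sigma>) powr (- c')"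
  proof (intro exI[of _ E] conjI ballI allI impI E0)
    fix t \<sigma> :: real assume t: "t \<in> {0..<1}" and \<sigma>: "0 \<le> \<sigma>"
    define r where "r = 1 - t + \<sigma>"
    show "cmod (complex_of_real (p t) * \<kappa> \<sigma> * selfsim c M (1 - t) \<sigma>) \<le> E * (1 - t + \<sigma>) powr (- c')"
    proof (cases "\<sigma> \<le> 1")
      case True
      have r: "0 < r" "r \<le> 2" using t \<sigma> True by (auto simp: r_def)
      have "r powr (- c) = r powr (c' - c) * r powr (- c')" by (simp add: powr_add[symmetric])
      also have "\<dots> \<le> 2 powr (c' - c) * r powr (- c')"
        by (rule mult_right_mono[OF powr_mono2]) (use r c in auto)
      finally have P: "r powr (- c) \<le> 2 powr (c' - c) * r powr (- c')" .
      have "cmod (complex_of_real (p t) * \<kappa> \<sigma> * selfsim c M (1 - t) \<sigma>) = \<bar>p t\<bar> * cmod (\<kappa> \<sigma>) * (r powr (- c) * cmod (M ((1 - t) / (1 - t + \<sigma>))))"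
        by (simp add: norm_mult selfsim_def r_def)
      also have "\<dots> \<le> 1 * D * ((2 powr (c' - c) * r powr (- c')) * A)"
        by (intro mult_mono p(2) t D A z P) (use \<sigma> True t A0 D0 in auto)
      also have "\<dots> = E * r powr (- c')" by (simp add: E_def)
      finally show ?thesis by (simp add: r_def)
    qed (use \<kappa>(2) E0 in simp)
  qed
qed


section \<open>The counterexample\<close>

lemma smooth_on_flat_reflected: "smooth_on S (\<lambda>\<sigma>. complex_of_real (flat j (1 - \<sigma>)))"
proof (rule smooth_on_compose[where g = "\<lambda>\<sigma>. 1 - \<sigma>" and g' = "\<lambda>_. - 1" and T = UNIV and F = "\<lambda>x. complex_of_real (flat j x)"])
  show "((\<lambda>\<sigma>. 1 - \<sigma>) has_real_derivative - 1) (at \<sigma>)" for \<sigma> :: real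
    by (auto intro!: derivative_eq_intros)
qed (auto intro: smooth_on_flat)

lemma flat_reflected_has_derivative:
  "((\<lambda>\<sigma>. complex_of_real (flat j (1 - \<sigma>))) has_vector_derivative
    complex_of_real (real j * flat (j + 1) (1 - \<sigma>) - flat (j + 2) (1 - \<sigma>))) (at \<sigma>)"
proof -
  have "((\<lambda>\<sigma>. 1 - \<sigma>) has_real_derivative - 1) (at \<sigma>)" by (auto intro!: derivative_eq_intros)
  from DERIV_chain2[OF DERIV_flat this, of j]
  have "((\<lambda>\<sigma>. flat j (1 - \<sigma>)) has_real_derivative real j * flat (j + 1) (1 - \<sigma>) - flat (j + 2) (1 - \<sigma>)) (at \<sigma>)"
    by (simp add: algebra_simps)
  then show ?thesis
    by (intro has_vector_derivative_of_real) (simp add: has_real_derivative_iff_has_vector_derivative)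
qed

definition cutoff :: "real \<Rightarrow> complex" where
  "cutoff \<sigma> = complex_of_real (flat 0 (1 - \<sigma>))"

definition cutoff_d :: "real \<Rightarrow> complex" where
  "cutoff_d \<sigma> = - complex_of_real (flat 2 (1 - \<sigma>))"

definition cutoff_dd :: "real \<Rightarrow> complex" where
  "cutoff_dd \<sigma> = complex_of_real (flat 4 (1 - \<sigma>)) - 2 * complex_of_real (flat 3 (1 - \<sigma>))"

lemma cutoff_has_derivative:
  "(cutoff has_vector_derivative cutoff_d \<sigma>) (at \<sigma>)"
  "(cutoff_d has_vector_derivative cutoff_dd \<sigma>) (at \<sigma>)"
proof -
  show "(cutoff has_vector_derivative cutoff_d \<sigma>) (at \<sigma>)"
    using flat_reflected_has_derivative[of 0 \<sigma>] by (simp add: cutoff_def[abs_def] cutoff_d_def numeral_2_eq_2)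
  show "(cutoff_d has_vector_derivative cutoff_dd \<sigma>) (at \<sigma>)"
    using has_vector_derivative_minus[OF flat_reflected_has_derivative[of 2 \<sigma>]]
    by (simp add: cutoff_d_def[abs_def] cutoff_dd_def)
qed

lemma smooth_on_cutoff: "smooth_on S cutoff" "smooth_on S cutoff_d" "smooth_on S cutoff_dd"
  unfolding cutoff_def[abs_def] cutoff_d_def[abs_def] cutoff_dd_def[abs_def]
  by (intro smooth_on_minus smooth_on_diff smooth_on_mult smooth_on_const smooth_on_flat_reflected)+

lemma continuous_cutoff: "continuous_on UNIV cutoff" "continuous_on UNIV cutoff_d" "continuous_on UNIV cutoff_dd"
  by (rule smooth_on_continuous_on[OF _ open_UNIV], rule smooth_on_cutoff)+

lemma cutoff_outside: "1 < \<sigma> \<Longrightarrow> cutoff \<sigma> = 0" "1 < \<sigma> \<Longrightarrow> cutoff_d \<sigma> = 0" "1 < \<sigma> \<Longrightarrow> cutoff_dd \<sigma> = 0"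
  by (simp_all add: cutoff_def cutoff_d_def cutoff_dd_def flat_def)

lemma term_has_derivative:
  assumes \<kappa>: "(\<kappa> has_vector_derivative \<kappa>') (at \<sigma>)" and M: "smooth_on S M" "open S"
    and r: "0 < \<tau> + \<sigma>" and z: "\<tau> / (\<tau> + \<sigma>) \<in> S"
  shows "((\<lambda>\<sigma>. p * \<kappa> \<sigma> * selfsim c M \<tau> \<sigma>) has_vector_derivative
    (p * \<kappa>' * selfsim c M \<tau> \<sigma> + p * \<kappa> \<sigma> * selfsim (c + 1) (dsig c M) \<tau> \<sigma>)) (at \<sigma>)"
  using has_vector_derivative_mult[OF has_vector_derivative_mult[OF has_vector_derivative_const[of p] \<kappa>]
      selfsim_derivatives(1)[OF M r z, of c]]
  by (simp add: algebra_simps)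

lemma square_powr:
  assumes "0 < x"
  shows "(x\<^sup>2) powr c = (x::real) powr (2 * c)"
proof -
  have "x\<^sup>2 = x powr 2" using assms by simp
  then show ?thesis by (simp only: powr_powr)
qed

lemma powr_step:
  assumes "0 < r"
  shows "r powr (- c) = (r::real) * r powr (- (c + 1))"
  using assms by (simp add: powr_mult_base)

lemma nn_integral_unit_interval_le:
  "(\<integral>\<^sup>+ t. f t \<partial>unit_interval) \<le> (\<integral>\<^sup>+ t. f t \<partial>lebesgue)"
  by (subst nn_integral_restrict_space) (auto intro!: nn_integral_mono simp: indicator_def)

lemma herm_self: "herm \<xi> \<xi> = complex_of_real ((norm \<xi>)\<^sup>2)"
proof -
  have "(norm \<xi>)\<^sup>2 = (\<Sum>i\<in>UNIV. (cmod (\<xi> $ i))\<^sup>2)"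
    by (simp add: norm_vec_def L2_set_def sum_nonneg)
  then show ?thesis by (simp only: herm_def of_real_sum complex_norm_square)
qed

text \<open>
  In \<open>u\<^sub>t - div (b \<nabla>u)\<close> for \<open>u = t \<chi> v\<close> the terms that contain no derivative of \<open>\<chi>\<close> cancel, except \<open>\<chi> v\<close>. Here
  \<open>R = \<tau> + \<sigma>\<close>, \<open>P = R\<^bsup>-a-2\<^esup>\<close> and \<open>\<sigma> = (1 - z) R\<close>; the assumption is the equation for \<open>v\<close>.
\<close>

lemma forcing_identity:
  fixes R P Z T X X1 X2 H K Q Q1 K1 E N :: complex
  assumes "E = - (N * K) - 2 * (1 - Z) * K1"
  shows "X * (R * R * P * H) - T * X * (R * P * E) -
      (N * (T * X1 * (R * R * P * Q) + T * X * (R * P * K)) +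
       2 * ((1 - Z) * R) * (T * X2 * (R * R * P * Q) + T * X1 * (R * P * Q1) + (T * X1 * (R * P * K) + T * X * (P * K1))))
    = X * (R * R * P * H) - T * (N * X1) * (R * R * P * Q) - T * (2 * ((1 - Z) * R) * X2) * (R * R * P * Q)
      - T * (2 * X1) * (R * R * P * ((1 - Z) * (Q1 + K)))"
  unfolding assms by (simp add: algebra_simps)

locale self_similar =
  fixes n \<epsilon> a \<mu> :: real and S :: "real set" and H K b :: "real \<Rightarrow> complex"
  assumes n: "2 \<le> n" and \<epsilon>: "0 < \<epsilon>" "\<epsilon> \<le> 1 / 4" and a_def: "a = (n - \<epsilon>) / 4"
    and openS: "open S" and S01: "{0..1} \<subseteq> S"
    and smooth_H: "smooth_on S H" and smooth_K: "smooth_on S K" and smooth_b: "smooth_on S b"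
    and \<mu>: "0 < \<mu>" "\<And>z. z \<in> {0..1} \<Longrightarrow> \<mu> \<le> Re (b z)" and H1: "H 1 \<noteq> 0"
    and equation: "\<And>z. z \<in> {0..1} \<Longrightarrow> a * H z - (1 - z) * vector_derivative H (at z) =
      n * K z - 2 * (1 - z) * ((a + 1) * K z + z * vector_derivative K (at z))"
    and flux: "\<And>z. z \<in> S \<Longrightarrow> K z = 2 * b z * (- a * H z - z * vector_derivative H (at z))"
begin

lemma a_pos: "0 < a" using n \<epsilon> by (simp add: a_def)

definition Q :: "real \<Rightarrow> complex" where "Q z = 2 * b z * H z"

text \<open>
  The solution in the variables \<open>t\<close> and \<open>\<sigma> = |x|\<^sup>2\<close>, its derivatives \<open>U1\<close> in \<open>\<sigma>\<close> and \<open>U2\<close> in \<open>t\<close>, the flux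
  \<open>g x\<close> with the derivative \<open>g1\<close> of \<open>g\<close> in \<open>\<sigma>\<close>, and the right-hand side \<open>F\<close> after cancellation. Each is
  written as a sum of products of the kind to which \<open>family_of_order_term\<close> applies.
\<close>

definition U :: "real \<Rightarrow> real \<Rightarrow> complex" where
  "U t \<sigma> = complex_of_real t * cutoff \<sigma> * selfsim a H (1 - t) \<sigma>"

definition U1 :: "real \<Rightarrow> real \<Rightarrow> complex" where
  "U1 t \<sigma> = complex_of_real t * cutoff_d \<sigma> * selfsim a H (1 - t) \<sigma> +
     complex_of_real t * cutoff \<sigma> * selfsim (a + 1) (dsig a H) (1 - t) \<sigma>"

definition U2 :: "real \<Rightarrow> real \<Rightarrow> complex" where
  "U2 t \<sigma> = complex_of_real 1 * cutoff \<sigma> * selfsim a H (1 - t) \<sigma> +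
     complex_of_real (- t) * cutoff \<sigma> * selfsim (a + 1) (dtau a H) (1 - t) \<sigma>"

definition g :: "real \<Rightarrow> real \<Rightarrow> complex" where
  "g t \<sigma> = complex_of_real t * cutoff_d \<sigma> * selfsim a Q (1 - t) \<sigma> +
     complex_of_real t * cutoff \<sigma> * selfsim (a + 1) K (1 - t) \<sigma>"

definition g1 :: "real \<Rightarrow> real \<Rightarrow> complex" where
  "g1 t \<sigma> = (complex_of_real t * cutoff_dd \<sigma> * selfsim a Q (1 - t) \<sigma> +
       complex_of_real t * cutoff_d \<sigma> * selfsim (a + 1) (dsig a Q) (1 - t) \<sigma>) +
     (complex_of_real t * cutoff_d \<sigma> * selfsim (a + 1) K (1 - t) \<sigma> +
       complex_of_real t * cutoff \<sigma> * selfsim (a + 1 + 1) (dsig (a + 1) K) (1 - t) \<sigma>)"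

definition F :: "real \<Rightarrow> real \<Rightarrow> complex" where
  "F t \<sigma> = complex_of_real 1 * cutoff \<sigma> * selfsim a H (1 - t) \<sigma> +
     (complex_of_real (- t) * (complex_of_real n * cutoff_d \<sigma>) * selfsim a Q (1 - t) \<sigma> +
     (complex_of_real (- t) * (2 * complex_of_real \<sigma> * cutoff_dd \<sigma>) * selfsim a Q (1 - t) \<sigma> +
      complex_of_real (- t) * (2 * cutoff_d \<sigma>) *
        selfsim a (\<lambda>z. complex_of_real (1 - z) * (dsig a Q z + K z)) (1 - t) \<sigma>))"

lemma smooth_Q: "smooth_on S Q"
  unfolding Q_def by (intro smooth_on_mult smooth_on_const smooth_b smooth_H)

lemma continuous_profile: "smooth_on S M \<Longrightarrow> continuous_on {0..1} M"
  by (rule continuous_on_subset[OF smooth_on_continuous_on[OF _ openS] S01])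

lemmas profiles = continuous_profile[OF smooth_H] continuous_profile[OF smooth_K] continuous_profile[OF smooth_Q]
  continuous_profile[OF smooth_on_dsig[OF smooth_H openS]] continuous_profile[OF smooth_on_dtau[OF smooth_H openS]]
  continuous_profile[OF smooth_on_dsig[OF smooth_Q openS]] continuous_profile[OF smooth_on_dsig[OF smooth_K openS]]

lemma point:
  assumes "t \<in> {0..<1}" "0 \<le> \<sigma>"
  shows "0 < 1 - t + \<sigma>" "(1 - t) / (1 - t + \<sigma>) \<in> {0..1}" "(1 - t) / (1 - t + \<sigma>) \<in> S"
proof -
  show "0 < 1 - t + \<sigma>" using assms by simp
  show "(1 - t) / (1 - t + \<sigma>) \<in> {0..1}" using selfsim_ratio[of "1 - t" \<sigma>] assms by simp
  then show "(1 - t) / (1 - t + \<sigma>) \<in> S" using S01 by blast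
qed

lemma families:
  "family_of_order (a + 1 / 2) U" "family_of_order (a + 1) U1" "family_of_order (a + 1) U2"
  "family_of_order (a + 1) g" "family_of_order (a + 2) g1" "family_of_order a F"
proof -
  have p: "continuous_on UNIV (\<lambda>t::real. t)" "continuous_on UNIV (\<lambda>t::real. - t)" "continuous_on UNIV (\<lambda>t::real. 1::real)"
    by (auto intro: continuous_intros)
  note T = family_of_order_term[OF p(1)] family_of_order_term[OF p(2)] family_of_order_term[OF p(3)]
  show "family_of_order (a + 1 / 2) U"
    unfolding U_def by (rule T(1)[OF _ continuous_cutoff(1) cutoff_outside(1) profiles(1)]) auto
  show "family_of_order (a + 1) U1"
    unfolding U1_def
    by (intro family_of_order_add T(1)[OF _ continuous_cutoff(1) cutoff_outside(1)]
        T(1)[OF _ continuous_cutoff(2) cutoff_outside(2)] profiles) auto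
  show "family_of_order (a + 1) U2"
    unfolding U2_def
    by (intro family_of_order_add T(3)[OF _ continuous_cutoff(1) cutoff_outside(1)]
        T(2)[OF _ continuous_cutoff(1) cutoff_outside(1)] profiles) auto
  show "family_of_order (a + 1) g"
    unfolding g_def
    by (intro family_of_order_add T(1)[OF _ continuous_cutoff(1) cutoff_outside(1)]
        T(1)[OF _ continuous_cutoff(2) cutoff_outside(2)] profiles) auto
  show "family_of_order (a + 2) g1"
    unfolding g1_def
    by (intro family_of_order_add T(1)[OF _ continuous_cutoff(1) cutoff_outside(1)]
        T(1)[OF _ continuous_cutoff(2) cutoff_outside(2)] T(1)[OF _ continuous_cutoff(3) cutoff_outside(3)] profiles) auto
  have c: "continuous_on UNIV (\<lambda>\<sigma>. complex_of_real n * cutoff_d \<sigma>)"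
      "continuous_on UNIV (\<lambda>\<sigma>. 2 * complex_of_real \<sigma> * cutoff_dd \<sigma>)" "continuous_on UNIV (\<lambda>\<sigma>. 2 * cutoff_d \<sigma>)"
      "continuous_on {0..1} (\<lambda>z. complex_of_real (1 - z) * (dsig a Q z + K z))"
    by (intro continuous_intros continuous_cutoff profiles)+
  show "family_of_order a F"
    unfolding F_def
    by (intro family_of_order_add T(3)[OF _ continuous_cutoff(1) cutoff_outside(1)]
        T(2)[OF _ c(1)] T(2)[OF _ c(2)] T(2)[OF _ c(3) _ c(4)] profiles) (auto simp: cutoff_outside)
qed

lemma U1_derivative:
  assumes "t \<in> {0..<1}" "0 \<le> \<sigma>"
  shows "(U t has_vector_derivative U1 t \<sigma>) (at \<sigma>)"
  unfolding U_def[abs_def] U1_def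
  by (rule term_has_derivative[OF cutoff_has_derivative(1) smooth_H openS point(1,3)[OF assms]])

lemma g1_derivative:
  assumes "t \<in> {0..<1}" "0 \<le> \<sigma>"
  shows "(g t has_vector_derivative g1 t \<sigma>) (at \<sigma>)"
  unfolding g_def[abs_def] g1_def
  by (intro has_vector_derivative_add term_has_derivative[OF _ _ openS point(1,3)[OF assms]]
      cutoff_has_derivative smooth_Q smooth_K)

lemma U2_derivative:
  assumes "t \<in> {0..<1}" "0 \<le> \<sigma>"
  shows "((\<lambda>s. U s \<sigma>) has_vector_derivative U2 t \<sigma>) (at t within X)"
proof (rule has_vector_derivative_at_within)
  have "((\<lambda>s. 1 - s) has_vector_derivative (- 1 :: real)) (at t)"
    by (auto intro!: derivative_eq_intros)
  from vector_diff_chain_at[where f = "\<lambda>s. 1 - s" and g = "\<lambda>\<tau>. selfsim a H \<tau> \<sigma>",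
      OF this selfsim_derivatives(2)[OF smooth_H openS point(1,3)[OF assms]]]
  have d: "((\<lambda>s. selfsim a H (1 - s) \<sigma>) has_vector_derivative - selfsim (a + 1) (dtau a H) (1 - t) \<sigma>) (at t)"
    by (simp add: comp_def)
  have "((\<lambda>s. complex_of_real s * cutoff \<sigma>) has_vector_derivative cutoff \<sigma>) (at t)"
    by (auto intro!: derivative_eq_intros has_vector_derivative_mult_left has_vector_derivative_of_real)
  from has_vector_derivative_mult[OF this d]
  show "((\<lambda>s. U s \<sigma>) has_vector_derivative U2 t \<sigma>) (at t)"
    by (simp add: U_def U2_def algebra_simps)
qed

lemma smooth_slices:
  assumes t: "t \<in> {0..<1}"
  shows "\<exists>T. {0..} \<subseteq> T \<and> smooth_on T (U t) \<and> smooth_on T (g t)"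
proof (intro exI conjI)
  show "{0..} \<subseteq> {\<sigma>. 0 < 1 - t + \<sigma> \<and> (1 - t) / (1 - t + \<sigma>) \<in> S}"
    using point(1,3)[OF t] by auto
  show "smooth_on {\<sigma>. 0 < 1 - t + \<sigma> \<and> (1 - t) / (1 - t + \<sigma>) \<in> S} (U t)"
    unfolding U_def[abs_def]
    by (intro smooth_on_mult smooth_on_const smooth_on_cutoff smooth_on_selfsim smooth_H)
  show "smooth_on {\<sigma>. 0 < 1 - t + \<sigma> \<and> (1 - t) / (1 - t + \<sigma>) \<in> S} (g t)"
    unfolding g_def[abs_def]
    by (intro smooth_on_add smooth_on_mult smooth_on_const smooth_on_cutoff smooth_on_selfsim smooth_Q smooth_K)
qed

lemma forcing_eq:
  assumes "t \<in> {0..<1}" "0 \<le> \<sigma>"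
  shows "U2 t \<sigma> - (complex_of_real n * g t \<sigma> + 2 * complex_of_real \<sigma> * g1 t \<sigma>) = F t \<sigma>"
proof -
  define r z where "r = 1 - t + \<sigma>" and "z = (1 - t) / r"
  have r: "0 < r" and z: "z \<in> {0..1}" using point[OF assms] by (simp_all add: r_def z_def)
  define P R where "P = complex_of_real (r powr (- (a + 1 + 1)))" and "R = complex_of_real r"
  have p1: "complex_of_real (r powr (- (a + 1))) = R * P"
  proof -
    have "r powr (- (a + 1)) = r * r powr (- (a + 1 + 1))" by (rule powr_step[OF r])
    then show ?thesis by (simp only: P_def R_def of_real_mult)
  qed
  have p0: "complex_of_real (r powr (- a)) = R * R * P"
  proof -
    have "r powr (- a) = r * r powr (- (a + 1))" by (rule powr_step[OF r])
    then have "complex_of_real (r powr (- a)) = R * complex_of_real (r powr (- (a + 1)))" by (simp only: R_def of_real_mult)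
    then show ?thesis unfolding p1 by (simp only: mult.assoc)
  qed
  have s: "complex_of_real \<sigma> = (1 - complex_of_real z) * R"
  proof -
    have "\<sigma> = (1 - z) * r" using r by (simp add: z_def r_def field_simps)
    then show ?thesis unfolding R_def by (metis of_real_1 of_real_diff of_real_mult)
  qed
  have ss: "selfsim a M (1 - t) \<sigma> = R * R * P * M z" "selfsim (a + 1) M (1 - t) \<sigma> = R * P * M z"
      "selfsim (a + 1 + 1) M (1 - t) \<sigma> = P * M z" for M
    unfolding selfsim_def r_def[symmetric] z_def[symmetric] p0 p1 P_def[symmetric] by (rule refl)+
  have E: "dtau a H z = - (complex_of_real n * K z) - 2 * (1 - complex_of_real z) * dsig (a + 1) K z"
    using equation[OF z] by (simp add: dtau_def dsig_def algebra_simps)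
  show ?thesis
    unfolding U2_def g_def g1_def F_def ss s
    using forcing_identity[OF E, of "cutoff \<sigma>" R P "H z" "complex_of_real t" "cutoff_d \<sigma>" "Q z" "cutoff_dd \<sigma>" "dsig a Q z"]
    by simp
qed

text \<open>
  The indicator function makes the coefficient a Borel function; for \<open>t \<in> [0,1]\<close> it equals \<open>1\<close>, also where
  the quotient is \<open>0 / 0 = 0\<close>.
\<close>

definition \<beta> :: "real \<Rightarrow> 'x::real_normed_vector \<Rightarrow> complex" where
  "\<beta> t x = (indicator {0..1} ((1 - t) / (1 - t + (norm x)\<^sup>2)) :: real) *\<^sub>R b ((1 - t) / (1 - t + (norm x)\<^sup>2))"

lemma \<beta>_eq:
  assumes "t \<in> {0..1}"
  shows "\<beta> t x = b ((1 - t) / (1 - t + (norm x)\<^sup>2))" "(1 - t) / (1 - t + (norm x)\<^sup>2) \<in> {0..1}"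
proof -
  show "(1 - t) / (1 - t + (norm x)\<^sup>2) \<in> {0..1}" using selfsim_ratio[of "1 - t" "(norm x)\<^sup>2"] assms by simp
  then show "\<beta> t x = b ((1 - t) / (1 - t + (norm x)\<^sup>2))" by (simp add: \<beta>_def)
qed

lemma \<beta>_bounded:
  obtains \<Lambda> where "0 < \<Lambda>" "\<And>t x. t \<in> {0..1} \<Longrightarrow> cmod (\<beta> t x) \<le> \<Lambda>"
proof -
  have "compact (b ` {0..1})" by (rule compact_continuous_image[OF continuous_profile[OF smooth_b]]) simp
  then obtain A where A: "0 < A" "\<And>z. z \<in> {0..1} \<Longrightarrow> cmod (b z) \<le> A"
    using compact_imp_bounded bounded_pos by (metis imageI)
  show ?thesis
    by (rule that[OF A(1)]) (use A(2) \<beta>_eq in metis)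
qed

lemma elliptic_\<beta>: "elliptic (\<lambda>t (x :: real ^ 'n::finite). mat (\<beta> t x))"
  unfolding elliptic_def
proof
  have "(\<lambda>z. (indicator {0..1} z :: real) *\<^sub>R b z) \<in> borel_measurable borel"
    by (rule borel_measurable_continuous_on_indicator) (use continuous_profile[OF smooth_b] in auto)
  moreover have "(\<lambda>p::real \<times> (real ^ 'n). (1 - fst p) / (1 - fst p + (norm (snd p))\<^sup>2)) \<in> borel_measurable borel"
    by (intro borel_measurable_divide borel_measurable_continuous_onI continuous_intros)
  ultimately have "(\<lambda>p::real \<times> (real ^ 'n). \<beta> (fst p) (snd p)) \<in> borel_measurable borel"
    unfolding \<beta>_def by (rule measurable_compose_rev)
  moreover have "continuous_on UNIV (mat :: complex \<Rightarrow> complex ^ 'n ^ 'n)"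
    unfolding mat_def
  proof (intro continuous_on_vec_lambda)
    show "continuous_on UNIV (\<lambda>x::complex. if i = j then x else 0)" for i j :: 'n
      by (cases "i = j") auto
  qed
  ultimately have "(\<lambda>p::real \<times> (real ^ 'n). mat (\<beta> (fst p) (snd p)) :: complex ^ 'n ^ 'n) \<in> borel_measurable borel"
    by (intro borel_measurable_continuous_on[of mat])
  then show "(\<lambda>(t, x :: real ^ 'n). mat (\<beta> t x) :: complex ^ 'n ^ 'n) \<in> borel_measurable (restrict_space borel ({0..1} \<times> UNIV))"
    unfolding case_prod_beta by (rule measurable_restrict_space1)
  obtain \<Lambda> where \<Lambda>: "0 < \<Lambda>" "\<And>t (x :: real ^ 'n). t \<in> {0..1} \<Longrightarrow> cmod (\<beta> t x) \<le> \<Lambda>"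
    using \<beta>_bounded by blast
  show "\<exists>\<Lambda>>0. \<exists>\<mu>>0. \<forall>t\<in>{0..1}. \<forall>x \<xi>. norm (mat (\<beta> t (x :: real ^ 'n)) *v \<xi>) \<le> \<Lambda> * norm \<xi> \<and>
      \<mu> * (norm \<xi>)\<^sup>2 \<le> Re (herm (mat (\<beta> t x) *v \<xi>) \<xi>)"
  proof (intro exI conjI ballI allI, rule \<Lambda>(1), rule \<mu>(1))
    fix t and x :: "real ^ 'n" and \<xi> assume t: "t \<in> {0..1::real}"
    show "norm (mat (\<beta> t x) *v \<xi>) \<le> \<Lambda> * norm \<xi>"
      unfolding mat_vector_mult norm_vector_smult by (rule mult_right_mono[OF \<Lambda>(2)[OF t]]) simp
    have "\<mu> \<le> Re (\<beta> t x)" using \<mu>(2) \<beta>_eq[OF t, of x] by simp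
    then show "\<mu> * (norm \<xi>)\<^sup>2 \<le> Re (herm (mat (\<beta> t x) *v \<xi>) \<xi>)"
      unfolding mat_vector_mult herm_rules herm_self by (simp add: mult_right_mono)
  qed
qed

lemma flux_eq:
  assumes t: "t \<in> {0..<1}"
  shows "\<beta> t x * (2 * U1 t ((norm x)\<^sup>2)) = g t ((norm x)\<^sup>2)"
proof -
  have t': "t \<in> {0..1}" using t by simp
  define z where "z = (1 - t) / (1 - t + (norm x)\<^sup>2)"
  have z: "z \<in> S" using point(3)[OF t, of "(norm x)\<^sup>2"] by (simp add: z_def)
  have "K z = 2 * b z * dsig a H z" using flux[OF z] by (simp add: dsig_def)
  then show ?thesis
    unfolding \<beta>_eq(1)[OF t'] U1_def g_def selfsim_def z_def[symmetric] Q_def by (simp add: algebra_simps)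
qed

text \<open>
  The integrand is at most a multiple of \<open>(\<tau> + \<sigma>)\<^bsup>-2a-1\<^esup>\<close>. With \<open>\<theta> = \<epsilon>/4\<close> this power is at most
  \<open>\<tau>\<^bsup>-1+\<theta>\<^esup> \<sigma>\<^bsup>-2a-\<theta>\<^esup>\<close>; the first factor is integrable in time, and the second one is \<open>|x|\<^bsup>-n+\<epsilon>/2\<^esup>\<close>.
\<close>

lemma energy_finite:
  assumes nn: "n = real CARD('n::finite)"
  shows "(\<integral>\<^sup>+ t. ennreal (LINT x|lebesgue. (cmod (U t ((norm (x :: real ^ 'n))\<^sup>2)))\<^sup>2 +
    4 * (norm x)\<^sup>2 * (cmod (U1 t ((norm x)\<^sup>2)))\<^sup>2) \<partial>unit_interval) < \<infinity>"
proof -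
  obtain C where C: "0 \<le> C" "\<And>t \<sigma>. t \<in> {0..<1} \<Longrightarrow> 0 \<le> \<sigma> \<Longrightarrow> cmod (U t \<sigma>) \<le> C * (1 - t + \<sigma>) powr (- (a + 1 / 2))"
    using families(1) unfolding family_of_order_def by blast
  obtain D where D: "0 \<le> D" "\<And>t \<sigma>. t \<in> {0..<1} \<Longrightarrow> 0 \<le> \<sigma> \<Longrightarrow> cmod (U1 t \<sigma>) \<le> D * (1 - t + \<sigma>) powr (- (a + 1))"
    using families(2) unfolding family_of_order_def by blast
  define \<theta> where "\<theta> = \<epsilon> / 4"
  define e where "e = 2 * (2 * a + \<theta>)"
  define G where "G x = indicator (cball 0 1) x * norm (x - 0) powr (- e)" for x :: "real ^ 'n"
  have "e = n - \<epsilon> / 2" by (simp add: e_def \<theta>_def a_def field_simps)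
  then have e: "0 \<le> e" "e < real DIM(real ^ 'n)" using n \<epsilon> nn by auto
  have G: "integrable lebesgue G" unfolding G_def by (rule integrable_norm_powr[OF e])
  define A where "A = C\<^sup>2 + 4 * D\<^sup>2"
  have A: "0 \<le> A" by (simp add: A_def)
  define I where "I = (LINT x|lebesgue. G x)"
  have I: "0 \<le> I" unfolding I_def by (rule integral_nonneg_AE) (simp add: G_def)
  have pointwise: "(cmod (U t ((norm x)\<^sup>2)))\<^sup>2 + 4 * (norm x)\<^sup>2 * (cmod (U1 t ((norm x)\<^sup>2)))\<^sup>2
      \<le> A * (1 - t) powr (- (1 - \<theta>)) * G x" if t: "t \<in> {0..<1}" and x: "x \<noteq> 0" for t and x :: "real ^ 'n"
  proof (cases "norm x \<le> 1")
    case True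
    define s r where "s = (norm x)\<^sup>2" and "r = 1 - t + s"
    have s0: "0 < s" using x by (simp add: s_def)
    then have s: "0 < s" "s \<le> r" and r: "0 < r" "1 - t \<le> r" using t by (auto simp: r_def)
    have q: "(y powr (- c))\<^sup>2 = y powr (- (2 * c))" for y c :: real
      by (simp add: power2_eq_square powr_add[symmetric])
    have "(cmod (U t s))\<^sup>2 \<le> (C * r powr (- (a + 1 / 2)))\<^sup>2"
      unfolding r_def by (rule power_mono[OF C(2)]) (use t s in auto)
    also have "\<dots> = C\<^sup>2 * r powr (- (2 * a + 1))" unfolding power_mult_distrib q by (simp add: algebra_simps)
    finally have 1: "(cmod (U t s))\<^sup>2 \<le> C\<^sup>2 * r powr (- (2 * a + 1))" .
    have "(cmod (U1 t s))\<^sup>2 \<le> (D * r powr (- (a + 1)))\<^sup>2"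
      unfolding r_def by (rule power_mono[OF D(2)]) (use t s in auto)
    also have "\<dots> = D\<^sup>2 * r powr (- (2 * a + 2))" unfolding power_mult_distrib q by (simp add: algebra_simps)
    finally have "s * (cmod (U1 t s))\<^sup>2 \<le> r * (D\<^sup>2 * r powr (- (2 * a + 2)))"
      by (rule mult_mono[OF s(2)]) (use r in auto)
    also have "\<dots> = D\<^sup>2 * (r * r powr (- (2 * a + 2)))" by simp
    also have "r * r powr (- (2 * a + 2)) = r powr (- (2 * a + 1))"
      using powr_step[OF r(1), of "2 * a + 1"] by (simp only: add.assoc one_add_one)
    finally have 2: "s * (cmod (U1 t s))\<^sup>2 \<le> D\<^sup>2 * r powr (- (2 * a + 1))" .
    have "- (2 * a + 1) = - (1 - \<theta>) + - (2 * a + \<theta>)" by simp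
    then have "r powr (- (2 * a + 1)) = r powr (- (1 - \<theta>)) * r powr (- (2 * a + \<theta>))"
      by (simp only: powr_add)
    also have "\<dots> \<le> (1 - t) powr (- (1 - \<theta>)) * s powr (- (2 * a + \<theta>))"
      by (intro mult_mono powr_mono2') (use t s r \<epsilon> a_pos in \<open>auto simp: \<theta>_def\<close>)
    also have "s powr (- (2 * a + \<theta>)) = G x"
      using True x by (simp add: G_def s_def square_powr e_def)
    finally have 3: "r powr (- (2 * a + 1)) \<le> (1 - t) powr (- (1 - \<theta>)) * G x" .
    have "(cmod (U t s))\<^sup>2 + 4 * s * (cmod (U1 t s))\<^sup>2 \<le> A * r powr (- (2 * a + 1))"
      using 1 2 by (simp add: A_def algebra_simps)
    also have "\<dots> \<le> A * ((1 - t) powr (- (1 - \<theta>)) * G x)"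
      by (rule mult_left_mono[OF 3 A])
    finally show ?thesis by (simp add: s_def mult.assoc)
  next
    case False
    then have "1 < norm x" by simp
    have "U t ((norm x)\<^sup>2) = 0" "U1 t ((norm x)\<^sup>2) = 0"
      using radial_familyD(2)[OF _ t \<open>1 < norm x\<close>] families(1,2) unfolding family_of_order_def by blast+
    then show ?thesis using A by (simp add: G_def)
  qed
  have AE0: "AE x in lebesgue. (x :: real ^ 'n) \<noteq> 0" by (rule AE_completion) (rule AE_lborel_singleton)
  have "(LINT x|lebesgue. (cmod (U t ((norm (x :: real ^ 'n))\<^sup>2)))\<^sup>2 + 4 * (norm x)\<^sup>2 * (cmod (U1 t ((norm x)\<^sup>2)))\<^sup>2)
      \<le> (A * I) * (1 - t) powr (- (1 - \<theta>))" if t: "t \<in> {0..<1}" for t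
  proof -
    have "(LINT x|lebesgue. (cmod (U t ((norm (x :: real ^ 'n))\<^sup>2)))\<^sup>2 + 4 * (norm x)\<^sup>2 * (cmod (U1 t ((norm x)\<^sup>2)))\<^sup>2)
        \<le> (LINT x|lebesgue. A * (1 - t) powr (- (1 - \<theta>)) * G x)"
    proof (rule integral_mono_AE')
      show "integrable lebesgue (\<lambda>x. A * (1 - t) powr (- (1 - \<theta>)) * G x)" using G by (rule integrable_mult_right)
      show "AE x in lebesgue. (cmod (U t ((norm (x :: real ^ 'n))\<^sup>2)))\<^sup>2 + 4 * (norm x)\<^sup>2 * (cmod (U1 t ((norm x)\<^sup>2)))\<^sup>2
          \<le> A * (1 - t) powr (- (1 - \<theta>)) * G x"
        using AE0 by eventually_elim (rule pointwise[OF t])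
      show "AE x in lebesgue. 0 \<le> A * (1 - t) powr (- (1 - \<theta>)) * G x"
        using A by (simp add: G_def)
    qed
    then show ?thesis by (simp add: I_def mult_ac)
  qed
  then have "(\<integral>\<^sup>+ t. ennreal (LINT x|lebesgue. (cmod (U t ((norm (x :: real ^ 'n))\<^sup>2)))\<^sup>2 +
      4 * (norm x)\<^sup>2 * (cmod (U1 t ((norm x)\<^sup>2)))\<^sup>2) \<partial>unit_interval)
    \<le> (\<integral>\<^sup>+ t. ennreal (A * I) * ennreal (norm (indicator (cball 1 1) t * norm (t - 1) powr (- (1 - \<theta>)))) \<partial>unit_interval)"
    by (intro nn_integral_mono)
      (auto simp: space_restrict_space dist_real_def ennreal_mult[symmetric] A I intro!: ennreal_leI)
  also have "\<dots> \<le> (\<integral>\<^sup>+ t. ennreal (A * I) * ennreal (norm (indicator (cball 1 1) (t :: real) * norm (t - 1) powr (- (1 - \<theta>)))) \<partial>lebesgue)"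
    by (rule nn_integral_unit_interval_le)
  also have "\<dots> = ennreal (A * I) * (\<integral>\<^sup>+ t. ennreal (norm (indicator (cball 1 1) (t :: real) * norm (t - 1) powr (- (1 - \<theta>)))) \<partial>lebesgue)"
    by (rule nn_integral_cmult)
      (use integrable_norm_powr[of "1 - \<theta>" "1 :: real"] \<epsilon> in \<open>simp add: \<theta>_def borel_measurable_integrable\<close>)
  also have "\<dots> < \<infinity>"
  proof -
    have "integrable lebesgue (\<lambda>t::real. indicator (cball 1 1) t * norm (t - 1) powr (- (1 - \<theta>)))"
      by (rule integrable_norm_powr) (use \<epsilon> in \<open>auto simp: \<theta>_def\<close>)
    then show ?thesis by (simp add: integrable_iff_bounded ennreal_mult_less_top)
  qed
  finally show ?thesis .
qed

text \<open>
  \<open>F\<close> is bounded by a multiple of \<open>\<sigma>\<^bsup>-a\<^esup>\<close>, whose square is \<open>|x|\<^bsup>-n+\<epsilon>\<^esup>\<close>.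
\<close>

lemma forcing_bounded:
  assumes nn: "n = real CARD('n::finite)"
  obtains C where "\<And>t. t \<in> {0..<1} \<Longrightarrow> L2_norm lebesgue (\<lambda>x :: real ^ 'n. F t ((norm x)\<^sup>2)) \<le> C"
proof -
  obtain C where C: "0 \<le> C" "\<And>t \<sigma>. t \<in> {0..<1} \<Longrightarrow> 0 \<le> \<sigma> \<Longrightarrow> cmod (F t \<sigma>) \<le> C * (1 - t + \<sigma>) powr (- a)"
    using families(6) unfolding family_of_order_def by blast
  have rF: "radial_family F" using families(6) unfolding family_of_order_def by blast
  define G where "G x = indicator (cball 0 1) x * norm (x - 0) powr (- (2 * a))" for x :: "real ^ 'n"
  have "integrable lebesgue (\<lambda>x :: real ^ 'n. indicator (cball 0 1) x * norm (x - 0) powr (- (4 * a)))"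
    by (rule integrable_norm_powr) (use n \<epsilon> nn in \<open>auto simp: a_def\<close>)
  moreover have "(norm (G x))\<^sup>2 = indicator (cball 0 1) x * norm (x - 0) powr (- (4 * a))" for x
    by (simp add: G_def indicator_def power2_eq_square powr_add[symmetric])
  moreover have "integrable lebesgue G"
    unfolding G_def by (rule integrable_norm_powr) (use n \<epsilon> nn in \<open>auto simp: a_def\<close>)
  ultimately have G: "square_integrable lebesgue G"
    by (simp add: square_integrable_def borel_measurable_integrable)
  have AE0: "AE x in lebesgue. (x :: real ^ 'n) \<noteq> 0" by (rule AE_completion) (rule AE_lborel_singleton)
  show ?thesis
  proof (rule that[of "C * L2_norm lebesgue G"])
    fix t :: real assume t: "t \<in> {0..<1}"
    show "L2_norm lebesgue (\<lambda>x :: real ^ 'n. F t ((norm x)\<^sup>2)) \<le> C * L2_norm lebesgue G"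
    proof (rule L2_norm_dominated[OF G _ _ C(1)])
      have "continuous_on UNIV (\<lambda>x :: real ^ 'n. F t ((norm x)\<^sup>2))"
        by (rule continuous_slice[OF radial_familyD(1)[OF rF] t])
      then show "(\<lambda>x :: real ^ 'n. F t ((norm x)\<^sup>2)) \<in> borel_measurable lebesgue"
        by (intro measurable_completion) (simp add: borel_measurable_continuous_onI)
      show "AE x in lebesgue. norm (F t ((norm (x :: real ^ 'n))\<^sup>2)) \<le> C * norm (G x)"
        using AE0
      proof eventually_elim
        case (elim x)
        show ?case
        proof (cases "norm x \<le> 1")
          case True
          have "cmod (F t ((norm x)\<^sup>2)) \<le> C * (1 - t + (norm x)\<^sup>2) powr (- a)" by (rule C(2)[OF t]) simp
          also have "\<dots> \<le> C * ((norm x)\<^sup>2) powr (- a)"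
            by (intro mult_left_mono powr_mono2' C(1)) (use elim t a_pos in auto)
          also have "((norm x)\<^sup>2) powr (- a) = norm (G x)"
            using True elim by (simp add: G_def square_powr)
          finally show ?thesis .
        next
          case False
          then show ?thesis using radial_familyD(2)[OF rF t, of x] C(1) by (simp add: G_def)
        qed
      qed
    qed
  qed
qed

text \<open>
  For \<open>\<sigma> \<le> \<eta>\<tau>\<close> the ratio \<open>z\<close> is so close to \<open>1\<close> that \<open>H(z)\<close> stays away from \<open>0\<close>.
\<close>

lemma U_lower_bound:
  obtains c \<eta> where "0 < c" "0 < \<eta>" "\<eta> \<le> 1 / 2"
    "\<And>t \<sigma>. t \<in> {1 / 2..<1} \<Longrightarrow> 0 \<le> \<sigma> \<Longrightarrow> \<sigma> \<le> \<eta> * (1 - t) \<Longrightarrow> c * (1 - t) powr (- a) \<le> cmod (U t \<sigma>)"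
proof -
  define h where "h = cmod (H 1) / 2"
  have h: "0 < h" using H1 by (simp add: h_def)
  have "1 \<in> S" using S01 by auto
  then have "continuous (at 1) H"
    using smooth_on_continuous_on[OF smooth_H openS] openS by (simp add: continuous_on_eq_continuous_at)
  then obtain d where d: "0 < d" "\<And>z. dist z 1 < d \<Longrightarrow> dist (H z) (H 1) < h"
    unfolding continuous_at_eps_delta using h by blast
  define \<eta> where "\<eta> = min (1 / 2) (d / 2)"
  have \<eta>: "0 < \<eta>" "\<eta> \<le> 1 / 2" "\<eta> < d" using d(1) by (auto simp: \<eta>_def)
  define c where "c = 1 / 2 * exp (- 4 / 3) * (2 powr (- a) * h)"
  have "0 < c" using h by (simp add: c_def)
  moreover have "c * (1 - t) powr (- a) \<le> cmod (U t \<sigma>)"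
    if t: "t \<in> {1 / 2..<1}" and \<sigma>: "0 \<le> \<sigma>" "\<sigma> \<le> \<eta> * (1 - t)" for t \<sigma>
  proof -
    have "\<eta> * (1 - t) \<le> 1 / 2 * (1 / 2)" by (rule mult_mono) (use \<eta> t in auto)
    then have s4: "\<sigma> \<le> 1 / 4" using \<sigma> by simp
    have "\<eta> * (1 - t) \<le> 1 * (1 - t)" by (rule mult_right_mono) (use \<eta> t in auto)
    then have s1: "\<sigma> \<le> 1 - t" using \<sigma> by simp
    define z where "z = (1 - t) / (1 - t + \<sigma>)"
    have "1 - z = \<sigma> / (1 - t + \<sigma>)" using t \<sigma> by (simp add: z_def field_simps)
    also have "\<dots> \<le> \<sigma> / (1 - t)" by (rule divide_left_mono) (use t \<sigma> in auto)
    also have "\<dots> \<le> \<eta>" using t \<sigma> by (simp add: divide_le_eq)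
    finally have "1 - z < d" using \<eta> by simp
    moreover have "z \<le> 1" using t \<sigma> by (simp add: z_def)
    ultimately have "dist (H z) (H 1) < h" by (intro d(2)) (simp add: dist_real_def)
    then have Hz: "h \<le> cmod (H z)"
      using norm_triangle_ineq2[of "H 1" "H z"] by (simp add: h_def dist_norm norm_minus_commute)
    have "- 4 / 3 \<le> - 1 / (1 - \<sigma>)" using s4 \<sigma> by (simp add: field_simps)
    then have X: "exp (- 4 / 3) \<le> cmod (cutoff \<sigma>)" using s4 by (simp add: cutoff_def flat_def)
    have "2 powr (- a) * (1 - t) powr (- a) = (2 * (1 - t)) powr (- a)"
      using powr_mult[of 2 "1 - t" "- a"] t by simp
    also have "\<dots> \<le> (1 - t + \<sigma>) powr (- a)"
      by (rule powr_mono2') (use t \<sigma> s1 a_pos in auto)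
    finally have P: "2 powr (- a) * (1 - t) powr (- a) \<le> (1 - t + \<sigma>) powr (- a)" .
    have "c * (1 - t) powr (- a) = (1 / 2 * exp (- 4 / 3)) * ((2 powr (- a) * (1 - t) powr (- a)) * h)"
      by (simp add: c_def)
    also have "\<dots> \<le> (t * cmod (cutoff \<sigma>)) * ((1 - t + \<sigma>) powr (- a) * cmod (H z))"
      by (intro mult_mono X P Hz) (use t h in auto)
    also have "\<dots> = cmod (U t \<sigma>)"
      using t by (simp add: U_def selfsim_def z_def norm_mult)
    finally show ?thesis .
  qed
  ultimately show ?thesis using that \<eta> by blast
qed

text \<open>
  The ball of radius \<open>\<surd>(\<eta>\<tau>)\<close> alone contributes a multiple of \<open>\<tau>\<^bsup>-a + n/(2s)\<^esup>\<close> to the norm in \<open>L\<^sup>s\<close>.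
\<close>

lemma Lr_Ls_norm_infinite:
  fixes s r :: real
  assumes nn: "n = real CARD('n::finite)" and s: "1 < s" and r: "1 < r" and a: "1 / r + n / (2 * s) \<le> a"
  shows "(\<integral>\<^sup>+ t. ennreal (snorm (Lspace s) (\<lambda>x :: real ^ 'n. U t ((norm x)\<^sup>2)) powr r) \<partial>unit_interval) = \<infinity>"
proof -
  obtain c \<eta> where c: "0 < c" and \<eta>: "0 < \<eta>" "\<eta> \<le> 1 / 2"
    and low: "\<And>t \<sigma>. t \<in> {1 / 2..<1} \<Longrightarrow> 0 \<le> \<sigma> \<Longrightarrow> \<sigma> \<le> \<eta> * (1 - t) \<Longrightarrow> c * (1 - t) powr (- a) \<le> cmod (U t \<sigma>)"
    using U_lower_bound by blast
  have rU: "radial_family U" using families(1) unfolding family_of_order_def by blast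
  define V where "V = unit_ball_vol n"
  have V: "0 < V" using n by (simp add: V_def)
  define p where "p = a - n / (2 * s)"
  have "1 / r * r \<le> p * r" by (rule mult_right_mono) (use a r in \<open>auto simp: p_def\<close>)
  then have pr: "1 \<le> p * r" using r by simp
  define c1 where "c1 = c * (V powr (1 / s) * \<eta> powr (n / (2 * s)))"
  have c1: "0 < c1" using c V \<eta> by (simp add: c1_def)
  have "c1 powr r / (1 - t) \<le> snorm (Lspace s) (\<lambda>x :: real ^ 'n. U t ((norm x)\<^sup>2)) powr r" if t: "t \<in> {1 / 2..<1}" for t
  proof -
    define \<tau> where "\<tau> = 1 - t"
    have \<tau>: "0 < \<tau>" "\<tau> \<le> 1" using t by (auto simp: \<tau>_def)
    have t': "t \<in> {0..<1}" using t by simp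
    define w where "w x = cmod (U t ((norm x)\<^sup>2)) powr s" for x :: "real ^ 'n"
    have w0: "w x = 0" if "x \<notin> cball 0 1" for x
      using radial_familyD(2)[OF rU t', of x] that by (simp add: w_def)
    have "continuous_on UNIV (\<lambda>x :: real ^ 'n. U t ((norm x)\<^sup>2))"
      by (rule continuous_slice[OF radial_familyD(1)[OF rU] t'])
    then have "continuous_on UNIV w"
      unfolding w_def using s by (intro continuous_on_powr' continuous_intros) auto
    then have w: "integrable lebesgue w"
      by (rule integrable_continuous_compact_support[OF _ compact_cball w0])
    define \<rho> where "\<rho> = sqrt (\<eta> * \<tau>)"
    have \<rho>: "0 < \<rho>" "\<rho>\<^sup>2 = \<eta> * \<tau>" using \<eta> \<tau> by (auto simp: \<rho>_def)
    define A where "A = (c * \<tau> powr (- a)) powr s"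
    have A: "0 \<le> A" by (simp add: A_def)
    have \<rho>n: "\<rho> ^ CARD('n) = (\<eta> * \<tau>) powr (n / 2)"
    proof -
      have "\<rho> ^ CARD('n) = \<rho> powr n" using \<rho>(1) by (simp add: nn powr_realpow)
      also have "\<dots> = (\<rho>\<^sup>2) powr (n / 2)" unfolding square_powr[OF \<rho>(1)] by simp
      finally show ?thesis by (simp only: \<rho>(2))
    qed
    have "A * (V * (\<eta> * \<tau>) powr (n / 2)) = (LINT x|lebesgue. A * indicator (cball (0 :: real ^ 'n) \<rho>) x)"
      using \<rho>(1) by (simp add: content_cball V_def nn \<rho>n[unfolded nn])
    also have "\<dots> \<le> (LINT x|lebesgue. w x)"
    proof (rule integral_mono'[OF w])
      fix x :: "real ^ 'n"
      show "A * indicator (cball 0 \<rho>) x \<le> w x"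
      proof (cases "x \<in> cball 0 \<rho>")
        case True
        then have "(norm x)\<^sup>2 \<le> \<eta> * (1 - t)"
          using power_mono[of "norm x" \<rho> 2] \<rho>(2) by (simp add: \<tau>_def)
        then have "c * \<tau> powr (- a) \<le> cmod (U t ((norm x)\<^sup>2))" unfolding \<tau>_def by (intro low[OF t]) auto
        then show ?thesis
          using True c s unfolding A_def w_def by (simp add: powr_mono2)
      qed (simp add: w_def)
    qed (simp add: w_def)
    finally have "(A * (V * (\<eta> * \<tau>) powr (n / 2))) powr (1 / s) \<le> (LINT x|lebesgue. w x) powr (1 / s)"
      by (rule powr_mono2[rotated 2]) (use s A V in auto)
    moreover have "(A * (V * (\<eta> * \<tau>) powr (n / 2))) powr (1 / s) = c1 * \<tau> powr (- p)"
    proof -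
      have "(A * (V * (\<eta> * \<tau>) powr (n / 2))) powr (1 / s) = A powr (1 / s) * (V powr (1 / s) * ((\<eta> * \<tau>) powr (n / 2)) powr (1 / s))"
        using A V by (simp add: powr_mult)
      also have "A powr (1 / s) = c * \<tau> powr (- a)"
        using s c by (simp add: A_def powr_powr)
      also have "((\<eta> * \<tau>) powr (n / 2)) powr (1 / s) = \<eta> powr (n / (2 * s)) * \<tau> powr (n / (2 * s))"
        using \<eta> \<tau> by (simp add: powr_powr powr_mult)
      also have "c * \<tau> powr (- a) * (V powr (1 / s) * (\<eta> powr (n / (2 * s)) * \<tau> powr (n / (2 * s)))) =
          c1 * (\<tau> powr (- a) * \<tau> powr (n / (2 * s)))" by (simp add: c1_def)
      also have "\<tau> powr (- a) * \<tau> powr (n / (2 * s)) = \<tau> powr (- p)"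
        by (simp add: powr_add[symmetric] p_def)
      finally show ?thesis .
    qed
    moreover have "snorm (Lspace s) (\<lambda>x :: real ^ 'n. U t ((norm x)\<^sup>2)) = (LINT x|lebesgue. w x) powr (1 / s)"
      by (simp add: Lspace_def w_def)
    ultimately have L: "c1 * \<tau> powr (- p) \<le> snorm (Lspace s) (\<lambda>x :: real ^ 'n. U t ((norm x)\<^sup>2))" by simp
    have "c1 powr r / \<tau> = c1 powr r * \<tau> powr (- 1)" using \<tau> by (simp add: powr_minus divide_inverse)
    also have "\<dots> \<le> c1 powr r * \<tau> powr (- (p * r))"
      by (intro mult_left_mono powr_mono') (use pr \<tau> in auto)
    also have "\<dots> = (c1 * \<tau> powr (- p)) powr r" using c1 by (simp add: powr_mult powr_powr)
    also have "\<dots> \<le> snorm (Lspace s) (\<lambda>x :: real ^ 'n. U t ((norm x)\<^sup>2)) powr r"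
      by (rule powr_mono2[OF _ _ L]) (use r c1 in auto)
    finally show ?thesis by (simp add: \<tau>_def)
  qed
  then have "(\<integral>\<^sup>+ t. ennreal (c1 powr r / (1 - t)) * indicator {1 / 2..<1} t \<partial>lebesgue)
      \<le> (\<integral>\<^sup>+ t. ennreal (snorm (Lspace s) (\<lambda>x :: real ^ 'n. U t ((norm x)\<^sup>2)) powr r) \<partial>unit_interval)"
    by (subst nn_integral_restrict_space) (auto intro!: nn_integral_mono ennreal_leI simp: indicator_def)
  moreover have "(\<integral>\<^sup>+ t. ennreal (c1 powr r / (1 - t)) * indicator {1 / 2..<1} t \<partial>lebesgue) = \<infinity>"
    by (rule nn_integral_inverse_infinite) (use c1 in simp)
  ultimately show ?thesis by (simp add: top_unique)
qed

end


theorem theorem2p4: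
  fixes s r :: real
  assumes "CARD('n::finite) \<ge> 2"
    and "s > 1" and "r > 1"
    and "2 / r + real CARD('n) / s < real CARD('n) / 2"
  shows "\<exists>(B :: real \<Rightarrow> real ^ 'n \<Rightarrow> complex ^ 'n ^ 'n) (f :: real \<Rightarrow> real ^ 'n \<Rightarrow> complex).
    elliptic B \<and>
    f \<in> bochner_Linf (lebesgue_on {0<..<1}) (Lspace 2) \<and>
    (\<exists>u. is_solution B (\<lambda>t. to_Hneg1 (f t)) u \<and>
         (\<forall>v. is_solution B (\<lambda>t. to_Hneg1 (f t)) v \<longrightarrow>
              (AE t in lebesgue_on {0<..<1}. AE x in lebesgue. v t x = u t x)) \<and>
         u \<notin> bochner_Lp (lebesgue_on {0<..<1}) r (Lspace s))"
proof -
  define n where "n = real CARD('n)"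
  have n: "2 \<le> n" using assms(1) by (simp add: n_def)
  \<comment> \<open>The choice \<open>\<epsilon> \<le> 4 gap\<close> gives \<open>a \<ge> 1/r + n/(2s)\<close>, and \<open>profile\<close> needs \<open>\<epsilon> \<le> 1/4\<close>.\<close>
  define gap where "gap = n / 4 - (1 / r + n / (2 * s))"
  have gap: "0 < gap"
  proof -
    have "gap = (n / 2 - (2 / r + n / s)) / 2" by (simp add: gap_def)
    then show ?thesis using assms(4) by (simp add: n_def)
  qed
  define \<epsilon> where "\<epsilon> = min (1 / 4) (4 * gap)"
  have \<epsilon>: "0 < \<epsilon>" "\<epsilon> \<le> 1 / 4" "\<epsilon> \<le> 4 * gap" using gap by (auto simp: \<epsilon>_def)
  define a where "a = (n - \<epsilon>) / 4"
  have a: "1 / r + n / (2 * s) \<le> a" using \<epsilon>(3) by (simp add: a_def gap_def)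
  obtain S and H K b :: "real \<Rightarrow> complex" and \<mu> where S: "open S" "{0..1} \<subseteq> S"
    "smooth_on S H" "smooth_on S K" "smooth_on S b" "0 < \<mu>" "H 1 \<noteq> 0"
    "\<And>z. z \<in> {0..1} \<Longrightarrow> \<mu> \<le> Re (b z)"
    "\<And>z. z \<in> {0..1} \<Longrightarrow> a * H z - (1 - z) * vector_derivative H (at z) =
      n * K z - 2 * (1 - z) * ((a + 1) * K z + z * vector_derivative K (at z))"
    "\<And>z. z \<in> S \<Longrightarrow> K z = 2 * b z * (- a * H z - z * vector_derivative H (at z))"
    using profile[OF n \<epsilon>(1,2) a_def] by metis
  interpret self_similar n \<epsilon> a \<mu> S H K b
    by unfold_locales (use n \<epsilon> a_def S in auto)
  define f where "f t x = U2 t ((norm x)\<^sup>2) -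
      (of_nat CARD('n) * g t ((norm x)\<^sup>2) + 2 * complex_of_real ((norm x)\<^sup>2) * g1 t ((norm x)\<^sup>2))"
    for t and x :: "real ^ 'n"
  define u where "u t x = U t ((norm x)\<^sup>2)" for t and x :: "real ^ 'n"
  have fF: "f t = (\<lambda>x. F t ((norm x)\<^sup>2))" if "t \<in> {0..<1}" for t
  proof
    have "complex_of_real n = of_nat CARD('n)" by (simp add: n_def)
    then show "f t x = F t ((norm x)\<^sup>2)" for x
      using forcing_eq[OF that, of "(norm x)\<^sup>2"] by (simp only: f_def zero_le_power2)
  qed
  obtain C where C: "\<And>t. t \<in> {0..<1} \<Longrightarrow> L2_norm lebesgue (f t) \<le> C"
    using forcing_bounded[where 'n = 'n, OF n_def] fF by metis
  obtain \<Lambda> where \<Lambda>: "\<And>t (x :: real ^ 'n). t \<in> {0..1} \<Longrightarrow> cmod (\<beta> t x) \<le> \<Lambda>"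
    using \<beta>_bounded by metis
  have fam: "radial_family U" "radial_family U1" "radial_family U2" "radial_family g" "radial_family g1"
    using families unfolding family_of_order_def by blast+
  have \<Lambda>': "cmod (\<beta> t x) \<le> \<Lambda>" if "t \<in> {0..<1}" for t and x :: "real ^ 'n" using \<Lambda> that by simp
  have U0: "U 0 \<sigma> = 0" for \<sigma> by (simp add: U_def)
  note sol = radial_solution[of U g U1 g1 U2 "\<lambda>t x :: real ^ 'n. \<beta> t x" \<Lambda> C, OF smooth_slices U1_derivative g1_derivative
      U2_derivative fam U0 flux_eq \<Lambda>' energy_finite[OF n_def] C[unfolded f_def], folded f_def u_def]
  have u: "is_solution (\<lambda>t x. mat (\<beta> t x)) (\<lambda>t. to_Hneg1 (f t)) u" and f: "path_in (Lspace 2) f"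
    using sol by (simp_all add: f_def[abs_def] u_def[abs_def])
  have ell: "elliptic (\<lambda>t (x :: real ^ 'n). mat (\<beta> t x))" by (rule elliptic_\<beta>)
  show ?thesis
  proof (intro exI conjI allI impI)
    show "elliptic (\<lambda>t (x :: real ^ 'n). mat (\<beta> t x))" by (rule ell)
    show "f \<in> bochner_Linf unit_interval (Lspace 2)"
      unfolding bochner_Linf_def mem_Collect_eq
    proof (intro conjI exI)
      show "strongly_measurable unit_interval (Lspace 2) f"
        by (rule L2.strongly_measurable_path) (use path_inD[OF f] in auto)
      show "AE t in unit_interval. snorm (Lspace 2) (f t) \<le> C"
        unfolding snorm_Lspace2 by (rule AE_I2) (use C in \<open>auto simp: space_restrict_space\<close>)
    qed
    show "is_solution (\<lambda>t x. mat (\<beta> t x)) (\<lambda>t. to_Hneg1 (f t)) u" by (rule u)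
    show "AE t in unit_interval. AE x in lebesgue. v t x = u t x"
      if "is_solution (\<lambda>t x. mat (\<beta> t x)) (\<lambda>t. to_Hneg1 (f t)) v" for v
      by (rule solution_unique[OF ell that u])
    show "u \<notin> bochner_Lp unit_interval r (Lspace s)"
      using Lr_Ls_norm_infinite[where 'n = 'n, OF n_def assms(2,3) a]
      by (simp add: bochner_Lp_def u_def[abs_def])
  qed
qed

end
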